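(* Let $\Omega_0\subset\mathbb{C}$ be the unit disk. There exists a continuous subharmonic function $\varphi$ on $\Omega_0$ with $\nabla\varphi\in L^2(\Omega_0)$ in the sense of distributions and $\Delta\varphi\in L^1(\Omega_0)$ lower semicontinuous, such that $$\lim_{n\to\infty}\lambda^{\mathrm m}_{n\varphi}=\infty\quad\text{but}\quad\lim_{n\to\infty}\lambda^{\mathrm e}_{n\varphi}<\infty .$$
   Context: For a subharmonic function $\psi$ on $\Omega_0$ with $\nabla\psi\in L^2(\Omega_0)$, set $D_\psi=(\partial_x+i\psi_y,\ \partial_y-i\psi_x)$ and $$\lambda^{\mathrm m}_\psi=\inf\Big\{\int_{\Omega_0}|D_\psi u|^2+\int_{\Omega_0}\Delta\psi\,|u|^2:\ u\in C_0^\infty(\Omega_0),\ \|u\|_{L^2(\Omega_0)}=1\Big\},$$ $$\lambda^{\mathrm e}_\psi=\inf\Big\{\int_{\Omega_0}|\nabla u|^2+\int_{\Omega_0}\Delta\psi\,|u|^2:\ u\in C_0^\infty(\Omega_0),\ \|u\|_{L^2(\Omega_0)}=1\Big\},$$ with complex-valued $u$. These are the lowest eigenvalues of the Dirichlet realizations of $S_\psi=-[(\partial_x+i\psi_y)^2+(\partial_y-i\psi_x)^2]+\Delta\psi$ and of $S^0_\psi=-\partial_x^2-\partial_y^2+\Delta\psi$. The index $n$ runs over positive integers. *)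

theory Defs
  imports "HOL-Analysis.Analysis"
begin

text \<open>
  The plane is the real normed space \<open>complex\<close>: derivatives are real Frechet derivatives,
  and \<open>\<partial>x\<close>, \<open>\<partial>y\<close> are the derivatives in the directions \<open>1\<close> and \<open>\<i>\<close>.
\<close>

definition partial :: "complex \<Rightarrow> (complex \<Rightarrow> complex) \<Rightarrow> complex \<Rightarrow> complex" where
  "partial v u z = frechet_derivative u (at z) v"

abbreviation partial_x :: "(complex \<Rightarrow> complex) \<Rightarrow> complex \<Rightarrow> complex" where
  "partial_x \<equiv> partial 1"

abbreviation partial_y :: "(complex \<Rightarrow> complex) \<Rightarrow> complex \<Rightarrow> complex" where
  "partial_y \<equiv> partial \<i>"

primrec C_k :: "nat \<Rightarrow> (complex \<Rightarrow> complex) \<Rightarrow> bool" where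
  "C_k 0 u \<longleftrightarrow> continuous_on UNIV u"
| "C_k (Suc k) u \<longleftrightarrow>
     (\<forall>z. u differentiable (at z)) \<and> C_k k (partial_x u) \<and> C_k k (partial_y u)"

text \<open>\<open>C_0^\<infinity>(S)\<close>; its elements are extended by zero to the whole plane.\<close>

definition test_functions :: "complex set \<Rightarrow> (complex \<Rightarrow> complex) set" where
  "test_functions S =
     {u. (\<forall>k. C_k k u) \<and> compact (closure {z. u z \<noteq> 0}) \<and> closure {z. u z \<noteq> 0} \<subseteq> S}"

definition upper_semicontinuous_on :: "complex set \<Rightarrow> (complex \<Rightarrow> real) \<Rightarrow> bool" where
  "upper_semicontinuous_on S f \<longleftrightarrow> (\<forall>c. openin (top_of_set S) {z \<in> S. f z < c})"

definition lower_semicontinuous_on :: "complex set \<Rightarrow> (complex \<Rightarrow> real) \<Rightarrow> bool" where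
  "lower_semicontinuous_on S f \<longleftrightarrow> (\<forall>c. openin (top_of_set S) {z \<in> S. c < f z})"

text \<open>
  Subharmonicity of finite-valued functions on an open set. Such a function is automatically
  integrable over circles; this is demanded explicitly because the Bochner integral of a
  non-integrable function is \<open>0\<close>.
\<close>

definition subharmonic_on :: "complex set \<Rightarrow> (complex \<Rightarrow> real) \<Rightarrow> bool" where
  "subharmonic_on S f \<longleftrightarrow>
     upper_semicontinuous_on S f \<and>
     (\<forall>a r. 0 < r \<longrightarrow> cball a r \<subseteq> S \<longrightarrow>
        set_integrable lborel {0..2*pi} (\<lambda>t. f (a + of_real r * cis t)) \<and>
        f a \<le> (LINT t:{0..2*pi}|lborel. f (a + of_real r * cis t)) / (2*pi))"

definition locally_integrable_on :: "complex set \<Rightarrow> (complex \<Rightarrow> real) \<Rightarrow> bool" where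
  "locally_integrable_on S f \<longleftrightarrow> (\<forall>K. compact K \<longrightarrow> K \<subseteq> S \<longrightarrow> set_integrable lborel K f)"

definition square_integrable_on :: "complex set \<Rightarrow> (complex \<Rightarrow> real) \<Rightarrow> bool" where
  "square_integrable_on S f \<longleftrightarrow>
     set_borel_measurable lborel S f \<and> set_integrable lborel S (\<lambda>z. (f z)\<^sup>2)"

definition has_weak_partial ::
  "complex set \<Rightarrow> complex \<Rightarrow> (complex \<Rightarrow> real) \<Rightarrow> (complex \<Rightarrow> real) \<Rightarrow> bool" where
  "has_weak_partial S v \<psi> g \<longleftrightarrow>
     locally_integrable_on S \<psi> \<and> locally_integrable_on S g \<and>
     (\<forall>\<eta> \<in> test_functions S.
        (LINT z:S|lborel. of_real (\<psi> z) * partial v \<eta> z) =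
        - (LINT z:S|lborel. of_real (g z) * \<eta> z))"

definition has_weak_laplacian ::
  "complex set \<Rightarrow> (complex \<Rightarrow> real) \<Rightarrow> (complex \<Rightarrow> real) \<Rightarrow> bool" where
  "has_weak_laplacian S \<psi> f \<longleftrightarrow>
     locally_integrable_on S \<psi> \<and> locally_integrable_on S f \<and>
     (\<forall>\<eta> \<in> test_functions S.
        (LINT z:S|lborel. of_real (\<psi> z) *
           (partial_x (partial_x \<eta>) z + partial_y (partial_y \<eta>) z)) =
        (LINT z:S|lborel. of_real (f z) * \<eta> z))"

text \<open>
  Distributional derivatives that are functions are unique only up to null sets; a
  representative is chosen. The energies below do not depend on this choice.
\<close>

definition weak_partial :: "complex set \<Rightarrow> complex \<Rightarrow> (complex \<Rightarrow> real) \<Rightarrow> complex \<Rightarrow> real" where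
  "weak_partial S v \<psi> = (SOME g. has_weak_partial S v \<psi> g)"

definition weak_laplacian :: "complex set \<Rightarrow> (complex \<Rightarrow> real) \<Rightarrow> complex \<Rightarrow> real" where
  "weak_laplacian S \<psi> = (SOME f. has_weak_laplacian S \<psi> f)"

definition normalized_test_functions :: "complex set \<Rightarrow> (complex \<Rightarrow> complex) set" where
  "normalized_test_functions S =
     {u \<in> test_functions S. sqrt (LINT z:S|lborel. (cmod (u z))\<^sup>2) = 1}"

definition lambda_m :: "complex set \<Rightarrow> (complex \<Rightarrow> real) \<Rightarrow> ereal" where
  "lambda_m S \<psi> = (INF u \<in> normalized_test_functions S. ereal (
     (LINT z:S|lborel.
        (cmod (partial_x u z + \<i> * of_real (weak_partial S \<i> \<psi> z) * u z))\<^sup>2 +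
        (cmod (partial_y u z - \<i> * of_real (weak_partial S 1 \<psi> z) * u z))\<^sup>2) +
     (LINT z:S|lborel. weak_laplacian S \<psi> z * (cmod (u z))\<^sup>2)))"

definition lambda_e :: "complex set \<Rightarrow> (complex \<Rightarrow> real) \<Rightarrow> ereal" where
  "lambda_e S \<psi> = (INF u \<in> normalized_test_functions S. ereal (
     (LINT z:S|lborel. (cmod (partial_x u z))\<^sup>2 + (cmod (partial_y u z))\<^sup>2) +
     (LINT z:S|lborel. weak_laplacian S \<psi> z * (cmod (u z))\<^sup>2)))"

end

theory Submission
  imports Defs "HOL-Complex_Analysis.Complex_Analysis"
begin

text \<open>
  The function \<open>\<phi>\<close> is a sum over \<open>k\<close> of \<open>flux k = 1024\<^sup>-\<^sup>k\<close> times logarithmic potentials, smoothed on tiny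
  discs, one for each dyadic square of side \<open>2\<^sup>-\<^sup>k\<close>, omitting discs that meet an older one; \<open>\<Delta>\<phi>\<close> lives on the discs.

  Given \<open>n\<close>, choose \<open>k\<close> such that \<open>n flux k\<close> lies between \<open>1/2048\<close> and \<open>1/2\<close>. On a loop around the
  centre of a square of level \<open>k\<close>, \<open>|u|\<close> is controlled by \<open>|D u|\<close>, because parallel transport around the loop
  multiplies \<open>u\<close> by \<open>cis\<close> of the enclosed flux, which stays away from \<open>2\<pi>\<int>\<close>; if older discs interfere,
  \<open>n \<Delta>\<phi>\<close> is large on a fixed proportion of the square. A Poincare inequality on each square gives
  \<open>\<lambda>\<^sup>m \<ge> c 4\<^sup>k\<close>. Without the magnetic field only the support of \<open>\<Delta>\<phi>\<close> matters, and the discs have so small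
  a logarithmic capacity that functions vanishing on any finite number of levels keep bounded energy and mass
  bounded below; the remaining levels contribute arbitrarily little.
\<close>

section \<open>Smooth functions on the plane\<close>

text \<open>A point of the plane has capacity zero, so without a field a function can be cut off
  near tiny discs at almost no cost. With a field, the phase that a disc imprints on a surrounding
  loop (the Aharonov-Bohm effect) prevents this unless the enclosed flux lies in 2 pi Z. A single
  level of discs may therefore fail for infinitely many \<open>n\<close>, and each level is
  responsible only for a window of \<open>n\<close>. Younger discs disturb a loop by at most 1/255
  of the flux of its central disc, since per level their number grows by 4 and their flux shrinks by
  1024. Older discs may be cut by the loop, so their contribution is arbitrary; near them the
  estimate has to come from the density. The radii face opposite demands: a small capacity wants a
  large |ln rad|, while continuity of phi and square integrability of its gradient bound it in terms
  of the flux. As the gradient of the full sum exists only almost everywhere, transport along lines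
  is done for truncated sums, with constants independent of the truncation, and the limit is taken
  in the energies.\<close>

definition smooth_real :: "(real \<Rightarrow> real) \<Rightarrow> bool" where
  "smooth_real g \<longleftrightarrow> (\<exists>d :: nat \<Rightarrow> real \<Rightarrow> real. d 0 = g \<and>
     (\<forall>i t. (d i has_real_derivative d (Suc i) t) (at t)))"

text \<open>Shifting the sequence of derivatives by one shows that the derivative is smooth again,
  so an induction on the order of differentiability can pass from \<open>g\<close> to
  \<open>g'\<close> without mentioning the sequence.\<close>

lemma smooth_realE:
  assumes "smooth_real g"
  obtains g' where "smooth_real g'" "\<And>t. (g has_real_derivative g' t) (at t)"
proof -
  obtain d where d: "d 0 = g" "\<And>i t. (d i has_real_derivative d (Suc i) t) (at t)"
    using assms by (auto simp: smooth_real_def)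
  have "smooth_real (d 1)"
    unfolding smooth_real_def by (rule exI[of _ "\<lambda>i. d (Suc i)"]) (use d in auto)
  then show thesis using that[of "d 1"] d(1) d(2)[of 0] by simp
qed

lemma partial_eq:
  assumes "(u has_derivative D) (at z)"
  shows "partial v u z = D v"
  unfolding partial_def using frechet_derivative_at[OF assms] by simp

lemma partial_mult:
  assumes "u differentiable (at z)" "w differentiable (at z)"
  shows "partial v (\<lambda>z. u z * w z) z = u z * partial v w z + partial v u z * w z"
proof -
  have "((\<lambda>z. u z * w z) has_derivative
      (\<lambda>h. u z * frechet_derivative w (at z) h + frechet_derivative u (at z) h * w z)) (at z)"
    by (intro has_derivative_mult) (use assms in \<open>auto simp: frechet_derivative_works\<close>)
  from partial_eq[OF this, of v] show ?thesis by (simp add: partial_def)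
qed

lemma partial_add:
  assumes "u differentiable (at z)" "w differentiable (at z)"
  shows "partial v (\<lambda>z. u z + w z) z = partial v u z + partial v w z"
proof -
  have "((\<lambda>z. u z + w z) has_derivative
      (\<lambda>h. frechet_derivative u (at z) h + frechet_derivative w (at z) h)) (at z)"
    by (intro has_derivative_add) (use assms in \<open>auto simp: frechet_derivative_works\<close>)
  from partial_eq[OF this, of v] show ?thesis by (simp add: partial_def)
qed

lemma partial_const [simp]: "partial v (\<lambda>z. c) = (\<lambda>z. 0)"
  by (rule ext, rule partial_eq[OF has_derivative_const])

lemma partial_cmult:
  assumes "u differentiable (at z)"
  shows "partial v (\<lambda>z. c * u z) z = c * partial v u z"
  using partial_mult[of "\<lambda>_. c" z u v] assms by simp

lemma C_k_continuous: "C_k k u \<Longrightarrow> continuous_on UNIV u"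
  by (cases k) (auto intro!: differentiable_imp_continuous_on simp: differentiable_on_def)

lemma C_k_differentiable: "C_k (Suc k) u \<Longrightarrow> u differentiable (at z)"
  by simp

lemma C_k_partial:
  assumes "C_k (Suc k) u" "v = 1 \<or> v = \<i>"
  shows "C_k k (partial v u)"
  using assms by auto

lemma C_k_Suc_imp: "C_k (Suc k) u \<Longrightarrow> C_k k u"
proof (induction k arbitrary: u)
  case 0 then show ?case using C_k_continuous[of "Suc 0" u] by simp
next
  case (Suc k)
  have "\<forall>z. u differentiable (at z)" "C_k k (partial_x u)" "C_k k (partial_y u)"
    using Suc.IH[of "partial_x u"] Suc.IH[of "partial_y u"] Suc.prems C_k.simps(2)[of "Suc k" u] by blast+
  then show ?case using C_k.simps(2)[of k u] by blast
qed

lemma C_k_const [simp]: "C_k k (\<lambda>z. c)"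
  by (induction k arbitrary: c) auto

lemma C_k_add: "C_k k u \<Longrightarrow> C_k k w \<Longrightarrow> C_k k (\<lambda>z. u z + w z)"
proof (induction k arbitrary: u w)
  case 0 then show ?case by (auto intro!: continuous_intros)
next
  case (Suc k)
  have "partial v (\<lambda>z. u z + w z) = (\<lambda>z. partial v u z + partial v w z)" for v
    using Suc.prems by (intro ext partial_add) (simp_all)
  with Suc.prems Suc.IH show ?case by simp
qed

lemma C_k_mult: "C_k k u \<Longrightarrow> C_k k w \<Longrightarrow> C_k k (\<lambda>z. u z * w z)"
proof (induction k arbitrary: u w)
  case 0 then show ?case by (auto intro!: continuous_intros)
next
  case (Suc k)
  have eq: "partial v (\<lambda>z. u z * w z) = (\<lambda>z. u z * partial v w z + partial v u z * w z)" for v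
    using Suc.prems by (intro ext partial_mult) (simp_all)
  have 1: "C_k k u" "C_k k w" by (fact Suc.prems[THEN C_k_Suc_imp])+
  have "C_k k (\<lambda>z. u z * partial v w z + partial v u z * w z)" if "v = 1 \<or> v = \<i>" for v
    by (rule C_k_add; rule Suc.IH) (rule 1 C_k_partial[OF Suc.prems(1) that] C_k_partial[OF Suc.prems(2) that])+
  with Suc.prems eq show ?case by (simp add: differentiable_mult)
qed

lemma C_k_sum: "(\<And>i. i \<in> I \<Longrightarrow> C_k k (u i)) \<Longrightarrow> C_k k (\<lambda>z. \<Sum>i\<in>I. u i z)"
  by (induction I rule: infinite_finite_induct) (auto intro: C_k_add)

lemma C_k_prod: "(\<And>i. i \<in> I \<Longrightarrow> C_k k (u i)) \<Longrightarrow> C_k k (\<lambda>z. \<Prod>i\<in>I. u i z)"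
  by (induction I rule: infinite_finite_induct) (auto intro: C_k_mult)

text \<open>\<open>C_k\<close> speaks of complex-valued functions only, so the real inner function
  enters through \<open>of_real\<close>. The chain rule produces \<open>of_real (g' (q z))\<close>
  times a partial derivative of \<open>q\<close>; the induction therefore runs over all smooth
  \<open>g\<close> at once.\<close>

lemma C_k_compose:
  "C_k k (\<lambda>z. of_real (q z)) \<Longrightarrow> smooth_real g \<Longrightarrow> C_k k (\<lambda>z. of_real (g (q z)))"
proof (induction k arbitrary: g)
  case 0
  obtain g' where "smooth_real g'" "\<And>t. (g has_real_derivative g' t) (at t)"
    using "0.prems"(2) by (auto elim: smooth_realE)
  then have g: "continuous_on UNIV g" by (intro DERIV_continuous_on) (rule DERIV_subset, assumption, simp)
  have "continuous_on UNIV (\<lambda>z. Re (of_real (q z)))" using 0 by (intro continuous_intros) simp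
  then have "continuous_on UNIV q" by simp
  then have "continuous_on UNIV (\<lambda>z. g (q z))" by (rule continuous_on_compose2[OF g]) simp
  then show ?case by (auto intro!: continuous_intros)
next
  case (Suc k)
  obtain g' where g': "smooth_real g'" "\<And>t. (g has_real_derivative g' t) (at t)"
    using Suc.prems(2) by (auto elim: smooth_realE)
  let ?Q = "\<lambda>z. complex_of_real (q z)"
  have D: "((\<lambda>z. complex_of_real (g (q z))) has_derivative
      (\<lambda>h. of_real (g' (q z)) * frechet_derivative ?Q (at z) h)) (at z)" for z
  proof -
    have "?Q differentiable (at z)" using Suc.prems by simp
    then have Q: "(?Q has_derivative frechet_derivative ?Q (at z)) (at z)"
      by (simp add: frechet_derivative_works)
    then have q: "(q has_derivative (\<lambda>h. Re (frechet_derivative ?Q (at z) h))) (at z)"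
      using has_derivative_Re[OF Q] by simp
    have "(?Q has_derivative (\<lambda>h. of_real (Re (frechet_derivative ?Q (at z) h)))) (at z)"
      by (rule has_derivative_of_real[OF q])
    \<comment> \<open>The derivative of a real-valued function takes real values; uniqueness of the
      derivative turns this into an equation that removes \<open>Re\<close>.\<close>
    then have eq: "of_real (Re (frechet_derivative ?Q (at z) h)) = frechet_derivative ?Q (at z) h" for h
      using has_derivative_unique[OF Q] by metis
    have "((\<lambda>z. g (q z)) has_derivative (\<lambda>h. Re (frechet_derivative ?Q (at z) h) * g' (q z))) (at z)"
      using has_derivative_compose[OF q g'(2)[of "q z", unfolded has_field_derivative_def]]
      by (simp only: mult.commute)
    then have "((\<lambda>z. complex_of_real (g (q z))) has_derivative
        (\<lambda>h. of_real (Re (frechet_derivative ?Q (at z) h) * g' (q z)))) (at z)"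
      by (rule has_derivative_of_real)
    then show ?thesis by (simp only: of_real_mult eq mult.commute)
  qed
  have p: "partial v (\<lambda>z. complex_of_real (g (q z))) = (\<lambda>z. of_real (g' (q z)) * partial v ?Q z)" for v
    by (rule ext, subst partial_eq[OF D]) (simp add: partial_def)
  have "C_k k (\<lambda>z. of_real (g' (q z)))" by (rule Suc.IH[OF C_k_Suc_imp[OF Suc.prems(1)] g'(1)])
  then have "C_k k (\<lambda>z. of_real (g' (q z)) * partial v ?Q z)" if "v = 1 \<or> v = \<i>" for v
    by (rule C_k_mult) (rule C_k_partial[OF Suc.prems(1) that])
  then have "C_k k (partial v (\<lambda>z. complex_of_real (g (q z))))" if "v = 1 \<or> v = \<i>" for v
    unfolding p using that by blast
  moreover have "(\<lambda>z. complex_of_real (g (q z))) differentiable (at z)" for z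
    using D[of z] by (rule differentiableI)
  ultimately show ?case by simp
qed

lemma partial_bounded_linear: "bounded_linear f \<Longrightarrow> partial v f = (\<lambda>z. f v)"
  by (rule ext, rule partial_eq[OF bounded_linear_imp_has_derivative])

lemma C_k_Re: "C_k k (\<lambda>z. of_real (Re z))" and C_k_Im: "C_k k (\<lambda>z. of_real (Im z))"
proof -
  \<comment> \<open>Partial derivatives of a bounded linear map are constant, so a case distinction
    on \<open>k\<close> takes the place of an induction.\<close>
  have *: "C_k k f" if "bounded_linear f" for f
    using that
    by (cases k) (auto simp: partial_bounded_linear linear_continuous_on
        intro: bounded_linear_imp_differentiable)
  show "C_k k (\<lambda>z. of_real (Re z))" "C_k k (\<lambda>z. of_real (Im z))"
    by (intro * bounded_linear_compose[OF bounded_linear_of_real] bounded_linear_Re bounded_linear_Im)+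
qed

lemma C_k_affine_real:
  assumes "C_k k (\<lambda>z. of_real (q z))"
  shows "C_k k (\<lambda>z. of_real (a * q z + b))"
  using C_k_add[OF C_k_mult[OF C_k_const[of k "of_real a"] assms] C_k_const[of k "of_real b"]] by simp

lemma C_k_cmod_sq: "C_k k (\<lambda>z. of_real ((cmod (z - p))\<^sup>2))"
proof -
  have "C_k k (\<lambda>z. of_real (1 * Re z + (- Re p)) * of_real (1 * Re z + (- Re p)) +
                of_real (1 * Im z + (- Im p)) * of_real (1 * Im z + (- Im p)))"
    by (intro C_k_add C_k_mult C_k_affine_real C_k_Re C_k_Im)
  moreover have "(\<lambda>z. of_real (1 * Re z + (- Re p)) * of_real (1 * Re z + (- Re p)) +
                of_real (1 * Im z + (- Im p)) * of_real (1 * Im z + (- Im p))) = (\<lambda>z. complex_of_real ((cmod (z - p))\<^sup>2))"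
    unfolding of_real_mult[symmetric] of_real_add[symmetric]
    by (intro ext arg_cong[where f = of_real]) (simp add: cmod_def power2_eq_square)
  ultimately show ?thesis by (simp only:)
qed

section \<open>Smooth cutoffs on the real line\<close>

definition flat_exp :: "real \<Rightarrow> real" where
  "flat_exp t = (if 0 < t then exp (- (1 / t)) else 0)"

lemma poly_exp_tendsto_0:
  fixes p :: "real poly"
  shows "((\<lambda>x. poly p x * exp (- x)) \<longlongrightarrow> 0) at_top"
proof -
  have "((\<lambda>x. (\<Sum>i\<le>degree p. coeff p i * (x ^ i / exp x))) \<longlongrightarrow>
     (\<Sum>i\<le>degree p. coeff p i * 0)) at_top"
    by (intro tendsto_sum tendsto_mult tendsto_const tendsto_power_div_exp_0)
  moreover have "poly p x * exp (- x) = (\<Sum>i\<le>degree p. coeff p i * (x ^ i / exp x))" for x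
    unfolding poly_altdef sum_distrib_right by (intro sum.cong refl) (simp add: exp_minus divide_inverse)
  ultimately show ?thesis by simp
qed

text \<open>For t > 0 every derivative has the form P_i(1/t) exp(-1/t) with a polynomial P_i, which
  tends to 0 as t decreases to 0 because the exponential beats every polynomial; for t <= 0 all
  derivatives are 0.\<close>

lemma smooth_real_flat_exp: "smooth_real flat_exp"
proof -
  \<comment> \<open>The recursion comes from d/dt [P(1/t) exp(-1/t)] = (1/t)^2 (P - P')(1/t)
    exp(-1/t).\<close>
  define P :: "nat \<Rightarrow> real poly" where
    "P = rec_nat 1 (\<lambda>_ p. [:0, 0, 1:] * (p - pderiv p))"
  define d where "d i t = (if 0 < t then poly (P i) (1 / t) * exp (- (1 / t)) else 0)" for i and t :: real
  have P: "P (Suc i) = [:0, 0, 1:] * (P i - pderiv (P i))" for i by (simp add: P_def)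
  have lim: "((\<lambda>t. poly q (1 / t) * exp (- (1 / t))) \<longlongrightarrow> 0) (at_right 0)" for q :: "real poly"
    using filterlim_compose[OF poly_exp_tendsto_0 filterlim_inverse_at_top_right] by (simp add: inverse_eq_divide)
  have "(d i has_real_derivative d (Suc i) t) (at t)" for i t
  proof -
    consider "t < 0" | "t > 0" | "t = 0" by linarith
    then show ?thesis
    proof cases
      case 1
      have "eventually (\<lambda>s. s < 0) (nhds t)"
        using eventually_nhds_in_open[of "{..<0}" t] 1 by simp
      then have "eventually (\<lambda>s. 0 = d i s) (nhds t)" by eventually_elim (simp add: d_def)
      then have "((\<lambda>t. 0) has_real_derivative 0) (at t) = (d i has_real_derivative 0) (at t)"
        by (rule DERIV_cong_ev[OF refl _ refl])
      then show ?thesis using 1 by (simp add: d_def)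
    next
      case 2
      have inv: "((\<lambda>t. 1 / t) has_real_derivative - (1 / t\<^sup>2)) (at t)"
        using 2 by (auto intro!: derivative_eq_intros simp: power2_eq_square)
      have "((\<lambda>t. poly (P i) (1 / t)) has_real_derivative poly (pderiv (P i)) (1 / t) * (- (1 / t\<^sup>2))) (at t)"
        by (rule DERIV_chain2[OF poly_DERIV inv])
      moreover have "((\<lambda>t. exp (- (1 / t))) has_real_derivative exp (- (1 / t)) * (1 / t\<^sup>2)) (at t)"
        by (rule DERIV_chain2[OF DERIV_exp]) (use DERIV_minus[OF inv] in simp)
      ultimately have "((\<lambda>t. poly (P i) (1 / t) * exp (- (1 / t))) has_real_derivative
         poly (P i) (1 / t) * (exp (- (1 / t)) * (1 / t\<^sup>2)) + (poly (pderiv (P i)) (1 / t) * (- (1 / t\<^sup>2))) * exp (- (1 / t))) (at t)"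
        by (rule DERIV_mult')
      also have "poly (P i) (1 / t) * (exp (- (1 / t)) * (1 / t\<^sup>2)) + (poly (pderiv (P i)) (1 / t) * (- (1 / t\<^sup>2))) * exp (- (1 / t)) = d (Suc i) t"
        using 2 by (simp add: d_def P algebra_simps power2_eq_square)
      finally have D: "((\<lambda>t. poly (P i) (1 / t) * exp (- (1 / t))) has_real_derivative d (Suc i) t) (at t)" .
      have "eventually (\<lambda>s. s > 0) (nhds t)"
        using eventually_nhds_in_open[of "{0<..}" t] 2 by simp
      then have "eventually (\<lambda>s. poly (P i) (1 / s) * exp (- (1 / s)) = d i s) (nhds t)" by eventually_elim (simp add: d_def)
      then show ?thesis by (rule DERIV_cong_ev[OF refl _ refl, THEN iffD1]) (rule D)
    next
      case 3
      \<comment> \<open>The difference quotient at 0 is (1/h) P_i(1/h) exp(-1/h), again of the form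
        covered by \<open>lim\<close>, with the polynomial X P_i.\<close>
      have "((\<lambda>h. (d i h - d i 0) / h) \<longlongrightarrow> 0) (at_right 0)"
      proof (rule Lim_transform_eventually[OF lim[of "[:0,1:] * P i"]])
        show "\<forall>\<^sub>F x in at_right 0. poly ([:0, 1:] * P i) (1 / x) * exp (- (1 / x)) = (d i x - d i 0) / x"
          by (rule eventually_at_right_less[THEN eventually_mono]) (simp add: d_def)
      qed
      moreover have "((\<lambda>h. (d i h - d i 0) / h) \<longlongrightarrow> 0) (at_left 0)"
      proof (rule Lim_transform_eventually[OF tendsto_const])
        show "\<forall>\<^sub>F x in at_left 0. 0 = (d i x - d i 0) / x"
          by (auto simp: d_def eventually_at_left_field intro!: exI[of _ "-1"])
      qed
      ultimately have "((\<lambda>h. (d i h - d i 0) / h) \<longlongrightarrow> 0) (at 0)"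
        by (simp add: filterlim_at_split)
      then show ?thesis using 3 by (simp add: DERIV_def d_def)
    qed
  qed
  moreover have "d 0 = flat_exp" by (auto simp: d_def flat_exp_def P_def)
  ultimately show ?thesis unfolding smooth_real_def by (intro exI[of _ d] conjI allI)
qed

text \<open>The bump \<open>flat_exp (1 - t)\<close> vanishes for \<open>t \<ge> 1\<close> and exceeds \<open>exp (- 1)\<close> for \<open>t \<le> 0\<close>.\<close>

definition smooth_step :: "real \<Rightarrow> real" where
  "smooth_step t = flat_exp (exp (- 1) - flat_exp (1 - t)) / flat_exp (exp (- 1))"

lemma flat_exp_nonneg: "0 \<le> flat_exp t" by (simp add: flat_exp_def)
lemma flat_exp_pos: "0 < t \<Longrightarrow> 0 < flat_exp t" by (simp add: flat_exp_def)
lemma flat_exp_mono: "s \<le> t \<Longrightarrow> flat_exp s \<le> flat_exp t"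
  by (auto simp: flat_exp_def frac_le)

lemma smooth_step_0: "t \<le> 0 \<Longrightarrow> smooth_step t = 0"
proof -
  assume "t \<le> 0"
  then have "flat_exp 1 \<le> flat_exp (1 - t)" by (intro flat_exp_mono) simp
  moreover have "flat_exp 1 = exp (- 1)" by (simp add: flat_exp_def)
  ultimately have "flat_exp (exp (- 1) - flat_exp (1 - t)) = 0" unfolding flat_exp_def[of "exp (- 1) - _"] by simp
  then show ?thesis by (simp add: smooth_step_def)
qed

lemma smooth_step_1: "1 \<le> t \<Longrightarrow> smooth_step t = 1"
proof -
  assume "1 \<le> t"
  then have "flat_exp (1 - t) = 0" by (simp add: flat_exp_def)
  then show ?thesis using flat_exp_pos[OF exp_gt_zero, of "-1"] unfolding smooth_step_def by simp
qed

lemma smooth_step_nonneg: "0 \<le> smooth_step t" and smooth_step_le_1: "smooth_step t \<le> 1"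
proof -
  show "0 \<le> smooth_step t" unfolding smooth_step_def by (intro divide_nonneg_nonneg flat_exp_nonneg)
  have "flat_exp (exp (- 1) - flat_exp (1 - t)) \<le> flat_exp (exp (- 1))"
    using flat_exp_nonneg[of "1 - t"] by (intro flat_exp_mono) linarith
  then show "smooth_step t \<le> 1" using flat_exp_pos[OF exp_gt_zero, of "-1"] unfolding smooth_step_def
    by (subst divide_le_eq_1_pos)
qed

lemma C_k_smooth_step:
  assumes "C_k k (\<lambda>z. of_real (q z))"
  shows "C_k k (\<lambda>z. of_real (smooth_step (q z)))"
proof -
  let ?q1 = "\<lambda>z. flat_exp ((-1) * q z + 1)"
  let ?q2 = "\<lambda>z. flat_exp ((-1) * ?q1 z + exp (- 1))"
  have "C_k k (\<lambda>z. of_real (?q1 z))"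
    by (rule C_k_compose[where q = "\<lambda>z. (-1) * q z + 1", OF C_k_affine_real[OF assms] smooth_real_flat_exp])
  from C_k_compose[where q = "\<lambda>z. (-1) * ?q1 z + exp (- 1)", OF C_k_affine_real[OF this] smooth_real_flat_exp]
  have "C_k k (\<lambda>z. of_real (1 / flat_exp (exp (- 1)) * ?q2 z + 0))"
    by (rule C_k_affine_real)
  moreover have "1 / flat_exp (exp (- 1)) * ?q2 z + 0 = smooth_step (q z)" for z
    by (simp add: smooth_step_def)
  ultimately show ?thesis by (simp only:)
qed

section \<open>Integration of derivatives and uniqueness of weak derivatives\<close>

lemma measurable_Complex [measurable]:
  "(\<lambda>(x, y). Complex x y) \<in> borel_measurable (borel \<Otimes>\<^sub>M borel)"
proof -
  have "(\<lambda>p. of_real (fst p) + \<i> * of_real (snd p)) \<in> borel_measurable (borel \<Otimes>\<^sub>M borel :: (real \<times> real) measure)"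
    by measurable
  then show ?thesis by (simp add: case_prod_beta Complex_eq)
qed

text \<open>Lebesgue measure is determined by its values on boxes, where both sides give the product
  of the side lengths. This transfers Fubini's theorem for pairs to functions of a complex
  variable.\<close>

lemma lborel_complex_eq: "(lborel :: complex measure) = distr (lborel \<Otimes>\<^sub>M lborel) borel (\<lambda>(x, y). Complex x y)"
proof (rule lborel_eqI)
  fix l u :: complex
  assume le: "\<And>b. b \<in> Basis \<Longrightarrow> l \<bullet> b \<le> u \<bullet> b"
  have le': "Re l \<le> Re u" "Im l \<le> Im u" using le[of 1] le[of \<i>] by (auto simp: Basis_complex_def inner_complex_def)
  have "emeasure (distr (lborel \<Otimes>\<^sub>M lborel) borel (\<lambda>(x, y). Complex x y)) (box l u)
      = emeasure (lborel \<Otimes>\<^sub>M lborel) ({Re l<..<Re u} \<times> {Im l<..<Im u})"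
  proof (subst emeasure_distr)
    show "(\<lambda>(x, y). Complex x y) \<in> borel_measurable (lborel \<Otimes>\<^sub>M lborel)"
      using measurable_Complex by (simp add: borel_prod)
    have "(\<lambda>(x, y). Complex x y) -` box l u \<inter> space (lborel \<Otimes>\<^sub>M lborel) = {Re l<..<Re u} \<times> {Im l<..<Im u}"
      by (auto simp: in_box_complex_iff space_pair_measure)
    then show "emeasure (lborel \<Otimes>\<^sub>M lborel) ((\<lambda>(x, y). Complex x y) -` box l u \<inter> space (lborel \<Otimes>\<^sub>M lborel)) =
      emeasure (lborel \<Otimes>\<^sub>M lborel) ({Re l<..<Re u} \<times> {Im l<..<Im u})" by simp
  qed simp
  also have "\<dots> = ennreal (Re u - Re l) * ennreal (Im u - Im l)"
    using le' by (subst lborel.emeasure_pair_measure_Times) auto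
  also have "\<dots> = ennreal (\<Prod>b\<in>Basis. (u - l) \<bullet> b)"
    using le' by (simp add: Basis_complex_def inner_complex_def ennreal_mult)
  finally show "emeasure (distr (lborel \<Otimes>\<^sub>M lborel) borel (\<lambda>(x, y). Complex x y)) (box l u) = (\<Prod>b\<in>Basis. (u - l) \<bullet> b)" .
qed simp

lemma
  fixes f :: "complex \<Rightarrow> 'b::{banach, second_countable_topology}"
  assumes f: "integrable lborel f"
  shows AE_integrable_Complex_fst: "AE x in lborel. integrable lborel (\<lambda>y. f (Complex x y))"
    and AE_integrable_Complex_snd: "AE y in lborel. integrable lborel (\<lambda>x. f (Complex x y))"
    and Fubini_complex_fst: "(LINT z|lborel. f z) = (LINT x|lborel. LINT y|lborel. f (Complex x y))"
    and Fubini_complex_snd: "(LINT z|lborel. f z) = (LINT y|lborel. LINT x|lborel. f (Complex x y))"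
proof -
  have m: "(\<lambda>(x, y). Complex x y) \<in> measurable (lborel \<Otimes>\<^sub>M lborel) borel"
    using measurable_Complex by (simp add: borel_prod)
  have fm: "f \<in> borel_measurable borel" using f by auto
  have i: "integrable (lborel \<Otimes>\<^sub>M lborel) (\<lambda>p. f (case p of (x, y) \<Rightarrow> Complex x y))"
    using f unfolding lborel_complex_eq by (rule integrable_distr[OF m])
  have i2: "integrable (lborel \<Otimes>\<^sub>M lborel) (\<lambda>(x, y). f (Complex x y))"
    using i by (simp add: case_prod_beta')
  have e: "(LINT z|lborel. f z) = integral\<^sup>L (lborel \<Otimes>\<^sub>M lborel) (\<lambda>(x, y). f (Complex x y))"
    unfolding lborel_complex_eq by (subst integral_distr[OF m fm]) (simp add: case_prod_beta')
  have i3: "integrable (lborel \<Otimes>\<^sub>M lborel) (\<lambda>(y, x). f (Complex x y))"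
    using lborel_pair.integrable_product_swap[OF i2] by (simp add: case_prod_beta')
  show "AE x in lborel. integrable lborel (\<lambda>y. f (Complex x y))"
    using lborel_pair.AE_integrable_fst'[OF i2] by simp
  show "AE y in lborel. integrable lborel (\<lambda>x. f (Complex x y))"
    using lborel_pair.AE_integrable_fst'[OF i3] by simp
  show "(LINT z|lborel. f z) = (LINT x|lborel. LINT y|lborel. f (Complex x y))"
    using lborel_pair.integral_fst'[OF i2] e by simp
  have "integral\<^sup>L (lborel \<Otimes>\<^sub>M lborel) (\<lambda>(x, y). f (Complex x y)) = integral\<^sup>L (lborel \<Otimes>\<^sub>M lborel) (\<lambda>(y, x). f (Complex x y))"
    using lborel_pair.integral_product_swap[of "\<lambda>(x, y). f (Complex x y)"] i2 by (simp add: case_prod_beta')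
  then show "(LINT z|lborel. f z) = (LINT y|lborel. LINT x|lborel. f (Complex x y))"
    using lborel_pair.integral_fst'[OF i3] e by simp
qed

text \<open>The fundamental theorem on an interval that contains the support. The finite set
  \<open>E\<close> allows for jumps of the derivative: the second derivatives of
  \<open>log_pot\<close> jump where a line crosses the boundary circle of the disc.\<close>

lemma integral_derivative_eq_0:
  fixes w w' :: "real \<Rightarrow> 'b::euclidean_space"
  assumes "continuous_on UNIV w" "finite E"
    and "\<And>x. x \<notin> E \<Longrightarrow> (w has_vector_derivative w' x) (at x)"
    and "\<And>x. \<bar>x\<bar> > b \<Longrightarrow> w x = 0 \<and> w' x = 0" "integrable lborel w'"
  shows "(LINT x|lborel. w' x) = 0"
proof -
  let ?b = "\<bar>b\<bar> + 1"
  have "(w' has_integral (w ?b - w (- ?b))) {- ?b..?b}"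
    by (rule fundamental_theorem_of_calculus_strong[OF assms(2)])
       (use assms(1,3) in \<open>auto intro: continuous_on_subset\<close>)
  moreover have "w ?b = 0" "w (- ?b) = 0" by (auto intro!: assms(4)[THEN conjunct1])
  ultimately have "(w' has_integral 0) {- ?b..?b}" by simp
  then have "(w' has_integral 0) UNIV"
    by (rule has_integral_on_superset) (auto intro!: assms(4)[THEN conjunct2])
  with has_integral_integral_lborel[OF assms(5)] show ?thesis
    by (rule has_integral_unique)
qed

lemma integral_x_derivative_eq_0:
  fixes w w' :: "complex \<Rightarrow> complex"
  assumes "\<And>y. continuous_on UNIV (\<lambda>x. w (Complex x y))" "\<And>y. finite (E y)"
    and "\<And>x y. x \<notin> E y \<Longrightarrow> ((\<lambda>x. w (Complex x y)) has_vector_derivative w' (Complex x y)) (at x)"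
    and supp: "\<And>z. cmod z > b \<Longrightarrow> w z = 0 \<and> w' z = 0" and int: "integrable lborel w'"
  shows "(LINT z|lborel. w' z) = 0"
proof -
  have "AE y in lborel. (LINT x|lborel. w' (Complex x y)) = 0"
    using AE_integrable_Complex_snd[OF int]
  proof eventually_elim
    case (elim y)
    show ?case
    proof (rule integral_derivative_eq_0[OF assms(1)[of y] assms(2)[of y] assms(3) _ elim, of b])
      fix x :: real assume "\<bar>x\<bar> > b"
      then have "cmod (Complex x y) > b" using abs_Re_le_cmod[of "Complex x y"] by simp
      then show "w (Complex x y) = 0 \<and> w' (Complex x y) = 0" by (rule supp)
    qed
  qed
  then have "(LINT y|lborel. LINT x|lborel. w' (Complex x y)) = 0" by (rule integral_eq_zero_AE)
  then show ?thesis using Fubini_complex_snd[OF int] by simp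
qed

lemma integral_y_derivative_eq_0:
  fixes w w' :: "complex \<Rightarrow> complex"
  assumes "\<And>x. continuous_on UNIV (\<lambda>y. w (Complex x y))" "\<And>x. finite (E x)"
    and "\<And>x y. y \<notin> E x \<Longrightarrow> ((\<lambda>y. w (Complex x y)) has_vector_derivative w' (Complex x y)) (at y)"
    and supp: "\<And>z. cmod z > b \<Longrightarrow> w z = 0 \<and> w' z = 0" and int: "integrable lborel w'"
  shows "(LINT z|lborel. w' z) = 0"
proof -
  have "AE x in lborel. (LINT y|lborel. w' (Complex x y)) = 0"
    using AE_integrable_Complex_fst[OF int]
  proof eventually_elim
    case (elim x)
    show ?case
    proof (rule integral_derivative_eq_0[OF assms(1)[of x] assms(2)[of x] assms(3) _ elim, of b])
      fix y :: real assume "\<bar>y\<bar> > b"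
      then have "cmod (Complex x y) > b" using abs_Im_le_cmod[of "Complex x y"] by simp
      then show "w (Complex x y) = 0 \<and> w' (Complex x y) = 0" by (rule supp)
    qed
  qed
  then have "(LINT x|lborel. LINT y|lborel. w' (Complex x y)) = 0" by (rule integral_eq_zero_AE)
  then show ?thesis using Fubini_complex_fst[OF int] by simp
qed

text \<open>Boxes are stable under intersection and generate the Borel sets, so the integral over
  every Borel set is 0; applied to the sets where \<open>h\<close> is positive or negative this
  makes both of them null sets.\<close>

lemma AE_eq_0_if_box_integrals_eq_0:
  fixes h :: "complex \<Rightarrow> real"
  assumes h: "integrable lborel h" and box0: "\<And>a b. (LINT z:box a b|lborel. h z) = 0"
  shows "AE z in lborel. h z = 0"
proof -
  have hA: "set_integrable lborel A h" if "A \<in> sets borel" for A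
    using integrable_mult_indicator[of A lborel h] that h by (simp add: set_integrable_def)
  \<comment> \<open>The complement step of the induction below needs the integral over the whole
    plane, which is the limit over growing boxes.\<close>
  have UN: "(LINT z:UNIV|lborel. h z) = 0"
  proof -
    let ?B = "\<lambda>n::nat. box (- (real n *\<^sub>R (\<Sum>Basis))) (real n *\<^sub>R (\<Sum>Basis)) :: complex set"
    have "incseq ?B"
      by (auto simp: incseq_def box_def intro: less_le_trans order.strict_trans1 )
    have UN: "(\<Union>n. ?B n) = UNIV" by (rule UN_box_eq_UNIV)
    have "(\<lambda>n. LINT z:?B n|lborel. h z) \<longlonglongrightarrow> (LINT z:(\<Union>n. ?B n)|lborel. h z)"
      by (rule set_integral_cont_up) (use \<open>incseq ?B\<close> hA UN in auto)
    moreover have "(\<lambda>n. LINT z:?B n|lborel. h z) = (\<lambda>n. 0)" using box0 by simp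
    ultimately have "(\<lambda>n::nat. 0) \<longlonglongrightarrow> (LINT z:UNIV|lborel. h z)" using UN by (simp only:)
    then show ?thesis by (simp add: LIMSEQ_const_iff)
  qed
  have main: "(LINT z:A|lborel. h z) = 0" if "A \<in> sets borel" for A
  proof -
    let ?G = "range (\<lambda>(a, b). box a b :: complex set)"
    have sets: "sigma_sets UNIV ?G = sets borel"
      by (simp add: borel_eq_box)
    have "Int_stable ?G"
      by (auto simp: Int_stable_def box_Int_box)
    moreover have "?G \<subseteq> Pow UNIV" by simp
    moreover have "A \<in> sigma_sets UNIV ?G" using that sets by simp
    ultimately show ?thesis
    proof (induction rule: sigma_sets_induct_disjoint)
      case (basic A) then show ?case using box0 by auto
    next
      case empty then show ?case by (simp add: set_lebesgue_integral_def)
    next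
      case (compl A)
      have A: "A \<in> sets borel" using compl sets by simp
      have "(LINT z:A \<union> (UNIV - A)|lborel. h z) = (LINT z:A|lborel. h z) + (LINT z:(UNIV - A)|lborel. h z)"
        by (rule set_integral_Un) (use hA A in auto)
      then show ?case using UN compl by simp
    next
      case (union A)
      have A: "A i \<in> sets borel" for i using union(2) sets by auto
      have "(LINT z:(\<Union>i. A i)|lborel. h z) = (\<Sum>i. LINT z:A i|lborel. h z)"
        by (rule lebesgue_integral_countable_add) (use hA A union(1) in \<open>auto simp: disjoint_family_on_def\<close>)
      then show ?case using union by simp
    qed
  qed
  have meas: "h \<in> borel_measurable borel" using h by auto
  have [measurable]: "{z. 0 < h z} \<in> sets borel" "{z. h z < 0} \<in> sets borel"
    using meas by measurable
  have "AE z in lborel. indicator {z. 0 < h z} z *\<^sub>R h z = 0"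
  proof (rule integral_nonneg_eq_0_iff_AE[THEN iffD1])
    show "integrable lborel (\<lambda>z. indicator {z. 0 < h z} z *\<^sub>R h z)"
      using hA[of "{z. 0 < h z}"] by (simp add: set_integrable_def)
    show "(LINT z|lborel. indicator {z. 0 < h z} z *\<^sub>R h z) = 0"
      using main[of "{z. 0 < h z}"] by (simp add: set_lebesgue_integral_def)
  qed (auto simp: indicator_def)
  moreover have "AE z in lborel. - (indicator {z. h z < 0} z *\<^sub>R h z) = 0"
  proof (rule integral_nonneg_eq_0_iff_AE[THEN iffD1])
    show "integrable lborel (\<lambda>z. - (indicator {z. h z < 0} z *\<^sub>R h z))"
      using hA[of "{z. h z < 0}"] by (simp add: set_integrable_def)
    show "(LINT z|lborel. - (indicator {z. h z < 0} z *\<^sub>R h z)) = 0"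
      using main[of "{z. h z < 0}"] by (simp add: set_lebesgue_integral_def)
  qed (auto simp: indicator_def)
  ultimately show ?thesis by eventually_elim (auto simp: indicator_def split: if_splits)
qed

lemma test_function_bounded:
  assumes "u \<in> test_functions S"
  obtains M where "\<And>z. cmod (u z) \<le> M" "0 \<le> M"
proof -
  let ?K = "closure {z. u z \<noteq> 0}"
  have c: "compact ?K" and "C_k 0 u" using assms by (auto simp: test_functions_def)
  then have "continuous_on ?K u" by (auto intro: continuous_on_subset)
  then have "bounded (u ` ?K)" using c compact_continuous_image compact_imp_bounded by blast
  then obtain M where M: "\<And>z. z \<in> ?K \<Longrightarrow> cmod (u z) \<le> M" by (auto simp: bounded_iff)
  have "cmod (u z) \<le> max M 0" for z
  proof (cases "u z = 0")
    case False
    then have "z \<in> ?K" using closure_subset[of "{z. u z \<noteq> 0}"] by auto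
    then show ?thesis using M[of z] by simp
  qed simp
  then show thesis using that[of "max M 0"] by simp
qed

lemma test_function_support:
  assumes "u \<in> test_functions S"
  obtains b where "\<And>z. cmod z > b \<Longrightarrow> u z = 0"
proof -
  have "bounded (closure {z. u z \<noteq> 0})" using assms compact_imp_bounded by (auto simp: test_functions_def)
  then obtain b where b: "\<And>z. z \<in> closure {z. u z \<noteq> 0} \<Longrightarrow> cmod z \<le> b" by (auto simp: bounded_iff)
  have "u z = 0" if "cmod z > b" for z
    using b[of z] that closure_subset[of "{z. u z \<noteq> 0}"] by force
  then show thesis using that by blast
qed

lemma partial_eq_0_off_support:
  assumes "z \<notin> closure {z. u z \<noteq> 0}"
  shows "partial v u z = 0"
proof -
  have "((\<lambda>z. 0) has_derivative (\<lambda>h. 0)) (at z)" by simp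
  then have "(u has_derivative (\<lambda>h. 0)) (at z)"
    by (rule has_derivative_transform_within_open[where s = "- closure {z. u z \<noteq> 0}"])
       (use assms closure_subset[of "{z. u z \<noteq> 0}"] in auto)
  then show ?thesis by (rule partial_eq)
qed

lemma test_functions_partial:
  assumes "u \<in> test_functions S" "v = 1 \<or> v = \<i>"
  shows "partial v u \<in> test_functions S"
proof -
  have sub: "closure {z. partial v u z \<noteq> 0} \<subseteq> closure {z. u z \<noteq> 0}"
    using partial_eq_0_off_support by (intro closure_minimal) auto
  have K: "compact (closure {z. u z \<noteq> 0})" "closure {z. u z \<noteq> 0} \<subseteq> S" and C: "\<And>k. C_k k u"
    using assms by (auto simp: test_functions_def)
  have "compact (closure {z. partial v u z \<noteq> 0})"
    using compact_Int_closed[OF K(1) closed_closure, of "{z. partial v u z \<noteq> 0}"] sub by (simp add: Int_absorb1)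
  moreover have "C_k k (partial v u)" for k using C[of "Suc k"] assms(2) by (rule C_k_partial)
  ultimately show ?thesis using sub K by (auto simp: test_functions_def)
qed

lemma test_functions_continuous: "u \<in> test_functions S \<Longrightarrow> continuous_on UNIV u"
  using C_k_continuous[of 0 u] unfolding test_functions_def by blast

lemma test_functions_measurable: "u \<in> test_functions S \<Longrightarrow> u \<in> borel_measurable borel"
  using test_functions_continuous borel_measurable_continuous_onI by blast

lemma test_functions_differentiable: "u \<in> test_functions S \<Longrightarrow> u differentiable (at z)"
  using C_k_differentiable[of 0 u z] by (auto simp: test_functions_def simp del: C_k.simps)

lemma test_functions_eq_0: "u \<in> test_functions S \<Longrightarrow> z \<notin> S \<Longrightarrow> u z = 0"
  using closure_subset[of "{z. u z \<noteq> 0}"] by (auto simp: test_functions_def)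

lemma integrable_mult_test_function:
  assumes g: "locally_integrable_on S g" and u: "u \<in> test_functions S" and S: "S \<in> sets borel"
  shows "integrable lborel (\<lambda>z. indicator S z *\<^sub>R (of_real (g z) * u z))"
proof -
  let ?K = "closure {z. u z \<noteq> 0}"
  have K: "compact ?K" "?K \<subseteq> S" using u by (auto simp: test_functions_def)
  obtain M where M: "\<And>z. cmod (u z) \<le> M" using test_function_bounded[OF u] by blast
  have gK: "integrable lborel (\<lambda>z. indicator ?K z *\<^sub>R g z)"
    using g K by (auto simp: locally_integrable_on_def set_integrable_def)
  \<comment> \<open>Local integrability controls \<open>g\<close> on compact sets only, so the
    indicator of \<open>S\<close> is traded for that of the support of \<open>u\<close>, outside of
    which the product is 0.\<close>
  have eq: "indicator S z *\<^sub>R (of_real (g z) * u z) = of_real (indicator ?K z *\<^sub>R g z) * u z" for z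
    using K closure_subset[of "{z. u z \<noteq> 0}"] by (cases "u z = 0") (auto simp: indicator_def)
  show ?thesis unfolding eq
  proof (rule Bochner_Integration.integrable_bound[where f = "\<lambda>z. M * (indicator ?K z *\<^sub>R g z)"])
    show "integrable lborel (\<lambda>z. M * (indicator ?K z *\<^sub>R g z))" using gK by (rule integrable_mult_right)
    show "(\<lambda>z. of_real (indicator ?K z *\<^sub>R g z) * u z) \<in> borel_measurable lborel"
    proof -
      define G where "G z = indicator ?K z *\<^sub>R g z" for z
      have "G \<in> borel_measurable lborel" "u \<in> borel_measurable lborel"
        using borel_measurable_integrable[OF gK] test_functions_measurable[OF u] unfolding G_def by simp_all
      then have "(\<lambda>z. of_real (G z) * u z) \<in> borel_measurable lborel" by measurable
      then show ?thesis unfolding G_def .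
    qed
    show "AE z in lborel. norm (of_real (indicator ?K z *\<^sub>R g z) * u z) \<le> norm (M * (indicator ?K z *\<^sub>R g z))"
    proof (rule AE_I2)
      fix z
      have "cmod (u z) \<le> \<bar>M\<bar>" using M[of z] by linarith
      then have "\<bar>indicator ?K z *\<^sub>R g z\<bar> * cmod (u z) \<le> \<bar>indicator ?K z *\<^sub>R g z\<bar> * \<bar>M\<bar>"
        by (rule mult_left_mono) simp
      then show "norm (of_real (indicator ?K z *\<^sub>R g z) * u z) \<le> norm (M * (indicator ?K z *\<^sub>R g z))"
        by (simp add: norm_mult abs_mult mult.commute)
    qed
  qed
qed

text \<open>As \<open>j\<close> grows, these bumps tend pointwise to the indicator of the open box.
  The arguments have the shape \<open>a * q z + b\<close> expected by
  \<open>C_k_affine_real\<close>.\<close>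

definition box_bump :: "complex \<Rightarrow> complex \<Rightarrow> nat \<Rightarrow> complex \<Rightarrow> real" where
  "box_bump a b j z = smooth_step (real j * Re z + - (real j * Re a)) * smooth_step (- real j * Re z + real j * Re b) *
     (smooth_step (real j * Im z + - (real j * Im a)) * smooth_step (- real j * Im z + real j * Im b))"

lemma box_bump_eq_0: "z \<notin> box a b \<Longrightarrow> box_bump a b j z = 0"
proof -
  assume "z \<notin> box a b"
  then consider "Re z \<le> Re a" | "Re b \<le> Re z" | "Im z \<le> Im a" | "Im b \<le> Im z"
    by (force simp: in_box_complex_iff)
  then show ?thesis
    by cases (auto simp: box_bump_def mult_left_mono smooth_step_0)
qed

lemma box_bump_bounds: "0 \<le> box_bump a b j z" "box_bump a b j z \<le> 1"
  unfolding box_bump_def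
  by (auto intro!: mult_nonneg_nonneg mult_le_one smooth_step_nonneg smooth_step_le_1)

lemma box_bump_test_function:
  assumes "cbox a b \<subseteq> S"
  shows "(\<lambda>z. of_real (box_bump a b j z)) \<in> test_functions S"
proof -
  have "C_k k (\<lambda>z. of_real (box_bump a b j z))" for k
    unfolding box_bump_def of_real_mult
    by (intro C_k_mult C_k_smooth_step C_k_affine_real C_k_Re C_k_Im)
  moreover have sub: "closure {z. complex_of_real (box_bump a b j z) \<noteq> 0} \<subseteq> cbox a b"
    using box_bump_eq_0 box_subset_cbox by (intro closure_minimal) fastforce+
  moreover have "compact (closure {z. complex_of_real (box_bump a b j z) \<noteq> 0})"
    using compact_Int_closed[OF compact_cbox closed_closure, of a b "{z. complex_of_real (box_bump a b j z) \<noteq> 0}"] sub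
    by (simp add: Int_absorb1)
  ultimately show ?thesis using assms by (auto simp: test_functions_def)
qed

lemma smooth_step_tendsto_1: "0 < t \<Longrightarrow> (\<lambda>j. smooth_step (real j * t)) \<longlonglongrightarrow> 1"
proof (rule tendsto_eventually)
  assume "0 < t"
  then obtain N :: nat where N: "1 < real N * t" using reals_Archimedean3 by blast
  have "smooth_step (real j * t) = 1" if "N \<le> j" for j
  proof -
    have "real N * t \<le> real j * t" using that \<open>0 < t\<close> by simp
    then show ?thesis using N by (intro smooth_step_1) linarith
  qed
  then show "\<forall>\<^sub>F j in sequentially. smooth_step (real j * t) = 1"
    by (auto simp: eventually_sequentially)
qed

lemma box_bump_tendsto: "(\<lambda>j. box_bump a b j z) \<longlonglongrightarrow> indicator (box a b) z"
proof (cases "z \<in> box a b")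
  case True
  then have z: "0 < Re z - Re a" "0 < Re b - Re z" "0 < Im z - Im a" "0 < Im b - Im z"
    by (auto simp: in_box_complex_iff)
  have eq: "box_bump a b j z = smooth_step (real j * (Re z - Re a)) * smooth_step (real j * (Re b - Re z)) *
     (smooth_step (real j * (Im z - Im a)) * smooth_step (real j * (Im b - Im z)))" for j
    unfolding box_bump_def by (intro arg_cong2[where f = "(*)"] arg_cong[where f = smooth_step]) (simp_all only: algebra_simps)
  have "(\<lambda>j. box_bump a b j z) \<longlonglongrightarrow> 1 * 1 * (1 * 1)"
    unfolding eq by (intro tendsto_mult smooth_step_tendsto_1 z)
  then show ?thesis using True by simp
qed (simp add: box_bump_eq_0)

text \<open>Testing against \<open>box_bump\<close> and letting \<open>j\<close> grow shows that
  \<open>g\<close> has integral 0 over every box whose closed box lies in \<open>S\<close>. So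
  \<open>g\<close> vanishes almost everywhere on each such box, and countably many of them cover
  \<open>S\<close>.\<close>

lemma du_Bois_Reymond:
  assumes "open S" and g: "locally_integrable_on S g"
    and zero: "\<And>u. u \<in> test_functions S \<Longrightarrow> (LINT z:S|lborel. of_real (g z) * u z) = 0"
  shows "AE z in lborel. z \<in> S \<longrightarrow> g z = 0"
proof -
  have box0: "(LINT z:box a b|lborel. g z) = 0" if ab: "cbox a b \<subseteq> S" for a b
  proof -
    have gK: "integrable lborel (\<lambda>z. indicator (cbox a b) z *\<^sub>R g z)"
      using g ab by (auto simp: locally_integrable_on_def set_integrable_def)
    have meas: "box_bump a b j \<in> borel_measurable borel" for j
    proof -
      have "(\<lambda>z. Re (of_real (box_bump a b j z))) \<in> borel_measurable borel"
        using test_functions_measurable[OF box_bump_test_function[OF ab]] by measurable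
      then show ?thesis by simp
    qed
    have "(\<lambda>j. LINT z|lborel. (indicator (cbox a b) z *\<^sub>R g z) * box_bump a b j z) \<longlonglongrightarrow>
          (LINT z|lborel. (indicator (cbox a b) z *\<^sub>R g z) * indicator (box a b) z)"
    proof (rule integral_dominated_convergence[where w = "\<lambda>z. norm (indicator (cbox a b) z *\<^sub>R g z)"])
      show "integrable lborel (\<lambda>z. norm (indicator (cbox a b) z *\<^sub>R g z))" using gK by (rule integrable_norm)
      show "AE z in lborel. norm ((indicator (cbox a b) z *\<^sub>R g z) * box_bump a b j z) \<le> norm (indicator (cbox a b) z *\<^sub>R g z)" for j
      proof (rule AE_I2)
        fix z
        have "\<bar>indicator (cbox a b) z *\<^sub>R g z\<bar> * box_bump a b j z \<le> \<bar>indicator (cbox a b) z *\<^sub>R g z\<bar>"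
          by (rule mult_left_le[OF box_bump_bounds(2) abs_ge_zero])
        then show "norm ((indicator (cbox a b) z *\<^sub>R g z) * box_bump a b j z) \<le> norm (indicator (cbox a b) z *\<^sub>R g z)"
          using box_bump_bounds(1)[of a b j z] by (simp only: real_norm_def abs_mult abs_of_nonneg)
      qed
      show "AE z in lborel. (\<lambda>j. (indicator (cbox a b) z *\<^sub>R g z) * box_bump a b j z) \<longlonglongrightarrow>
          (indicator (cbox a b) z *\<^sub>R g z) * indicator (box a b) z"
        by (intro AE_I2 tendsto_mult tendsto_const box_bump_tendsto)
      show "(\<lambda>z. (indicator (cbox a b) z *\<^sub>R g z) * indicator (box a b) z) \<in> borel_measurable lborel"
        using borel_measurable_integrable[OF gK] by measurable
      show "(\<lambda>z. (indicator (cbox a b) z *\<^sub>R g z) * box_bump a b j z) \<in> borel_measurable lborel" for j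
        using borel_measurable_integrable[OF gK] meas[of j] by measurable
    qed
    moreover have "(LINT z|lborel. (indicator (cbox a b) z *\<^sub>R g z) * box_bump a b j z) = 0" for j
    proof -
      have "complex_of_real (LINT z|lborel. (indicator (cbox a b) z *\<^sub>R g z) * box_bump a b j z) =
        (LINT z|lborel. of_real ((indicator (cbox a b) z *\<^sub>R g z) * box_bump a b j z))"
        by (rule integral_complex_of_real[symmetric])
      also have "\<dots> = (LINT z:S|lborel. of_real (g z) * of_real (box_bump a b j z))"
        unfolding set_lebesgue_integral_def
      proof (rule Bochner_Integration.integral_cong[OF refl])
        fix z
        have "z \<in> cbox a b \<and> z \<in> S" if "z \<in> box a b" using that ab box_subset_cbox[of a b] by blast
        then show "complex_of_real ((indicator (cbox a b) z *\<^sub>R g z) * box_bump a b j z) =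
            indicator S z *\<^sub>R (of_real (g z) * of_real (box_bump a b j z))"
          by (cases "z \<in> box a b") (simp_all add: box_bump_eq_0)
      qed
      also have "\<dots> = 0" by (rule zero[OF box_bump_test_function[OF ab]])
      finally show ?thesis by simp
    qed
    ultimately have "(LINT z|lborel. (indicator (cbox a b) z *\<^sub>R g z) * indicator (box a b) z) = 0"
      by (simp add: LIMSEQ_const_iff)
    moreover have "(LINT z|lborel. (indicator (cbox a b) z *\<^sub>R g z) * indicator (box a b) z) = (LINT z:box a b|lborel. g z)"
      unfolding set_lebesgue_integral_def using box_subset_cbox[of a b]
      by (intro Bochner_Integration.integral_cong refl) (auto simp: indicator_def)
    ultimately show ?thesis by simp
  qed
  have loc: "AE z in lborel. z \<in> box a b \<longrightarrow> g z = 0" if ab: "cbox a b \<subseteq> S" for a b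
  proof -
    let ?h = "\<lambda>z. indicator (box a b) z *\<^sub>R g z"
    have gK: "set_integrable lborel (cbox a b) g"
      using g ab by (auto simp: locally_integrable_on_def)
    have "set_integrable lborel (box a b) g"
      by (rule set_integrable_subset[OF gK]) (auto simp: box_subset_cbox)
    then have "integrable lborel ?h" by (simp add: set_integrable_def)
    moreover have "(LINT z:box c d|lborel. ?h z) = 0" for c d
    proof -
      obtain p q where pq: "box c d \<inter> box a b = box p q" using box_Int_box by blast
      have "(LINT z:box c d|lborel. ?h z) = (LINT z:box p q|lborel. g z)"
        unfolding set_lebesgue_integral_def pq[symmetric]
        by (intro Bochner_Integration.integral_cong refl) (auto simp: indicator_def)
      also have "\<dots> = 0"
      proof (cases "box p q = {}")
        case False
        then have "closure (box p q) = cbox p q" by (rule closure_box)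
        moreover have "closure (box p q) \<subseteq> cbox a b"
          unfolding pq[symmetric] using box_subset_cbox[of a b] by (intro closure_minimal) auto
        ultimately have "cbox p q \<subseteq> S" using ab by simp
        then show ?thesis by (rule box0)
      qed (simp add: set_lebesgue_integral_def)
      finally show ?thesis .
    qed
    ultimately have "AE z in lborel. ?h z = 0" by (rule AE_eq_0_if_box_integrals_eq_0)
    then show ?thesis by eventually_elim (auto simp: indicator_def split: if_splits)
  qed
  define \<F> where "\<F> = {box a b | a b. cbox a b \<subseteq> S}"
  have "\<Union>\<F> = S"
  proof
    show "\<Union>\<F> \<subseteq> S"
    proof
      fix z assume "z \<in> \<Union>\<F>"
      then obtain a b where "cbox a b \<subseteq> S" "z \<in> box a b" by (auto simp: \<F>_def)
      then show "z \<in> S" using box_subset_cbox[of a b] by blast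
    qed
    show "S \<subseteq> \<Union>\<F>"
    proof
      fix z assume "z \<in> S"
      obtain a b where "cbox a b \<subseteq> S" "z \<in> box a b" "\<forall>i\<in>Basis. a \<bullet> i < b \<bullet> i"
        by (rule open_contains_cbox[OF \<open>open S\<close> \<open>z \<in> S\<close>])
      then show "z \<in> \<Union>\<F>" by (auto simp: \<F>_def)
    qed
  qed
  \<comment> \<open>The exceptional null sets may be united only over a countable family.\<close>
  obtain \<F>' where \<F>': "\<F>' \<subseteq> \<F>" "countable \<F>'" "\<Union>\<F>' = \<Union>\<F>"
    by (rule Lindelof[of \<F>]) (auto simp: \<F>_def)
  have "AE z in lborel. \<forall>B\<in>\<F>'. z \<in> B \<longrightarrow> g z = 0"
  proof (subst AE_ball_countable[OF \<F>'(2)], rule ballI)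
    fix B assume "B \<in> \<F>'"
    then obtain a b where "B = box a b" "cbox a b \<subseteq> S" using \<F>'(1) by (auto simp: \<F>_def)
    then show "AE z in lborel. z \<in> B \<longrightarrow> g z = 0" using loc by simp
  qed
  then show ?thesis
  proof eventually_elim
    case (elim z)
    then show ?case using \<F>'(3) \<open>\<Union>\<F> = S\<close> by blast
  qed
qed

lemma weak_rep_unique:
  assumes "open S" "locally_integrable_on S g" "locally_integrable_on S h"
    and "\<And>u. u \<in> test_functions S \<Longrightarrow> (LINT z:S|lborel. of_real (g z) * u z) = (LINT z:S|lborel. of_real (h z) * u z)"
  shows "AE z in lborel. z \<in> S \<longrightarrow> g z = h z"
proof -
  have S: "S \<in> sets borel" using assms(1) by simp
  have "AE z in lborel. z \<in> S \<longrightarrow> g z - h z = 0"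
  proof (rule du_Bois_Reymond[OF assms(1)])
    show "locally_integrable_on S (\<lambda>z. g z - h z)"
      using assms(2,3) by (auto simp: locally_integrable_on_def intro: set_integral_diff)
    fix u assume u: "u \<in> test_functions S"
    have "(LINT z:S|lborel. of_real (g z - h z) * u z) = (LINT z:S|lborel. of_real (g z) * u z - of_real (h z) * u z)"
      by (simp add: algebra_simps)
    also have "\<dots> = (LINT z:S|lborel. of_real (g z) * u z) - (LINT z:S|lborel. of_real (h z) * u z)"
      using integrable_mult_test_function[OF assms(2) u S] integrable_mult_test_function[OF assms(3) u S]
      by (intro set_integral_diff) (auto simp: set_integrable_def)
    finally show "(LINT z:S|lborel. of_real (g z - h z) * u z) = 0" using assms(4)[OF u] by simp
  qed
  then show ?thesis by simp
qed

lemma weak_partial_AE: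
  assumes "open S" "has_weak_partial S v \<psi> g"
  shows "AE z in lborel. z \<in> S \<longrightarrow> weak_partial S v \<psi> z = g z"
proof -
  have "has_weak_partial S v \<psi> (weak_partial S v \<psi>)"
    unfolding weak_partial_def by (rule someI[of "has_weak_partial S v \<psi>", OF assms(2)])
  with assms show ?thesis
    by (intro weak_rep_unique) (auto simp: has_weak_partial_def)
qed

lemma weak_laplacian_AE:
  assumes "open S" "has_weak_laplacian S \<psi> f"
  shows "AE z in lborel. z \<in> S \<longrightarrow> weak_laplacian S \<psi> z = f z"
proof -
  have "has_weak_laplacian S \<psi> (weak_laplacian S \<psi>)"
    unfolding weak_laplacian_def by (rule someI[of "has_weak_laplacian S \<psi>", OF assms(2)])
  with assms show ?thesis
    by (intro weak_rep_unique) (auto simp: has_weak_laplacian_def)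
qed

section \<open>The potential of a disc\<close>

text \<open>\<open>log_pot r\<close> is the \<open>C\<^sup>1\<close> potential of the disc of radius \<open>r\<close> carrying constant density and total mass \<open>2\<pi>\<close>.\<close>

definition log_pot :: "real \<Rightarrow> complex \<Rightarrow> real" where
  "log_pot r z = (if r \<le> cmod z then ln (cmod z) else ln r + ((cmod z)\<^sup>2 / r\<^sup>2 - 1) / 2)"

definition pot_x :: "real \<Rightarrow> complex \<Rightarrow> real" where
  "pot_x r z = Re z / max ((cmod z)\<^sup>2) (r\<^sup>2)"

definition pot_y :: "real \<Rightarrow> complex \<Rightarrow> real" where
  "pot_y r z = Im z / max ((cmod z)\<^sup>2) (r\<^sup>2)"

definition pot_xx :: "real \<Rightarrow> complex \<Rightarrow> real" where
  "pot_xx r z = (if cmod z < r then 1 / r\<^sup>2 else ((Im z)\<^sup>2 - (Re z)\<^sup>2) / ((cmod z)\<^sup>2)\<^sup>2)"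

definition pot_yy :: "real \<Rightarrow> complex \<Rightarrow> real" where
  "pot_yy r z = (if cmod z < r then 1 / r\<^sup>2 else ((Re z)\<^sup>2 - (Im z)\<^sup>2) / ((cmod z)\<^sup>2)\<^sup>2)"

lemma pot_xx_add_yy: "pot_xx r z + pot_yy r z = 2 / r\<^sup>2 * indicator (ball 0 r) z"
  by (auto simp: pot_xx_def pot_yy_def simp flip: add_divide_distrib)

text \<open>\<open>log_pot\<close> as a function of s = |z|^2, a variable that is smooth at the
  centre, unlike |z|.\<close>

definition radial_log :: "real \<Rightarrow> real \<Rightarrow> real" where
  "radial_log r s = (if r\<^sup>2 \<le> s then ln s / 2 else ln r + (s / r\<^sup>2 - 1) / 2)"

lemma log_pot_radial: "0 < r \<Longrightarrow> log_pot r z = radial_log r ((cmod z)\<^sup>2)"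
  using power2_le_iff_abs_le[of "cmod z" r] abs_le_square_iff[of r "cmod z"]
  by (auto simp: log_pot_def radial_log_def ln_realpow)

text \<open>Both branches have the same value and the derivative 1 / (2 r^2) at s = r^2, so one
  formula with \<open>max\<close> covers both sides. At the seam the two one-sided difference
  quotients are treated separately.\<close>

lemma DERIV_radial_log:
  assumes r: "0 < r"
  shows "(radial_log r has_real_derivative 1 / (2 * max s (r\<^sup>2))) (at s)"
proof -
  have r2: "0 < r\<^sup>2" using r by simp
  have D1: "((\<lambda>s. ln s / 2) has_real_derivative 1 / (2 * s)) (at s)" if "0 < s" for s
    using that by (auto intro!: derivative_eq_intros)
  have D2: "((\<lambda>s. ln r + (s / r\<^sup>2 - 1) / 2) has_real_derivative 1 / (2 * r\<^sup>2)) (at s)" for s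
  proof -
    have "((\<lambda>s. ln r + (s / r\<^sup>2 - 1) / 2) has_real_derivative 0 + (1 / r\<^sup>2 - 0) / 2) (at s)"
      by (intro DERIV_add DERIV_const DERIV_cdivide DERIV_diff DERIV_ident)
    then show ?thesis by (simp add: mult.commute)
  qed
  consider "s < r\<^sup>2" | "r\<^sup>2 < s" | "s = r\<^sup>2" by linarith
  then show ?thesis
  proof cases
    case 1
    have "eventually (\<lambda>t. t < r\<^sup>2) (nhds s)" using eventually_nhds_in_open[of "{..<r\<^sup>2}" s] 1 by simp
    then have ev: "eventually (\<lambda>t. ln r + (t / r\<^sup>2 - 1) / 2 = radial_log r t) (nhds s)"
      by eventually_elim (simp add: radial_log_def)
    have m: "max s (r\<^sup>2) = r\<^sup>2" using 1 by simp
    show ?thesis unfolding m by (rule DERIV_cong_ev[OF refl ev refl, THEN iffD1, OF D2])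
  next
    case 2
    have "eventually (\<lambda>t. r\<^sup>2 < t) (nhds s)" using eventually_nhds_in_open[of "{r\<^sup>2<..}" s] 2 by simp
    then have ev: "eventually (\<lambda>t. ln t / 2 = radial_log r t) (nhds s)"
      by eventually_elim (simp add: radial_log_def)
    have m: "max s (r\<^sup>2) = s" using 2 by simp
    show ?thesis unfolding m by (rule DERIV_cong_ev[OF refl ev refl, THEN iffD1, OF D1[OF less_trans[OF r2 2]]])
  next
    case 3
    have at: "radial_log r s = ln s / 2" "radial_log r s = ln r + (s / r\<^sup>2 - 1) / 2"
      using 3 r by (auto simp: radial_log_def ln_realpow)
    have "((\<lambda>t. (radial_log r t - radial_log r s) / (t - s)) \<longlongrightarrow> 1 / (2 * s)) (at_right s)"
    proof (rule Lim_transform_eventually)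
      show "((\<lambda>t. (ln t / 2 - ln s / 2) / (t - s)) \<longlongrightarrow> 1 / (2 * s)) (at_right s)"
        using D1[of s] 3 r2 has_field_derivative_at_within[of _ _ s "{s<..}"] by (auto simp: has_field_derivative_iff)
      show "\<forall>\<^sub>F t in at_right s. (ln t / 2 - ln s / 2) / (t - s) = (radial_log r t - radial_log r s) / (t - s)"
        unfolding at(1) using 3 by (intro eventually_at_right_less[THEN eventually_mono]) (simp add: radial_log_def)
    qed
    moreover have "((\<lambda>t. (radial_log r t - radial_log r s) / (t - s)) \<longlongrightarrow> 1 / (2 * s)) (at_left s)"
    proof (rule Lim_transform_eventually)
      show "((\<lambda>t. ((ln r + (t / r\<^sup>2 - 1) / 2) - (ln r + (s / r\<^sup>2 - 1) / 2)) / (t - s)) \<longlongrightarrow> 1 / (2 * s)) (at_left s)"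
        using D2[of s] 3 has_field_derivative_at_within[of "\<lambda>s. ln r + (s / r\<^sup>2 - 1) / 2" _ s "{..<s}"] by (auto simp: has_field_derivative_iff)
      show "\<forall>\<^sub>F t in at_left s. ((ln r + (t / r\<^sup>2 - 1) / 2) - (ln r + (s / r\<^sup>2 - 1) / 2)) / (t - s) = (radial_log r t - radial_log r s) / (t - s)"
        unfolding at(2) using 3 by (intro eventually_at_leftI[of "s - 1"]) (auto simp: radial_log_def)
    qed
    ultimately have "((\<lambda>t. (radial_log r t - radial_log r s) / (t - s)) \<longlongrightarrow> 1 / (2 * s)) (at s)"
      by (simp add: filterlim_at_split)
    then show ?thesis using 3 by (simp add: has_field_derivative_iff)
  qed
qed

lemma max_sq_pos: "0 < r \<Longrightarrow> 0 < max a (r\<^sup>2 :: real)"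
  using zero_less_power[of r 2] by (simp add: less_max_iff_disj)

lemma has_derivative_log_pot:
  assumes r: "0 < r"
  shows "((\<lambda>z. log_pot r (z - p)) has_derivative (\<lambda>h. pot_x r (z - p) * Re h + pot_y r (z - p) * Im h)) (at z)"
proof -
  have "((\<lambda>z. (cmod (z - p))\<^sup>2) has_derivative (\<lambda>h. 2 * Re (z - p) * Re h + 2 * Im (z - p) * Im h)) (at z)"
    unfolding cmod_power2 by (auto intro!: derivative_eq_intros simp: fun_eq_iff algebra_simps)
  from has_derivative_compose[OF this DERIV_radial_log[OF r, of "(cmod (z - p))\<^sup>2", unfolded has_field_derivative_def]]
  have "((\<lambda>z. radial_log r ((cmod (z - p))\<^sup>2)) has_derivative
      (\<lambda>h. 1 / (2 * max ((cmod (z - p))\<^sup>2) (r\<^sup>2)) * (2 * Re (z - p) * Re h + 2 * Im (z - p) * Im h))) (at z)" .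
  moreover have "(\<lambda>h. 1 / (2 * max ((cmod (z - p))\<^sup>2) (r\<^sup>2)) * (2 * Re (z - p) * Re h + 2 * Im (z - p) * Im h))
     = (\<lambda>h. pot_x r (z - p) * Re h + pot_y r (z - p) * Im h)"
  proof -
    have key: "1 / (2 * m) * (2 * a * x + 2 * b * y) = a / m * x + b / m * y" if "0 < m" for m a b x y :: real
      using that by (simp add: field_simps)
    show ?thesis unfolding pot_x_def pot_y_def by (intro ext key max_sq_pos r)
  qed
  ultimately show ?thesis using log_pot_radial[OF r] by simp
qed

lemma continuous_log_pot: "0 < r \<Longrightarrow> continuous_on S (\<lambda>z. log_pot r (z - p))"
  by (rule has_derivative_continuous_on, rule has_derivative_at_withinI, rule has_derivative_log_pot)

lemma
  assumes r: "0 < r"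
  shows continuous_pot_x: "continuous_on S (\<lambda>z. pot_x r (z - p))"
    and continuous_pot_y: "continuous_on S (\<lambda>z. pot_y r (z - p))"
proof -
  have nz: "\<forall>z\<in>S. max ((cmod (z - p))\<^sup>2) (r\<^sup>2) \<noteq> 0"
  proof
    fix z show "max ((cmod (z - p))\<^sup>2) (r\<^sup>2) \<noteq> 0" using max_sq_pos[OF r, of "(cmod (z - p))\<^sup>2"] by linarith
  qed
  have c: "continuous_on S (\<lambda>z. max ((cmod (z - p))\<^sup>2) (r\<^sup>2))" by (intro continuous_intros)
  show "continuous_on S (\<lambda>z. pot_x r (z - p))" unfolding pot_x_def
    by (rule continuous_on_divide[OF _ c nz]) (intro continuous_intros)
  show "continuous_on S (\<lambda>z. pot_y r (z - p))" unfolding pot_y_def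
    by (rule continuous_on_divide[OF _ c nz]) (intro continuous_intros)
qed

lemma pot_grad_sq_le:
  assumes r: "0 < r"
  shows "(pot_x r z)\<^sup>2 + (pot_y r z)\<^sup>2 \<le> 1 / max ((cmod z)\<^sup>2) (r\<^sup>2)"
proof -
  let ?m = "max ((cmod z)\<^sup>2) (r\<^sup>2)"
  have m: "0 < ?m" using r by (rule max_sq_pos)
  have "(pot_x r z)\<^sup>2 + (pot_y r z)\<^sup>2 = (cmod z)\<^sup>2 / ?m\<^sup>2"
    by (simp add: pot_x_def pot_y_def power_divide cmod_power2 flip: add_divide_distrib)
  also have "\<dots> \<le> ?m / ?m\<^sup>2" by (intro divide_right_mono) auto
  also have "\<dots> = 1 / ?m" using m by (simp add: power2_eq_square)
  finally show ?thesis .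
qed

lemma
  assumes r: "0 < r"
  shows abs_pot_x_le: "\<bar>pot_x r z\<bar> \<le> 1 / r" and abs_pot_y_le: "\<bar>pot_y r z\<bar> \<le> 1 / r"
proof -
  have "1 / max ((cmod z)\<^sup>2) (r\<^sup>2) \<le> 1 / r\<^sup>2" using r max_sq_pos[OF r] by (intro divide_left_mono) auto
  with pot_grad_sq_le[OF r, of z] have "(pot_x r z)\<^sup>2 + (pot_y r z)\<^sup>2 \<le> (1 / r)\<^sup>2" by (simp add: power_divide)
  then have "(pot_x r z)\<^sup>2 \<le> (1 / r)\<^sup>2" "(pot_y r z)\<^sup>2 \<le> (1 / r)\<^sup>2"
    using zero_le_power2[of "pot_x r z"] zero_le_power2[of "pot_y r z"] by linarith+
  then show "\<bar>pot_x r z\<bar> \<le> 1 / r" "\<bar>pot_y r z\<bar> \<le> 1 / r"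
    using r power2_le_iff_abs_le[of "1 / r"] by simp_all
qed

lemma abs_pot_second_le:
  assumes r: "0 < r"
  shows "\<bar>pot_xx r z\<bar> \<le> 1 / r\<^sup>2" "\<bar>pot_yy r z\<bar> \<le> 1 / r\<^sup>2"
proof -
  have *: "\<bar>a\<bar> / ((cmod z)\<^sup>2)\<^sup>2 \<le> 1 / r\<^sup>2" if "\<bar>a\<bar> \<le> (cmod z)\<^sup>2" "r \<le> cmod z" for a
  proof -
    have "\<bar>a\<bar> / ((cmod z)\<^sup>2)\<^sup>2 \<le> (cmod z)\<^sup>2 / ((cmod z)\<^sup>2)\<^sup>2" using that by (intro divide_right_mono) auto
    also have "\<dots> = 1 / (cmod z)\<^sup>2" using that r by (simp add: power2_eq_square)
    also have "\<dots> \<le> 1 / r\<^sup>2" using that r by (intro divide_left_mono mult_pos_pos power_mono) auto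
    finally show ?thesis .
  qed
  have a: "\<bar>(Im z)\<^sup>2 - (Re z)\<^sup>2\<bar> \<le> (cmod z)\<^sup>2" "\<bar>(Re z)\<^sup>2 - (Im z)\<^sup>2\<bar> \<le> (cmod z)\<^sup>2"
    unfolding cmod_power2 by (simp_all add: abs_le_iff)
  show "\<bar>pot_xx r z\<bar> \<le> 1 / r\<^sup>2" "\<bar>pot_yy r z\<bar> \<le> 1 / r\<^sup>2"
    using *[OF a(1)] *[OF a(2)] by (auto simp: pot_xx_def pot_yy_def)
qed

lemma measurable_pot_second [measurable]: "pot_xx r \<in> borel_measurable borel" "pot_yy r \<in> borel_measurable borel"
  unfolding pot_xx_def pot_yy_def by measurable

text \<open>The function is a component of the gradient of \<open>log_pot\<close> on a line. Its
  derivative jumps where the line meets the circle, which \<open>ne\<close> excludes.\<close>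

lemma DERIV_quotient_max:
  fixes x y r :: real
  assumes r: "0 < r" and ne: "x\<^sup>2 + y\<^sup>2 \<noteq> r\<^sup>2"
  shows "((\<lambda>x. x / max (x\<^sup>2 + y\<^sup>2) (r\<^sup>2)) has_real_derivative
     (if x\<^sup>2 + y\<^sup>2 < r\<^sup>2 then 1 / r\<^sup>2 else (y\<^sup>2 - x\<^sup>2) / (x\<^sup>2 + y\<^sup>2)\<^sup>2)) (at x)"
proof (cases "x\<^sup>2 + y\<^sup>2 < r\<^sup>2")
  case True
  have "open {x. x\<^sup>2 + y\<^sup>2 < r\<^sup>2}" by (intro open_Collect_less continuous_intros)
  then have "eventually (\<lambda>x. x\<^sup>2 + y\<^sup>2 < r\<^sup>2) (nhds x)" using eventually_nhds_in_open[of "{x. x\<^sup>2 + y\<^sup>2 < r\<^sup>2}" x] True by simp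
  then have ev: "eventually (\<lambda>x. x / r\<^sup>2 = x / max (x\<^sup>2 + y\<^sup>2) (r\<^sup>2)) (nhds x)"
    by eventually_elim (simp add: max_def)
  have "((\<lambda>x. x / r\<^sup>2) has_real_derivative 1 / r\<^sup>2) (at x)"
    by (rule DERIV_cdivide[OF DERIV_ident])
  with True show ?thesis using DERIV_cong_ev[OF refl ev refl] by simp
next
  case False
  then have gt: "r\<^sup>2 < x\<^sup>2 + y\<^sup>2" using ne by simp
  have "open {x. r\<^sup>2 < x\<^sup>2 + y\<^sup>2}" by (intro open_Collect_less continuous_intros)
  then have "eventually (\<lambda>x. r\<^sup>2 < x\<^sup>2 + y\<^sup>2) (nhds x)" using eventually_nhds_in_open[of "{x. r\<^sup>2 < x\<^sup>2 + y\<^sup>2}" x] gt by simp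
  then have ev: "eventually (\<lambda>x. x / (x\<^sup>2 + y\<^sup>2) = x / max (x\<^sup>2 + y\<^sup>2) (r\<^sup>2)) (nhds x)"
    by eventually_elim (simp add: max_def)
  have nz: "x\<^sup>2 + y\<^sup>2 \<noteq> 0" using gt zero_le_power2[of r] by linarith
  have "((\<lambda>x. x\<^sup>2 + y\<^sup>2) has_real_derivative 2 * x) (at x)"
    by (auto intro!: derivative_eq_intros)
  from DERIV_divide[where f = "\<lambda>x. x" and D = 1, OF DERIV_ident this nz]
  have "((\<lambda>x. x / (x\<^sup>2 + y\<^sup>2)) has_real_derivative (1 * (x\<^sup>2 + y\<^sup>2) - x * (2 * x)) / ((x\<^sup>2 + y\<^sup>2) * (x\<^sup>2 + y\<^sup>2))) (at x)"
    .
  moreover have "(1 * (x\<^sup>2 + y\<^sup>2) - x * (2 * x)) / ((x\<^sup>2 + y\<^sup>2) * (x\<^sup>2 + y\<^sup>2)) = (y\<^sup>2 - x\<^sup>2) / (x\<^sup>2 + y\<^sup>2)\<^sup>2"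
    by (simp add: power2_eq_square)
  ultimately show ?thesis using False DERIV_cong_ev[OF refl ev refl] by simp
qed

definition pot_line_exc :: "real \<Rightarrow> real \<Rightarrow> real \<Rightarrow> real set" where
  "pot_line_exc r c y = {x. (x - c)\<^sup>2 + y\<^sup>2 = r\<^sup>2}"

lemma finite_pot_line_exc: "finite (pot_line_exc r c y)"
proof -
  have "pot_line_exc r c y \<subseteq> {c + sqrt (r\<^sup>2 - y\<^sup>2), c - sqrt (r\<^sup>2 - y\<^sup>2)}"
  proof
    fix x assume "x \<in> pot_line_exc r c y"
    then have "(x - c)\<^sup>2 = r\<^sup>2 - y\<^sup>2" by (simp add: pot_line_exc_def)
    then have "sqrt (r\<^sup>2 - y\<^sup>2) = \<bar>x - c\<bar>" by (metis real_sqrt_abs)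
    then show "x \<in> {c + sqrt (r\<^sup>2 - y\<^sup>2), c - sqrt (r\<^sup>2 - y\<^sup>2)}" by auto
  qed
  then show ?thesis by (rule finite_subset) simp
qed

lemma cmod_less_iff_sq: "0 < r \<Longrightarrow> cmod z < r \<longleftrightarrow> (Re z)\<^sup>2 + (Im z)\<^sup>2 < r\<^sup>2"
  unfolding cmod_power2[symmetric]
  using power_strict_mono[of "cmod z" r 2] power2_less_imp_less[of "cmod z" r] by auto

lemma DERIV_pot_x:
  assumes r: "0 < r" and x: "x \<notin> pot_line_exc r (Re p) (y - Im p)"
  shows "((\<lambda>x. pot_x r (Complex x y - p)) has_real_derivative pot_xx r (Complex x y - p)) (at x)"
proof -
  have "((\<lambda>x. (x - Re p) / max ((x - Re p)\<^sup>2 + (y - Im p)\<^sup>2) (r\<^sup>2)) has_real_derivative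
     (if (x - Re p)\<^sup>2 + (y - Im p)\<^sup>2 < r\<^sup>2 then 1 / r\<^sup>2
      else ((y - Im p)\<^sup>2 - (x - Re p)\<^sup>2) / ((x - Re p)\<^sup>2 + (y - Im p)\<^sup>2)\<^sup>2) * 1) (at x)"
    by (rule DERIV_chain2[OF DERIV_quotient_max[OF r]])
       (use x in \<open>auto simp: pot_line_exc_def intro!: derivative_eq_intros\<close>)
  then show ?thesis
    unfolding pot_x_def pot_xx_def cmod_less_iff_sq[OF r] cmod_power2
    by (simp only: minus_complex.sel complex.sel mult_1_right)
qed

lemma DERIV_pot_y:
  assumes r: "0 < r" and y: "y \<notin> pot_line_exc r (Im p) (x - Re p)"
  shows "((\<lambda>y. pot_y r (Complex x y - p)) has_real_derivative pot_yy r (Complex x y - p)) (at y)"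
proof -
  have "((\<lambda>y. (y - Im p) / max ((y - Im p)\<^sup>2 + (x - Re p)\<^sup>2) (r\<^sup>2)) has_real_derivative
     (if (y - Im p)\<^sup>2 + (x - Re p)\<^sup>2 < r\<^sup>2 then 1 / r\<^sup>2
      else ((x - Re p)\<^sup>2 - (y - Im p)\<^sup>2) / ((y - Im p)\<^sup>2 + (x - Re p)\<^sup>2)\<^sup>2) * 1) (at y)"
    by (rule DERIV_chain2[OF DERIV_quotient_max[OF r]])
       (use y in \<open>auto simp: pot_line_exc_def intro!: derivative_eq_intros\<close>)
  then show ?thesis
    unfolding pot_y_def pot_yy_def cmod_less_iff_sq[OF r] cmod_power2
    by (simp only: minus_complex.sel complex.sel mult_1_right add.commute)
qed

lemma integrable_bounded_mult_test_function:
  fixes g :: "complex \<Rightarrow> real"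
  assumes g: "g \<in> borel_measurable borel" "\<And>z. u z \<noteq> 0 \<Longrightarrow> \<bar>g z\<bar> \<le> M" and u: "u \<in> test_functions S"
  shows "integrable lborel (\<lambda>z. of_real (g z) * u z)"
proof -
  obtain b where b: "\<And>z. cmod z > b \<Longrightarrow> u z = 0" using test_function_support[OF u] by blast
  obtain N where N: "\<And>z. cmod (u z) \<le> N" "0 \<le> N" using test_function_bounded[OF u] by blast
  show ?thesis
  proof (rule Bochner_Integration.integrable_bound[where f = "\<lambda>z. \<bar>M\<bar> * N * indicator (cball 0 b) z"])
    show "integrable lborel (\<lambda>z. \<bar>M\<bar> * N * indicator (cball 0 b :: complex set) z)"
      using emeasure_bounded_finite[OF bounded_cball, of "0 :: complex" b]
      by (intro integrable_mult_right integrable_real_indicator) (auto simp: infinity_ennreal_def)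
    have "u \<in> borel_measurable borel" by (rule test_functions_measurable[OF u])
    with g show "(\<lambda>z. of_real (g z) * u z) \<in> borel_measurable lborel" by measurable
    show "AE z in lborel. norm (of_real (g z) * u z) \<le> norm (\<bar>M\<bar> * N * indicator (cball 0 b) z)"
    proof (rule AE_I2)
      fix z
      show "norm (of_real (g z) * u z) \<le> norm (\<bar>M\<bar> * N * indicator (cball 0 b) z)"
      proof (cases "u z = 0")
        case False
        then have "z \<in> cball 0 b" using b[of z] by (auto simp: not_le[symmetric])
        moreover have "\<bar>g z\<bar> * cmod (u z) \<le> \<bar>M\<bar> * N"
          using g(2)[OF False] N by (intro mult_mono) auto
        ultimately show ?thesis using N(2) by (simp add: norm_mult)
      qed simp
    qed
  qed
qed

lemma partial_x_has_vector_derivative: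
  assumes "u differentiable (at (Complex x y))"
  shows "((\<lambda>x. u (Complex x y)) has_vector_derivative partial_x u (Complex x y)) (at x)"
proof -
  have "((\<lambda>x. Complex x y) has_vector_derivative 1) (at x)"
    unfolding Complex_eq by (auto intro!: derivative_eq_intros)
  then have "((u \<circ> (\<lambda>x. Complex x y)) has_vector_derivative frechet_derivative u (at (Complex x y)) 1) (at x)"
    using assms by (intro vector_derivative_diff_chain_within[where S = UNIV, simplified])
       (auto simp: frechet_derivative_works intro: has_derivative_at_withinI)
  then show ?thesis by (simp add: partial_def o_def)
qed

lemma partial_y_has_vector_derivative:
  assumes "u differentiable (at (Complex x y))"
  shows "((\<lambda>y. u (Complex x y)) has_vector_derivative partial_y u (Complex x y)) (at y)"
proof -
  have "((\<lambda>y. Complex x y) has_vector_derivative \<i>) (at y)"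
    unfolding Complex_eq by (auto intro!: derivative_eq_intros)
  then have "((u \<circ> (\<lambda>y. Complex x y)) has_vector_derivative frechet_derivative u (at (Complex x y)) \<i>) (at y)"
    using assms by (intro vector_derivative_diff_chain_within[where S = UNIV, simplified])
       (auto simp: frechet_derivative_works intro: has_derivative_at_withinI)
  then show ?thesis by (simp add: partial_def o_def)
qed

lemma continuous_on_Complex_line:
  assumes "continuous_on UNIV w"
  shows "continuous_on S (\<lambda>x. w (Complex x y))" "continuous_on S (\<lambda>y. w (Complex x y))"
proof -
  have "continuous_on S (\<lambda>x. Complex x y)" "continuous_on S (\<lambda>y. Complex x y)"
    unfolding Complex_eq by (intro continuous_intros)+
  then show "continuous_on S (\<lambda>x. w (Complex x y))" "continuous_on S (\<lambda>y. w (Complex x y))"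
    using continuous_on_compose2[OF assms] by blast+
qed

lemma continuous_bounded_on_support:
  fixes g :: "complex \<Rightarrow> real"
  assumes "continuous_on UNIV g" "u \<in> test_functions S"
  obtains M where "\<And>z. u z \<noteq> 0 \<Longrightarrow> \<bar>g z\<bar> \<le> M"
proof -
  obtain b where b: "\<And>z. cmod z > b \<Longrightarrow> u z = 0" using test_function_support[OF assms(2)] by blast
  have "bounded (g ` cball 0 b)"
    using assms(1) by (intro compact_imp_bounded compact_continuous_image) (auto intro: continuous_on_subset)
  then obtain M where M: "\<forall>x\<in>g ` cball 0 b. norm x \<le> M" unfolding bounded_iff by blast
  have "\<bar>g z\<bar> \<le> M" if "u z \<noteq> 0" for z
  proof -
    have "\<not> cmod z > b" using that b by blast
    then show ?thesis using M by simp
  qed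
  then show thesis using that by blast
qed

text \<open>The derivative of \<open>g * u\<close> along each horizontal line integrates to 0.
  Continuity of \<open>g\<close> makes the exceptional points harmless: a jump of \<open>g\<close>
  would leave a boundary term.\<close>

lemma integration_by_parts_x:
  fixes g g' :: "complex \<Rightarrow> real"
  assumes g: "continuous_on UNIV g" and g': "g' \<in> borel_measurable borel" "\<And>z. \<bar>g' z\<bar> \<le> M"
    and E: "\<And>y. finite (E y)"
    and deriv: "\<And>x y. x \<notin> E y \<Longrightarrow> ((\<lambda>x. g (Complex x y)) has_real_derivative g' (Complex x y)) (at x)"
    and u: "u \<in> test_functions S"
  shows "(LINT z|lborel. of_real (g z) * partial_x u z) = - (LINT z|lborel. of_real (g' z) * u z)"
proof -
  obtain b where b: "\<And>z. cmod z > b \<Longrightarrow> u z = 0" using test_function_support[OF u] by blast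
  have ux: "partial_x u \<in> test_functions S" using u by (intro test_functions_partial) auto
  obtain b' where b': "\<And>z. cmod z > b' \<Longrightarrow> partial_x u z = 0" using test_function_support[OF ux] by blast
  obtain M' where M': "\<And>z. partial_x u z \<noteq> 0 \<Longrightarrow> \<bar>g z\<bar> \<le> M'" using continuous_bounded_on_support[OF g ux] by blast
  have i1: "integrable lborel (\<lambda>z. of_real (g z) * partial_x u z)"
    by (rule integrable_bounded_mult_test_function[OF borel_measurable_continuous_onI[OF g] M' ux])
  have i2: "integrable lborel (\<lambda>z. of_real (g' z) * u z)"
    by (rule integrable_bounded_mult_test_function[OF g'(1) g'(2) u])
  have "(LINT z|lborel. of_real (g z) * partial_x u z + of_real (g' z) * u z) = 0"
  proof (rule integral_x_derivative_eq_0[where w = "\<lambda>z. of_real (g z) * u z" and E = E and b = "max b b'"])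
    have "continuous_on UNIV (\<lambda>z. of_real (g z) * u z)"
      using g test_functions_continuous[OF u] by (intro continuous_intros)
    then show "continuous_on UNIV (\<lambda>x. of_real (g (Complex x y)) * u (Complex x y))" for y
      by (rule continuous_on_Complex_line)
    fix x y assume x: "x \<notin> E y"
    have "((\<lambda>x. complex_of_real (g (Complex x y))) has_vector_derivative of_real (g' (Complex x y))) (at x)"
      using deriv[OF x] by (intro has_vector_derivative_of_real) (simp add: has_real_derivative_iff_has_vector_derivative)
    from has_vector_derivative_mult[OF this partial_x_has_vector_derivative[OF test_functions_differentiable[OF u]]]
    show "((\<lambda>x. of_real (g (Complex x y)) * u (Complex x y)) has_vector_derivative
       of_real (g (Complex x y)) * partial_x u (Complex x y) + of_real (g' (Complex x y)) * u (Complex x y)) (at x)" .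
  qed (use E b b' i1 i2 in auto)
  then show ?thesis using i1 i2 by (simp add: add_eq_0_iff)
qed

lemma integration_by_parts_y:
  fixes g g' :: "complex \<Rightarrow> real"
  assumes g: "continuous_on UNIV g" and g': "g' \<in> borel_measurable borel" "\<And>z. \<bar>g' z\<bar> \<le> M"
    and E: "\<And>x. finite (E x)"
    and deriv: "\<And>x y. y \<notin> E x \<Longrightarrow> ((\<lambda>y. g (Complex x y)) has_real_derivative g' (Complex x y)) (at y)"
    and u: "u \<in> test_functions S"
  shows "(LINT z|lborel. of_real (g z) * partial_y u z) = - (LINT z|lborel. of_real (g' z) * u z)"
proof -
  obtain b where b: "\<And>z. cmod z > b \<Longrightarrow> u z = 0" using test_function_support[OF u] by blast
  have ux: "partial_y u \<in> test_functions S" using u by (intro test_functions_partial) auto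
  obtain b' where b': "\<And>z. cmod z > b' \<Longrightarrow> partial_y u z = 0" using test_function_support[OF ux] by blast
  obtain M' where M': "\<And>z. partial_y u z \<noteq> 0 \<Longrightarrow> \<bar>g z\<bar> \<le> M'" using continuous_bounded_on_support[OF g ux] by blast
  have i1: "integrable lborel (\<lambda>z. of_real (g z) * partial_y u z)"
    by (rule integrable_bounded_mult_test_function[OF borel_measurable_continuous_onI[OF g] M' ux])
  have i2: "integrable lborel (\<lambda>z. of_real (g' z) * u z)"
    by (rule integrable_bounded_mult_test_function[OF g'(1) g'(2) u])
  have "(LINT z|lborel. of_real (g z) * partial_y u z + of_real (g' z) * u z) = 0"
  proof (rule integral_y_derivative_eq_0[where w = "\<lambda>z. of_real (g z) * u z" and E = E and b = "max b b'"])
    have "continuous_on UNIV (\<lambda>z. of_real (g z) * u z)"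
      using g test_functions_continuous[OF u] by (intro continuous_intros)
    then show "continuous_on UNIV (\<lambda>y. of_real (g (Complex x y)) * u (Complex x y))" for x
      by (rule continuous_on_Complex_line)
    fix x y assume y: "y \<notin> E x"
    have "((\<lambda>y. complex_of_real (g (Complex x y))) has_vector_derivative of_real (g' (Complex x y))) (at y)"
      using deriv[OF y] by (intro has_vector_derivative_of_real) (simp add: has_real_derivative_iff_has_vector_derivative)
    from has_vector_derivative_mult[OF this partial_y_has_vector_derivative[OF test_functions_differentiable[OF u]]]
    show "((\<lambda>y. of_real (g (Complex x y)) * u (Complex x y)) has_vector_derivative
       of_real (g (Complex x y)) * partial_y u (Complex x y) + of_real (g' (Complex x y)) * u (Complex x y)) (at y)" .
  qed (use E b b' i1 i2 in auto)
  then show ?thesis using i1 i2 by (simp add: add_eq_0_iff)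
qed

lemma log_pot_weak_x:
  assumes r: "0 < r" and u: "u \<in> test_functions S"
  shows "(LINT z|lborel. of_real (log_pot r (z - p)) * partial_x u z) = - (LINT z|lborel. of_real (pot_x r (z - p)) * u z)"
proof (rule integration_by_parts_x[where E = "\<lambda>_. {}", OF continuous_log_pot[OF r] borel_measurable_continuous_onI[OF continuous_pot_x[OF r]] abs_pot_x_le[OF r] _ _ u])
  fix x y
  have "((\<lambda>x. Complex x y) has_derivative (\<lambda>h. of_real h)) (at x)"
    unfolding Complex_eq by (auto intro!: derivative_eq_intros)
  from has_derivative_compose[OF this has_derivative_log_pot[OF r]]
  show "((\<lambda>x. log_pot r (Complex x y - p)) has_real_derivative pot_x r (Complex x y - p)) (at x)"
    by (simp add: has_field_derivative_def)
qed simp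

lemma log_pot_weak_y:
  assumes r: "0 < r" and u: "u \<in> test_functions S"
  shows "(LINT z|lborel. of_real (log_pot r (z - p)) * partial_y u z) = - (LINT z|lborel. of_real (pot_y r (z - p)) * u z)"
proof (rule integration_by_parts_y[where E = "\<lambda>_. {}", OF continuous_log_pot[OF r] borel_measurable_continuous_onI[OF continuous_pot_y[OF r]] abs_pot_y_le[OF r] _ _ u])
  fix x y
  have "((\<lambda>y. Complex x y) has_derivative (\<lambda>h. \<i> * of_real h)) (at y)"
    unfolding Complex_eq by (auto intro!: derivative_eq_intros)
  from has_derivative_compose[OF this has_derivative_log_pot[OF r]]
  show "((\<lambda>y. log_pot r (Complex x y - p)) has_real_derivative pot_y r (Complex x y - p)) (at y)"
    by (simp add: has_field_derivative_def)
qed simp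

text \<open>Two integrations by parts in each variable. The gradient is continuous, so the circle
  itself carries no mass, and the jump of the second derivatives shows up only in the
  density.\<close>

lemma log_pot_weak_laplacian:
  assumes r: "0 < r" and u: "u \<in> test_functions S"
  shows "(LINT z|lborel. of_real (log_pot r (z - p)) * (partial_x (partial_x u) z + partial_y (partial_y u) z)) =
     (LINT z|lborel. of_real (2 / r\<^sup>2 * indicator (ball p r) z) * u z)"
proof -
  have ux: "partial_x u \<in> test_functions S" and uy: "partial_y u \<in> test_functions S"
    using u by (auto intro!: test_functions_partial)
  have uxx: "partial_x (partial_x u) \<in> test_functions S" and uyy: "partial_y (partial_y u) \<in> test_functions S"
    using ux uy by (auto intro!: test_functions_partial)
  have i: "integrable lborel (\<lambda>z. of_real (log_pot r (z - p)) * w z)" if w: "w \<in> test_functions S" for w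
  proof -
    obtain M where "\<And>z. w z \<noteq> 0 \<Longrightarrow> \<bar>log_pot r (z - p)\<bar> \<le> M"
      using continuous_bounded_on_support[OF continuous_log_pot[OF r] w, of p] by blast
    then show ?thesis
      by (intro integrable_bounded_mult_test_function[OF borel_measurable_continuous_onI[OF continuous_log_pot[OF r]] _ w])
  qed
  have m2: "(\<lambda>z. pot_xx r (z - p)) \<in> borel_measurable borel" "(\<lambda>z. pot_yy r (z - p)) \<in> borel_measurable borel"
    by measurable
  have i2: "integrable lborel (\<lambda>z. of_real (pot_xx r (z - p)) * u z)" "integrable lborel (\<lambda>z. of_real (pot_yy r (z - p)) * u z)"
    by (rule integrable_bounded_mult_test_function[OF m2(1) abs_pot_second_le(1)[OF r] u],
        rule integrable_bounded_mult_test_function[OF m2(2) abs_pot_second_le(2)[OF r] u])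
  have "(LINT z|lborel. of_real (log_pot r (z - p)) * (partial_x (partial_x u) z + partial_y (partial_y u) z)) =
     (LINT z|lborel. of_real (log_pot r (z - p)) * partial_x (partial_x u) z) + (LINT z|lborel. of_real (log_pot r (z - p)) * partial_y (partial_y u) z)"
    using i[OF uxx] i[OF uyy] by (simp add: distrib_left)
  also have "(LINT z|lborel. of_real (log_pot r (z - p)) * partial_x (partial_x u) z) = (LINT z|lborel. of_real (pot_xx r (z - p)) * u z)"
    using log_pot_weak_x[OF r ux, of p]
      integration_by_parts_x[OF continuous_pot_x[OF r] m2(1) abs_pot_second_le(1)[OF r] finite_pot_line_exc DERIV_pot_x[OF r] u]
    by simp
  also have "(LINT z|lborel. of_real (log_pot r (z - p)) * partial_y (partial_y u) z) = (LINT z|lborel. of_real (pot_yy r (z - p)) * u z)"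
    using log_pot_weak_y[OF r uy, of p]
      integration_by_parts_y[OF continuous_pot_y[OF r] m2(2) abs_pot_second_le(2)[OF r] finite_pot_line_exc DERIV_pot_y[OF r] u]
    by simp
  also have "(LINT z|lborel. of_real (pot_xx r (z - p)) * u z) + (LINT z|lborel. of_real (pot_yy r (z - p)) * u z) =
      (LINT z|lborel. of_real (pot_xx r (z - p)) * u z + of_real (pot_yy r (z - p)) * u z)"
    using i2 by simp
  also have "\<dots> = (LINT z|lborel. of_real (2 / r\<^sup>2 * indicator (ball p r) z) * u z)"
  proof (rule Bochner_Integration.integral_cong[OF refl])
    fix z
    have "indicator (ball 0 r) (z - p) = (indicator (ball p r) z :: real)"
      by (simp add: indicator_def dist_norm norm_minus_commute)
    then have "pot_xx r (z - p) + pot_yy r (z - p) = 2 / r\<^sup>2 * indicator (ball p r) z" by (simp only: pot_xx_add_yy)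
    then show "of_real (pot_xx r (z - p)) * u z + of_real (pot_yy r (z - p)) * u z = of_real (2 / r\<^sup>2 * indicator (ball p r) z) * u z"
      by (simp only: flip: distrib_right of_real_add)
  qed
  finally show ?thesis .
qed

section \<open>The sub-mean value property\<close>

text \<open>The mean over the circle is evaluated by factoring the argument of the logarithm as
  \<open>c * |1 + q e\<^sup>i\<^sup>t|\<^sup>2\<close> with \<open>|q| < 1\<close>: then \<open>Ln (1 + q z)\<close> is holomorphic on the closed unit disk.\<close>

lemma integral_ln_one_plus:
  fixes q :: complex
  assumes q: "cmod q < 1"
  shows "((\<lambda>t. ln (cmod (1 + q * cis t))) has_integral 0) {0..2*pi}"
proof -
  let ?f = "\<lambda>z. Ln (1 + q * z)"
  have re: "0 < Re (1 + q * z)" if "cmod z \<le> 1" for z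
  proof -
    have "cmod (q * z) \<le> cmod q * 1" unfolding norm_mult using that by (intro mult_left_mono) auto
    then have "\<bar>Re (q * z)\<bar> < 1" using abs_Re_le_cmod[of "q * z"] q by linarith
    then show ?thesis by simp
  qed
  have nr: "1 + q * z \<notin> \<real>\<^sub>\<le>\<^sub>0" if "cmod z \<le> 1" for z
    using re[OF that] by (auto simp: complex_nonpos_Reals_iff)
  have "continuous_on (cball 0 1) ?f" using nr by (intro continuous_intros) auto
  moreover have "?f holomorphic_on ball 0 1" using nr by (intro holomorphic_intros) auto
  \<comment> \<open>Cauchy's formula for the value at the centre, which is Ln 1 = 0; parametrised by
    the angle it becomes the mean over the circle.\<close>
  ultimately have "((\<lambda>u. ?f u / (u - 0)) has_contour_integral (2 * of_real pi * \<i> * ?f 0)) (circlepath 0 1)"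
    by (rule Cauchy_integral_circlepath) simp
  then have "((\<lambda>x. ?f (circlepath 0 1 x) / circlepath 0 1 x * vector_derivative (circlepath 0 1) (at x within {0..1})) has_integral 0) {0..1}"
    by (simp add: has_contour_integral_def)
  then have "((\<lambda>x. 2 * of_real pi * \<i> * ?f (cis (2 * pi * x))) has_integral 0) {0..1}"
  proof (rule has_integral_eq[rotated])
    fix x :: real assume x: "x \<in> {0..1}"
    have "circlepath 0 1 x = cis (2 * pi * x)"
      by (simp add: circlepath cis_conv_exp mult_ac)
    moreover have "vector_derivative (circlepath 0 1) (at x within {0..1}) = 2 * of_real pi * \<i> * cis (2 * pi * x)"
      using x by (simp add: vector_derivative_circlepath01 cis_conv_exp mult_ac)
    ultimately show "?f (circlepath 0 1 x) / circlepath 0 1 x * vector_derivative (circlepath 0 1) (at x within {0..1}) =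
      2 * of_real pi * \<i> * ?f (cis (2 * pi * x))"
      by simp
  qed
  then have "((\<lambda>x. (1 / (2 * of_real pi * \<i>)) * (2 * of_real pi * \<i> * ?f (cis (2 * pi * x)))) has_integral (1 / (2 * of_real pi * \<i>)) * 0) {0..1}"
    by (rule has_integral_mult_right)
  then have "((\<lambda>x. ?f (cis (2 * pi * x))) has_integral 0) {0..1}" by simp
  from has_integral_stretch_real[OF this, of "1 / (2 * pi)"]
  have "((\<lambda>t. ?f (cis t)) has_integral 0) ((\<lambda>x. x * (2 * pi)) ` {0..1})" by simp
  moreover have "(\<lambda>x. x * (2 * pi)) ` {0..1} = {0..2*pi}"
    using image_mult_atLeastAtMost[of "2 * pi" 0 1] by (simp add: mult.commute)
  ultimately have "((\<lambda>t. ?f (cis t)) has_integral 0) {0..2*pi}" by simp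
  from has_integral_Re[OF this] have "((\<lambda>t. Re (?f (cis t))) has_integral 0) {0..2*pi}" by simp
  then show ?thesis
  proof (rule has_integral_eq[rotated])
    fix t
    have "0 < Re (1 + q * cis t)" by (rule re) simp
    then have "1 + q * cis t \<noteq> 0" by (metis less_irrefl zero_complex.sel(1))
    then show "Re (?f (cis t)) = ln (cmod (1 + q * cis t))" by (rule Re_Ln)
  qed
qed

lemma mean_ln_ge:
  fixes a :: complex
  assumes \<rho>: "0 < \<rho>" and e: "0 < e"
  obtains I where "((\<lambda>t. ln ((cmod (a + of_real \<rho> * cis t))\<^sup>2 + e)) has_integral I) {0..2*pi}"
    "2 * pi * ln ((cmod a)\<^sup>2 + e) \<le> I"
proof -
  define A B where "A = (cmod a)\<^sup>2" and "B = A + \<rho>\<^sup>2 + e"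
  \<comment> \<open>Comparing |a + rho e^(it)|^2 + e = B + 2 rho Re(cnj a e^(it)) with c |1 + q
    e^(it)|^2 forces c q = rho cnj a and c + A rho^2 / c = B. The larger root of this quadratic
    equation is the one with |q| < 1.\<close>
  define c where "c = (B + sqrt (B\<^sup>2 - 4 * A * \<rho>\<^sup>2)) / 2"
  define q where "q = of_real (\<rho> / c) * cnj a"
  have A: "0 \<le> A" by (simp add: A_def)
  have "A + \<rho>\<^sup>2 < B" using e by (simp add: B_def)
  have "(A + \<rho>\<^sup>2)\<^sup>2 < B\<^sup>2" using A \<open>A + \<rho>\<^sup>2 < B\<close> by (intro power_strict_mono) auto
  moreover have "(A + \<rho>\<^sup>2)\<^sup>2 = 4 * A * \<rho>\<^sup>2 + (A - \<rho>\<^sup>2)\<^sup>2" by (simp add: power2_eq_square algebra_simps)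
  ultimately have disc: "4 * A * \<rho>\<^sup>2 < B\<^sup>2" using zero_le_power2[of "A - \<rho>\<^sup>2"] by linarith
  have Bpos: "0 < B" unfolding B_def by (intro add_nonneg_pos add_nonneg_nonneg A zero_le_power2 e)
  have cB: "B / 2 \<le> c" using disc by (simp add: c_def)
  have cpos: "0 < c" using cB Bpos by linarith
  have "2 * c - B = sqrt (B\<^sup>2 - 4 * A * \<rho>\<^sup>2)" by (simp add: c_def field_simps)
  then have "(2 * c - B)\<^sup>2 = B\<^sup>2 - 4 * A * \<rho>\<^sup>2" using disc by simp
  then have ceq: "c * c + A * \<rho>\<^sup>2 = B * c" by (simp add: power2_eq_square algebra_simps)
  \<comment> \<open>The mean of the logarithm over the circle is ln c, so the sub-mean value
    property amounts to this inequality. The difference of the two squares below is 4 e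
    rho^2.\<close>
  have cge: "A + e \<le> c"
  proof -
    have "(2 * (A + e) - B)\<^sup>2 \<le> B\<^sup>2 - 4 * A * \<rho>\<^sup>2"
      using e A \<rho> by (simp add: B_def power2_eq_square algebra_simps)
    then have "2 * (A + e) - B \<le> sqrt (B\<^sup>2 - 4 * A * \<rho>\<^sup>2)" by (rule real_le_rsqrt)
    then show ?thesis by (simp add: c_def)
  qed
  have q2: "(cmod q)\<^sup>2 = A * \<rho>\<^sup>2 / c\<^sup>2"
    using cpos \<rho> by (simp add: q_def A_def norm_mult power_mult_distrib power_divide norm_divide)
  have "(B / 2)\<^sup>2 \<le> c\<^sup>2" using cB Bpos by (intro power_mono) auto
  then have "A * \<rho>\<^sup>2 < c\<^sup>2" using disc by (simp add: power_divide)
  then have "(cmod q)\<^sup>2 < 1\<^sup>2" using cpos unfolding q2 by simp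
  then have q1: "cmod q < 1" by (rule power2_less_imp_less) simp
  have fac: "ln ((cmod (a + of_real \<rho> * cis t))\<^sup>2 + e) = ln c + 2 * ln (cmod (1 + q * cis t))" for t
  proof -
    have nz: "1 + q * cis t \<noteq> 0"
    proof
      assume "1 + q * cis t = 0"
      then have "cmod (q * cis t) = cmod (-1)" by (simp add: add_eq_0_iff)
      then show False using q1 by (simp add: norm_mult)
    qed
    have sq: "(cmod (x + y))\<^sup>2 = (cmod x)\<^sup>2 + (cmod y)\<^sup>2 + 2 * Re (cnj x * y)" for x y
      unfolding cmod_power2 by (simp add: power2_eq_square algebra_simps)
    have "c * (cmod (1 + q * cis t))\<^sup>2 = c + c * (cmod q)\<^sup>2 + 2 * c * Re (q * cis t)"
      unfolding sq by (simp add: norm_mult algebra_simps)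
    also have "c * Re (q * cis t) = \<rho> * Re (cnj a * cis t)"
      using cpos by (simp add: q_def field_simps)
    then have "2 * c * Re (q * cis t) = 2 * \<rho> * Re (cnj a * cis t)" by simp
    also have "c + c * (cmod q)\<^sup>2 = B"
      unfolding q2 using ceq cpos by (simp add: field_simps power2_eq_square)
    also have "B + 2 * \<rho> * Re (cnj a * cis t) = (cmod (a + of_real \<rho> * cis t))\<^sup>2 + e"
      unfolding sq B_def A_def using \<rho> by (simp add: norm_mult algebra_simps)
    finally have "(cmod (a + of_real \<rho> * cis t))\<^sup>2 + e = c * (cmod (1 + q * cis t))\<^sup>2" by simp
    then show ?thesis using cpos nz by (simp add: ln_mult ln_realpow)
  qed
  have "((\<lambda>t. ln c + 2 * ln (cmod (1 + q * cis t))) has_integral ((2 * pi - 0) *\<^sub>R ln c + 2 * 0)) {0..2*pi}"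
    by (intro has_integral_add has_integral_const_real[THEN has_integral_eq_rhs] has_integral_mult_right integral_ln_one_plus q1) simp
  then have "((\<lambda>t. ln ((cmod (a + of_real \<rho> * cis t))\<^sup>2 + e)) has_integral (2 * pi * ln c)) {0..2*pi}"
    unfolding fac by simp
  moreover have "2 * pi * ln (A + e) \<le> 2 * pi * ln c"
    using cge A e by (intro mult_left_mono) auto
  ultimately show thesis using that A_def by blast
qed

text \<open>In the variable \<open>ln |z|\<^sup>2\<close> the right-hand side touches \<open>log_pot r\<close> from below at \<open>|z|\<^sup>2 = s\<close>.\<close>

lemma log_pot_ge:
  assumes r: "0 < r" and s: "0 \<le> s" "s < r\<^sup>2"
  shows "ln r + (s / r\<^sup>2 - 1) / 2 + ln (((cmod z)\<^sup>2 + (r\<^sup>2 - s)) / r\<^sup>2) / 2 \<le> log_pot r z"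
proof -
  define x where "x = (cmod z)\<^sup>2 / r\<^sup>2"
  define d where "d = 1 - s / r\<^sup>2"
  have r2: "0 < r\<^sup>2" using r by simp
  have x: "0 \<le> x" by (simp add: x_def)
  have d: "0 < d" "d \<le> 1" using s r2 by (auto simp: d_def)
  have e: "((cmod z)\<^sup>2 + (r\<^sup>2 - s)) / r\<^sup>2 = x + d" using r2 by (simp add: x_def d_def field_simps)
  have "ln r - d / 2 + ln (x + d) / 2 \<le> log_pot r z"
  proof (cases "r \<le> cmod z")
    case True
    have x1: "1 \<le> x" using True r unfolding x_def by (simp add: power_mono)
    have "x + d = x * (1 + d / x)" using x1 by (simp add: field_simps)
    then have "ln (x + d) = ln (x * (1 + d / x))" by simp
    also have "\<dots> = ln x + ln (1 + d / x)" using x1 d by (intro ln_mult_pos) (auto intro!: add_pos_nonneg)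
    also have "ln (1 + d / x) \<le> d / x" using x1 d by (intro ln_add_one_self_le_self) auto
    also have "d / x \<le> d" using x1 d by (simp add: divide_le_eq mult_left_le)
    finally have "ln (x + d) \<le> ln x + d" by simp
    moreover have "ln x = 2 * ln (cmod z) - 2 * ln r"
    proof -
      have "0 < cmod z" using True r by linarith
      then show ?thesis using r by (simp add: x_def ln_div ln_realpow)
    qed
    ultimately show ?thesis using True by (simp add: log_pot_def)
  next
    case False
    have "ln (x + d) \<le> x + d - 1" using x d by (intro ln_le_minus_one) auto
    then show ?thesis using False by (simp add: log_pot_def x_def field_simps)
  qed
  then show ?thesis unfolding e by (simp add: d_def field_simps)
qed

text \<open>Each minorant from \<open>log_pot_ge\<close> has the sub-mean value property by
  \<open>mean_ln_ge\<close>, so it suffices to find one that touches \<open>log_pot r\<close> at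
  \<open>a\<close>. For |a| < r this is the one with s = |a|^2; for |a| >= r contact is reached only
  in the limit as s tends to r^2.\<close>

lemma log_pot_submean:
  assumes r: "0 < r" and \<rho>: "0 < \<rho>"
  shows "2 * pi * log_pot r a \<le> integral {0..2*pi} (\<lambda>t. log_pot r (a + of_real \<rho> * cis t))"
proof -
  let ?I = "integral {0..2*pi} (\<lambda>t. log_pot r (a + of_real \<rho> * cis t))"
  have r2: "0 < r\<^sup>2" using r by simp
  have "continuous_on UNIV (log_pot r)" using continuous_log_pot[OF r, of UNIV 0] by simp
  then have "continuous_on {0..2*pi} (\<lambda>t. log_pot r (a + of_real \<rho> * cis t))"
    by (rule continuous_on_compose2) (auto intro!: continuous_intros)
  then have int: "(\<lambda>t. log_pot r (a + of_real \<rho> * cis t)) integrable_on {0..2*pi}"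
    by (rule integrable_continuous_real)
  have main: "2 * pi * (ln r + (s / r\<^sup>2 - 1) / 2 + (ln ((cmod a)\<^sup>2 + (r\<^sup>2 - s)) - ln (r\<^sup>2)) / 2) \<le> ?I"
    if s: "0 \<le> s" "s < r\<^sup>2" for s
  proof -
    obtain I where I: "((\<lambda>t. ln ((cmod (a + of_real \<rho> * cis t))\<^sup>2 + (r\<^sup>2 - s))) has_integral I) {0..2*pi}"
      "2 * pi * ln ((cmod a)\<^sup>2 + (r\<^sup>2 - s)) \<le> I"
      using mean_ln_ge[OF \<rho>, of "r\<^sup>2 - s" a] s by auto
    let ?k = "ln r + (s / r\<^sup>2 - 1) / 2 - ln (r\<^sup>2) / 2"
    have "((\<lambda>t. ?k + 1 / 2 * ln ((cmod (a + of_real \<rho> * cis t))\<^sup>2 + (r\<^sup>2 - s))) has_integral ((2 * pi - 0) *\<^sub>R ?k + 1 / 2 * I)) {0..2*pi}"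
      by (intro has_integral_add has_integral_const_real[THEN has_integral_eq_rhs] has_integral_mult_right I(1)) simp
    moreover have "(?k + 1 / 2 * ln ((cmod z)\<^sup>2 + (r\<^sup>2 - s))) \<le> log_pot r z" for z
    proof -
      have "0 < (cmod z)\<^sup>2 + (r\<^sup>2 - s)" using s by (intro add_nonneg_pos) auto
      then show ?thesis using log_pot_ge[OF r s, of z] r2 by (simp add: ln_div diff_divide_distrib)
    qed
    ultimately have le: "(2 * pi - 0) *\<^sub>R ?k + 1 / 2 * I \<le> ?I"
      using has_integral_le[OF _ integrable_integral[OF int]] by blast
    have eq: "2 * pi * (A + (T - L) / 2) = (2 * pi - 0) *\<^sub>R (A - L / 2) + 1 / 2 * (2 * pi * T)" for A T L
      by (simp add: field_simps)
    have "1 / 2 * (2 * pi * ln ((cmod a)\<^sup>2 + (r\<^sup>2 - s))) \<le> 1 / 2 * I"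
      using I(2) by (intro mult_left_mono) auto
    with le show ?thesis unfolding eq by (rule order_trans[OF add_left_mono, rotated])
  qed
  show ?thesis
  proof (cases "r \<le> cmod a")
    case True
    have "log_pot r a \<le> ?I / (2 * pi) + d" if d: "0 < d" for d
    proof -
      \<comment> \<open>Here d' stands for 1 - s / r^2; it is capped at 1 to keep s nonnegative, and
        the resulting bound falls short of ln |a| by at most d'/2.\<close>
      define d' where "d' = min d 1"
      have d': "0 < d'" "d' \<le> 1" "d' \<le> d" using d by (auto simp: d'_def)
      have *: "ln ((cmod a)\<^sup>2) \<le> ln ((cmod a)\<^sup>2 + r\<^sup>2 * d')" using True r d' by (intro ln_mono) (auto intro!: add_pos_pos)
      have "2 * pi * (ln r + ((r\<^sup>2 * (1 - d')) / r\<^sup>2 - 1) / 2 + (ln ((cmod a)\<^sup>2 + (r\<^sup>2 - r\<^sup>2 * (1 - d'))) - ln (r\<^sup>2)) / 2) \<le> ?I"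
        by (rule main) (use d' r2 in \<open>auto simp: algebra_simps\<close>)
      moreover have "(r\<^sup>2 * (1 - d')) / r\<^sup>2 - 1 = - d'" "r\<^sup>2 - r\<^sup>2 * (1 - d') = r\<^sup>2 * d'"
        using r by (simp_all add: field_simps)
      ultimately have "2 * pi * (ln r - d' / 2 + (ln ((cmod a)\<^sup>2 + r\<^sup>2 * d') - ln (r\<^sup>2)) / 2) \<le> ?I"
        by simp
      then have "ln r - d' / 2 + (ln ((cmod a)\<^sup>2 + r\<^sup>2 * d') - ln (r\<^sup>2)) / 2 \<le> ?I / (2 * pi)"
        by (simp add: field_simps)
      moreover have "log_pot r a = ln (cmod a)" using True by (simp add: log_pot_def)
      moreover have "ln ((cmod a)\<^sup>2) = 2 * ln (cmod a)" "ln (r\<^sup>2) = 2 * ln r"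
        by (simp_all add: ln_realpow)
      moreover have "ln r - d' / 2 + (X - 2 * ln r) / 2 = X / 2 - d' / 2" for X by (simp add: field_simps)
      ultimately have "ln ((cmod a)\<^sup>2 + r\<^sup>2 * d') / 2 - d' / 2 \<le> ?I / (2 * pi)"
        "2 * log_pot r a \<le> ln ((cmod a)\<^sup>2 + r\<^sup>2 * d')" using * by simp_all
      then show ?thesis using d' by (smt (verit) field_sum_of_halves)
    qed
    then have "log_pot r a \<le> ?I / (2 * pi)" by (rule field_le_epsilon)
    then show ?thesis by (simp add: field_simps)
  next
    case False
    then have "(cmod a)\<^sup>2 < r\<^sup>2" by (intro power_strict_mono) auto
    then show ?thesis using main[of "(cmod a)\<^sup>2"] False by (simp add: log_pot_def)
  qed
qed

section \<open>The superposition of discs\<close>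

text \<open>The exponent \<open>64\<^sup>k\<close> leaves room for \<open>64\<^sup>k\<close> disjoint dyadic annuli between \<open>rad k\<close> and
  \<open>(1/2)\<^sup>3\<^sup>k\<^sup>+\<^sup>5\<close>, so that a disc of level \<open>k\<close> can be cut off at an energy of order \<open>1/64\<^sup>k\<close>, small
  compared with the number \<open>4 * 4\<^sup>k\<close> of such discs.\<close>

definition rad :: "nat \<Rightarrow> real" where
  "rad k = (1 / 2) ^ (64 ^ k + 3 * k + 5)"

text \<open>The base 1024 exceeds 4 * 64, the growth per level of the number of discs times the
  logarithm of their radius, so the potentials of the levels are uniformly summable
  (\<open>abs_stage_log_pot_le\<close>). It is also the ratio of the bounds 1/2 and 1/2048 in
  \<open>flux_level\<close>, so every positive \<open>n\<close> finds its level.\<close>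

definition flux :: "nat \<Rightarrow> real" where
  "flux k = (1 / 1024) ^ k"

text \<open>The coordinates are odd multiples of half the side. Centres of an older level therefore
  lie on lines that bound younger cells, never inside those cells
  (\<open>old_center_far\<close>).\<close>

definition grid_point :: "nat \<Rightarrow> int \<times> int \<Rightarrow> complex" where
  "grid_point k = (\<lambda>(a, b). Complex ((of_int a + 1 / 2) / 2 ^ k) ((of_int b + 1 / 2) / 2 ^ k))"

definition grid_index :: "nat \<Rightarrow> (int \<times> int) set" where
  "grid_index k = {- (2 ^ k)..<2 ^ k} \<times> {- (2 ^ k)..<2 ^ k}"

definition grid :: "nat \<Rightarrow> complex set" where
  "grid k = grid_point k ` grid_index k"

text \<open>Whether a disc is kept depends on all older levels, so the recursion carries the whole
  set of pairs of level and centre. Discs of equal level are disjoint because their centres are at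
  least a side length apart (\<open>kept_disjoint\<close>).\<close>

primrec kept_upto :: "nat \<Rightarrow> (nat \<times> complex) set" where
  "kept_upto 0 = {}"
| "kept_upto (Suc k) = kept_upto k \<union>
     {k} \<times> {p \<in> grid k. \<forall>(i, q) \<in> kept_upto k. disjnt (ball p (rad k)) (ball q (rad i))}"

definition kept :: "nat \<Rightarrow> complex set" where
  "kept k = {p. (k, p) \<in> kept_upto (Suc k)}"

lemma rad_pos: "0 < rad k" by (simp add: rad_def)

lemma rad_le: "rad k \<le> (1 / 2) ^ (3 * k + 6)"
  unfolding rad_def by (intro power_decreasing) auto

lemma rad_le_cell: "rad k \<le> (1 / 2) ^ k / 64"
proof -
  have "rad k \<le> (1 / 2) ^ (k + 6)" by (rule order_trans[OF rad_le]) (intro power_decreasing, auto)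
  moreover have "(1 / 2 :: real) ^ (k + 6) = (1 / 2) ^ k / 64" by (simp add: power_add power_divide)
  ultimately show ?thesis by linarith
qed

lemma flux_pos: "0 < flux k" by (simp add: flux_def)

lemma finite_grid: "finite (grid k)" by (simp add: grid_def grid_index_def)

lemma card_grid_index: "card (grid_index k) = 4 * 4 ^ k"
proof -
  have "nat (2 ^ k - (- (2 ^ k) :: int)) = 2 * 2 ^ k" by (simp add: nat_eq_iff)
  moreover have "(4::nat) ^ k = 2 ^ k * 2 ^ k" by (simp flip: power_mult_distrib)
  ultimately show ?thesis by (simp add: grid_index_def card_cartesian_product)
qed

lemma card_grid_le: "card (grid k) \<le> 4 * 4 ^ k"
  unfolding grid_def using card_image_le[of "grid_index k" "grid_point k"] card_grid_index[of k]
  by (simp add: grid_index_def)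

lemma grid_bound:
  assumes "p \<in> grid k"
  shows "\<bar>Re p\<bar> \<le> 1" "\<bar>Im p\<bar> \<le> 1" "cmod p \<le> 2"
proof -
  have *: "\<bar>(of_int a + 1 / 2) / 2 ^ k\<bar> \<le> (1 :: real)" if "- (2 ^ k) \<le> a" "a < 2 ^ k" for a :: int
  proof -
    have "- (2 ^ k) \<le> real_of_int a" using that(1) by (metis of_int_le_iff of_int_minus of_int_numeral of_int_power)
    moreover have "a + 1 \<le> 2 ^ k" using that(2) by simp
    then have "real_of_int (a + 1) \<le> 2 ^ k" by (metis of_int_le_iff of_int_numeral of_int_power)
    ultimately have "\<bar>of_int a + 1 / 2\<bar> \<le> (2 ^ k :: real)" by simp
    then show ?thesis by (simp add: abs_divide)
  qed
  show "\<bar>Re p\<bar> \<le> 1" "\<bar>Im p\<bar> \<le> 1" using assms * by (auto simp: grid_def grid_point_def grid_index_def)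
  then show "cmod p \<le> 2" using cmod_le[of p] by linarith
qed

lemma kept_upto_less: "(i, p) \<in> kept_upto n \<Longrightarrow> i < n"
  by (induction n) auto

lemma kept_upto_iff: "(i, p) \<in> kept_upto n \<longleftrightarrow> i < n \<and> p \<in> kept i"
proof (induction n)
  case (Suc n)
  show ?case
  proof (cases "i = n")
    case True then show ?thesis by (simp add: kept_def)
  next
    case False then show ?thesis using Suc by auto
  qed
qed simp

lemma kept_iff: "p \<in> kept k \<longleftrightarrow> p \<in> grid k \<and> (\<forall>i<k. \<forall>q\<in>kept i. disjnt (ball p (rad k)) (ball q (rad i)))"
proof -
  have "(k, p) \<notin> kept_upto k" using kept_upto_less by blast
  then have "p \<in> kept k \<longleftrightarrow> p \<in> grid k \<and> (\<forall>(i, q) \<in> kept_upto k. disjnt (ball p (rad k)) (ball q (rad i)))"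
    by (simp add: kept_def)
  then show ?thesis using kept_upto_iff[of _ _ k] by fastforce
qed

lemma kept_subset: "kept k \<subseteq> grid k" using kept_iff by blast
lemma finite_kept: "finite (kept k)" using kept_subset finite_grid finite_subset by blast
lemma card_kept_le: "real (card (kept k)) \<le> 4 * 4 ^ k"
proof -
  have "card (kept k) \<le> 4 * 4 ^ k" using card_mono[OF finite_grid kept_subset] card_grid_le by (rule order_trans)
  then have "real (card (kept k)) \<le> real (4 * 4 ^ k)" by (simp only: of_nat_le_iff)
  then show ?thesis by simp
qed

lemma sum_kept_le:
  fixes g :: "complex \<Rightarrow> real"
  assumes "\<And>p. p \<in> kept k \<Longrightarrow> g p \<le> c" "0 \<le> c"
  shows "(\<Sum>p\<in>kept k. g p) \<le> 4 * 4 ^ k * c"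
proof -
  have "(\<Sum>p\<in>kept k. g p) \<le> real (card (kept k)) * c" using assms(1) by (rule sum_bounded_above)
  also have "\<dots> \<le> 4 * 4 ^ k * c" by (intro mult_right_mono card_kept_le assms(2))
  finally show ?thesis .
qed

lemma grid_point_dist:
  assumes "ab \<noteq> cd"
  shows "1 / 2 ^ k \<le> dist (grid_point k ab) (grid_point k cd)"
proof -
  obtain a b c d where e: "ab = (a, b)" "cd = (c, d)" by (cases ab; cases cd) auto
  have *: "1 / 2 ^ k \<le> \<bar>(real_of_int a + 1 / 2) / 2 ^ k - (real_of_int c + 1 / 2) / 2 ^ k\<bar>" if "a \<noteq> c" for a c :: int
  proof -
    have "1 \<le> \<bar>a - c\<bar>" using that by linarith
    then have "1 \<le> \<bar>real_of_int a - of_int c\<bar>" by linarith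
    moreover have "(real_of_int a + 1 / 2) / 2 ^ k - (real_of_int c + 1 / 2) / 2 ^ k = (real_of_int a - real_of_int c) / 2 ^ k"
      by (simp add: field_simps)
    ultimately show ?thesis by (simp add: abs_divide divide_right_mono)
  qed
  have "a \<noteq> c \<or> b \<noteq> d" using assms e by auto
  then show ?thesis
    using *[of a c] *[of b d] abs_Re_le_cmod[of "grid_point k ab - grid_point k cd"] abs_Im_le_cmod[of "grid_point k ab - grid_point k cd"]
    by (auto simp: e grid_point_def dist_norm)
qed

lemma kept_disjoint:
  assumes "p \<in> kept k" "q \<in> kept i" "(k, p) \<noteq> (i, q)"
  shows "disjnt (ball p (rad k)) (ball q (rad i))"
proof -
  consider "i < k" | "k < i" | "i = k" by linarith
  then show ?thesis
  proof cases
    case 1 then show ?thesis using assms kept_iff by blast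
  next
    case 2 then show ?thesis using assms kept_iff by (blast intro: disjnt_sym)
  next
    case 3
    obtain ab where p: "p = grid_point k ab" using assms(1) kept_subset[of k] unfolding grid_def by blast
    obtain cd where q: "q = grid_point k cd" using assms(2) kept_subset[of i] 3 unfolding grid_def by blast
    have "ab \<noteq> cd" using p q assms(3) 3 by auto
    then have "1 / 2 ^ k \<le> dist p q" unfolding p q by (rule grid_point_dist)
    moreover have "(1 / 2 :: real) ^ k = 1 / 2 ^ k" by (simp add: power_one_over)
    moreover have "0 < 1 / (2 :: real) ^ k" by simp
    ultimately have "rad k + rad k \<le> dist p q" using rad_le_cell[of k] by linarith
    then have "ball p (rad k) \<inter> ball q (rad k) = {}" by (rule disjoint_ballI)
    then show ?thesis using 3 by (simp add: disjnt_def)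
  qed
qed

lemma k_le_64_pow: "real k \<le> 64 ^ k"
proof -
  have "k \<le> 64 ^ k" by (rule less_imp_le, rule order_less_le_trans[OF less_exp power_mono]) auto
  then show ?thesis by (metis of_nat_le_iff of_nat_numeral of_nat_power)
qed

lemma level_le: "real (64 ^ k + 3 * k + 5) \<le> 9 * 64 ^ k"
proof -
  have "(1::real) \<le> 64 ^ k" by simp
  moreover have "real (64 ^ k + 3 * k + 5) = 64 ^ k + 3 * real k + 5" by simp
  ultimately show ?thesis using k_le_64_pow[of k] by linarith
qed

lemma ln_rad_ge: "- (9 * 64 ^ k) \<le> ln (rad k)"
proof -
  define N where "N = 64 ^ k + 3 * k + 5"
  have "ln (rad k) = - (real N * ln 2)"
    unfolding rad_def N_def[symmetric] by (simp add: ln_realpow ln_div)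
  moreover have "real N * ln 2 \<le> real N"
    using ln_2_less_1 by (intro mult_left_le) auto
  moreover have "real N \<le> 9 * 64 ^ k" using level_le[of k] by (simp only: N_def)
  ultimately show ?thesis by linarith
qed

text \<open>The potential is lowest at the centre of the disc, where it is of the order of
  \<open>ln (rad k)\<close>, that is of -64^k; this growth is the price of the small
  capacity.\<close>

lemma abs_log_pot_rad_le:
  assumes "cmod x \<le> 4"
  shows "\<bar>log_pot (rad k) x\<bar> \<le> 10 * 64 ^ k"
proof -
  have r: "0 < rad k" by (rule rad_pos)
  have one: "(1::real) \<le> 64 ^ k" by simp
  have lb: "ln (rad k) - 1 / 2 \<le> log_pot (rad k) x"
  proof (cases "rad k \<le> cmod x")
    case True
    then have "ln (rad k) \<le> ln (cmod x)" using r by (intro ln_mono) auto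
    then show ?thesis using True by (simp add: log_pot_def)
  next
    case False then show ?thesis by (simp add: log_pot_def)
  qed
  have ub: "log_pot (rad k) x \<le> 3"
  proof (cases "rad k \<le> cmod x")
    case True
    then have "0 < cmod x" using r by linarith
    then have "ln (cmod x) \<le> cmod x - 1" by (rule ln_le_minus_one)
    then show ?thesis using True assms by (simp add: log_pot_def)
  next
    case False
    then have "(cmod x)\<^sup>2 \<le> (rad k)\<^sup>2" by (intro power_mono) auto
    then have "(cmod x)\<^sup>2 / (rad k)\<^sup>2 \<le> 1" using r by simp
    moreover have "ln (rad k) \<le> rad k - 1" using r by (rule ln_le_minus_one)
    moreover have "rad k \<le> 1" by (simp add: rad_def power_le_one)
    moreover have "log_pot (rad k) x = ln (rad k) + ((cmod x)\<^sup>2 / (rad k)\<^sup>2 - 1) / 2"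
      using False by (simp add: log_pot_def)
    moreover have "L + (X - 1) / 2 \<le> 3" if "X \<le> 1" "L \<le> t - 1" "t \<le> 1" for L X t :: real
      using that by (simp add: field_simps)
    ultimately show ?thesis by metis
  qed
  show ?thesis using lb ub ln_rad_ge[of k] one unfolding abs_le_iff by linarith
qed

lemma measure_cball_complex: "0 \<le> r \<Longrightarrow> measure lborel (cball (p::complex) r) = pi * r\<^sup>2"
  and measure_ball_complex: "0 \<le> r \<Longrightarrow> measure lborel (ball (p::complex) r) = pi * r\<^sup>2"
  by (simp_all add: content_cball content_ball unit_ball_vol_2)

text \<open>A dyadic substitute for polar coordinates: \<open>x\<close> lies in a ring of radius
  about 4 / 2^i, where a single term of the sum already dominates. Every term has integral 16 pi, so
  the total integral is proportional to the logarithm of the radius.\<close>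

lemma inverse_max_sq_le:
  assumes "cmod x \<le> 4"
  shows "1 / max ((cmod x)\<^sup>2) (((1 / 2) ^ M)\<^sup>2) \<le> (\<Sum>i\<le>M + 2. 4 ^ i * indicator (cball 0 (4 / 2 ^ i)) x)"
proof -
  let ?r = "(1 / 2 :: real) ^ M"
  let ?S = "\<Sum>i\<le>M + 2. 4 ^ i * indicator (cball 0 (4 / 2 ^ i)) x :: real"
  have le_S: "4 ^ i * indicator (cball 0 (4 / 2 ^ i)) x \<le> ?S" if "i \<le> M + 2" for i
    using that by (intro member_le_sum) auto
  have p4: "(4::real) ^ i = 2 ^ i * 2 ^ i" for i by (simp flip: power_mult_distrib)
  show ?thesis
  proof (cases "cmod x \<le> ?r")
    case True
    have "4 ^ (M + 2) * indicator (cball 0 (4 / 2 ^ (M + 2))) x = (4 ^ (M + 2) :: real)"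
      using True by (simp add: power_add power_divide)
    moreover have "1 / max ((cmod x)\<^sup>2) (?r\<^sup>2) \<le> 1 / ?r\<^sup>2"
      by (intro divide_left_mono mult_pos_pos) (auto simp: less_max_iff_disj)
    moreover have "1 / ?r\<^sup>2 = 4 ^ M" by (simp add: power_divide power2_eq_square p4)
    moreover have "(4::real) ^ M \<le> 4 ^ (M + 2)" by (intro power_increasing) auto
    ultimately show ?thesis using le_S[of "M + 2"] by linarith
  next
    case False
    \<comment> \<open>The smallest disc of the list that contains \<open>x\<close>. The case
      hypothesis keeps the index away from the last one, so \<open>x\<close> lies outside the next
      disc.\<close>
    define i where "i = (GREATEST i. i \<le> M + 2 \<and> cmod x \<le> 4 / 2 ^ i)"
    have i: "i \<le> M + 2 \<and> cmod x \<le> 4 / 2 ^ i"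
      unfolding i_def by (rule GreatestI_nat[of _ 0 "M + 2"]) (use assms in auto)
    have "i \<noteq> M + 2"
    proof
      assume "i = M + 2"
      then have "cmod x \<le> 4 / 2 ^ (M + 2)" using i by simp
      then show False using False by (simp add: power_add power_divide)
    qed
    have "\<not> cmod x \<le> 4 / 2 ^ Suc i"
    proof
      assume "cmod x \<le> 4 / 2 ^ Suc i"
      then have "Suc i \<le> i" unfolding i_def using i \<open>i \<noteq> M + 2\<close> i_def
        by (intro Greatest_le_nat[of _ _ "M + 2"]) auto
      then show False by simp
    qed
    then have "2 / 2 ^ i < cmod x" by simp
    then have "(2 / 2 ^ i)\<^sup>2 \<le> (cmod x)\<^sup>2" by (intro power_mono) auto
    then have "(1 / 2 ^ i)\<^sup>2 \<le> (cmod x)\<^sup>2" by (rule order_trans[rotated]) (intro power_mono divide_right_mono, auto)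
    then have "(1 / 2 ^ i)\<^sup>2 \<le> max ((cmod x)\<^sup>2) (?r\<^sup>2)" by (rule max.coboundedI1)
    then have "1 / max ((cmod x)\<^sup>2) (?r\<^sup>2) \<le> 1 / (1 / 2 ^ i)\<^sup>2"
      by (intro divide_left_mono mult_pos_pos) (auto simp: less_max_iff_disj)
    also have "\<dots> = 4 ^ i" by (simp add: power_divide power2_eq_square p4)
    also have "\<dots> = 4 ^ i * indicator (cball 0 (4 / 2 ^ i)) x" using i by simp
    also have "\<dots> \<le> ?S" using i by (intro le_S) simp
    finally show ?thesis .
  qed
qed

lemma integral_inverse_max_sq_le:
  assumes p: "cmod p \<le> 2"
  shows "(LINT z:ball 0 1|lborel. 1 / max ((cmod (z - p))\<^sup>2) (((1 / 2) ^ M)\<^sup>2)) \<le> 16 * pi * real (M + 3)"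
    "set_integrable lborel (ball 0 1) (\<lambda>z. 1 / max ((cmod (z - p))\<^sup>2) (((1 / 2) ^ M)\<^sup>2))"
proof -
  let ?g = "\<lambda>z. 1 / max ((cmod (z - p))\<^sup>2) (((1 / 2) ^ M)\<^sup>2)"
  let ?s = "\<lambda>z. \<Sum>i\<le>M + 2. 4 ^ i * indicator (cball p (4 / 2 ^ i)) z :: real"
  have r: "0 < (1 / 2 :: real) ^ M" by simp
  have nz: "max ((cmod (z - p))\<^sup>2) (((1 / 2) ^ M)\<^sup>2) \<noteq> 0" for z
    using max_sq_pos[OF r, of "(cmod (z - p))\<^sup>2"] by linarith
  have "continuous_on UNIV ?g" using nz by (intro continuous_intros) blast
  then have "set_integrable lborel (cball 0 1) ?g"
    unfolding set_integrable_def by (intro borel_integrable_compact compact_cball) (rule continuous_on_subset, auto)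
  then show int: "set_integrable lborel (ball 0 1) ?g"
    by (rule set_integrable_subset) (auto simp: ball_subset_cball)
  have fin: "integrable lborel (\<lambda>z. indicator (cball p R) z :: real)" for R
    using emeasure_bounded_finite[OF bounded_cball, of p R]
    by (intro integrable_real_indicator) (auto simp: infinity_ennreal_def)
  have sint: "integrable lborel ?s" by (intro Bochner_Integration.integrable_sum integrable_mult_right fin)
  have "(LINT z:ball 0 1|lborel. ?g z) \<le> (LINT z|lborel. ?s z)"
    unfolding set_lebesgue_integral_def
  proof (rule integral_mono[OF int[unfolded set_integrable_def] sint])
    fix z
    have "?g z \<le> ?s z" if "z \<in> ball 0 1"
    proof -
      have "cmod (z - p) \<le> 4" using that p norm_triangle_ineq4[of z p] by simp
      from inverse_max_sq_le[OF this, of M]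
      have "?g z \<le> (\<Sum>i\<le>M + 2. 4 ^ i * indicator (cball 0 (4 / 2 ^ i)) (z - p))" .
      also have "\<dots> = ?s z" by (intro sum.cong refl) (auto simp: indicator_def dist_norm norm_minus_commute)
      finally show ?thesis .
    qed
    moreover have "0 \<le> ?s z" by (intro sum_nonneg) auto
    ultimately show "indicator (ball 0 1) z *\<^sub>R ?g z \<le> ?s z" by (simp add: indicator_def)
  qed
  also have "\<dots> = (\<Sum>i\<le>M + 2. 4 ^ i * measure lborel (cball p (4 / 2 ^ i)))"
    using fin by (subst Bochner_Integration.integral_sum) auto
  also have "\<dots> = (\<Sum>i\<le>M + 2. 16 * pi)"
  proof (intro sum.cong refl)
    fix i
    have "(4::real) ^ i = 2 ^ i * 2 ^ i" by (simp flip: power_mult_distrib)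
    then show "4 ^ i * measure lborel (cball p (4 / 2 ^ i)) = 16 * pi"
      by (simp add: measure_cball_complex power2_eq_square)
  qed
  also have "\<dots> = 16 * pi * real (M + 3)" by simp
  finally show "(LINT z:ball 0 1|lborel. ?g z) \<le> 16 * pi * real (M + 3)" .
qed

text \<open>The kernel \<open>V\<close> is a parameter, so one series serves the potential, both
  components of its gradient, its Laplacian and the majorant \<open>grad_abs\<close>.\<close>

definition stage :: "(real \<Rightarrow> complex \<Rightarrow> real) \<Rightarrow> nat \<Rightarrow> complex \<Rightarrow> real" where
  "stage V k z = flux k * (\<Sum>p\<in>kept k. V (rad k) (z - p))"

definition pot_sum :: "(real \<Rightarrow> complex \<Rightarrow> real) \<Rightarrow> nat \<Rightarrow> complex \<Rightarrow> real" where
  "pot_sum V K z = (\<Sum>(i, p)\<in>kept_upto K. flux i * V (rad i) (z - p))"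

definition pot_total :: "(real \<Rightarrow> complex \<Rightarrow> real) \<Rightarrow> complex \<Rightarrow> real" where
  "pot_total V z = (\<Sum>k. stage V k z)"

text \<open>The Laplacian of \<open>log_pot r\<close>; its total mass is 2 pi.\<close>

definition disc_density :: "real \<Rightarrow> complex \<Rightarrow> real" where
  "disc_density r z = 2 / r\<^sup>2 * indicator (ball 0 r) z"

lemma finite_kept_upto: "finite (kept_upto K)"
  by (induction K) (auto simp: finite_grid)

lemma kept_upto_Suc: "kept_upto (Suc K) = kept_upto K \<union> Pair K ` kept K" "kept_upto K \<inter> Pair K ` kept K = {}"
  by (auto simp: kept_upto_iff less_Suc_eq simp del: kept_upto.simps)

lemma pot_sum_eq: "pot_sum V K z = (\<Sum>k<K. stage V k z)"
proof (induction K)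
  case (Suc K)
  have "pot_sum V (Suc K) z = pot_sum V K z + (\<Sum>(i, p)\<in>Pair K ` kept K. flux i * V (rad i) (z - p))"
    unfolding pot_sum_def kept_upto_Suc(1)
    by (rule sum.union_disjoint) (auto simp: finite_kept_upto finite_kept kept_upto_Suc(2))
  also have "(\<Sum>(i, p)\<in>Pair K ` kept K. flux i * V (rad i) (z - p)) = stage V K z"
    by (subst sum.reindex) (auto simp: inj_on_def stage_def sum_distrib_left)
  finally show ?case using Suc by simp
qed (simp add: pot_sum_def)

lemma abs_stage_le:
  assumes "\<And>p. p \<in> kept k \<Longrightarrow> \<bar>V (rad k) (z - p)\<bar> \<le> c" "0 \<le> c"
  shows "\<bar>stage V k z\<bar> \<le> flux k * (4 * 4 ^ k * c)"
proof -
  have "\<bar>\<Sum>p\<in>kept k. V (rad k) (z - p)\<bar> \<le> 4 * 4 ^ k * c"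
    using assms by (intro order_trans[OF sum_abs] sum_kept_le) auto
  then show ?thesis using flux_pos[of k] by (simp add: stage_def abs_mult)
qed

lemma kept_dist_le:
  assumes "z \<in> ball 0 1" "p \<in> kept k"
  shows "cmod (z - p) \<le> 4"
proof -
  have "cmod p \<le> 2" using assms(2) kept_subset grid_bound(3) by blast
  then show ?thesis using assms(1) norm_triangle_ineq4[of z p] by simp
qed

lemma abs_stage_log_pot_le:
  assumes "z \<in> ball 0 1"
  shows "\<bar>stage log_pot k z\<bar> \<le> 40 * (1 / 4) ^ k"
proof -
  have "\<bar>stage log_pot k z\<bar> \<le> flux k * (4 * 4 ^ k * (10 * 64 ^ k))"
    using kept_dist_le[OF assms] by (intro abs_stage_le abs_log_pot_rad_le) auto
  also have "\<dots> = 40 * ((1 / 1024) ^ k * 4 ^ k * 64 ^ k)" by (simp add: flux_def)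
  also have "(1 / 1024) ^ k * 4 ^ k * 64 ^ k = (1 / 4 :: real) ^ k" by (simp flip: power_mult_distrib)
  finally show ?thesis .
qed

lemma summable_quarter: "summable (\<lambda>k. 40 * (1 / 4 :: real) ^ k)"
  by (intro summable_mult summable_geometric) simp

lemma continuous_stage:
  assumes "\<And>r p. 0 < r \<Longrightarrow> continuous_on S (\<lambda>z. V r (z - p))"
  shows "continuous_on S (stage V k)"
  unfolding stage_def by (intro continuous_intros assms rad_pos)

lemma uniform_limit_pot_sum_log:
  "uniform_limit (ball 0 1) (pot_sum log_pot) (pot_total log_pot) sequentially"
proof -
  have "uniform_limit (ball 0 1) (\<lambda>K z. \<Sum>k<K. stage log_pot k z) (\<lambda>z. \<Sum>k. stage log_pot k z) sequentially"
    by (rule Weierstrass_m_test[OF _ summable_quarter]) (use abs_stage_log_pot_le in auto)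
  then show ?thesis by (simp add: pot_sum_eq[abs_def] pot_total_def[abs_def])
qed

lemma continuous_pot_sum:
  assumes "\<And>r p. 0 < r \<Longrightarrow> continuous_on S (\<lambda>z. V r (z - p))"
  shows "continuous_on S (pot_sum V K)"
proof -
  have "continuous_on S (\<lambda>z. \<Sum>k<K. stage V k z)" by (intro continuous_on_sum continuous_stage assms)
  then show ?thesis by (simp add: pot_sum_eq[abs_def])
qed

lemma continuous_pot_total_log: "continuous_on (ball 0 1) (pot_total log_pot)"
  by (rule uniform_limit_theorem[OF _ uniform_limit_pot_sum_log])
     (auto intro!: always_eventually continuous_pot_sum continuous_log_pot)

lemma abs_pot_sum_log_le:
  assumes "z \<in> ball 0 1"
  shows "\<bar>pot_sum log_pot K z\<bar> \<le> (\<Sum>k. 40 * (1 / 4) ^ k)"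
proof -
  have "\<bar>pot_sum log_pot K z\<bar> \<le> (\<Sum>k<K. 40 * (1 / 4) ^ k)"
    unfolding pot_sum_eq by (intro order_trans[OF sum_abs] sum_mono abs_stage_log_pot_le assms)
  also have "\<dots> \<le> (\<Sum>k. 40 * (1 / 4) ^ k)" by (intro sum_le_suminf summable_quarter) auto
  finally show ?thesis .
qed

lemma pot_sum_log_tendsto: "z \<in> ball 0 1 \<Longrightarrow> (\<lambda>K. pot_sum log_pot K z) \<longlonglongrightarrow> pot_total log_pot z"
  by (rule tendsto_uniform_limitI[OF uniform_limit_pot_sum_log])

lemma pot_sum_log_submean:
  assumes "0 < \<rho>"
  shows "2 * pi * pot_sum log_pot K a \<le> integral {0..2*pi} (\<lambda>t. pot_sum log_pot K (a + of_real \<rho> * cis t))"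
proof -
  have int: "(\<lambda>t. log_pot r (a + of_real \<rho> * cis t - p)) integrable_on {0..2*pi}" if "0 < r" for r p
    by (intro integrable_continuous_real continuous_on_compose2[OF continuous_log_pot[OF that, of UNIV p]])
       (auto intro!: continuous_intros)
  have "2 * pi * pot_sum log_pot K a = (\<Sum>(i, p)\<in>kept_upto K. flux i * (2 * pi * log_pot (rad i) (a - p)))"
    by (simp add: pot_sum_def sum_distrib_left case_prod_beta mult_ac)
  also have "\<dots> \<le> (\<Sum>(i, p)\<in>kept_upto K. flux i * integral {0..2*pi} (\<lambda>t. log_pot (rad i) (a + of_real \<rho> * cis t - p)))"
  proof (rule sum_mono, clarify)
    fix i p
    have "2 * pi * log_pot (rad i) (a - p) \<le> integral {0..2*pi} (\<lambda>t. log_pot (rad i) ((a - p) + of_real \<rho> * cis t))"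
      by (rule log_pot_submean[OF rad_pos assms])
    also have "(\<lambda>t. log_pot (rad i) ((a - p) + of_real \<rho> * cis t)) = (\<lambda>t. log_pot (rad i) (a + of_real \<rho> * cis t - p))"
      by (simp add: algebra_simps)
    finally show "flux i * (2 * pi * log_pot (rad i) (a - p)) \<le>
        flux i * integral {0..2*pi} (\<lambda>t. log_pot (rad i) (a + of_real \<rho> * cis t - p))"
      using flux_pos[of i] by (intro mult_left_mono) auto
  qed
  also have "\<dots> = integral {0..2*pi} (\<lambda>t. pot_sum log_pot K (a + of_real \<rho> * cis t))"
    unfolding pot_sum_def case_prod_beta
    by (subst integral_sum) (auto simp: finite_kept_upto rad_pos intro!: integrable_on_mult_right int)
  finally show ?thesis .
qed

lemma upper_semicontinuous_on_continuous:
  assumes "continuous_on S f"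
  shows "upper_semicontinuous_on S f"
  unfolding upper_semicontinuous_on_def
proof
  fix c
  have "{z \<in> S. f z < c} = S \<inter> f -` {..<c}" by auto
  then show "openin (top_of_set S) {z \<in> S. f z < c}"
    using continuous_openin_preimage_gen[OF assms, of "{..<c}"] by simp
qed

text \<open>The truncated sums have the sub-mean value property by linearity, and it survives the
  limit because they converge and are uniformly bounded on the unit disc.\<close>

lemma subharmonic_pot_total_log: "subharmonic_on (ball 0 1) (pot_total log_pot)"
  unfolding subharmonic_on_def
proof (intro conjI allI impI)
  show "upper_semicontinuous_on (ball 0 1) (pot_total log_pot)"
    by (rule upper_semicontinuous_on_continuous[OF continuous_pot_total_log])
  fix a :: complex and \<rho> :: real
  assume \<rho>: "0 < \<rho>" and sub: "cball a \<rho> \<subseteq> ball 0 1"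
  have in_ball: "a + of_real \<rho> * cis t \<in> ball 0 1" for t
  proof -
    have "a + of_real \<rho> * cis t \<in> cball a \<rho>" using \<rho> by (simp add: dist_norm norm_mult)
    then show ?thesis using sub by blast
  qed
  let ?g = "\<lambda>t. pot_total log_pot (a + of_real \<rho> * cis t)"
  have cont: "continuous_on {0..2*pi} ?g"
    by (rule continuous_on_compose2[OF continuous_pot_total_log]) (use in_ball in \<open>auto intro!: continuous_intros\<close>)
  show int: "set_integrable lborel {0..2*pi} ?g"
    unfolding set_integrable_def by (rule borel_integrable_compact[OF compact_Icc cont])
  have "(\<lambda>K. integral {0..2*pi} (\<lambda>t. pot_sum log_pot K (a + of_real \<rho> * cis t))) \<longlonglongrightarrow> integral {0..2*pi} ?g"
  proof (rule dominated_convergence(2)[where h = "\<lambda>_. \<Sum>k. 40 * (1 / 4) ^ k"])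
    show "(\<lambda>t. pot_sum log_pot K (a + of_real \<rho> * cis t)) integrable_on {0..2*pi}" for K
      by (intro integrable_continuous_real continuous_on_compose2[OF continuous_pot_sum[where S = UNIV, OF continuous_log_pot]])
         (auto intro!: continuous_intros)
    show "norm (pot_sum log_pot K (a + of_real \<rho> * cis t)) \<le> (\<Sum>k. 40 * (1 / 4) ^ k)" for K t
      using abs_pot_sum_log_le[OF in_ball] by simp
    show "(\<lambda>K. pot_sum log_pot K (a + of_real \<rho> * cis t)) \<longlonglongrightarrow> ?g t" for t
      by (rule pot_sum_log_tendsto[OF in_ball])
  qed (rule integrable_const_ivl)
  moreover have "(\<lambda>K. 2 * pi * pot_sum log_pot K a) \<longlonglongrightarrow> 2 * pi * pot_total log_pot a"
  proof (intro tendsto_mult tendsto_const pot_sum_log_tendsto)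
    show "a \<in> ball 0 1" using sub centre_in_cball[of a \<rho>] \<rho> by (meson less_imp_le subsetD)
  qed
  ultimately have "2 * pi * pot_total log_pot a \<le> integral {0..2*pi} ?g"
    using pot_sum_log_submean[OF \<rho>] LIMSEQ_le by blast
  also have "integral {0..2*pi} ?g = (LINT t:{0..2*pi}|lborel. ?g t)"
    using set_borel_integral_eq_integral(2)[OF int] by simp
  finally show "pot_total log_pot a \<le> (LINT t:{0..2*pi}|lborel. ?g t) / (2*pi)"
    by (simp add: field_simps)
qed

section \<open>Square integrability of the gradient series\<close>

lemma AE_summable_if_summable_integrals:
  fixes f :: "nat \<Rightarrow> 'a \<Rightarrow> real"
  assumes int: "\<And>k. integrable M (f k)" and nn: "\<And>k x. 0 \<le> f k x" and s: "summable (\<lambda>k. integral\<^sup>L M (f k))"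
  shows "AE x in M. summable (\<lambda>k. f k x)" "integrable M (\<lambda>x. \<Sum>k. f k x)"
    "integral\<^sup>L M (\<lambda>x. \<Sum>k. f k x) = (\<Sum>k. integral\<^sup>L M (f k))"
proof -
  have m: "\<And>k. f k \<in> borel_measurable M" using int by auto
  have "(\<integral>\<^sup>+x. (\<Sum>k. ennreal (f k x)) \<partial>M) = (\<Sum>k. \<integral>\<^sup>+x. ennreal (f k x) \<partial>M)"
    using m by (intro nn_integral_suminf) measurable
  also have "\<dots> = (\<Sum>k. ennreal (integral\<^sup>L M (f k)))"
    using int nn by (intro suminf_cong nn_integral_eq_integral) auto
  also have "\<dots> = ennreal (\<Sum>k. integral\<^sup>L M (f k))"
    using s nn by (intro suminf_ennreal2) auto
  finally have "(\<integral>\<^sup>+x. (\<Sum>k. ennreal (f k x)) \<partial>M) \<noteq> \<infinity>" by simp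
  moreover have "(\<lambda>x. \<Sum>k. ennreal (f k x)) \<in> borel_measurable M" using m by measurable
  ultimately have "AE x in M. (\<Sum>k. ennreal (f k x)) \<noteq> \<infinity>" by (intro nn_integral_PInf_AE)
  then show AE: "AE x in M. summable (\<lambda>k. f k x)"
    by eventually_elim (use nn in \<open>auto intro: summable_suminf_not_top\<close>)
  have AE': "AE x in M. summable (\<lambda>k. norm (f k x))" using AE nn by simp
  have s': "summable (\<lambda>k. LINT x|M. norm (f k x))" using s nn by simp
  show "integrable M (\<lambda>x. \<Sum>k. f k x)" by (rule integrable_suminf[OF int AE' s'])
  show "integral\<^sup>L M (\<lambda>x. \<Sum>k. f k x) = (\<Sum>k. integral\<^sup>L M (f k))" by (rule integral_suminf[OF int AE' s'])
qed

text \<open>Cauchy-Schwarz with the weights 2^-k, whose squares sum to 4/3. In this way a geometric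
  gain in the square norms of the levels yields square integrability of their sum.\<close>

lemma weighted_square_summable:
  fixes m :: "nat \<Rightarrow> real"
  assumes nn: "\<And>k. 0 \<le> m k" and s: "summable (\<lambda>k. 4 ^ k * (m k)\<^sup>2)"
  shows "summable m" "(\<Sum>k. m k)\<^sup>2 \<le> 2 * (\<Sum>k. 4 ^ k * (m k)\<^sup>2)"
proof -
  \<comment> \<open>Summability of \<open>m\<close> has to come first, since \<open>suminf\<close>
    carries no information without it; it follows from 2 a b <= a^2 + b^2.\<close>
  have le: "m k \<le> (1 / 4) ^ k + 4 ^ k * (m k)\<^sup>2" for k
  proof -
    have "2 * ((1 / 2) ^ k * (2 ^ k * m k)) \<le> ((1 / 2) ^ k)\<^sup>2 + (2 ^ k * m k)\<^sup>2"
      using sum_squares_bound[of "(1 / 2) ^ k" "2 ^ k * m k"] by (simp add: mult.assoc)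
    moreover have "(1 / 2) ^ k * (2 ^ k * m k) = m k" by (simp add: power_one_over)
    moreover have "((1 / 2 :: real) ^ k)\<^sup>2 = (1 / 4) ^ k" "(2 ^ k * m k)\<^sup>2 = 4 ^ k * (m k)\<^sup>2"
      by (simp_all add: power2_eq_square mult_ac flip: power_mult_distrib)
    ultimately show ?thesis using nn[of k] by linarith
  qed
  show sm: "summable m"
  proof (rule summable_comparison_test')
    show "summable (\<lambda>k. (1 / 4) ^ k + 4 ^ k * (m k)\<^sup>2)" by (intro summable_add s summable_geometric) simp
    show "norm (m k) \<le> (1 / 4) ^ k + 4 ^ k * (m k)\<^sup>2" if "0 \<le> k" for k using le[of k] nn[of k] by simp
  qed
  have fin: "(\<Sum>k<n. m k)\<^sup>2 \<le> 2 * (\<Sum>k. 4 ^ k * (m k)\<^sup>2)" for n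
  proof -
    have "(\<Sum>k<n. m k)\<^sup>2 = (\<Sum>k<n. (1 / 2) ^ k * (2 ^ k * m k))\<^sup>2" by (simp add: power_one_over)
    also have "\<dots> \<le> (\<Sum>k<n. ((1 / 2) ^ k)\<^sup>2) * (\<Sum>k<n. (2 ^ k * m k)\<^sup>2)" by (rule Cauchy_Schwarz_ineq_sum)
    also have "(\<Sum>k<n. (2 ^ k * m k)\<^sup>2) = (\<Sum>k<n. 4 ^ k * (m k)\<^sup>2)"
      by (intro sum.cong refl) (simp add: power2_eq_square mult_ac flip: power_mult_distrib)
    also have "(\<Sum>k<n. ((1 / 2 :: real) ^ k)\<^sup>2) = (\<Sum>k<n. (1 / 4) ^ k)"
      by (intro sum.cong refl) (simp add: power2_eq_square flip: power_mult_distrib)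
    also have "(\<Sum>k<n. (1 / 4) ^ k) * (\<Sum>k<n. 4 ^ k * (m k)\<^sup>2) \<le> 2 * (\<Sum>k. 4 ^ k * (m k)\<^sup>2)"
    proof (rule mult_mono)
      have "(\<Sum>k<n. (1 / 4 :: real) ^ k) \<le> (\<Sum>k. (1 / 4) ^ k)" by (intro sum_le_suminf summable_geometric) auto
      then show "(\<Sum>k<n. (1 / 4 :: real) ^ k) \<le> 2" by (simp add: suminf_geometric)
      show "(\<Sum>k<n. 4 ^ k * (m k)\<^sup>2) \<le> (\<Sum>k. 4 ^ k * (m k)\<^sup>2)" by (intro sum_le_suminf s) auto
    qed (auto intro: sum_nonneg)
    finally show ?thesis .
  qed
  have "(\<lambda>n. (\<Sum>k<n. m k)\<^sup>2) \<longlonglongrightarrow> (\<Sum>k. m k)\<^sup>2" by (intro tendsto_power summable_LIMSEQ sm)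
  then show "(\<Sum>k. m k)\<^sup>2 \<le> 2 * (\<Sum>k. 4 ^ k * (m k)\<^sup>2)" by (rule LIMSEQ_le_const2) (use fin in auto)
qed

definition grad_abs :: "real \<Rightarrow> complex \<Rightarrow> real" where
  "grad_abs r z = \<bar>pot_x r z\<bar> + \<bar>pot_y r z\<bar>"

lemma continuous_grad_abs: "0 < r \<Longrightarrow> continuous_on S (\<lambda>z. grad_abs r (z - p))"
  unfolding grad_abs_def by (intro continuous_intros continuous_pot_x continuous_pot_y)

lemma stage_grad_abs_nonneg: "0 \<le> stage grad_abs k z"
  unfolding stage_def grad_abs_def using flux_pos[of k] by (intro mult_nonneg_nonneg sum_nonneg) auto

lemma abs_stage_le_grad_abs: "\<bar>stage pot_x k z\<bar> \<le> stage grad_abs k z" "\<bar>stage pot_y k z\<bar> \<le> stage grad_abs k z"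
  unfolding stage_def abs_mult abs_of_pos[OF flux_pos]
  by (intro mult_left_mono less_imp_le[OF flux_pos] order_trans[OF sum_abs] sum_mono; simp add: grad_abs_def)+

text \<open>Cauchy-Schwarz over the at most 4 * 4^k discs of the level, followed by the pointwise
  bound 1 / max(|z|^2, r^2) for the squared gradient of one disc.\<close>

lemma stage_grad_abs_sq_le:
  "(stage grad_abs k z)\<^sup>2 \<le> (flux k)\<^sup>2 * (4 * 4 ^ k) * (\<Sum>p\<in>kept k. 2 * (1 / max ((cmod (z - p))\<^sup>2) ((rad k)\<^sup>2)))"
proof -
  have "(\<Sum>p\<in>kept k. 1 * grad_abs (rad k) (z - p))\<^sup>2 \<le> (\<Sum>p\<in>kept k. 1\<^sup>2) * (\<Sum>p\<in>kept k. (grad_abs (rad k) (z - p))\<^sup>2)"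
    by (rule Cauchy_Schwarz_ineq_sum)
  also have "\<dots> \<le> (4 * 4 ^ k) * (\<Sum>p\<in>kept k. 2 * (1 / max ((cmod (z - p))\<^sup>2) ((rad k)\<^sup>2)))"
  proof (rule mult_mono)
    show "(\<Sum>p\<in>kept k. 1\<^sup>2) \<le> (4 * 4 ^ k :: real)" using card_kept_le by simp
    show "(\<Sum>p\<in>kept k. (grad_abs (rad k) (z - p))\<^sup>2) \<le> (\<Sum>p\<in>kept k. 2 * (1 / max ((cmod (z - p))\<^sup>2) ((rad k)\<^sup>2)))"
    proof (rule sum_mono)
      fix p
      have "(\<bar>a\<bar> + \<bar>b\<bar>)\<^sup>2 \<le> 2 * (a\<^sup>2 + b\<^sup>2)" for a b :: real
        using sum_squares_bound[of "\<bar>a\<bar>" "\<bar>b\<bar>"] by (simp add: power2_sum)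
      then have "(grad_abs (rad k) (z - p))\<^sup>2 \<le> 2 * ((pot_x (rad k) (z - p))\<^sup>2 + (pot_y (rad k) (z - p))\<^sup>2)"
        by (simp add: grad_abs_def)
      also have "\<dots> \<le> 2 * (1 / max ((cmod (z - p))\<^sup>2) ((rad k)\<^sup>2))"
        using pot_grad_sq_le[OF rad_pos] by (intro mult_left_mono) auto
      finally show "(grad_abs (rad k) (z - p))\<^sup>2 \<le> 2 * (1 / max ((cmod (z - p))\<^sup>2) ((rad k)\<^sup>2))" .
    qed
  qed (auto intro: sum_nonneg)
  finally have "(\<Sum>p\<in>kept k. grad_abs (rad k) (z - p))\<^sup>2 \<le> (4 * 4 ^ k) * (\<Sum>p\<in>kept k. 2 * (1 / max ((cmod (z - p))\<^sup>2) ((rad k)\<^sup>2)))" by simp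
  then have "(flux k)\<^sup>2 * (\<Sum>p\<in>kept k. grad_abs (rad k) (z - p))\<^sup>2 \<le> (flux k)\<^sup>2 * ((4 * 4 ^ k) * (\<Sum>p\<in>kept k. 2 * (1 / max ((cmod (z - p))\<^sup>2) ((rad k)\<^sup>2))))"
    by (rule mult_left_mono) simp
  then show ?thesis by (simp only: stage_def power_mult_distrib mult.assoc)
qed

lemma continuous_set_integrable_ball:
  fixes g :: "complex \<Rightarrow> real"
  assumes "continuous_on UNIV g"
  shows "set_integrable lborel (ball 0 1) g"
proof -
  have "set_integrable lborel (cball 0 1) g"
    unfolding set_integrable_def by (intro borel_integrable_compact compact_cball continuous_on_subset[OF assms]) auto
  then show ?thesis by (rule set_integrable_subset) (auto simp: ball_subset_cball)
qed

lemma
  fixes f :: "'i \<Rightarrow> 'a \<Rightarrow> real"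
  assumes "\<And>i. i \<in> I \<Longrightarrow> set_integrable M A (f i)"
  shows set_integrable_sum: "set_integrable M A (\<lambda>x. \<Sum>i\<in>I. f i x)"
    and set_integral_sum: "(LINT x:A|M. (\<Sum>i\<in>I. f i x)) = (\<Sum>i\<in>I. LINT x:A|M. f i x)"
  using assms unfolding set_integrable_def set_lebesgue_integral_def scaleR_sum_right
  by (auto intro: Bochner_Integration.integrable_sum Bochner_Integration.integral_sum)

text \<open>The factor 4^k is the weight demanded by \<open>weighted_square_summable\<close>. In
  total 4^k enters three times (weight, Cauchy-Schwarz, number of discs) and 64^k once, from the
  logarithm of the radius; against the square of \<open>flux k\<close> this leaves 256^-k.\<close>

lemma integral_stage_grad_abs_sq_le:
  "(LINT z:ball 0 1|lborel. 4 ^ k * (stage grad_abs k z)\<^sup>2) \<le> 6144 * pi * (1 / 256) ^ k"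
  "set_integrable lborel (ball 0 1) (\<lambda>z. 4 ^ k * (stage grad_abs k z)\<^sup>2)"
proof -
  let ?g = "\<lambda>p z. 1 / max ((cmod (z - p))\<^sup>2) ((rad k)\<^sup>2)"
  let ?M = "64 ^ k + 3 * k + 5"
  have gi: "set_integrable lborel (ball 0 1) (?g p)" "(LINT z:ball 0 1|lborel. ?g p z) \<le> 16 * pi * (12 * 64 ^ k)"
    if "p \<in> kept k" for p
  proof -
    have p: "cmod p \<le> 2" using that kept_subset grid_bound(3) by blast
    show "set_integrable lborel (ball 0 1) (?g p)"
      unfolding rad_def by (rule integral_inverse_max_sq_le(2)[OF p])
    have "(LINT z:ball 0 1|lborel. ?g p z) \<le> 16 * pi * real (?M + 3)"
      unfolding rad_def by (rule integral_inverse_max_sq_le(1)[OF p])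
    also have "real (?M + 3) \<le> 12 * 64 ^ k"
    proof -
      have "real (?M + 3) = real ?M + 3" by (simp only: of_nat_add of_nat_numeral)
      moreover have "(1::real) \<le> 64 ^ k" by simp
      ultimately show ?thesis using level_le[of k] by linarith
    qed
    finally show "(LINT z:ball 0 1|lborel. ?g p z) \<le> 16 * pi * (12 * 64 ^ k)" by simp
  qed
  have "continuous_on UNIV (stage grad_abs k)" by (intro continuous_stage continuous_grad_abs)
  then have "continuous_on UNIV (\<lambda>z. 4 ^ k * (stage grad_abs k z)\<^sup>2)" by (intro continuous_intros)
  then show int: "set_integrable lborel (ball 0 1) (\<lambda>z. 4 ^ k * (stage grad_abs k z)\<^sup>2)"
    by (rule continuous_set_integrable_ball)
  let ?c = "4 ^ k * ((flux k)\<^sup>2 * (4 * 4 ^ k)) :: real"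
  have int2: "set_integrable lborel (ball 0 1) (\<lambda>z. ?c * (\<Sum>p\<in>kept k. 2 * ?g p z))"
    using gi(1) by (intro set_integrable_mult_right set_integrable_sum) blast
  have "(LINT z:ball 0 1|lborel. 4 ^ k * (stage grad_abs k z)\<^sup>2) \<le> (LINT z:ball 0 1|lborel. ?c * (\<Sum>p\<in>kept k. 2 * ?g p z))"
  proof (rule set_integral_mono[OF int int2])
    fix z :: complex
    show "4 ^ k * (stage grad_abs k z)\<^sup>2 \<le> ?c * (\<Sum>p\<in>kept k. 2 * ?g p z)"
      using mult_left_mono[OF stage_grad_abs_sq_le[of k z], of "4 ^ k"] by (simp only: mult.assoc zero_le_power zero_le_numeral)
  qed
  also have "\<dots> = ?c * (\<Sum>p\<in>kept k. 2 * (LINT z:ball 0 1|lborel. ?g p z))"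
  proof -
    have "(LINT z:ball 0 1|lborel. (\<Sum>p\<in>kept k. 2 * ?g p z)) = (\<Sum>p\<in>kept k. LINT z:ball 0 1|lborel. 2 * ?g p z)"
      using gi(1) by (intro set_integral_sum set_integrable_mult_right) blast
    then show ?thesis by (simp only: set_integral_mult_right)
  qed
  also have "\<dots> \<le> ?c * (4 * 4 ^ k * (2 * (16 * pi * (12 * 64 ^ k))))"
    using gi(2) by (intro mult_left_mono sum_kept_le) auto
  also have "\<dots> = 6144 * pi * (4 ^ k * 4 ^ k * 4 ^ k * 64 ^ k * (flux k)\<^sup>2)" by simp
  also have "4 ^ k * 4 ^ k * 4 ^ k * 64 ^ k * (flux k)\<^sup>2 = (1 / 256) ^ k"
    by (simp add: flux_def power2_eq_square flip: power_mult_distrib)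
  finally show "(LINT z:ball 0 1|lborel. 4 ^ k * (stage grad_abs k z)\<^sup>2) \<le> 6144 * pi * (1 / 256) ^ k" .
qed

text \<open>A square integrable majorant of all truncated gradients; it is the dominating function
  whenever the truncation of the gradient is removed.\<close>

definition grad_major :: "complex \<Rightarrow> real" where
  "grad_major z = (\<Sum>k. stage grad_abs k z)"

lemma measurable_stage:
  assumes "\<And>r. 0 < r \<Longrightarrow> V r \<in> borel_measurable borel"
  shows "stage V k \<in> borel_measurable borel"
proof -
  have "(\<lambda>z. V (rad k) (z - p)) \<in> borel_measurable borel" for p
    by (rule measurable_compose[OF borel_measurable_continuous_onI assms[OF rad_pos]]) (intro continuous_intros)
  then show ?thesis unfolding stage_def[abs_def]
    by (intro borel_measurable_times borel_measurable_const borel_measurable_sum)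
qed

lemma measurable_pot_total:
  assumes "\<And>r. 0 < r \<Longrightarrow> V r \<in> borel_measurable borel"
  shows "pot_total V \<in> borel_measurable borel"
  unfolding pot_total_def[abs_def] by (rule borel_measurable_suminf) (rule measurable_stage[OF assms])

lemma measurable_pot_sum:
  assumes "\<And>r. 0 < r \<Longrightarrow> V r \<in> borel_measurable borel"
  shows "pot_sum V K \<in> borel_measurable borel"
proof -
  have "(\<lambda>z. \<Sum>k<K. stage V k z) \<in> borel_measurable borel"
    by (rule borel_measurable_sum) (rule measurable_stage[OF assms])
  then show ?thesis by (simp add: pot_sum_eq[abs_def])
qed

lemma measurable_pots:
  assumes r: "0 < r"
  shows "log_pot r \<in> borel_measurable borel" "pot_x r \<in> borel_measurable borel"
    "pot_y r \<in> borel_measurable borel" "grad_abs r \<in> borel_measurable borel"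
    "disc_density r \<in> borel_measurable borel"
proof -
  show "log_pot r \<in> borel_measurable borel" "pot_x r \<in> borel_measurable borel"
    "pot_y r \<in> borel_measurable borel" "grad_abs r \<in> borel_measurable borel"
    using continuous_log_pot[OF r, of UNIV 0] continuous_pot_x[OF r, of UNIV 0]
      continuous_pot_y[OF r, of UNIV 0] continuous_grad_abs[OF r, of UNIV 0]
    by (auto intro: borel_measurable_continuous_onI)
  have "indicator (ball 0 r) \<in> borel_measurable (borel :: complex measure)"
    by (rule borel_measurable_indicator) simp
  then show "disc_density r \<in> borel_measurable borel"
    unfolding disc_density_def[abs_def] by (intro borel_measurable_times borel_measurable_const)
qed

lemma measurable_grad_major: "grad_major \<in> borel_measurable borel"
proof -
  have "grad_major = pot_total grad_abs" by (rule ext) (simp add: grad_major_def pot_total_def)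
  then show ?thesis using measurable_pot_total[of grad_abs, OF measurable_pots(4)] by simp
qed

lemma measurable_indicator_scaleR:
  fixes f :: "complex \<Rightarrow> real"
  assumes "f \<in> borel_measurable borel" "A \<in> sets borel"
  shows "(\<lambda>z. indicator A z *\<^sub>R f z) \<in> borel_measurable lborel"
  using assms by (intro borel_measurable_scaleR borel_measurable_indicator) simp_all

lemma
  shows AE_grad_summable: "AE z in lborel. z \<in> ball 0 1 \<longrightarrow> summable (\<lambda>k. 4 ^ k * (stage grad_abs k z)\<^sup>2)"
    and integrable_grad_major_sq: "set_integrable lborel (ball 0 1) (\<lambda>z. (grad_major z)\<^sup>2)"
proof -
  let ?f = "\<lambda>k z. indicator (ball 0 1) z *\<^sub>R (4 ^ k * (stage grad_abs k z)\<^sup>2) :: real"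
  have int: "integrable lborel (?f k)" for k
    using integral_stage_grad_abs_sq_le(2)[of k] by (simp add: set_integrable_def)
  have s: "summable (\<lambda>k. integral\<^sup>L lborel (?f k))"
  proof (rule summable_comparison_test')
    show "summable (\<lambda>k. 6144 * pi * (1 / 256) ^ k)" by (intro summable_mult summable_geometric) simp
    show "norm (integral\<^sup>L lborel (?f k)) \<le> 6144 * pi * (1 / 256) ^ k" if "0 \<le> k" for k
    proof -
      have "0 \<le> integral\<^sup>L lborel (?f k)" by (rule Bochner_Integration.integral_nonneg) simp
      then show ?thesis using integral_stage_grad_abs_sq_le(1)[of k] by (simp only: set_lebesgue_integral_def real_norm_def abs_of_nonneg)
    qed
  qed
  note L = AE_summable_if_summable_integrals[of lborel ?f, OF int _ s]
  have AE: "AE z in lborel. summable (\<lambda>k. ?f k z)" by (rule L(1)) simp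
  then show AE': "AE z in lborel. z \<in> ball 0 1 \<longrightarrow> summable (\<lambda>k. 4 ^ k * (stage grad_abs k z)\<^sup>2)"
  proof eventually_elim
    case (elim z)
    show ?case
    proof
      assume "z \<in> ball 0 1"
      then show "summable (\<lambda>k. 4 ^ k * (stage grad_abs k z)\<^sup>2)" using elim by (simp only: indicator_simps scaleR_one)
    qed
  qed
  have "integrable lborel (\<lambda>z. \<Sum>k. ?f k z)" by (rule L(2)) simp
  then have i2: "integrable lborel (\<lambda>z. 2 * (\<Sum>k. ?f k z))" by (rule integrable_mult_right)
  show "set_integrable lborel (ball 0 1) (\<lambda>z. (grad_major z)\<^sup>2)"
    unfolding set_integrable_def
  proof (rule Bochner_Integration.integrable_bound[OF i2])
    show "(\<lambda>z. indicator (ball 0 1) z *\<^sub>R (grad_major z)\<^sup>2) \<in> borel_measurable lborel"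
      using measurable_grad_major by (intro measurable_indicator_scaleR borel_measurable_power) auto
    show "AE z in lborel. norm (indicator (ball 0 1) z *\<^sub>R (grad_major z)\<^sup>2) \<le> norm (2 * (\<Sum>k. ?f k z))"
      using AE'
    proof eventually_elim
      case (elim z)
      show ?case
      proof (cases "z \<in> ball 0 1")
        case True
        have "(\<Sum>k. stage grad_abs k z)\<^sup>2 \<le> 2 * (\<Sum>k. 4 ^ k * (stage grad_abs k z)\<^sup>2)"
          using elim True by (simp add: weighted_square_summable(2)[OF stage_grad_abs_nonneg])
        then show ?thesis using True by (simp add: grad_major_def)
      qed simp
    qed
  qed
qed

text \<open>Absolute convergence at a point follows from the weighted square summability there,
  which is available only outside a null set.\<close>

lemma AE_grad:
  "AE z in lborel. z \<in> ball 0 1 \<longrightarrow>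
     (\<forall>K. \<bar>pot_sum pot_x K z\<bar> \<le> grad_major z \<and> \<bar>pot_sum pot_y K z\<bar> \<le> grad_major z) \<and>
     (\<lambda>K. pot_sum pot_x K z) \<longlonglongrightarrow> pot_total pot_x z \<and> (\<lambda>K. pot_sum pot_y K z) \<longlonglongrightarrow> pot_total pot_y z"
  using AE_grad_summable
proof eventually_elim
  case (elim z)
  have *: "(\<forall>K. \<bar>pot_sum V K z\<bar> \<le> grad_major z) \<and> (\<lambda>K. pot_sum V K z) \<longlonglongrightarrow> pot_total V z"
    if z: "z \<in> ball 0 1" and le: "\<And>k. \<bar>stage V k z\<bar> \<le> stage grad_abs k z" for V
  proof -
    have s: "summable (\<lambda>k. stage grad_abs k z)"
      using elim z by (simp add: weighted_square_summable(1)[OF stage_grad_abs_nonneg])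
    have sV: "summable (\<lambda>k. stage V k z)"
      by (rule summable_comparison_test'[OF s, of 0]) (simp add: le)
    have "\<bar>pot_sum V K z\<bar> \<le> grad_major z" for K
    proof -
      have "\<bar>pot_sum V K z\<bar> \<le> (\<Sum>k<K. stage grad_abs k z)"
        unfolding pot_sum_eq by (intro order_trans[OF sum_abs] sum_mono le)
      also have "\<dots> \<le> grad_major z" unfolding grad_major_def by (intro sum_le_suminf s stage_grad_abs_nonneg) auto
      finally show ?thesis .
    qed
    moreover have "(\<lambda>K. pot_sum V K z) \<longlonglongrightarrow> pot_total V z"
      using summable_LIMSEQ[OF sV] by (simp add: pot_sum_eq[abs_def] pot_total_def)
    ultimately show ?thesis by (intro conjI allI)
  qed
  show ?case
  proof
    assume "z \<in> ball 0 1"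
    note x = *[OF this abs_stage_le_grad_abs(1)] and y = *[OF this abs_stage_le_grad_abs(2)]
    show "(\<forall>K. \<bar>pot_sum pot_x K z\<bar> \<le> grad_major z \<and> \<bar>pot_sum pot_y K z\<bar> \<le> grad_major z) \<and>
     (\<lambda>K. pot_sum pot_x K z) \<longlonglongrightarrow> pot_total pot_x z \<and> (\<lambda>K. pot_sum pot_y K z) \<longlonglongrightarrow> pot_total pot_y z"
      using x y by (intro conjI allI) simp_all
  qed
qed

lemma set_integrable_const_ball: "set_integrable lborel (ball (0::complex) 1) (\<lambda>_. c :: real)"
  by (rule continuous_set_integrable_ball) simp

lemma integrable_grad_major: "set_integrable lborel (ball 0 1) grad_major"
proof (rule set_integrable_bound)
  show "set_integrable lborel (ball 0 1) (\<lambda>z. 1 + (grad_major z)\<^sup>2)"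
    by (intro set_integral_add set_integrable_const_ball integrable_grad_major_sq)
  show "set_borel_measurable lborel (ball 0 1) grad_major"
    unfolding set_borel_measurable_def using measurable_grad_major by (intro measurable_indicator_scaleR) auto
  have "\<bar>x\<bar> \<le> 1 + x\<^sup>2" for x :: real
    using sum_squares_bound[of "\<bar>x\<bar>" 1] abs_ge_zero[of x] by (simp only: power2_abs mult_1_right one_power2)
  then show "AE z in lborel. z \<in> ball 0 1 \<longrightarrow> norm (grad_major z) \<le> norm (1 + (grad_major z)\<^sup>2)"
    by simp
qed

lemma abs_pot_total_le:
  "AE z in lborel. z \<in> ball 0 1 \<longrightarrow> \<bar>pot_total pot_x z\<bar> \<le> grad_major z \<and> \<bar>pot_total pot_y z\<bar> \<le> grad_major z"
  using AE_grad
proof eventually_elim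
  case (elim z)
  show ?case
  proof (intro impI conjI)
    assume z: "z \<in> ball 0 1"
    have "(\<lambda>K. \<bar>pot_sum pot_x K z\<bar>) \<longlonglongrightarrow> \<bar>pot_total pot_x z\<bar>" "(\<lambda>K. \<bar>pot_sum pot_y K z\<bar>) \<longlonglongrightarrow> \<bar>pot_total pot_y z\<bar>"
      using elim z by (auto intro: tendsto_rabs)
    then show "\<bar>pot_total pot_x z\<bar> \<le> grad_major z" "\<bar>pot_total pot_y z\<bar> \<le> grad_major z"
      using elim z by (auto intro: LIMSEQ_le_const2)
  qed
qed

lemma square_integrable_pot_total:
  "square_integrable_on (ball 0 1) (pot_total pot_x)" "square_integrable_on (ball 0 1) (pot_total pot_y)"
proof -
  have *: "square_integrable_on (ball 0 1) g"
    if g: "g \<in> borel_measurable borel" "AE z in lborel. z \<in> ball 0 1 \<longrightarrow> \<bar>g z\<bar> \<le> grad_major z" for g :: "complex \<Rightarrow> real"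
    unfolding square_integrable_on_def
  proof
    show "set_borel_measurable lborel (ball 0 1) g"
      unfolding set_borel_measurable_def using g(1) by (intro measurable_indicator_scaleR) auto
    show "set_integrable lborel (ball 0 1) (\<lambda>z. (g z)\<^sup>2)"
    proof (rule set_integrable_bound[OF integrable_grad_major_sq])
      show "set_borel_measurable lborel (ball 0 1) (\<lambda>z. (g z)\<^sup>2)"
        unfolding set_borel_measurable_def using g(1) by (intro measurable_indicator_scaleR borel_measurable_power) auto
      show "AE z in lborel. z \<in> ball 0 1 \<longrightarrow> norm ((g z)\<^sup>2) \<le> norm ((grad_major z)\<^sup>2)"
        using g(2)
      proof eventually_elim
        case (elim z)
        show ?case
        proof
          assume "z \<in> ball 0 1"
          then have "\<bar>g z\<bar>\<^sup>2 \<le> (grad_major z)\<^sup>2" using elim by (intro power_mono) auto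
          then show "norm ((g z)\<^sup>2) \<le> norm ((grad_major z)\<^sup>2)" by simp
        qed
      qed
    qed
  qed
  have "AE z in lborel. z \<in> ball 0 1 \<longrightarrow> \<bar>pot_total pot_x z\<bar> \<le> grad_major z"
       "AE z in lborel. z \<in> ball 0 1 \<longrightarrow> \<bar>pot_total pot_y z\<bar> \<le> grad_major z"
    using abs_pot_total_le by (auto elim!: eventually_mono)
  then show "square_integrable_on (ball 0 1) (pot_total pot_x)" "square_integrable_on (ball 0 1) (pot_total pot_y)"
    using * measurable_pot_total[of pot_x, OF measurable_pots(2)] measurable_pot_total[of pot_y, OF measurable_pots(3)] by auto
qed

section \<open>The density of the Laplacian\<close>

lemma stage_disc_nonneg: "0 \<le> stage disc_density k z"
  unfolding stage_def disc_density_def using flux_pos[of k] by (intro mult_nonneg_nonneg sum_nonneg) auto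

lemma disc_density_shift: "disc_density r (z - p) = 2 / r\<^sup>2 * indicator (ball p r) z"
  by (simp add: disc_density_def indicator_def dist_norm norm_minus_commute)

lemma stage_disc_eq_0:
  assumes "\<And>p. p \<in> kept k \<Longrightarrow> z \<notin> ball p (rad k)"
  shows "stage disc_density k z = 0"
  unfolding stage_def disc_density_shift using assms by simp

text \<open>The kept discs are pairwise disjoint, so at a given point only one term of the double
  sum over levels and centres can be nonzero.\<close>

lemma stage_disc_eq:
  assumes p: "p \<in> kept k" and z: "z \<in> ball p (rad k)"
  shows "stage disc_density i z = (if i = k then flux k * (2 / (rad k)\<^sup>2) else 0)"
proof (cases "i = k")
  case True
  have *: "z \<notin> ball q (rad k)" if "q \<in> kept k" "q \<noteq> p" for q
  proof -
    have "disjnt (ball p (rad k)) (ball q (rad k))" using that by (intro kept_disjoint p) auto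
    then show ?thesis using z by (meson disjnt_iff)
  qed
  have "(\<Sum>q\<in>kept k. disc_density (rad k) (z - q)) = (\<Sum>q\<in>kept k. if q = p then 2 / (rad k)\<^sup>2 else 0)"
  proof (rule sum.cong[OF refl])
    fix q assume q: "q \<in> kept k"
    show "disc_density (rad k) (z - q) = (if q = p then 2 / (rad k)\<^sup>2 else 0)"
      unfolding disc_density_shift using z *[OF q] by (cases "q = p") (simp_all add: indicator_simps del: mem_ball)
  qed
  also have "\<dots> = 2 / (rad k)\<^sup>2" using p finite_kept by simp
  finally show ?thesis using True by (simp add: stage_def)
next
  case False
  have "z \<notin> ball q (rad i)" if "q \<in> kept i" for q
  proof -
    have "disjnt (ball p (rad k)) (ball q (rad i))" using that False by (intro kept_disjoint p) auto
    then show ?thesis using z by (meson disjnt_iff)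
  qed
  then have "stage disc_density i z = 0" by (rule stage_disc_eq_0)
  then show ?thesis using False by simp
qed

lemma stage_disc_sums:
  "(\<forall>k. \<forall>p\<in>kept k. z \<notin> ball p (rad k)) \<and> (\<lambda>k. stage disc_density k z) sums 0 \<or>
   (\<exists>k. \<exists>p\<in>kept k. z \<in> ball p (rad k) \<and> (\<lambda>k. stage disc_density k z) sums (flux k * (2 / (rad k)\<^sup>2)))"
proof (cases "\<exists>k. \<exists>p\<in>kept k. z \<in> ball p (rad k)")
  case True
  then obtain k p where p: "p \<in> kept k" "z \<in> ball p (rad k)" by blast
  have "(\<lambda>i. if i = k then flux k * (2 / (rad k)\<^sup>2) else 0) sums (flux k * (2 / (rad k)\<^sup>2))"
    using sums_If_finite[of "\<lambda>i. i = k" "\<lambda>_. flux k * (2 / (rad k)\<^sup>2)"] by simp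
  then have "(\<lambda>k. stage disc_density k z) sums (flux k * (2 / (rad k)\<^sup>2))"
    by (simp only: stage_disc_eq[OF p])
  then show ?thesis using p by blast
next
  case False
  then have "(\<lambda>k. stage disc_density k z) = (\<lambda>k. 0)" using stage_disc_eq_0 by blast
  then show ?thesis using False by simp
qed

lemma summable_stage_disc: "summable (\<lambda>k. stage disc_density k z)"
  using stage_disc_sums sums_summable by blast

lemma pot_total_disc_in: "p \<in> kept k \<Longrightarrow> z \<in> ball p (rad k) \<Longrightarrow> pot_total disc_density z = flux k * (2 / (rad k)\<^sup>2)"
proof -
  assume p: "p \<in> kept k" "z \<in> ball p (rad k)"
  have "(\<lambda>i. if i = k then flux k * (2 / (rad k)\<^sup>2) else 0) sums (flux k * (2 / (rad k)\<^sup>2))"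
    using sums_If_finite[of "\<lambda>i. i = k" "\<lambda>_. flux k * (2 / (rad k)\<^sup>2)"] by simp
  then have "(\<lambda>k. stage disc_density k z) sums (flux k * (2 / (rad k)\<^sup>2))"
    by (simp only: stage_disc_eq[OF p])
  then show ?thesis by (simp add: pot_total_def sums_iff)
qed

lemma pot_total_disc_out: "(\<And>k p. p \<in> kept k \<Longrightarrow> z \<notin> ball p (rad k)) \<Longrightarrow> pot_total disc_density z = 0"
  unfolding pot_total_def using stage_disc_eq_0 by simp

lemma pot_total_disc_nonneg: "0 \<le> pot_total disc_density z"
  unfolding pot_total_def by (intro suminf_nonneg summable_stage_disc stage_disc_nonneg)

lemma pot_sum_disc_le: "pot_sum disc_density K z \<le> pot_total disc_density z"
  unfolding pot_sum_eq pot_total_def by (intro sum_le_suminf summable_stage_disc stage_disc_nonneg) auto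

lemma pot_sum_disc_nonneg: "0 \<le> pot_sum disc_density K z"
  unfolding pot_sum_eq by (intro sum_nonneg stage_disc_nonneg)

lemma pot_sum_disc_tendsto: "(\<lambda>K. pot_sum disc_density K z) \<longlonglongrightarrow> pot_total disc_density z"
  using summable_LIMSEQ[OF summable_stage_disc[of z]] by (simp add: pot_sum_eq[abs_def] pot_total_def)

lemma integral_disc_density:
  assumes "0 < r"
  shows "integrable lborel (\<lambda>z. disc_density r (z - p))" "(LINT z|lborel. disc_density r (z - p)) = 2 * pi"
proof -
  have fin: "integrable lborel (indicator (ball p r) :: complex \<Rightarrow> real)"
    using emeasure_bounded_finite[OF bounded_ball, of p r]
    by (intro integrable_real_indicator) (auto simp: infinity_ennreal_def)
  then show "integrable lborel (\<lambda>z. disc_density r (z - p))"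
    unfolding disc_density_shift by (intro integrable_mult_right)
  show "(LINT z|lborel. disc_density r (z - p)) = 2 * pi"
    unfolding disc_density_shift using assms fin by (simp add: measure_ball_complex)
qed

lemma integral_stage_disc:
  "integrable lborel (stage disc_density k)" "(LINT z|lborel. stage disc_density k z) \<le> 8 * pi * (1 / 256) ^ k"
proof -
  show "integrable lborel (stage disc_density k)"
    unfolding stage_def by (intro integrable_mult_right Bochner_Integration.integrable_sum integral_disc_density rad_pos)
  have "(LINT z|lborel. stage disc_density k z) = flux k * (\<Sum>p\<in>kept k. 2 * pi)"
    unfolding stage_def using integral_disc_density[OF rad_pos] by (simp add: Bochner_Integration.integral_sum)
  also have "\<dots> \<le> flux k * (4 * 4 ^ k * (2 * pi))"
    using flux_pos[of k] by (intro mult_left_mono sum_kept_le) auto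
  also have "\<dots> = 8 * pi * (1 / 256) ^ k" by (simp add: flux_def flip: power_mult_distrib)
  finally show "(LINT z|lborel. stage disc_density k z) \<le> 8 * pi * (1 / 256) ^ k" .
qed

lemma integrable_pot_total_disc: "integrable lborel (pot_total disc_density)"
proof -
  have "summable (\<lambda>k. LINT z|lborel. stage disc_density k z)"
  proof (rule summable_comparison_test')
    show "summable (\<lambda>k. 8 * pi * (1 / 256) ^ k)" by (intro summable_mult summable_geometric) simp
    show "norm (LINT z|lborel. stage disc_density k z) \<le> 8 * pi * (1 / 256) ^ k" if "0 \<le> k" for k
      using integral_stage_disc(2)[of k] Bochner_Integration.integral_nonneg[of lborel "stage disc_density k"] stage_disc_nonneg by simp
  qed
  then show ?thesis
    unfolding pot_total_def[abs_def] by (intro AE_summable_if_summable_integrals(2) integral_stage_disc(1) stage_disc_nonneg)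
qed

text \<open>The density is constant on each of the disjoint open discs and 0 elsewhere, so a
  superlevel set with c >= 0 is a union of discs cut down to the unit disc; with c < 0 it is
  everything.\<close>

lemma lower_semicontinuous_pot_total_disc: "lower_semicontinuous_on (ball 0 1) (pot_total disc_density)"
  unfolding lower_semicontinuous_on_def
proof
  fix c
  show "openin (top_of_set (ball 0 1)) {z \<in> ball 0 1. c < pot_total disc_density z}"
  proof (cases "c < 0")
    case True
    then have "{z \<in> ball 0 1. c < pot_total disc_density z} = ball 0 1"
      using pot_total_disc_nonneg by (auto intro: less_le_trans)
    then show ?thesis by simp
  next
    case False
    let ?U = "\<Union>k\<in>{k. c < flux k * (2 / (rad k)\<^sup>2)}. \<Union>p\<in>kept k. ball p (rad k)"
    have "{z \<in> ball 0 1. c < pot_total disc_density z} = ball 0 1 \<inter> ?U"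
    proof (intro equalityI subsetI)
      fix z assume z: "z \<in> {z \<in> ball 0 1. c < pot_total disc_density z}"
      then have "pot_total disc_density z \<noteq> 0" using False by auto
      then obtain k p where p: "p \<in> kept k" "z \<in> ball p (rad k)" using pot_total_disc_out by blast
      then show "z \<in> ball 0 1 \<inter> ?U" using z pot_total_disc_in[OF p] by auto
    next
      fix z assume z: "z \<in> ball 0 1 \<inter> ?U"
      then obtain k p where p: "p \<in> kept k" "z \<in> ball p (rad k)" "c < flux k * (2 / (rad k)\<^sup>2)" by blast
      then show "z \<in> {z \<in> ball 0 1. c < pot_total disc_density z}" using z pot_total_disc_in[OF p(1,2)] by simp
    qed
    moreover have "open ?U" by blast
    ultimately show ?thesis by (simp add: openin_open_Int)
  qed
qed

section \<open>Weak derivatives of the full sum\<close>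

lemma pot_sum_integral_limit:
  assumes V: "\<And>r. 0 < r \<Longrightarrow> V r \<in> borel_measurable borel"
    and AE: "AE z in lborel. z \<in> ball 0 1 \<longrightarrow> (\<forall>K. \<bar>pot_sum V K z\<bar> \<le> D z) \<and> (\<lambda>K. pot_sum V K z) \<longlonglongrightarrow> pot_total V z"
    and D: "set_integrable lborel (ball 0 1) D" and u: "u \<in> test_functions (ball 0 1)"
  shows "(\<lambda>K. LINT z|lborel. of_real (pot_sum V K z) * u z) \<longlonglongrightarrow> (LINT z:ball 0 1|lborel. of_real (pot_total V z) * u z)"
proof -
  obtain M where M: "\<And>z. cmod (u z) \<le> M" "0 \<le> M" using test_function_bounded[OF u] by blast
  have um: "u \<in> borel_measurable borel" by (rule test_functions_measurable[OF u])
  have bm: "(\<lambda>z. of_real (f z) * u z) \<in> borel_measurable lborel" if "f \<in> borel_measurable borel" for f :: "complex \<Rightarrow> real"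
    using that um by measurable
  have eq: "indicator (ball 0 1) z *\<^sub>R (of_real (f z) * u z) = of_real (f z) * u z" for f :: "complex \<Rightarrow> real" and z
    using test_functions_eq_0[OF u, of z] by (cases "z \<in> ball 0 1") simp_all
  have "(\<lambda>K. LINT z|lborel. of_real (pot_sum V K z) * u z) \<longlonglongrightarrow> (LINT z|lborel. of_real (pot_total V z) * u z)"
  proof (rule integral_dominated_convergence[where w = "\<lambda>z. M * \<bar>indicator (ball 0 1) z *\<^sub>R D z\<bar>"])
    show "(\<lambda>z. of_real (pot_total V z) * u z) \<in> borel_measurable lborel"
      by (intro bm measurable_pot_total V)
    show "(\<lambda>z. of_real (pot_sum V K z) * u z) \<in> borel_measurable lborel" for K
      by (intro bm measurable_pot_sum V)
    show "integrable lborel (\<lambda>z. M * \<bar>indicator (ball 0 1) z *\<^sub>R D z\<bar>)"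
      using D by (intro integrable_mult_right integrable_abs) (simp only: set_integrable_def)
    show "AE z in lborel. (\<lambda>K. of_real (pot_sum V K z) * u z) \<longlonglongrightarrow> of_real (pot_total V z) * u z"
      using AE
    proof eventually_elim
      case (elim z)
      show ?case
      proof (cases "z \<in> ball 0 1")
        case True
        then show ?thesis using elim by (intro tendsto_mult tendsto_of_real tendsto_const) blast
      next
        case False
        then have "u z = 0" by (rule test_functions_eq_0[OF u])
        then show ?thesis by simp
      qed
    qed
    show "AE z in lborel. norm (of_real (pot_sum V K z) * u z) \<le> M * \<bar>indicator (ball 0 1) z *\<^sub>R D z\<bar>" for K
      using AE
    proof eventually_elim
      case (elim z)
      show ?case
      proof (cases "z \<in> ball 0 1")
        case True
        then have "\<bar>pot_sum V K z\<bar> \<le> D z" using elim by blast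
        then have "\<bar>pot_sum V K z\<bar> * cmod (u z) \<le> \<bar>D z\<bar> * M" using M by (intro mult_mono) auto
        then show ?thesis using True by (simp add: norm_mult mult.commute)
      next
        case False
        then have "u z = 0" by (rule test_functions_eq_0[OF u])
        then show ?thesis using M by simp
      qed
    qed
  qed
  then show ?thesis unfolding set_lebesgue_integral_def eq .
qed

lemma integral_pot_sum:
  assumes "\<And>r p. 0 < r \<Longrightarrow> integrable lborel (\<lambda>z. of_real (V r (z - p)) * u z :: complex)"
  shows "(LINT z|lborel. of_real (pot_sum V K z) * u z) =
    (\<Sum>(i, p)\<in>kept_upto K. of_real (flux i) * (LINT z|lborel. of_real (V (rad i) (z - p)) * u z))"
proof -
  have "(LINT z|lborel. of_real (pot_sum V K z) * u z) =
    (LINT z|lborel. (\<Sum>x\<in>kept_upto K. of_real (flux (fst x)) * (of_real (V (rad (fst x)) (z - snd x)) * u z)))"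
    by (simp add: pot_sum_def case_prod_beta sum_distrib_right mult.assoc)
  also have "\<dots> = (\<Sum>x\<in>kept_upto K. LINT z|lborel. of_real (flux (fst x)) * (of_real (V (rad (fst x)) (z - snd x)) * u z))"
    by (rule Bochner_Integration.integral_sum) (intro integrable_mult_right assms rad_pos)
  finally show ?thesis by (simp add: case_prod_beta)
qed

lemma integrable_continuous_mult_test_function:
  assumes "continuous_on UNIV g" "u \<in> test_functions S"
  shows "integrable lborel (\<lambda>z. of_real (g z) * u z)"
proof -
  obtain M where "\<And>z. u z \<noteq> 0 \<Longrightarrow> \<bar>g z\<bar> \<le> M" using continuous_bounded_on_support[OF assms] by blast
  then show ?thesis
    by (intro integrable_bounded_mult_test_function[OF borel_measurable_continuous_onI[OF assms(1)] _ assms(2)])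
qed

lemma set_integrable_locally_integrable:
  "set_integrable lborel S g \<Longrightarrow> locally_integrable_on S g"
  unfolding locally_integrable_on_def
proof (intro allI impI)
  fix K assume S: "set_integrable lborel S g" and K: "compact K" "K \<subseteq> S"
  show "set_integrable lborel K g"
    by (rule set_integrable_subset[OF S _ K(2)]) (simp add: borel_compact K)
qed

lemma continuous_locally_integrable:
  "continuous_on S g \<Longrightarrow> locally_integrable_on S g"
  unfolding locally_integrable_on_def set_integrable_def
  by (intro allI impI borel_integrable_compact) (auto intro: continuous_on_subset)

lemma set_integrable_pot_total_grad:
  "set_integrable lborel (ball 0 1) (pot_total pot_x)" "set_integrable lborel (ball 0 1) (pot_total pot_y)"
proof -
  have "set_borel_measurable lborel (ball 0 1) (pot_total pot_x)" "set_borel_measurable lborel (ball 0 1) (pot_total pot_y)"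
    using square_integrable_pot_total by (simp_all add: square_integrable_on_def)
  moreover have "AE z in lborel. z \<in> ball 0 1 \<longrightarrow> norm (pot_total pot_x z) \<le> norm (grad_major z)"
    using abs_pot_total_le by eventually_elim force
  moreover have "AE z in lborel. z \<in> ball 0 1 \<longrightarrow> norm (pot_total pot_y z) \<le> norm (grad_major z)"
    using abs_pot_total_le by eventually_elim force
  ultimately show "set_integrable lborel (ball 0 1) (pot_total pot_x)" "set_integrable lborel (ball 0 1) (pot_total pot_y)"
    using set_integrable_bound[OF integrable_grad_major] by blast+
qed

lemma log_limit_hyp:
  "AE z in lborel. z \<in> ball 0 1 \<longrightarrow> (\<forall>K. \<bar>pot_sum log_pot K z\<bar> \<le> (\<Sum>k. 40 * (1 / 4) ^ k)) \<and> (\<lambda>K. pot_sum log_pot K z) \<longlonglongrightarrow> pot_total log_pot z"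
proof (rule AE_I2, rule impI)
  fix z :: complex assume z: "z \<in> ball 0 1"
  show "(\<forall>K. \<bar>pot_sum log_pot K z\<bar> \<le> (\<Sum>k. 40 * (1 / 4) ^ k)) \<and> (\<lambda>K. pot_sum log_pot K z) \<longlonglongrightarrow> pot_total log_pot z"
    by (intro conjI allI abs_pot_sum_log_le[OF z] pot_sum_log_tendsto[OF z])
qed

lemma grad_limit_hyp:
  "AE z in lborel. z \<in> ball 0 1 \<longrightarrow> (\<forall>K. \<bar>pot_sum pot_x K z\<bar> \<le> grad_major z) \<and> (\<lambda>K. pot_sum pot_x K z) \<longlonglongrightarrow> pot_total pot_x z"
  "AE z in lborel. z \<in> ball 0 1 \<longrightarrow> (\<forall>K. \<bar>pot_sum pot_y K z\<bar> \<le> grad_major z) \<and> (\<lambda>K. pot_sum pot_y K z) \<longlonglongrightarrow> pot_total pot_y z"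
  using AE_grad by (eventually_elim, blast)+

text \<open>Integration by parts holds disc by disc, hence for the truncations. Both sides converge
  by dominated convergence, the potentials under a constant and the gradients under
  \<open>grad_major\<close>.\<close>

lemma has_weak_partial_x_pot_total: "has_weak_partial (ball 0 1) 1 (pot_total log_pot) (pot_total pot_x)"
  unfolding has_weak_partial_def
proof (intro conjI ballI)
  show "locally_integrable_on (ball 0 1) (pot_total log_pot)"
    by (rule continuous_locally_integrable[OF continuous_pot_total_log])
  show "locally_integrable_on (ball 0 1) (pot_total pot_x)"
    by (rule set_integrable_locally_integrable[OF set_integrable_pot_total_grad(1)])
  fix u assume u: "u \<in> test_functions (ball 0 1)"
  have ux: "partial_x u \<in> test_functions (ball 0 1)" using u by (rule test_functions_partial) simp
  have "(LINT z|lborel. of_real (pot_sum log_pot K z) * partial_x u z) = - (LINT z|lborel. of_real (pot_sum pot_x K z) * u z)" for K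
    using integral_pot_sum[where K = K, OF integrable_continuous_mult_test_function[OF continuous_log_pot ux]]
      integral_pot_sum[where K = K, OF integrable_continuous_mult_test_function[OF continuous_pot_x u]]
    by (simp add: log_pot_weak_x[OF rad_pos u] case_prod_beta sum_negf)
  then have "(\<lambda>K. - (LINT z|lborel. of_real (pot_sum pot_x K z) * u z)) \<longlonglongrightarrow> (LINT z:ball 0 1|lborel. of_real (pot_total log_pot z) * partial_x u z)"
    using pot_sum_integral_limit[OF measurable_pots(1) log_limit_hyp set_integrable_const_ball ux] by (simp only:)
  moreover have "(\<lambda>K. - (LINT z|lborel. of_real (pot_sum pot_x K z) * u z)) \<longlonglongrightarrow> - (LINT z:ball 0 1|lborel. of_real (pot_total pot_x z) * u z)"
    by (intro tendsto_minus pot_sum_integral_limit[OF measurable_pots(2) grad_limit_hyp(1) integrable_grad_major u])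
  ultimately show "(LINT z:ball 0 1|lborel. of_real (pot_total log_pot z) * partial_x u z) = - (LINT z:ball 0 1|lborel. of_real (pot_total pot_x z) * u z)"
    by (rule LIMSEQ_unique)
qed

lemma has_weak_partial_y_pot_total: "has_weak_partial (ball 0 1) \<i> (pot_total log_pot) (pot_total pot_y)"
  unfolding has_weak_partial_def
proof (intro conjI ballI)
  show "locally_integrable_on (ball 0 1) (pot_total log_pot)"
    by (rule continuous_locally_integrable[OF continuous_pot_total_log])
  show "locally_integrable_on (ball 0 1) (pot_total pot_y)"
    by (rule set_integrable_locally_integrable[OF set_integrable_pot_total_grad(2)])
  fix u assume u: "u \<in> test_functions (ball 0 1)"
  have ux: "partial_y u \<in> test_functions (ball 0 1)" using u by (rule test_functions_partial) simp
  have "(LINT z|lborel. of_real (pot_sum log_pot K z) * partial_y u z) = - (LINT z|lborel. of_real (pot_sum pot_y K z) * u z)" for K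
    using integral_pot_sum[where K = K, OF integrable_continuous_mult_test_function[OF continuous_log_pot ux]]
      integral_pot_sum[where K = K, OF integrable_continuous_mult_test_function[OF continuous_pot_y u]]
    by (simp add: log_pot_weak_y[OF rad_pos u] case_prod_beta sum_negf)
  then have "(\<lambda>K. - (LINT z|lborel. of_real (pot_sum pot_y K z) * u z)) \<longlonglongrightarrow> (LINT z:ball 0 1|lborel. of_real (pot_total log_pot z) * partial_y u z)"
    using pot_sum_integral_limit[OF measurable_pots(1) log_limit_hyp set_integrable_const_ball ux] by (simp only:)
  moreover have "(\<lambda>K. - (LINT z|lborel. of_real (pot_sum pot_y K z) * u z)) \<longlonglongrightarrow> - (LINT z:ball 0 1|lborel. of_real (pot_total pot_y z) * u z)"
    by (intro tendsto_minus pot_sum_integral_limit[OF measurable_pots(3) grad_limit_hyp(2) integrable_grad_major u])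
  ultimately show "(LINT z:ball 0 1|lborel. of_real (pot_total log_pot z) * partial_y u z) = - (LINT z:ball 0 1|lborel. of_real (pot_total pot_y z) * u z)"
    by (rule LIMSEQ_unique)
qed

lemma set_integrable_pot_total_disc: "set_integrable lborel (ball 0 1) (pot_total disc_density)"
  unfolding set_integrable_def by (rule integrable_mult_indicator[OF _ integrable_pot_total_disc]) simp

lemma test_functions_add:
  assumes f: "f \<in> test_functions S" and g: "g \<in> test_functions S"
  shows "(\<lambda>z. f z + g z) \<in> test_functions S"
proof -
  have F: "C_k k f" "compact (closure {z. f z \<noteq> 0})" "closure {z. f z \<noteq> 0} \<subseteq> S"
    and G: "C_k k g" "compact (closure {z. g z \<noteq> 0})" "closure {z. g z \<noteq> 0} \<subseteq> S" for k
    using f g unfolding test_functions_def by blast+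
  have sub: "closure {z. f z + g z \<noteq> 0} \<subseteq> closure {z. f z \<noteq> 0} \<union> closure {z. g z \<noteq> 0}"
    unfolding closure_Un[symmetric] by (rule closure_mono) auto
  have "bounded ({z. f z \<noteq> 0} \<union> {z. g z \<noteq> 0})" using F(2) G(2) by simp
  then have "bounded {z. f z + g z \<noteq> 0}" by (rule bounded_subset) auto
  then have "compact (closure {z. f z + g z \<noteq> 0})" by simp
  moreover have "C_k k (\<lambda>z. f z + g z)" for k using F(1) G(1) by (rule C_k_add)
  moreover have "closure {z. f z + g z \<noteq> 0} \<subseteq> S" using sub F(3) G(3) by blast
  ultimately show ?thesis unfolding test_functions_def by blast
qed

lemma has_weak_laplacian_pot_total: "has_weak_laplacian (ball 0 1) (pot_total log_pot) (pot_total disc_density)"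
  unfolding has_weak_laplacian_def
proof (intro conjI ballI)
  show "locally_integrable_on (ball 0 1) (pot_total log_pot)"
    by (rule continuous_locally_integrable[OF continuous_pot_total_log])
  show "locally_integrable_on (ball 0 1) (pot_total disc_density)"
    by (rule set_integrable_locally_integrable[OF set_integrable_pot_total_disc])
  fix u assume u: "u \<in> test_functions (ball 0 1)"
  have uxx: "partial_x (partial_x u) \<in> test_functions (ball 0 1)" and uyy: "partial_y (partial_y u) \<in> test_functions (ball 0 1)"
    using u by (auto intro!: test_functions_partial)
  let ?L = "\<lambda>z. partial_x (partial_x u) z + partial_y (partial_y u) z"
  have L: "?L \<in> test_functions (ball 0 1)" by (rule test_functions_add[OF uxx uyy])
  have int: "integrable lborel (\<lambda>z. of_real (disc_density r (z - p)) * u z)" if "0 < r" for r p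
  proof (rule integrable_bounded_mult_test_function[OF _ _ u])
    show "(\<lambda>z. disc_density r (z - p)) \<in> borel_measurable borel"
      using borel_measurable_integrable[OF integral_disc_density(1)[OF that]] by simp
    show "\<bar>disc_density r (z - p)\<bar> \<le> 2 / r\<^sup>2" for z by (simp add: disc_density_def indicator_def)
  qed
  have "(LINT z|lborel. of_real (pot_sum log_pot K z) * ?L z) = (LINT z|lborel. of_real (pot_sum disc_density K z) * u z)" for K
    using integral_pot_sum[where K = K, OF integrable_continuous_mult_test_function[OF continuous_log_pot L]]
      integral_pot_sum[where K = K, OF int]
    by (simp add: log_pot_weak_laplacian[OF rad_pos u] disc_density_shift case_prod_beta)
  then have "(\<lambda>K. LINT z|lborel. of_real (pot_sum disc_density K z) * u z) \<longlonglongrightarrow> (LINT z:ball 0 1|lborel. of_real (pot_total log_pot z) * ?L z)"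
    using pot_sum_integral_limit[OF measurable_pots(1) log_limit_hyp set_integrable_const_ball L] by (simp only:)
  moreover have "(\<lambda>K. LINT z|lborel. of_real (pot_sum disc_density K z) * u z) \<longlonglongrightarrow> (LINT z:ball 0 1|lborel. of_real (pot_total disc_density z) * u z)"
  proof (rule pot_sum_integral_limit[OF measurable_pots(5) _ set_integrable_pot_total_disc u])
    show "AE z in lborel. z \<in> ball 0 1 \<longrightarrow> (\<forall>K. \<bar>pot_sum disc_density K z\<bar> \<le> pot_total disc_density z) \<and> (\<lambda>K. pot_sum disc_density K z) \<longlonglongrightarrow> pot_total disc_density z"
      using pot_sum_disc_le pot_sum_disc_nonneg pot_sum_disc_tendsto by (intro AE_I2) (simp add: abs_of_nonneg)
  qed
  ultimately show "(LINT z:ball 0 1|lborel. of_real (pot_total log_pot z) * ?L z) = (LINT z:ball 0 1|lborel. of_real (pot_total disc_density z) * u z)"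
    by (rule LIMSEQ_unique)
qed

section \<open>Eigenvalues in terms of the explicit derivatives\<close>

lemma locally_integrable_cmult: "locally_integrable_on S g \<Longrightarrow> locally_integrable_on S (\<lambda>z. c * g z)"
  unfolding locally_integrable_on_def by (auto intro: set_integrable_mult_right)

lemma has_weak_partial_cmult:
  assumes "has_weak_partial S v \<psi> g"
  shows "has_weak_partial S v (\<lambda>z. c * \<psi> z) (\<lambda>z. c * g z)"
  using assms unfolding has_weak_partial_def
  by (simp add: locally_integrable_cmult mult.assoc)

lemma has_weak_laplacian_cmult:
  assumes "has_weak_laplacian S \<psi> f"
  shows "has_weak_laplacian S (\<lambda>z. c * \<psi> z) (\<lambda>z. c * f z)"
  using assms unfolding has_weak_laplacian_def
  by (simp add: locally_integrable_cmult mult.assoc)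

lemma energy_measurable:
  assumes S: "S \<in> sets borel" and u: "u \<in> test_functions S"
    and loc: "locally_integrable_on S p" "locally_integrable_on S q" "locally_integrable_on S f"
  shows "(\<lambda>z. indicator S z *\<^sub>R ((cmod (partial_x u z + \<i> * of_real (q z) * u z))\<^sup>2 + (cmod (partial_y u z - \<i> * of_real (p z) * u z))\<^sup>2)) \<in> borel_measurable lborel"
    and "(\<lambda>z. indicator S z *\<^sub>R (f z * (cmod (u z))\<^sup>2)) \<in> borel_measurable lborel"
proof -
  have *: "(\<lambda>z. of_real (g z) * u z) \<in> borel_measurable borel" if "locally_integrable_on S g" for g
  proof -
    have "(\<lambda>z. indicator S z *\<^sub>R (of_real (g z) * u z)) \<in> borel_measurable lborel"
      by (rule borel_measurable_integrable[OF integrable_mult_test_function[OF that u S]])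
    moreover have "indicator S z *\<^sub>R (of_real (g z) * u z) = of_real (g z) * u z" for z
      using test_functions_eq_0[OF u, of z] by (cases "z \<in> S") simp_all
    ultimately show ?thesis by simp
  qed
  \<comment> \<open>Local integrability gives no measurability of \<open>p\<close>,
    \<open>q\<close>, \<open>f\<close> on the whole plane; what is known to be measurable are their
    products with \<open>u\<close>. The form f |u|^2 is recovered from \<open>F\<close> and
    \<open>u\<close> as a real inner product.\<close>
  define P Q F where "P z = of_real (p z) * u z" and "Q z = of_real (q z) * u z" and "F z = of_real (f z) * u z" for z
  have m [measurable]: "P \<in> borel_measurable borel" "Q \<in> borel_measurable borel" "F \<in> borel_measurable borel"
    using *[OF loc(1)] *[OF loc(2)] *[OF loc(3)] by (simp_all add: P_def[abs_def] Q_def[abs_def] F_def[abs_def])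
  have [measurable]: "u \<in> borel_measurable borel" "partial_x u \<in> borel_measurable borel" "partial_y u \<in> borel_measurable borel"
    using u by (auto intro!: test_functions_measurable test_functions_partial)
  have [measurable]: "S \<in> sets borel" by (rule S)
  have "(\<lambda>z. (cmod (partial_x u z + \<i> * Q z))\<^sup>2 + (cmod (partial_y u z - \<i> * P z))\<^sup>2) \<in> borel_measurable borel"
    by measurable
  from measurable_indicator_scaleR[OF this S]
  show "(\<lambda>z. indicator S z *\<^sub>R ((cmod (partial_x u z + \<i> * of_real (q z) * u z))\<^sup>2 + (cmod (partial_y u z - \<i> * of_real (p z) * u z))\<^sup>2)) \<in> borel_measurable lborel"
    by (simp only: P_def Q_def mult.assoc)
  have "(\<lambda>z. Re (F z) * Re (u z) + Im (F z) * Im (u z)) \<in> borel_measurable borel"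
    by measurable
  moreover have "Re (F z) * Re (u z) + Im (F z) * Im (u z) = f z * (cmod (u z))\<^sup>2" for z
    unfolding cmod_power2 by (simp add: F_def power2_eq_square algebra_simps)
  ultimately have "(\<lambda>z. f z * (cmod (u z))\<^sup>2) \<in> borel_measurable borel" by simp
  from measurable_indicator_scaleR[OF this S]
  show "(\<lambda>z. indicator S z *\<^sub>R (f z * (cmod (u z))\<^sup>2)) \<in> borel_measurable lborel" .
qed

lemma weak_rep_locally_integrable:
  "has_weak_partial S v \<psi> g \<Longrightarrow> locally_integrable_on S (weak_partial S v \<psi>)"
  "has_weak_laplacian S \<psi> f \<Longrightarrow> locally_integrable_on S (weak_laplacian S \<psi>)"
proof -
  assume "has_weak_partial S v \<psi> g"
  then have "has_weak_partial S v \<psi> (weak_partial S v \<psi>)"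
    unfolding weak_partial_def by (rule someI[of "has_weak_partial S v \<psi>"])
  then show "locally_integrable_on S (weak_partial S v \<psi>)" by (simp only: has_weak_partial_def)
next
  assume "has_weak_laplacian S \<psi> f"
  then have "has_weak_laplacian S \<psi> (weak_laplacian S \<psi>)"
    unfolding weak_laplacian_def by (rule someI[of "has_weak_laplacian S \<psi>"])
  then show "locally_integrable_on S (weak_laplacian S \<psi>)" by (simp only: has_weak_laplacian_def)
qed

text \<open>Weak derivatives are unique up to null sets, so the representatives picked by
  \<open>SOME\<close> in the definition of the eigenvalues can be replaced by explicit ones.\<close>

lemma
  assumes S: "open S" and p: "has_weak_partial S 1 \<psi> p" and q: "has_weak_partial S \<i> \<psi> q" and f: "has_weak_laplacian S \<psi> f"
    and u: "u \<in> test_functions S"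
  shows integral_weak_magnetic:
      "(LINT z:S|lborel. (cmod (partial_x u z + \<i> * of_real (weak_partial S \<i> \<psi> z) * u z))\<^sup>2 + (cmod (partial_y u z - \<i> * of_real (weak_partial S 1 \<psi> z) * u z))\<^sup>2) =
       (LINT z:S|lborel. (cmod (partial_x u z + \<i> * of_real (q z) * u z))\<^sup>2 + (cmod (partial_y u z - \<i> * of_real (p z) * u z))\<^sup>2)"
    and integral_weak_laplacian:
      "(LINT z:S|lborel. weak_laplacian S \<psi> z * (cmod (u z))\<^sup>2) = (LINT z:S|lborel. f z * (cmod (u z))\<^sup>2)"
proof -
  have Sb: "S \<in> sets borel" using S by simp
  have loc: "locally_integrable_on S p" "locally_integrable_on S q" "locally_integrable_on S f"
    using p q f by (simp_all only: has_weak_partial_def has_weak_laplacian_def)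
  note locw = weak_rep_locally_integrable(1)[OF p] weak_rep_locally_integrable(1)[OF q] weak_rep_locally_integrable(2)[OF f]
  show "(LINT z:S|lborel. (cmod (partial_x u z + \<i> * of_real (weak_partial S \<i> \<psi> z) * u z))\<^sup>2 + (cmod (partial_y u z - \<i> * of_real (weak_partial S 1 \<psi> z) * u z))\<^sup>2) =
       (LINT z:S|lborel. (cmod (partial_x u z + \<i> * of_real (q z) * u z))\<^sup>2 + (cmod (partial_y u z - \<i> * of_real (p z) * u z))\<^sup>2)"
    unfolding set_lebesgue_integral_def
  proof (rule integral_cong_AE[OF energy_measurable(1)[OF Sb u locw] energy_measurable(1)[OF Sb u loc]])
    show "AE z in lborel. indicator S z *\<^sub>R ((cmod (partial_x u z + \<i> * of_real (weak_partial S \<i> \<psi> z) * u z))\<^sup>2 + (cmod (partial_y u z - \<i> * of_real (weak_partial S 1 \<psi> z) * u z))\<^sup>2) =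
        indicator S z *\<^sub>R ((cmod (partial_x u z + \<i> * of_real (q z) * u z))\<^sup>2 + (cmod (partial_y u z - \<i> * of_real (p z) * u z))\<^sup>2)"
      using weak_partial_AE[OF S p] weak_partial_AE[OF S q]
    proof eventually_elim
      case (elim z) then show ?case by (cases "z \<in> S") simp_all
    qed
  qed
  show "(LINT z:S|lborel. weak_laplacian S \<psi> z * (cmod (u z))\<^sup>2) = (LINT z:S|lborel. f z * (cmod (u z))\<^sup>2)"
    unfolding set_lebesgue_integral_def
  proof (rule integral_cong_AE[OF energy_measurable(2)[OF Sb u locw] energy_measurable(2)[OF Sb u loc]])
    show "AE z in lborel. indicator S z *\<^sub>R (weak_laplacian S \<psi> z * (cmod (u z))\<^sup>2) = indicator S z *\<^sub>R (f z * (cmod (u z))\<^sup>2)"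
      using weak_laplacian_AE[OF S f]
    proof eventually_elim
      case (elim z) then show ?case by (cases "z \<in> S") simp_all
    qed
  qed
qed

definition magnetic_energy :: "nat \<Rightarrow> (complex \<Rightarrow> complex) \<Rightarrow> real" where
  "magnetic_energy n u = (LINT z:ball 0 1|lborel. (cmod (partial_x u z + \<i> * of_real (real n * pot_total pot_y z) * u z))\<^sup>2 +
     (cmod (partial_y u z - \<i> * of_real (real n * pot_total pot_x z) * u z))\<^sup>2)"

definition potential_energy :: "(complex \<Rightarrow> complex) \<Rightarrow> real" where
  "potential_energy u = (LINT z:ball 0 1|lborel. pot_total disc_density z * (cmod (u z))\<^sup>2)"

definition dirichlet_energy :: "(complex \<Rightarrow> complex) \<Rightarrow> real" where
  "dirichlet_energy u = (LINT z:ball 0 1|lborel. (cmod (partial_x u z))\<^sup>2 + (cmod (partial_y u z))\<^sup>2)"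

lemma
  shows lambda_m_eq: "lambda_m (ball 0 1) (\<lambda>z. real n * pot_total log_pot z) =
     (INF u \<in> normalized_test_functions (ball 0 1). ereal (magnetic_energy n u + real n * potential_energy u))"
    and lambda_e_eq: "lambda_e (ball 0 1) (\<lambda>z. real n * pot_total log_pot z) =
     (INF u \<in> normalized_test_functions (ball 0 1). ereal (dirichlet_energy u + real n * potential_energy u))"
proof -
  note W = has_weak_partial_cmult[OF has_weak_partial_x_pot_total, of "real n"]
    has_weak_partial_cmult[OF has_weak_partial_y_pot_total, of "real n"]
    has_weak_laplacian_cmult[OF has_weak_laplacian_pot_total, of "real n"]
  have pe: "(LINT z:ball 0 1|lborel. real n * pot_total disc_density z * (cmod (u z))\<^sup>2) = real n * potential_energy u" for u
    unfolding potential_energy_def by (simp only: mult.assoc set_integral_mult_right)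
  have test: "u \<in> test_functions (ball 0 1)" if "u \<in> normalized_test_functions (ball 0 1)" for u
    using that by (simp add: normalized_test_functions_def)
  show "lambda_m (ball 0 1) (\<lambda>z. real n * pot_total log_pot z) =
     (INF u \<in> normalized_test_functions (ball 0 1). ereal (magnetic_energy n u + real n * potential_energy u))"
    unfolding lambda_m_def
  proof (rule INF_cong[OF refl])
    fix u assume "u \<in> normalized_test_functions (ball 0 1)"
    note u = test[OF this]
    show "ereal ((LINT z:ball 0 1|lborel. (cmod (partial_x u z + \<i> * of_real (weak_partial (ball 0 1) \<i> (\<lambda>z. real n * pot_total log_pot z) z) * u z))\<^sup>2 +
        (cmod (partial_y u z - \<i> * of_real (weak_partial (ball 0 1) 1 (\<lambda>z. real n * pot_total log_pot z) z) * u z))\<^sup>2) +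
        (LINT z:ball 0 1|lborel. weak_laplacian (ball 0 1) (\<lambda>z. real n * pot_total log_pot z) z * (cmod (u z))\<^sup>2)) =
      ereal (magnetic_energy n u + real n * potential_energy u)"
      unfolding integral_weak_magnetic[OF open_ball W u] integral_weak_laplacian[OF open_ball W u] pe magnetic_energy_def ..
  qed
  show "lambda_e (ball 0 1) (\<lambda>z. real n * pot_total log_pot z) =
     (INF u \<in> normalized_test_functions (ball 0 1). ereal (dirichlet_energy u + real n * potential_energy u))"
    unfolding lambda_e_def
  proof (rule INF_cong[OF refl])
    fix u assume "u \<in> normalized_test_functions (ball 0 1)"
    note u = test[OF this]
    show "ereal ((LINT z:ball 0 1|lborel. (cmod (partial_x u z))\<^sup>2 + (cmod (partial_y u z))\<^sup>2) +
        (LINT z:ball 0 1|lborel. weak_laplacian (ball 0 1) (\<lambda>z. real n * pot_total log_pot z) z * (cmod (u z))\<^sup>2)) =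
      ereal (dirichlet_energy u + real n * potential_energy u)"
      unfolding integral_weak_laplacian[OF open_ball W u] pe dirichlet_energy_def ..
  qed
qed

section \<open>Magnetic estimates on squares\<close>

text \<open>Multiplication of \<open>u\<close> by \<open>cis (A x)\<close> with A' = a turns u' + i
  a u into an ordinary derivative of the same modulus. The fundamental theorem then compares the end
  points up to the accumulated phase.\<close>

lemma gauge_bound:
  fixes u u' :: "real \<Rightarrow> complex" and a :: "real \<Rightarrow> real"
  assumes le: "s \<le> t" and u: "\<And>x. x \<in> {s..t} \<Longrightarrow> (u has_vector_derivative u' x) (at x within {s..t})"
    and c: "continuous_on {s..t} u'" "continuous_on {s..t} a"
  shows "cmod (u t * cis (integral {s..t} a) - u s) \<le> integral {s..t} (\<lambda>x. cmod (u' x + \<i> * of_real (a x) * u x))"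
proof -
  define A where "A x = integral {s..x} a" for x
  have uc: "continuous_on {s..t} u"
    using u by (rule continuous_on_vector_derivative)
  have A: "(A has_real_derivative a x) (at x within {s..t})" if "x \<in> {s..t}" for x
    unfolding A_def using integral_has_real_derivative[OF c(2) that] .
  have Ac: "continuous_on {s..t} A"
    using A by (intro DERIV_continuous_on)
  have cisd: "((\<lambda>x. cis (A x)) has_vector_derivative (\<i> * of_real (a x) * cis (A x))) (at x within {s..t})" if "x \<in> {s..t}" for x
  proof -
    have "((\<lambda>x. exp (\<i> * of_real (A x))) has_vector_derivative (\<i> * of_real (a x)) * exp (\<i> * of_real (A x))) (at x within {s..t})"
    proof (rule field_vector_diff_chain_within[of "\<lambda>x. \<i> * of_real (A x)" _ _ _ exp "exp (\<i> * of_real (A x))", unfolded o_def])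
      show "((\<lambda>x. \<i> * complex_of_real (A x)) has_vector_derivative \<i> * of_real (a x)) (at x within {s..t})"
        using A[OF that] by (intro has_vector_derivative_mult_right has_vector_derivative_of_real) (simp add: has_real_derivative_iff_has_vector_derivative)
      show "(exp has_field_derivative exp (\<i> * of_real (A x))) (at (\<i> * of_real (A x)) within (\<lambda>x. \<i> * of_real (A x)) ` {s..t})"
        by (rule has_field_derivative_at_within[OF DERIV_exp])
    qed
    then show ?thesis by (simp add: cis_conv_exp)
  qed
  define w' where "w' x = (u' x + \<i> * of_real (a x) * u x) * cis (A x)" for x
  have d: "((\<lambda>x. u x * cis (A x)) has_vector_derivative w' x) (at x within {s..t})" if "x \<in> {s..t}" for x
    using has_vector_derivative_mult[OF u[OF that] cisd[OF that]] by (simp add: w'_def algebra_simps)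
  have "(w' has_integral (u t * cis (A t) - u s * cis (A s))) {s..t}"
    by (rule fundamental_theorem_of_calculus[OF le d])
  then have i: "integral {s..t} w' = u t * cis (A t) - u s"
    by (simp add: integral_unique A_def)
  have "continuous_on {s..t} (\<lambda>x. cis (A x))"
    using cisd by (rule continuous_on_vector_derivative)
  then have w'c: "continuous_on {s..t} w'"
    unfolding w'_def using c uc Ac by (intro continuous_intros)
  have "cmod (integral {s..t} w') \<le> integral {s..t} (\<lambda>x. cmod (u' x + \<i> * of_real (a x) * u x))"
    by (rule integral_norm_bound_integral)
       (use w'c c uc in \<open>auto intro!: integrable_continuous_real continuous_intros simp: w'_def norm_mult\<close>)
  then show ?thesis by (simp add: i A_def)
qed

lemma integral_sq_le:
  fixes d :: "real \<Rightarrow> real"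
  assumes "a \<le> b" "continuous_on {a..b} d"
  shows "(integral {a..b} d)\<^sup>2 \<le> (b - a) * integral {a..b} (\<lambda>x. (d x)\<^sup>2)"
proof (cases "a = b")
  case False
  \<comment> \<open>Integrating (d - m)^2 >= 0 with the mean value m of \<open>d\<close> yields
    Cauchy-Schwarz against the constant 1.\<close>
  define m where "m = integral {a..b} d / (b - a)"
  have ab: "0 < b - a" using False assms by simp
  have i: "d integrable_on {a..b}" "(\<lambda>x. (d x)\<^sup>2) integrable_on {a..b}"
    using assms(2) by (auto intro!: integrable_continuous_real continuous_intros)
  have "0 \<le> integral {a..b} (\<lambda>x. (d x - m)\<^sup>2)"
    using assms(2) by (intro integral_nonneg integrable_continuous_real continuous_intros) auto
  also have "(\<lambda>x. (d x - m)\<^sup>2) = (\<lambda>x. (d x)\<^sup>2 + (- (2 * m)) * d x + m\<^sup>2)"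
    by (simp add: power2_eq_square algebra_simps fun_eq_iff)
  also have "integral {a..b} \<dots> = integral {a..b} (\<lambda>x. (d x)\<^sup>2) + (- (2 * m)) * integral {a..b} d + (b - a) * m\<^sup>2"
  proof (rule integral_unique)
    have "((\<lambda>x. m\<^sup>2) has_integral (b - a) * m\<^sup>2) {a..b}"
      using has_integral_const_real[of "m\<^sup>2" a b] assms(1) by simp
    then show "((\<lambda>x. (d x)\<^sup>2 + (- (2 * m)) * d x + m\<^sup>2) has_integral (integral {a..b} (\<lambda>x. (d x)\<^sup>2) + (- (2 * m)) * integral {a..b} d + (b - a) * m\<^sup>2)) {a..b}"
      using i by (intro has_integral_add has_integral_mult_right integrable_integral)
  qed
  also have "\<dots> = integral {a..b} (\<lambda>x. (d x)\<^sup>2) - (integral {a..b} d)\<^sup>2 / (b - a)"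
  proof -
    have "- (2 * (I / w)) * I + w * (I / w)\<^sup>2 = - (I\<^sup>2 / w)" if "0 < w" for I w :: real
      using that by (simp add: power2_eq_square field_simps)
    from this[OF ab] show ?thesis unfolding m_def by (simp only: add.assoc diff_conv_add_uminus)
  qed
  finally have "(integral {a..b} d)\<^sup>2 / (b - a) \<le> integral {a..b} (\<lambda>x. (d x)\<^sup>2)" by simp
  then show ?thesis using ab by (simp add: field_simps)
qed simp

text \<open>A one-dimensional Poincare inequality: f(x) is compared with f(x') for every x' in the
  subinterval, and the result is averaged over x'. The hypothesis bounds the oscillation of
  \<open>f\<close> rather than a derivative, because \<open>f\<close> will be |u|, which need not be
  differentiable at zeros of u.\<close>

lemma strip_bound:
  fixes f d :: "real \<Rightarrow> real"
  assumes f: "continuous_on {a..b} f" and d: "continuous_on {a..b} d" and nn: "\<And>x. 0 \<le> f x"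
    and osc: "\<And>x x'. x \<in> {a..b} \<Longrightarrow> x' \<in> {a..b} \<Longrightarrow> \<bar>f x - f x'\<bar> \<le> integral {a..b} d"
    and sub: "a \<le> a1" "a1 < b1" "b1 \<le> b"
  shows "(b1 - a1) * integral {a..b} (\<lambda>x. (f x)\<^sup>2) \<le>
    2 * (b - a) * integral {a1..b1} (\<lambda>x. (f x)\<^sup>2) + 2 * (b - a)\<^sup>2 * (b1 - a1) * integral {a..b} (\<lambda>x. (d x)\<^sup>2)"
proof -
  have ab: "a \<le> b" using sub by simp
  let ?D = "integral {a..b} (\<lambda>x. (d x)\<^sup>2)" and ?F = "integral {a..b} (\<lambda>x. (f x)\<^sup>2)"
  have f2: "continuous_on {a..b} (\<lambda>x. (f x)\<^sup>2)" using f by (intro continuous_intros)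
  have f2': "continuous_on {a1..b1} (\<lambda>x. (f x)\<^sup>2)" by (rule continuous_on_subset[OF f2]) (use sub in auto)
  have pt: "(f x)\<^sup>2 \<le> 2 * (f x')\<^sup>2 + 2 * ((b - a) * ?D)" if "x \<in> {a..b}" "x' \<in> {a..b}" for x x'
  proof -
    let ?i = "integral {a..b} d"
    have o: "\<bar>f x - f x'\<bar> \<le> ?i" by (rule osc[OF that])
    then have "f x \<le> f x' + ?i" by linarith
    then have "(f x)\<^sup>2 \<le> (f x' + ?i)\<^sup>2" using nn[of x] by (intro power_mono)
    also have "\<dots> \<le> 2 * (f x')\<^sup>2 + 2 * ?i\<^sup>2"
      using sum_squares_bound[of "f x'" ?i] by (simp add: power2_sum)
    also have "\<dots> \<le> 2 * (f x')\<^sup>2 + 2 * ((b - a) * ?D)" using integral_sq_le[OF ab d] by simp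
    finally show ?thesis .
  qed
  have av: "?F \<le> (b - a) * (2 * (f x')\<^sup>2 + 2 * ((b - a) * ?D))" if "x' \<in> {a..b}" for x'
  proof -
    have "?F \<le> integral {a..b} (\<lambda>x. 2 * (f x')\<^sup>2 + 2 * ((b - a) * ?D))"
      by (rule integral_le) (use f2 pt that in \<open>auto intro!: integrable_continuous_real\<close>)
    then show ?thesis using ab by simp
  qed
  have "(b1 - a1) * ?F = integral {a1..b1} (\<lambda>x'. ?F)" using sub by simp
  also have "\<dots> \<le> integral {a1..b1} (\<lambda>x'. (b - a) * (2 * (f x')\<^sup>2 + 2 * ((b - a) * ?D)))"
    by (rule integral_le) (use f2' av sub in \<open>auto intro!: integrable_continuous_real continuous_intros\<close>)
  also have "\<dots> = (b - a) * (2 * integral {a1..b1} (\<lambda>x. (f x)\<^sup>2) + (b1 - a1) * (2 * ((b - a) * ?D)))"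
  proof (rule integral_unique)
    have "((\<lambda>x. 2 * ((b - a) * ?D)) has_integral (b1 - a1) * (2 * ((b - a) * ?D))) {a1..b1}"
      using has_integral_const_real[of "2 * ((b - a) * ?D)" a1 b1] sub by simp
    then show "((\<lambda>x'. (b - a) * (2 * (f x')\<^sup>2 + 2 * ((b - a) * ?D))) has_integral
        (b - a) * (2 * integral {a1..b1} (\<lambda>x. (f x)\<^sup>2) + (b1 - a1) * (2 * ((b - a) * ?D)))) {a1..b1}"
      using f2' by (intro has_integral_add has_integral_mult_right integrable_integral integrable_continuous_real)
  qed
  finally show ?thesis by (simp add: power2_eq_square algebra_simps)
qed

text \<open>\<open>p\<close> and \<open>q\<close> stand for \<open>\<partial>\<^sub>x\<psi>\<close> and \<open>\<partial>\<^sub>y\<psi>\<close>, so that \<open>dx\<close> and \<open>dy\<close> are the moduli of the components of \<open>D\<^sub>\<psi> u\<close>.\<close>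

locale magnetic_data =
  fixes u :: "complex \<Rightarrow> complex" and p q :: "complex \<Rightarrow> real"
  assumes diff: "\<And>z. u differentiable (at z)"
    and cont: "continuous_on UNIV u" "continuous_on UNIV (partial_x u)" "continuous_on UNIV (partial_y u)"
      "continuous_on UNIV p" "continuous_on UNIV q"
begin

definition dx :: "complex \<Rightarrow> real" where
  "dx z = cmod (partial_x u z + \<i> * of_real (q z) * u z)"

definition dy :: "complex \<Rightarrow> real" where
  "dy z = cmod (partial_y u z - \<i> * of_real (p z) * u z)"

lemma continuous_d: "continuous_on UNIV dx" "continuous_on UNIV dy"
  unfolding dx_def dy_def using cont by (auto intro!: continuous_intros)

lemma horizontal_transport:
  assumes "s \<le> t"
  shows "cmod (u (Complex t y) * cis (integral {s..t} (\<lambda>x. q (Complex x y))) - u (Complex s y)) \<le> integral {s..t} (\<lambda>x. dx (Complex x y))"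
  unfolding dx_def
  by (rule gauge_bound[OF assms has_vector_derivative_at_within[OF partial_x_has_vector_derivative[OF diff]]
        continuous_on_Complex_line(1)[OF cont(2)] continuous_on_Complex_line(1)[OF cont(5)]])

lemma vertical_transport:
  assumes "s \<le> t"
  shows "cmod (u (Complex x t) * cis (- integral {s..t} (\<lambda>y. p (Complex x y))) - u (Complex x s)) \<le> integral {s..t} (\<lambda>y. dy (Complex x y))"
proof -
  have "continuous_on {s..t} (\<lambda>y. - p (Complex x y))"
    using continuous_on_Complex_line(2)[OF cont(4)] by (intro continuous_intros)
  from gauge_bound[OF assms has_vector_derivative_at_within[OF partial_y_has_vector_derivative[OF diff]]
        continuous_on_Complex_line(2)[OF cont(3)] this, of x]
  show ?thesis unfolding dy_def by (simp add: integral_neg)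
qed

lemma abs_diff_le:
  assumes "cmod (w * cis g - v) \<le> i"
  shows "\<bar>cmod w - cmod v\<bar> \<le> i"
  using norm_triangle_ineq3[of "w * cis g" v] assms by (simp add: norm_mult)

lemma d_nonneg: "0 \<le> dx z" "0 \<le> dy z" by (simp_all add: dx_def dy_def)

text \<open>Phases drop out on taking moduli, so |u| obeys the estimate of the case without a field;
  this is the diamagnetic inequality along a line.\<close>

lemma oscillation_x:
  assumes "x \<in> {a..b}" "x' \<in> {a..b}"
  shows "\<bar>cmod (u (Complex x y)) - cmod (u (Complex x' y))\<bar> \<le> integral {a..b} (\<lambda>x. dx (Complex x y))"
proof -
  have *: "\<bar>cmod (u (Complex t y)) - cmod (u (Complex s y))\<bar> \<le> integral {a..b} (\<lambda>x. dx (Complex x y))"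
    if "s \<le> t" "a \<le> s" "t \<le> b" for s t
  proof -
    have "integral {s..t} (\<lambda>x. dx (Complex x y)) \<le> integral {a..b} (\<lambda>x. dx (Complex x y))"
      by (rule integral_subset_le)
         (use that d_nonneg in \<open>auto intro!: integrable_continuous_real continuous_on_Complex_line(1)[OF continuous_d(1)]\<close>)
    then show ?thesis using abs_diff_le[OF horizontal_transport[OF that(1), of y]] by linarith
  qed
  show ?thesis using *[of x x'] *[of x' x] assms by (cases "x \<le> x'") (auto simp: abs_minus_commute)
qed

lemma oscillation_y:
  assumes "y \<in> {a..b}" "y' \<in> {a..b}"
  shows "\<bar>cmod (u (Complex x y)) - cmod (u (Complex x y'))\<bar> \<le> integral {a..b} (\<lambda>y. dy (Complex x y))"
proof -
  have *: "\<bar>cmod (u (Complex x t)) - cmod (u (Complex x s))\<bar> \<le> integral {a..b} (\<lambda>y. dy (Complex x y))"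
    if "s \<le> t" "a \<le> s" "t \<le> b" for s t
  proof -
    have "integral {s..t} (\<lambda>y. dy (Complex x y)) \<le> integral {a..b} (\<lambda>y. dy (Complex x y))"
      by (rule integral_subset_le)
         (use that d_nonneg in \<open>auto intro!: integrable_continuous_real continuous_on_Complex_line(2)[OF continuous_d(2)]\<close>)
    then show ?thesis using abs_diff_le[OF vertical_transport[OF that(1), of x]] by linarith
  qed
  show ?thesis using *[of y y'] *[of y' y] assms by (cases "y \<le> y'") (auto simp: abs_minus_commute)
qed

end

section \<open>Iterated integrals and the Poincare inequality on squares\<close>

definition rect_integral :: "real \<Rightarrow> real \<Rightarrow> real \<Rightarrow> real \<Rightarrow> (complex \<Rightarrow> real) \<Rightarrow> real" where
  "rect_integral a b c d g = integral {a..b} (\<lambda>x. integral {c..d} (\<lambda>y. g (Complex x y)))"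

lemma continuous_Complex_pair:
  fixes g :: "complex \<Rightarrow> real"
  assumes "continuous_on UNIV g"
  shows "continuous_on S (\<lambda>(x, y). g (Complex x y))"
proof -
  have "continuous_on S (\<lambda>p. Complex (fst p) (snd p))" unfolding Complex_eq by (intro continuous_intros)
  then show ?thesis unfolding case_prod_beta by (rule continuous_on_compose2[OF assms]) simp
qed

lemma rect_integral_swap:
  assumes "continuous_on UNIV g"
  shows "rect_integral a b c d g = integral {c..d} (\<lambda>y. integral {a..b} (\<lambda>x. g (Complex x y)))"
  unfolding rect_integral_def
  using integral_swap_continuous[where f = "\<lambda>x y. g (Complex x y)", OF continuous_Complex_pair[OF assms]]
  by (simp add: cbox_interval)

lemma continuous_inner_integral:
  fixes g :: "complex \<Rightarrow> real"
  assumes g: "continuous_on UNIV g"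
  shows "continuous_on S (\<lambda>x. integral {c..d} (\<lambda>y. g (Complex x y)))" "continuous_on S (\<lambda>y. integral {c..d} (\<lambda>x. g (Complex x y)))"
proof -
  have "continuous_on UNIV (\<lambda>x. integral (cbox c d) (\<lambda>y. g (Complex x y)))"
    by (rule integral_continuous_on_param) (rule continuous_Complex_pair[OF g])
  then show "continuous_on S (\<lambda>x. integral {c..d} (\<lambda>y. g (Complex x y)))"
    by (auto intro: continuous_on_subset simp: cbox_interval)
  have "continuous_on (UNIV \<times> cbox c d) (\<lambda>(y, x). g (Complex x y))"
  proof -
    have "continuous_on (UNIV \<times> cbox c d) (\<lambda>p. Complex (snd p) (fst p))" unfolding Complex_eq by (intro continuous_intros)
    then show ?thesis unfolding case_prod_beta by (rule continuous_on_compose2[OF g]) simp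
  qed
  then have "continuous_on UNIV (\<lambda>y. integral (cbox c d) (\<lambda>x. g (Complex x y)))"
    by (rule integral_continuous_on_param)
  then show "continuous_on S (\<lambda>y. integral {c..d} (\<lambda>x. g (Complex x y)))"
    by (auto intro: continuous_on_subset simp: cbox_interval)
qed

lemma rect_integral_mono:
  assumes g: "continuous_on UNIV g" "\<And>z. 0 \<le> g z" and sub: "a \<le> a1" "b1 \<le> b" "c \<le> c1" "d1 \<le> d"
  shows "rect_integral a1 b1 c1 d1 g \<le> rect_integral a b c d g"
proof -
  have "rect_integral a1 b1 c1 d1 g \<le> integral {a1..b1} (\<lambda>x. integral {c..d} (\<lambda>y. g (Complex x y)))"
    unfolding rect_integral_def
  proof (rule integral_le)
    fix x
    show "integral {c1..d1} (\<lambda>y. g (Complex x y)) \<le> integral {c..d} (\<lambda>y. g (Complex x y))"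
      by (rule integral_subset_le)
         (use sub g(2) in \<open>auto intro!: integrable_continuous_real continuous_on_Complex_line(2)[OF g(1)]\<close>)
  qed (auto intro!: integrable_continuous_real continuous_inner_integral g)
  also have "\<dots> \<le> rect_integral a b c d g"
    unfolding rect_integral_def
    by (rule integral_subset_le)
       (use sub g in \<open>auto intro!: integrable_continuous_real continuous_inner_integral integral_nonneg continuous_on_Complex_line(2)\<close>)
  finally show ?thesis .
qed

context magnetic_data
begin

text \<open>Comparison along horizontal lines and then along vertical lines; both use that \<open>|u|\<close> oscillates by at most the integral of \<open>|D\<^sub>\<psi> u|\<close>.\<close>

lemma poincare_square:
  assumes b: "b = a + \<delta>" "d = c + \<delta>" and \<delta>: "0 < \<delta>"
    and sub: "a \<le> a1" "b1 \<le> b" "c \<le> c1" "d1 \<le> d"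
    and \<kappa>: "b1 - a1 = \<kappa> * \<delta>" "d1 - c1 = \<kappa> * \<delta>" "0 < \<kappa>" "\<kappa> \<le> 1"
  shows "\<kappa>\<^sup>2 * rect_integral a b c d (\<lambda>z. (cmod (u z))\<^sup>2) \<le>
    4 * rect_integral a1 b1 c1 d1 (\<lambda>z. (cmod (u z))\<^sup>2) +
    4 * \<delta>\<^sup>2 * (rect_integral a b c d (\<lambda>z. (dx z)\<^sup>2) + rect_integral a b c d (\<lambda>z. (dy z)\<^sup>2))"
proof -
  let ?U = "\<lambda>z. (cmod (u z))\<^sup>2" and ?X = "\<lambda>z. (dx z)\<^sup>2" and ?Y = "\<lambda>z. (dy z)\<^sup>2"
  have cU: "continuous_on UNIV ?U" and cX: "continuous_on UNIV ?X" and cY: "continuous_on UNIV ?Y" and cu: "continuous_on UNIV (\<lambda>z. cmod (u z))"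
    using cont continuous_d by (auto intro!: continuous_intros)
  have lt: "a1 < b1" "c1 < d1" using \<kappa> \<delta> by (smt (verit) mult_pos_pos)+
  have pos: "0 < \<kappa> * \<delta>" using \<kappa> \<delta> by simp
  note ii = integrable_continuous_real[OF continuous_inner_integral(1)] integrable_continuous_real[OF continuous_inner_integral(2)]
  have "(d1 - c1) * rect_integral a b c d ?U = integral {a..b} (\<lambda>x. (d1 - c1) * integral {c..d} (\<lambda>y. ?U (Complex x y)))"
    unfolding rect_integral_def by simp
  also have "\<dots> \<le> integral {a..b} (\<lambda>x. 2 * \<delta> * integral {c1..d1} (\<lambda>y. ?U (Complex x y)) + 2 * \<delta>\<^sup>2 * (d1 - c1) * integral {c..d} (\<lambda>y. ?Y (Complex x y)))"
  proof (rule integral_le)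
    fix x
    show "(d1 - c1) * integral {c..d} (\<lambda>y. ?U (Complex x y)) \<le> 2 * \<delta> * integral {c1..d1} (\<lambda>y. ?U (Complex x y)) + 2 * \<delta>\<^sup>2 * (d1 - c1) * integral {c..d} (\<lambda>y. ?Y (Complex x y))"
      using strip_bound[OF continuous_on_Complex_line(2)[OF cu] continuous_on_Complex_line(2)[OF continuous_d(2)] norm_ge_zero oscillation_y sub(3) lt(2) sub(4)] b
      by simp
  qed (intro integrable_on_mult_right integrable_add ii cU cY)+
  also have "\<dots> = 2 * \<delta> * rect_integral a b c1 d1 ?U + 2 * \<delta>\<^sup>2 * (d1 - c1) * rect_integral a b c d ?Y"
    unfolding rect_integral_def by (subst integral_add) (auto intro!: integrable_on_mult_right ii cU cY)
  finally have 1: "\<kappa> * \<delta> * rect_integral a b c d ?U \<le> 2 * \<delta> * rect_integral a b c1 d1 ?U + 2 * \<delta>\<^sup>2 * (\<kappa> * \<delta>) * rect_integral a b c d ?Y"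
    by (simp only: \<kappa>(2))
  have "(b1 - a1) * rect_integral a b c1 d1 ?U = integral {c1..d1} (\<lambda>y. (b1 - a1) * integral {a..b} (\<lambda>x. ?U (Complex x y)))"
    unfolding rect_integral_swap[OF cU] by simp
  also have "\<dots> \<le> integral {c1..d1} (\<lambda>y. 2 * \<delta> * integral {a1..b1} (\<lambda>x. ?U (Complex x y)) + 2 * \<delta>\<^sup>2 * (b1 - a1) * integral {a..b} (\<lambda>x. ?X (Complex x y)))"
  proof (rule integral_le)
    fix y
    show "(b1 - a1) * integral {a..b} (\<lambda>x. ?U (Complex x y)) \<le> 2 * \<delta> * integral {a1..b1} (\<lambda>x. ?U (Complex x y)) + 2 * \<delta>\<^sup>2 * (b1 - a1) * integral {a..b} (\<lambda>x. ?X (Complex x y))"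
      using strip_bound[OF continuous_on_Complex_line(1)[OF cu] continuous_on_Complex_line(1)[OF continuous_d(1)] norm_ge_zero oscillation_x sub(1) lt(1) sub(2)] b
      by simp
  qed (intro integrable_on_mult_right integrable_add ii cU cX)+
  also have "\<dots> = 2 * \<delta> * rect_integral a1 b1 c1 d1 ?U + 2 * \<delta>\<^sup>2 * (b1 - a1) * rect_integral a b c1 d1 ?X"
    unfolding rect_integral_swap[OF cU] rect_integral_swap[OF cX] by (subst integral_add) (auto intro!: integrable_on_mult_right ii cU cX)
  finally have 2: "\<kappa> * \<delta> * rect_integral a b c1 d1 ?U \<le> 2 * \<delta> * rect_integral a1 b1 c1 d1 ?U + 2 * \<delta>\<^sup>2 * (\<kappa> * \<delta>) * rect_integral a b c1 d1 ?X"
    by (simp only: \<kappa>(1))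
  have 3: "rect_integral a b c1 d1 ?X \<le> rect_integral a b c d ?X" by (rule rect_integral_mono[OF cX]) (use sub in auto)
  \<comment> \<open>Both comparisons are divided by delta; the first one is then multiplied by
    kappa, so that the second one can be inserted. The remaining factors kappa are estimated by
    1.\<close>
  have alg: "\<kappa>\<^sup>2 * Q \<le> 4 * E + 4 * \<delta>\<^sup>2 * (X + Y)"
    if "\<kappa> * \<delta> * Q \<le> 2 * \<delta> * S + 2 * \<delta>\<^sup>2 * (\<kappa> * \<delta>) * Y" "\<kappa> * \<delta> * S \<le> 2 * \<delta> * E + 2 * \<delta>\<^sup>2 * (\<kappa> * \<delta>) * X'" "X' \<le> X" "0 \<le> X" "0 \<le> Y"
    for Q S E X Y X' :: real
  proof -
    have a: "\<kappa> * Q \<le> 2 * S + 2 * \<delta>\<^sup>2 * \<kappa> * Y"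
      using that(1) \<delta> mult_le_cancel_left_pos[of \<delta> "\<kappa> * Q" "2 * S + 2 * \<delta>\<^sup>2 * \<kappa> * Y"] by (simp add: algebra_simps)
    have b: "\<kappa> * S \<le> 2 * E + 2 * \<delta>\<^sup>2 * \<kappa> * X'"
      using that(2) \<delta> mult_le_cancel_left_pos[of \<delta> "\<kappa> * S" "2 * E + 2 * \<delta>\<^sup>2 * \<kappa> * X'"] by (simp add: algebra_simps)
    have "\<kappa>\<^sup>2 * Q = \<kappa> * (\<kappa> * Q)" by (simp add: power2_eq_square)
    also have "\<dots> \<le> \<kappa> * (2 * S + 2 * \<delta>\<^sup>2 * \<kappa> * Y)" using a \<kappa> by (intro mult_left_mono) auto
    also have "\<dots> = 2 * (\<kappa> * S) + 2 * \<delta>\<^sup>2 * (\<kappa>\<^sup>2 * Y)" by (simp add: power2_eq_square algebra_simps)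
    also have "\<dots> \<le> 2 * (2 * E + 2 * \<delta>\<^sup>2 * \<kappa> * X') + 2 * \<delta>\<^sup>2 * (\<kappa>\<^sup>2 * Y)" using b by simp
    also have "\<dots> = 4 * E + 4 * \<delta>\<^sup>2 * (\<kappa> * X') + 2 * \<delta>\<^sup>2 * (\<kappa>\<^sup>2 * Y)" by (simp add: algebra_simps)
    also have "\<dots> \<le> 4 * E + 4 * \<delta>\<^sup>2 * X + 4 * \<delta>\<^sup>2 * Y"
    proof -
      have "\<kappa> * X' \<le> \<kappa> * X" using that(3) \<kappa> by (intro mult_left_mono) auto
      also have "\<dots> \<le> X" using \<kappa> that(4) by (intro mult_left_le_one_le) auto
      finally have x: "4 * \<delta>\<^sup>2 * (\<kappa> * X') \<le> 4 * \<delta>\<^sup>2 * X" by (intro mult_left_mono) auto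
      have "\<kappa>\<^sup>2 * Y \<le> Y" using \<kappa> that(5) by (intro mult_left_le_one_le) (auto simp: power_le_one)
      then have "2 * \<delta>\<^sup>2 * (\<kappa>\<^sup>2 * Y) \<le> 2 * \<delta>\<^sup>2 * Y" by (intro mult_left_mono) auto
      also have "\<dots> \<le> 4 * \<delta>\<^sup>2 * Y" using that(5) by (intro mult_right_mono) auto
      finally show ?thesis using x by linarith
    qed
    finally show ?thesis by (simp add: algebra_simps)
  qed
  have nn: "0 \<le> rect_integral a b c d ?X" "0 \<le> rect_integral a b c d ?Y"
    unfolding rect_integral_def
    by (intro integral_nonneg integrable_continuous_real continuous_inner_integral continuous_on_Complex_line cX cY; simp)+
  show ?thesis by (rule alg[OF 1 2 3 nn])
qed

end

lemma
  fixes g :: "real \<Rightarrow> real"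
  assumes "continuous_on UNIV g"
  shows integral_shift_add: "integral {a..b} (\<lambda>t. g (c + t)) = integral {c + a..c + b} g"
    and integral_shift_diff: "integral {a..b} (\<lambda>t. g (c - t)) = integral {c - b..c - a} g"
proof -
  have "(g has_integral integral {c + a..c + b} g) {c + a..c + b}" "(g has_integral integral {c - b..c - a} g) {c - b..c - a}"
    by (auto intro!: integrable_integral integrable_continuous_real continuous_on_subset[OF assms])
  note h = this
  have "((\<lambda>t. g (1 *\<^sub>R t + c)) has_integral (1 / \<bar>1\<bar> ^ DIM(real)) *\<^sub>R integral {c + a..c + b} g) ((\<lambda>x. (1 / 1) *\<^sub>R x + - ((1 / 1) *\<^sub>R c)) ` cbox (c + a) (c + b))"
    by (rule has_integral_affinity) (use h(1) in \<open>auto simp: cbox_interval\<close>)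
  moreover have "(\<lambda>x. (1 / 1) *\<^sub>R x + - ((1 / 1) *\<^sub>R c)) ` cbox (c + a) (c + b) = {a..b}"
    using image_affinity_atLeastAtMost[of 1 "- c" "c + a" "c + b"] by (auto simp: cbox_interval)
  ultimately show "integral {a..b} (\<lambda>t. g (c + t)) = integral {c + a..c + b} g"
    by (simp add: integral_unique add.commute)
  have "((\<lambda>t. g ((-1) *\<^sub>R t + c)) has_integral (1 / \<bar>-1\<bar> ^ DIM(real)) *\<^sub>R integral {c - b..c - a} g) ((\<lambda>x. (1 / (-1)) *\<^sub>R x + - ((1 / (-1)) *\<^sub>R c)) ` cbox (c - b) (c - a))"
    by (rule has_integral_affinity) (use h(2) in \<open>auto simp: cbox_interval\<close>)
  moreover have "(\<lambda>x. (1 / (-1)) *\<^sub>R x + - ((1 / (-1)) *\<^sub>R c)) ` cbox (c - b) (c - a) = {a..b}"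
    using image_affinity_atLeastAtMost[of "-1" c "c - b" "c - a"] by (auto simp: cbox_interval)
  ultimately show "integral {a..b} (\<lambda>t. g (c - t)) = integral {c - b..c - a} g"
    by (simp add: integral_unique)
qed

lemma bounded_measurable_set_integrable:
  fixes f :: "'a::euclidean_space \<Rightarrow> real"
  assumes "f \<in> borel_measurable borel" "\<And>x. \<bar>f x\<bar> \<le> M" "bounded A" "A \<in> sets borel"
  shows "set_integrable lborel A f"
proof (rule set_integrable_bound)
  have "integrable lborel (\<lambda>x. indicator A x * M)"
    using emeasure_bounded_finite[OF assms(3)] assms(4)
    by (intro integrable_mult_left integrable_real_indicator) (auto simp: infinity_ennreal_def)
  then show "set_integrable lborel A (\<lambda>_. M)" by (simp add: set_integrable_def)
  show "set_borel_measurable lborel A f"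
    unfolding set_borel_measurable_def using assms(1,4)
    by (intro borel_measurable_scaleR borel_measurable_indicator) simp_all
  show "AE x in lborel. x \<in> A \<longrightarrow> norm (f x) \<le> norm M"
  proof (rule AE_I2, rule impI)
    fix x show "norm (f x) \<le> norm M" using assms(2)[of x] by simp
  qed
qed

lemma measurable_Complex_line:
  assumes "f \<in> borel_measurable borel"
  shows "(\<lambda>x. f (Complex x y)) \<in> borel_measurable borel" "(\<lambda>y. f (Complex x y)) \<in> borel_measurable borel"
proof -
  have "continuous_on UNIV (\<lambda>x. Complex x y)" "continuous_on UNIV (\<lambda>y. Complex x y)"
    unfolding Complex_eq by (intro continuous_intros)+
  then show "(\<lambda>x. f (Complex x y)) \<in> borel_measurable borel" "(\<lambda>y. f (Complex x y)) \<in> borel_measurable borel"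
    using measurable_compose[OF borel_measurable_continuous_onI assms] by blast+
qed

lemma indicator_rect: "indicator (cbox (Complex a c) (Complex b d)) (Complex x y) = (indicator {a..b} x * indicator {c..d} y :: real)"
  by (auto simp: in_cbox_complex_iff indicator_def)

text \<open>Half of the divergence theorem on a rectangle, by Fubini and the fundamental theorem on
  each line. Finitely many exceptional points per line are allowed, as required by the second
  derivatives of \<open>log_pot\<close>.\<close>

lemma rect_integral_x_derivative:
  fixes g g' :: "complex \<Rightarrow> real"
  assumes g: "continuous_on UNIV g" and g': "g' \<in> borel_measurable borel" "\<And>z. \<bar>g' z\<bar> \<le> M"
    and E: "\<And>y. finite (E y)"
    and deriv: "\<And>x y. x \<notin> E y \<Longrightarrow> ((\<lambda>x. g (Complex x y)) has_real_derivative g' (Complex x y)) (at x)"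
    and ab: "a \<le> b"
  shows "(LINT z:cbox (Complex a c) (Complex b d)|lborel. g' z) = integral {c..d} (\<lambda>y. g (Complex b y) - g (Complex a y))"
proof -
  let ?C = "cbox (Complex a c) (Complex b d)"
  have int: "integrable lborel (\<lambda>z. indicator ?C z *\<^sub>R g' z)"
    using bounded_measurable_set_integrable[OF g' bounded_cbox, of "Complex a c" "Complex b d"] by (simp add: set_integrable_def)
  have inner: "(LINT x|lborel. indicator ?C (Complex x y) *\<^sub>R g' (Complex x y)) = indicator {c..d} y *\<^sub>R (g (Complex b y) - g (Complex a y))" for y
  proof -
    have "((\<lambda>x. g' (Complex x y)) has_integral (g (Complex b y) - g (Complex a y))) {a..b}"
      by (rule fundamental_theorem_of_calculus_strong[OF E[of y] ab])
         (use deriv g in \<open>auto intro!: continuous_on_Complex_line simp: has_real_derivative_iff_has_vector_derivative\<close>)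
    then have i: "integral {a..b} (\<lambda>x. g' (Complex x y)) = g (Complex b y) - g (Complex a y)" by (rule integral_unique)
    have si: "set_integrable lborel {a..b} (\<lambda>x. g' (Complex x y))"
      by (rule bounded_measurable_set_integrable[OF measurable_Complex_line(1)[OF g'(1)] g'(2)]) auto
    have "(LINT x|lborel. indicator ?C (Complex x y) *\<^sub>R g' (Complex x y)) = (LINT x|lborel. indicator {c..d} y *\<^sub>R (indicator {a..b} x *\<^sub>R g' (Complex x y)))"
      by (simp add: indicator_rect mult_ac)
    also have "\<dots> = indicator {c..d} y *\<^sub>R (LINT x:{a..b}|lborel. g' (Complex x y))"
      unfolding set_lebesgue_integral_def by simp
    finally show ?thesis using set_borel_integral_eq_integral(2)[OF si] i by simp
  qed
  have "(LINT z:?C|lborel. g' z) = (LINT y|lborel. LINT x|lborel. indicator ?C (Complex x y) *\<^sub>R g' (Complex x y))"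
    unfolding set_lebesgue_integral_def by (rule Fubini_complex_snd[OF int])
  also have "\<dots> = (LINT y:{c..d}|lborel. g (Complex b y) - g (Complex a y))"
    unfolding inner set_lebesgue_integral_def ..
  also have "\<dots> = integral {c..d} (\<lambda>y. g (Complex b y) - g (Complex a y))"
  proof (rule set_borel_integral_eq_integral(2))
    show "set_integrable lborel {c..d} (\<lambda>y. g (Complex b y) - g (Complex a y))"
      unfolding set_integrable_def
      by (intro borel_integrable_compact compact_Icc continuous_intros continuous_on_Complex_line g)
  qed
  finally show ?thesis .
qed

lemma rect_integral_y_derivative:
  fixes g g' :: "complex \<Rightarrow> real"
  assumes g: "continuous_on UNIV g" and g': "g' \<in> borel_measurable borel" "\<And>z. \<bar>g' z\<bar> \<le> M"
    and E: "\<And>x. finite (E x)"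
    and deriv: "\<And>x y. y \<notin> E x \<Longrightarrow> ((\<lambda>y. g (Complex x y)) has_real_derivative g' (Complex x y)) (at y)"
    and cd: "c \<le> d"
  shows "(LINT z:cbox (Complex a c) (Complex b d)|lborel. g' z) = integral {a..b} (\<lambda>x. g (Complex x d) - g (Complex x c))"
proof -
  let ?C = "cbox (Complex a c) (Complex b d)"
  have int: "integrable lborel (\<lambda>z. indicator ?C z *\<^sub>R g' z)"
    using bounded_measurable_set_integrable[OF g' bounded_cbox, of "Complex a c" "Complex b d"] by (simp add: set_integrable_def)
  have inner: "(LINT y|lborel. indicator ?C (Complex x y) *\<^sub>R g' (Complex x y)) = indicator {a..b} x *\<^sub>R (g (Complex x d) - g (Complex x c))" for x
  proof -
    have "((\<lambda>y. g' (Complex x y)) has_integral (g (Complex x d) - g (Complex x c))) {c..d}"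
      by (rule fundamental_theorem_of_calculus_strong[OF E[of x] cd])
         (use deriv g in \<open>auto intro!: continuous_on_Complex_line simp: has_real_derivative_iff_has_vector_derivative\<close>)
    then have i: "integral {c..d} (\<lambda>y. g' (Complex x y)) = g (Complex x d) - g (Complex x c)" by (rule integral_unique)
    have si: "set_integrable lborel {c..d} (\<lambda>y. g' (Complex x y))"
      by (rule bounded_measurable_set_integrable[OF measurable_Complex_line(2)[OF g'(1)] g'(2)]) auto
    have "(LINT y|lborel. indicator ?C (Complex x y) *\<^sub>R g' (Complex x y)) = (LINT y|lborel. indicator {a..b} x *\<^sub>R (indicator {c..d} y *\<^sub>R g' (Complex x y)))"
      by (simp add: indicator_rect mult_ac)
    also have "\<dots> = indicator {a..b} x *\<^sub>R (LINT y:{c..d}|lborel. g' (Complex x y))"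
      unfolding set_lebesgue_integral_def by simp
    finally show ?thesis using set_borel_integral_eq_integral(2)[OF si] i by simp
  qed
  have "(LINT z:?C|lborel. g' z) = (LINT x|lborel. LINT y|lborel. indicator ?C (Complex x y) *\<^sub>R g' (Complex x y))"
    unfolding set_lebesgue_integral_def by (rule Fubini_complex_fst[OF int])
  also have "\<dots> = (LINT x:{a..b}|lborel. g (Complex x d) - g (Complex x c))"
    unfolding inner set_lebesgue_integral_def ..
  also have "\<dots> = integral {a..b} (\<lambda>x. g (Complex x d) - g (Complex x c))"
  proof (rule set_borel_integral_eq_integral(2))
    show "set_integrable lborel {a..b} (\<lambda>x. g (Complex x d) - g (Complex x c))"
      unfolding set_integrable_def
      by (intro borel_integrable_compact compact_Icc continuous_intros continuous_on_Complex_line g)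
  qed
  finally show ?thesis .
qed

text \<open>The bridge between the iterated gauge integrals of the one-dimensional estimates and the
  Lebesgue integrals in the energies.\<close>

lemma rect_integral_eq:
  fixes g :: "complex \<Rightarrow> real"
  assumes g: "continuous_on UNIV g"
  shows "(LINT z:cbox (Complex a c) (Complex b d)|lborel. g z) = rect_integral a b c d g"
    and "set_integrable lborel (cbox (Complex a c) (Complex b d)) g"
proof -
  let ?C = "cbox (Complex a c) (Complex b d)"
  show si: "set_integrable lborel ?C g"
    unfolding set_integrable_def by (intro borel_integrable_compact compact_cbox continuous_on_subset[OF g]) simp
  have inner: "(LINT y|lborel. indicator ?C (Complex x y) *\<^sub>R g (Complex x y)) = indicator {a..b} x *\<^sub>R integral {c..d} (\<lambda>y. g (Complex x y))" for x
  proof -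
    have siy: "set_integrable lborel {c..d} (\<lambda>y. g (Complex x y))"
      unfolding set_integrable_def by (intro borel_integrable_compact compact_Icc continuous_on_Complex_line g)
    have "(LINT y|lborel. indicator ?C (Complex x y) *\<^sub>R g (Complex x y)) = (LINT y|lborel. indicator {a..b} x *\<^sub>R (indicator {c..d} y *\<^sub>R g (Complex x y)))"
      by (simp add: indicator_rect mult_ac)
    also have "\<dots> = indicator {a..b} x *\<^sub>R (LINT y:{c..d}|lborel. g (Complex x y))"
      unfolding set_lebesgue_integral_def by simp
    finally show ?thesis using set_borel_integral_eq_integral(2)[OF siy] by simp
  qed
  have "(LINT z:?C|lborel. g z) = (LINT x|lborel. LINT y|lborel. indicator ?C (Complex x y) *\<^sub>R g (Complex x y))"
    unfolding set_lebesgue_integral_def by (rule Fubini_complex_fst) (use si in \<open>simp add: set_integrable_def\<close>)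
  also have "\<dots> = (LINT x:{a..b}|lborel. integral {c..d} (\<lambda>y. g (Complex x y)))"
    unfolding inner set_lebesgue_integral_def ..
  also have "\<dots> = rect_integral a b c d g"
    unfolding rect_integral_def
  proof (rule set_borel_integral_eq_integral(2))
    show "set_integrable lborel {a..b} (\<lambda>x. integral {c..d} (\<lambda>y. g (Complex x y)))"
      unfolding set_integrable_def by (intro borel_integrable_compact compact_Icc continuous_inner_integral g)
  qed
  finally show "(LINT z:?C|lborel. g z) = rect_integral a b c d g" .
qed

text \<open>The flux of the gradient field (p, q) through the boundary of the square. Up to sign it
  is the circulation of the magnetic potential (q, -p) along the boundary.\<close>

definition outward_flux :: "(complex \<Rightarrow> real) \<Rightarrow> (complex \<Rightarrow> real) \<Rightarrow> real \<Rightarrow> real \<Rightarrow> real \<Rightarrow> real" where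
  "outward_flux p q x0 y0 \<rho> = integral {y0 - \<rho>..y0 + \<rho>} (\<lambda>y. p (Complex (x0 + \<rho>) y) - p (Complex (x0 - \<rho>) y)) +
     integral {x0 - \<rho>..x0 + \<rho>} (\<lambda>x. q (Complex x (y0 + \<rho>)) - q (Complex x (y0 - \<rho>)))"

definition sup_square :: "real \<Rightarrow> real \<Rightarrow> real \<Rightarrow> complex set" where
  "sup_square x0 y0 \<rho> = cbox (Complex (x0 - \<rho>) (y0 - \<rho>)) (Complex (x0 + \<rho>) (y0 + \<rho>))"

text \<open>The divergence theorem, assembled from the two coordinate versions; it also covers
  squares whose boundary cuts the disc.\<close>

lemma outward_flux_pot:
  assumes r: "0 < r" and \<rho>: "0 \<le> \<rho>"
  shows "outward_flux (\<lambda>z. pot_x r (z - p)) (\<lambda>z. pot_y r (z - p)) x0 y0 \<rho> = (LINT z:sup_square x0 y0 \<rho>|lborel. disc_density r (z - p))"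
proof -
  let ?C = "sup_square x0 y0 \<rho>"
  have m2: "(\<lambda>z. pot_xx r (z - p)) \<in> borel_measurable borel" "(\<lambda>z. pot_yy r (z - p)) \<in> borel_measurable borel"
    by measurable
  have C: "bounded ?C" "?C \<in> sets borel" by (simp_all add: sup_square_def)
  note b = abs_pot_second_le[OF r]
  have "outward_flux (\<lambda>z. pot_x r (z - p)) (\<lambda>z. pot_y r (z - p)) x0 y0 \<rho> =
     (LINT z:?C|lborel. pot_xx r (z - p)) + (LINT z:?C|lborel. pot_yy r (z - p))"
    unfolding outward_flux_def sup_square_def
    using rect_integral_x_derivative[where a = "x0 - \<rho>" and b = "x0 + \<rho>", OF continuous_pot_x[OF r] m2(1) b(1) finite_pot_line_exc DERIV_pot_x[OF r]]
      rect_integral_y_derivative[where c = "y0 - \<rho>" and d = "y0 + \<rho>", OF continuous_pot_y[OF r] m2(2) b(2) finite_pot_line_exc DERIV_pot_y[OF r]] \<rho>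
    by simp
  also have "\<dots> = (LINT z:?C|lborel. pot_xx r (z - p) + pot_yy r (z - p))"
    by (rule set_integral_add(2)[symmetric])
       (rule bounded_measurable_set_integrable[OF m2(1) b(1) C], rule bounded_measurable_set_integrable[OF m2(2) b(2) C])
  also have "\<dots> = (LINT z:?C|lborel. disc_density r (z - p))"
    by (simp only: pot_xx_add_yy disc_density_def)
  finally show ?thesis .
qed

context magnetic_data
begin

text \<open>Transporting \<open>u\<close> around the square multiplies it by \<open>cis\<close> of the enclosed flux.\<close>

lemma loop_bound:
  assumes \<rho>: "0 \<le> \<rho>" and y: "y \<in> {y0 - \<rho>..y0 + \<rho>}"
    and c0: "0 < c0" "c0 \<le> cmod (cis (outward_flux p q x0 y0 \<rho>) - 1)"
  shows "cmod (u (Complex (x0 + \<rho>) y)) \<le> (1 / c0 + 1) *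
     (integral {x0 - \<rho>..x0 + \<rho>} (\<lambda>x. dx (Complex x (y0 - \<rho>))) + integral {x0 - \<rho>..x0 + \<rho>} (\<lambda>x. dx (Complex x (y0 + \<rho>))) +
      integral {y0 - \<rho>..y0 + \<rho>} (\<lambda>y. dy (Complex (x0 - \<rho>) y)) + integral {y0 - \<rho>..y0 + \<rho>} (\<lambda>y. dy (Complex (x0 + \<rho>) y)))"
    (is "_ \<le> _ * (?I1 + ?I3 + ?I4 + ?I2)")
proof -
  have le: "x0 - \<rho> \<le> x0 + \<rho>" "y0 - \<rho> \<le> y0 + \<rho>" using \<rho> by auto
  \<comment> \<open>\<open>G1\<close> to \<open>G4\<close> are the phases of the bottom, right, top
    and left side. The value at the upper right corner is carried to the lower left one along either
    pair of sides, and the two results differ by the factor \<open>cis\<close> of the flux.\<close>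
  define G1 where "G1 = integral {x0 - \<rho>..x0 + \<rho>} (\<lambda>x. q (Complex x (y0 - \<rho>)))"
  define G3 where "G3 = integral {x0 - \<rho>..x0 + \<rho>} (\<lambda>x. q (Complex x (y0 + \<rho>)))"
  define G2 where "G2 = - integral {y0 - \<rho>..y0 + \<rho>} (\<lambda>y. p (Complex (x0 + \<rho>) y))"
  define G4 where "G4 = - integral {y0 - \<rho>..y0 + \<rho>} (\<lambda>y. p (Complex (x0 - \<rho>) y))"
  define u1 u2 u3 u4 where "u1 = u (Complex (x0 + \<rho>) (y0 - \<rho>))" and "u2 = u (Complex (x0 + \<rho>) (y0 + \<rho>))"
    and "u3 = u (Complex (x0 - \<rho>) (y0 + \<rho>))" and "u4 = u (Complex (x0 - \<rho>) (y0 - \<rho>))"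
  have i1: "cmod (u1 * cis G1 - u4) \<le> ?I1" and i3: "cmod (u2 * cis G3 - u3) \<le> ?I3"
    unfolding G1_def G3_def u1_def u2_def u3_def u4_def by (rule horizontal_transport[OF le(1)])+
  have i2: "cmod (u2 * cis G2 - u1) \<le> ?I2" and i4: "cmod (u3 * cis G4 - u4) \<le> ?I4"
    unfolding G2_def G4_def u1_def u2_def u3_def u4_def by (rule vertical_transport[OF le(2)])+
  have nn: "0 \<le> ?I1" "0 \<le> ?I2" "0 \<le> ?I3" "0 \<le> ?I4"
    using i1 i2 i3 i4 norm_ge_zero order_trans by blast+
  let ?S = "?I1 + ?I3 + ?I4 + ?I2"
  have flux: "outward_flux p q x0 y0 \<rho> = (G3 + G4) - (G1 + G2)"
    unfolding outward_flux_def G1_def G2_def G3_def G4_def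
    by (subst (1 2) integral_diff) (auto intro!: integrable_continuous_real continuous_on_Complex_line cont)
  have "cmod (u2 * cis (G1 + G2) - u4) \<le> ?I1 + ?I2"
  proof -
    have "u2 * cis (G1 + G2) - u4 = (u2 * cis G2 - u1) * cis G1 + (u1 * cis G1 - u4)"
      by (simp add: algebra_simps cis_mult[symmetric] del: cis_mult)
    also have "cmod \<dots> \<le> cmod ((u2 * cis G2 - u1) * cis G1) + cmod (u1 * cis G1 - u4)" by (rule norm_triangle_ineq)
    finally show ?thesis using i1 i2 by (simp add: norm_mult)
  qed
  moreover have "cmod (u2 * cis (G3 + G4) - u4) \<le> ?I3 + ?I4"
  proof -
    have "u2 * cis (G3 + G4) - u4 = (u2 * cis G3 - u3) * cis G4 + (u3 * cis G4 - u4)"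
      by (simp add: algebra_simps cis_mult[symmetric] del: cis_mult)
    also have "cmod \<dots> \<le> cmod ((u2 * cis G3 - u3) * cis G4) + cmod (u3 * cis G4 - u4)" by (rule norm_triangle_ineq)
    finally show ?thesis using i3 i4 by (simp add: norm_mult)
  qed
  moreover have "cmod (u2 * cis (G3 + G4) - u2 * cis (G1 + G2)) \<le> cmod (u2 * cis (G3 + G4) - u4) + cmod (u2 * cis (G1 + G2) - u4)"
    using norm_triangle_ineq4[of "u2 * cis (G3 + G4) - u4" "u2 * cis (G1 + G2) - u4"] by simp
  ultimately have le_S: "cmod (u2 * cis (G3 + G4) - u2 * cis (G1 + G2)) \<le> ?S" by linarith
  have "u2 * cis (G3 + G4) - u2 * cis (G1 + G2) = u2 * cis (G1 + G2) * (cis (outward_flux p q x0 y0 \<rho>) - 1)"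
    unfolding flux by (simp add: right_diff_distrib mult.assoc cis_mult)
  then have "cmod u2 * cmod (cis (outward_flux p q x0 y0 \<rho>) - 1) \<le> ?S" using le_S by (simp add: norm_mult)
  moreover have "cmod u2 * c0 \<le> cmod u2 * cmod (cis (outward_flux p q x0 y0 \<rho>) - 1)" using c0 by (intro mult_left_mono) auto
  ultimately have "cmod u2 \<le> ?S / c0" using c0 by (simp add: pos_le_divide_eq)
  \<comment> \<open>From the corner to the other points of the right side only the oscillation of
    |u| enters.\<close>
  moreover have "cmod (u (Complex (x0 + \<rho>) y)) \<le> cmod u2 + ?I2"
    using oscillation_y[OF y, of "y0 + \<rho>" "x0 + \<rho>"] le unfolding u2_def by (simp add: abs_le_iff)
  ultimately have "cmod (u (Complex (x0 + \<rho>) y)) \<le> ?S / c0 + ?S" using nn by linarith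
  also have "\<dots> = (1 / c0 + 1) * ?S" by (simp add: distrib_right)
  finally show ?thesis .
qed

text \<open>\<open>loop_bound\<close> is squared and integrated over the loops with delta/4 <= rho
  <= 3 delta/8. Their right sides sweep out the small square on which |u|^2 is estimated, and their
  four sides sweep out strips of the big square, so line integrals become area integrals.\<close>

lemma square_loops_bound:
  assumes \<delta>: "0 < \<delta>" and c0: "0 < c0"
    and flux: "\<And>\<rho>. \<delta> / 4 \<le> \<rho> \<Longrightarrow> \<rho> \<le> 3 * \<delta> / 8 \<Longrightarrow> c0 \<le> cmod (cis (outward_flux p q x0 y0 \<rho>) - 1)"
  shows "rect_integral (x0 + \<delta> / 4) (x0 + 3 * \<delta> / 8) (y0 - \<delta> / 16) (y0 + \<delta> / 16) (\<lambda>z. (cmod (u z))\<^sup>2) \<le>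
    (1 / c0 + 1)\<^sup>2 * \<delta>\<^sup>2 *
    (rect_integral (x0 - \<delta> / 2) (x0 + \<delta> / 2) (y0 - \<delta> / 2) (y0 + \<delta> / 2) (\<lambda>z. (dx z)\<^sup>2) +
     rect_integral (x0 - \<delta> / 2) (x0 + \<delta> / 2) (y0 - \<delta> / 2) (y0 + \<delta> / 2) (\<lambda>z. (dy z)\<^sup>2))"
proof -
  let ?U = "\<lambda>z. (cmod (u z))\<^sup>2" and ?X = "\<lambda>z. (dx z)\<^sup>2" and ?Y = "\<lambda>z. (dy z)\<^sup>2"
  have cU: "continuous_on UNIV ?U" and cX: "continuous_on UNIV ?X" and cY: "continuous_on UNIV ?Y"
    using cont continuous_d by (auto intro!: continuous_intros)
  define C where "C = (1 / c0 + 1)\<^sup>2"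
  define HX where "HX y = integral {x0 - \<delta> / 2..x0 + \<delta> / 2} (\<lambda>x. ?X (Complex x y))" for y
  define VY where "VY x = integral {y0 - \<delta> / 2..y0 + \<delta> / 2} (\<lambda>y. ?Y (Complex x y))" for x
  have cHX: "continuous_on S HX" and cVY: "continuous_on S VY" for S
    unfolding HX_def VY_def by (intro continuous_inner_integral cX cY)+
  have HXnn: "0 \<le> HX y" and VYnn: "0 \<le> VY y" for y
    unfolding HX_def VY_def by (auto intro!: integral_nonneg integrable_continuous_real continuous_on_Complex_line cX cY)
  let ?B = "\<lambda>\<rho>. HX (y0 - \<rho>) + HX (y0 + \<rho>) + VY (x0 - \<rho>) + VY (x0 + \<rho>)"
  have cB: "continuous_on S ?B" for S
    by (intro continuous_intros continuous_on_compose2[OF cHX[of UNIV]] continuous_on_compose2[OF cVY[of UNIV]]) auto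
  have pt: "?U (Complex (x0 + \<rho>) y) \<le> C * (4 * \<delta> * ?B \<rho>)"
    if \<rho>: "\<delta> / 4 \<le> \<rho>" "\<rho> \<le> 3 * \<delta> / 8" and y: "y \<in> {y0 - \<delta> / 16..y0 + \<delta> / 16}" for \<rho> y
  proof -
    have \<rho>0: "0 \<le> \<rho>" "2 * \<rho> \<le> \<delta>" using \<rho> \<delta> by auto
    let ?I1 = "integral {x0 - \<rho>..x0 + \<rho>} (\<lambda>x. dx (Complex x (y0 - \<rho>)))"
    let ?I3 = "integral {x0 - \<rho>..x0 + \<rho>} (\<lambda>x. dx (Complex x (y0 + \<rho>)))"
    let ?I4 = "integral {y0 - \<rho>..y0 + \<rho>} (\<lambda>y. dy (Complex (x0 - \<rho>) y))"
    let ?I2 = "integral {y0 - \<rho>..y0 + \<rho>} (\<lambda>y. dy (Complex (x0 + \<rho>) y))"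
    have "cmod (u (Complex (x0 + \<rho>) y)) \<le> (1 / c0 + 1) * (?I1 + ?I3 + ?I4 + ?I2)"
      by (rule loop_bound[OF \<rho>0(1) _ c0 flux[OF \<rho>]]) (use y \<rho> in auto)
    then have "?U (Complex (x0 + \<rho>) y) \<le> ((1 / c0 + 1) * (?I1 + ?I3 + ?I4 + ?I2))\<^sup>2" by (rule power_mono) simp
    also have "\<dots> = C * (?I1 + ?I3 + ?I4 + ?I2)\<^sup>2" by (simp add: C_def power_mult_distrib)
    also have "\<dots> \<le> C * (4 * (?I1\<^sup>2 + ?I3\<^sup>2 + ?I4\<^sup>2 + ?I2\<^sup>2))"
    proof (rule mult_left_mono)
      have "(a + b + c + d)\<^sup>2 \<le> 4 * (a\<^sup>2 + b\<^sup>2 + c\<^sup>2 + d\<^sup>2)" for a b c d :: real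
      proof -
        have "4 * (a\<^sup>2 + b\<^sup>2 + c\<^sup>2 + d\<^sup>2) - (a + b + c + d)\<^sup>2 = (a - b)\<^sup>2 + (a - c)\<^sup>2 + (a - d)\<^sup>2 + (b - c)\<^sup>2 + (b - d)\<^sup>2 + (c - d)\<^sup>2"
          by (simp add: power2_eq_square algebra_simps)
        also have "0 \<le> \<dots>" by (intro add_nonneg_nonneg zero_le_power2)
        finally show ?thesis by simp
      qed
      then show "(?I1 + ?I3 + ?I4 + ?I2)\<^sup>2 \<le> 4 * (?I1\<^sup>2 + ?I3\<^sup>2 + ?I4\<^sup>2 + ?I2\<^sup>2)" .
    qed (simp add: C_def)
    also have "\<dots> \<le> C * (4 * (\<delta> * ?B \<rho>))"
    proof (intro mult_left_mono)
      have hx: "(integral {x0 - \<rho>..x0 + \<rho>} (\<lambda>x. dx (Complex x t)))\<^sup>2 \<le> \<delta> * HX t" for t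
      proof -
        have "(integral {x0 - \<rho>..x0 + \<rho>} (\<lambda>x. dx (Complex x t)))\<^sup>2 \<le> ((x0 + \<rho>) - (x0 - \<rho>)) * integral {x0 - \<rho>..x0 + \<rho>} (\<lambda>x. ?X (Complex x t))"
          using \<rho>0 by (intro integral_sq_le continuous_on_Complex_line continuous_d) auto
        also have "integral {x0 - \<rho>..x0 + \<rho>} (\<lambda>x. ?X (Complex x t)) \<le> HX t"
          unfolding HX_def using \<rho>0 by (intro integral_subset_le integrable_continuous_real continuous_on_Complex_line cX) auto
        then have "((x0 + \<rho>) - (x0 - \<rho>)) * integral {x0 - \<rho>..x0 + \<rho>} (\<lambda>x. ?X (Complex x t)) \<le> \<delta> * HX t"
          using \<rho>0 HXnn[of t] by (intro mult_mono integral_nonneg integrable_continuous_real continuous_on_Complex_line cX) auto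
        finally show ?thesis .
      qed
      have vy: "(integral {y0 - \<rho>..y0 + \<rho>} (\<lambda>y. dy (Complex t y)))\<^sup>2 \<le> \<delta> * VY t" for t
      proof -
        have "(integral {y0 - \<rho>..y0 + \<rho>} (\<lambda>y. dy (Complex t y)))\<^sup>2 \<le> ((y0 + \<rho>) - (y0 - \<rho>)) * integral {y0 - \<rho>..y0 + \<rho>} (\<lambda>y. ?Y (Complex t y))"
          using \<rho>0 by (intro integral_sq_le continuous_on_Complex_line continuous_d) auto
        also have "integral {y0 - \<rho>..y0 + \<rho>} (\<lambda>y. ?Y (Complex t y)) \<le> VY t"
          unfolding VY_def using \<rho>0 by (intro integral_subset_le integrable_continuous_real continuous_on_Complex_line cY) auto
        then have "((y0 + \<rho>) - (y0 - \<rho>)) * integral {y0 - \<rho>..y0 + \<rho>} (\<lambda>y. ?Y (Complex t y)) \<le> \<delta> * VY t"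
          using \<rho>0 VYnn[of t] by (intro mult_mono integral_nonneg integrable_continuous_real continuous_on_Complex_line cY) auto
        finally show ?thesis .
      qed
      show "?I1\<^sup>2 + ?I3\<^sup>2 + ?I4\<^sup>2 + ?I2\<^sup>2 \<le> \<delta> * ?B \<rho>"
        using hx[of "y0 - \<rho>"] hx[of "y0 + \<rho>"] vy[of "x0 - \<rho>"] vy[of "x0 + \<rho>"] by (simp add: distrib_left)
    qed (auto simp: C_def)
    finally show ?thesis by (simp add: mult.assoc)
  qed
  \<comment> \<open>The interval of y has length delta/8, which turns the factor 4 delta into
    delta^2/2.\<close>
  have inner: "integral {y0 - \<delta> / 16..y0 + \<delta> / 16} (\<lambda>y. ?U (Complex (x0 + \<rho>) y)) \<le> C * \<delta>\<^sup>2 / 2 * ?B \<rho>"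
    if \<rho>: "\<rho> \<in> {\<delta> / 4..3 * \<delta> / 8}" for \<rho>
  proof -
    have "integral {y0 - \<delta> / 16..y0 + \<delta> / 16} (\<lambda>y. ?U (Complex (x0 + \<rho>) y)) \<le> integral {y0 - \<delta> / 16..y0 + \<delta> / 16} (\<lambda>y. C * (4 * \<delta> * ?B \<rho>))"
      using \<rho> pt by (intro integral_le integrable_continuous_real continuous_on_Complex_line cU) auto
    also have "\<dots> = C * \<delta>\<^sup>2 / 2 * ?B \<rho>" using \<delta> by (simp add: power2_eq_square)
    finally show ?thesis .
  qed
  have "rect_integral (x0 + \<delta> / 4) (x0 + 3 * \<delta> / 8) (y0 - \<delta> / 16) (y0 + \<delta> / 16) ?U =
    integral {\<delta> / 4..3 * \<delta> / 8} (\<lambda>\<rho>. integral {y0 - \<delta> / 16..y0 + \<delta> / 16} (\<lambda>y. ?U (Complex (x0 + \<rho>) y)))"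
    unfolding rect_integral_def
    by (rule integral_shift_add[symmetric, where g = "\<lambda>x. integral {y0 - \<delta> / 16..y0 + \<delta> / 16} (\<lambda>y. ?U (Complex x y))"])
       (intro continuous_inner_integral cU)
  also have "\<dots> \<le> integral {\<delta> / 4..3 * \<delta> / 8} (\<lambda>\<rho>. C * \<delta>\<^sup>2 / 2 * ?B \<rho>)"
  proof (rule integral_le)
    have "continuous_on UNIV (\<lambda>x. integral {y0 - \<delta> / 16..y0 + \<delta> / 16} (\<lambda>y. ?U (Complex x y)))" by (intro continuous_inner_integral cU)
    then have "continuous_on {\<delta> / 4..3 * \<delta> / 8} (\<lambda>\<rho>. integral {y0 - \<delta> / 16..y0 + \<delta> / 16} (\<lambda>y. ?U (Complex (x0 + \<rho>) y)))"
      by (rule continuous_on_compose2) (auto intro!: continuous_intros)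
    then show "(\<lambda>\<rho>. integral {y0 - \<delta> / 16..y0 + \<delta> / 16} (\<lambda>y. ?U (Complex (x0 + \<rho>) y))) integrable_on {\<delta> / 4..3 * \<delta> / 8}"
      by (rule integrable_continuous_real)
    show "(\<lambda>\<rho>. C * \<delta>\<^sup>2 / 2 * ?B \<rho>) integrable_on {\<delta> / 4..3 * \<delta> / 8}"
      by (intro integrable_on_mult_right integrable_continuous_real cB)
  qed (rule inner)
  also have "\<dots> = C * \<delta>\<^sup>2 / 2 * integral {\<delta> / 4..3 * \<delta> / 8} ?B" by simp
  also have "integral {\<delta> / 4..3 * \<delta> / 8} ?B =
     integral {\<delta> / 4..3 * \<delta> / 8} (\<lambda>\<rho>. HX (y0 - \<rho>)) + integral {\<delta> / 4..3 * \<delta> / 8} (\<lambda>\<rho>. HX (y0 + \<rho>)) +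
     integral {\<delta> / 4..3 * \<delta> / 8} (\<lambda>\<rho>. VY (x0 - \<rho>)) + integral {\<delta> / 4..3 * \<delta> / 8} (\<lambda>\<rho>. VY (x0 + \<rho>))"
  proof -
    have "(\<lambda>\<rho>. HX (y0 - \<rho>)) integrable_on S" "(\<lambda>\<rho>. HX (y0 + \<rho>)) integrable_on S"
      "(\<lambda>\<rho>. VY (x0 - \<rho>)) integrable_on S" "(\<lambda>\<rho>. VY (x0 + \<rho>)) integrable_on S" if "S = {\<delta> / 4..3 * \<delta> / 8}" for S
      unfolding that
      by (intro integrable_continuous_real continuous_on_compose2[OF cHX[of UNIV]] continuous_on_compose2[OF cVY[of UNIV]] continuous_intros; simp)+
    from this[OF refl] show ?thesis by (simp add: integral_add integrable_add)
  qed
  \<comment> \<open>Each strip lies in the big square; the factors 2 account for the two opposite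
    sides of the loops.\<close>
  also have "\<dots> \<le> 2 * integral {y0 - \<delta> / 2..y0 + \<delta> / 2} HX + 2 * integral {x0 - \<delta> / 2..x0 + \<delta> / 2} VY"
  proof -
    have *: "integral {\<delta> / 4..3 * \<delta> / 8} (\<lambda>\<rho>. g (c - \<rho>)) \<le> integral {c - \<delta> / 2..c + \<delta> / 2} g"
            "integral {\<delta> / 4..3 * \<delta> / 8} (\<lambda>\<rho>. g (c + \<rho>)) \<le> integral {c - \<delta> / 2..c + \<delta> / 2} g"
      if g: "continuous_on UNIV g" "\<And>x. 0 \<le> g x" for g :: "real \<Rightarrow> real" and c
      unfolding integral_shift_add[OF g(1)] integral_shift_diff[OF g(1)]
      using \<delta> g by (auto intro!: integral_subset_le integrable_continuous_real continuous_on_subset[OF g(1)])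
    show ?thesis
      using *[OF cHX HXnn, of y0] *[OF cVY VYnn, of x0] by linarith
  qed
  finally have "rect_integral (x0 + \<delta> / 4) (x0 + 3 * \<delta> / 8) (y0 - \<delta> / 16) (y0 + \<delta> / 16) ?U \<le>
     C * \<delta>\<^sup>2 / 2 * (2 * integral {y0 - \<delta> / 2..y0 + \<delta> / 2} HX + 2 * integral {x0 - \<delta> / 2..x0 + \<delta> / 2} VY)"
    by (simp add: C_def mult_left_mono)
  also have "\<dots> = C * \<delta>\<^sup>2 * (integral {y0 - \<delta> / 2..y0 + \<delta> / 2} HX + integral {x0 - \<delta> / 2..x0 + \<delta> / 2} VY)"
    by (simp add: algebra_simps)
  also have "integral {y0 - \<delta> / 2..y0 + \<delta> / 2} HX = rect_integral (x0 - \<delta> / 2) (x0 + \<delta> / 2) (y0 - \<delta> / 2) (y0 + \<delta> / 2) ?X"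
    unfolding rect_integral_swap[OF cX] HX_def ..
  also have "integral {x0 - \<delta> / 2..x0 + \<delta> / 2} VY = rect_integral (x0 - \<delta> / 2) (x0 + \<delta> / 2) (y0 - \<delta> / 2) (y0 + \<delta> / 2) ?Y"
    unfolding rect_integral_def VY_def ..
  finally show ?thesis unfolding C_def .
qed

end

section \<open>The magnetic eigenvalues tend to infinity\<close>

lemma outward_flux_sum:
  assumes "finite I" and P: "\<And>x. x \<in> I \<Longrightarrow> continuous_on UNIV (P x)" and Q: "\<And>x. x \<in> I \<Longrightarrow> continuous_on UNIV (Q x)"
  shows "outward_flux (\<lambda>z. m * (\<Sum>x\<in>I. c x * P x z)) (\<lambda>z. m * (\<Sum>x\<in>I. c x * Q x z)) x0 y0 \<rho> =
    m * (\<Sum>x\<in>I. c x * outward_flux (P x) (Q x) x0 y0 \<rho>)"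
proof -
  have 1: "integral {a..b} (\<lambda>y. m * (\<Sum>x\<in>I. c x * P x (Complex s y)) - m * (\<Sum>x\<in>I. c x * P x (Complex t y))) =
      m * (\<Sum>x\<in>I. c x * integral {a..b} (\<lambda>y. P x (Complex s y) - P x (Complex t y)))" for a b s t
  proof -
    have "(\<lambda>y. m * (\<Sum>x\<in>I. c x * P x (Complex s y)) - m * (\<Sum>x\<in>I. c x * P x (Complex t y))) =
      (\<lambda>y. m * (\<Sum>x\<in>I. c x * (P x (Complex s y) - P x (Complex t y))))"
      by (simp add: right_diff_distrib sum_subtractf)
    moreover have "integral {a..b} (\<lambda>y. \<Sum>x\<in>I. c x * (P x (Complex s y) - P x (Complex t y))) =
      (\<Sum>x\<in>I. integral {a..b} (\<lambda>y. c x * (P x (Complex s y) - P x (Complex t y))))"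
      by (rule integral_sum[OF assms(1)])
         (intro integrable_on_mult_right integrable_continuous_real continuous_intros continuous_on_Complex_line P)
    ultimately show ?thesis by simp
  qed
  have 2: "integral {a..b} (\<lambda>y. m * (\<Sum>x\<in>I. c x * Q x (Complex y s)) - m * (\<Sum>x\<in>I. c x * Q x (Complex y t))) =
      m * (\<Sum>x\<in>I. c x * integral {a..b} (\<lambda>y. Q x (Complex y s) - Q x (Complex y t)))" for a b s t
  proof -
    have "(\<lambda>y. m * (\<Sum>x\<in>I. c x * Q x (Complex y s)) - m * (\<Sum>x\<in>I. c x * Q x (Complex y t))) =
      (\<lambda>y. m * (\<Sum>x\<in>I. c x * (Q x (Complex y s) - Q x (Complex y t))))"
      by (simp add: right_diff_distrib sum_subtractf)
    moreover have "integral {a..b} (\<lambda>y. \<Sum>x\<in>I. c x * (Q x (Complex y s) - Q x (Complex y t))) =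
      (\<Sum>x\<in>I. integral {a..b} (\<lambda>y. c x * (Q x (Complex y s) - Q x (Complex y t))))"
      by (rule integral_sum[OF assms(1)])
         (intro integrable_on_mult_right integrable_continuous_real continuous_intros continuous_on_Complex_line Q)
    ultimately show ?thesis by simp
  qed
  show ?thesis
    unfolding outward_flux_def 1 2 by (simp add: distrib_left sum.distrib)
qed

definition disc_mass :: "nat \<Rightarrow> complex \<Rightarrow> complex set \<Rightarrow> real" where
  "disc_mass i p A = (LINT z:A|lborel. disc_density (rad i) (z - p))"

lemma outward_flux_pot_sum:
  assumes "0 \<le> \<rho>"
  shows "outward_flux (\<lambda>z. m * pot_sum pot_x K z) (\<lambda>z. m * pot_sum pot_y K z) x0 y0 \<rho> =
    m * (\<Sum>i<K. flux i * (\<Sum>p\<in>kept i. disc_mass i p (sup_square x0 y0 \<rho>)))"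
proof -
  have e: "pot_sum V K z = (\<Sum>x\<in>kept_upto K. flux (fst x) * V (rad (fst x)) (z - snd x))" for V z
    by (simp add: pot_sum_def case_prod_beta)
  have "outward_flux (\<lambda>z. m * pot_sum pot_x K z) (\<lambda>z. m * pot_sum pot_y K z) x0 y0 \<rho> =
     m * (\<Sum>x\<in>kept_upto K. flux (fst x) * outward_flux (\<lambda>z. pot_x (rad (fst x)) (z - snd x)) (\<lambda>z. pot_y (rad (fst x)) (z - snd x)) x0 y0 \<rho>)"
    unfolding e by (rule outward_flux_sum[OF finite_kept_upto continuous_pot_x[OF rad_pos] continuous_pot_y[OF rad_pos]])
  also have "\<dots> = m * (\<Sum>x\<in>kept_upto K. flux (fst x) * disc_mass (fst x) (snd x) (sup_square x0 y0 \<rho>))"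
    by (simp only: outward_flux_pot[OF rad_pos assms] disc_mass_def)
  also have "(\<Sum>x\<in>kept_upto K. flux (fst x) * disc_mass (fst x) (snd x) (sup_square x0 y0 \<rho>)) = (\<Sum>i<K. \<Sum>p\<in>kept i. flux i * disc_mass i p (sup_square x0 y0 \<rho>))"
  proof -
    have "kept_upto K = Sigma {..<K} kept" using kept_upto_iff by auto
    then show ?thesis by (simp add: sum.Sigma finite_kept case_prod_beta)
  qed
  finally show ?thesis by (simp add: sum_distrib_left)
qed

lemma disc_mass_bounds:
  assumes A: "A \<in> sets borel"
  shows "0 \<le> disc_mass i p A" "disc_mass i p A \<le> 2 * pi"
    "ball p (rad i) \<subseteq> A \<Longrightarrow> disc_mass i p A = 2 * pi" "ball p (rad i) \<inter> A = {} \<Longrightarrow> disc_mass i p A = 0"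
proof -
  have nn: "0 \<le> disc_density (rad i) z" for z by (simp add: disc_density_def)
  note I = integral_disc_density[OF rad_pos[of i], of p]
  have iA: "integrable lborel (\<lambda>z. indicator A z *\<^sub>R disc_density (rad i) (z - p))"
    using A I(1) by (intro integrable_mult_indicator) auto
  show "0 \<le> disc_mass i p A"
    unfolding disc_mass_def set_lebesgue_integral_def using nn by (intro Bochner_Integration.integral_nonneg) auto
  have "disc_mass i p A \<le> (LINT z|lborel. disc_density (rad i) (z - p))"
    unfolding disc_mass_def set_lebesgue_integral_def using nn by (intro integral_mono[OF iA I(1)]) (auto simp: indicator_def)
  then show "disc_mass i p A \<le> 2 * pi" using I(2) by simp
  show "disc_mass i p A = 2 * pi" if "ball p (rad i) \<subseteq> A"
  proof -
    have "disc_mass i p A = (LINT z|lborel. disc_density (rad i) (z - p))"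
      unfolding disc_mass_def set_lebesgue_integral_def disc_density_shift
      using that by (intro Bochner_Integration.integral_cong refl) (auto simp: indicator_def simp del: mem_ball)
    then show ?thesis using I(2) by simp
  qed
  show "disc_mass i p A = 0" if "ball p (rad i) \<inter> A = {}"
    unfolding disc_mass_def set_lebesgue_integral_def disc_density_shift
    using that by (intro Bochner_Integration.integral_eq_zero_AE AE_I2) (auto simp: indicator_def simp del: mem_ball)
qed

lemma in_sup_square: "z \<in> sup_square x0 y0 \<rho> \<longleftrightarrow> \<bar>Re z - x0\<bar> \<le> \<rho> \<and> \<bar>Im z - y0\<bar> \<le> \<rho>"
  by (auto simp: sup_square_def in_cbox_complex_iff)

lemma sets_sup_square: "sup_square x0 y0 \<rho> \<in> sets borel" by (simp add: sup_square_def)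

lemma card_interval_le:
  assumes "\<And>a'. a' \<in> A \<Longrightarrow> of_int a * 2 ^ m < real_of_int a' + 1 / 2 \<and> real_of_int a' + 1 / 2 < (of_int a + 1) * 2 ^ m"
  shows "A \<subseteq> {a * 2 ^ m..<(a + 1) * 2 ^ m}"
proof
  fix a' assume "a' \<in> A"
  from assms[OF this] have "real_of_int (a * 2 ^ m) < real_of_int a' + 1" "real_of_int a' < real_of_int ((a + 1) * 2 ^ m)"
    by auto
  then have "a * 2 ^ m < a' + 1" "a' < (a + 1) * 2 ^ m" by linarith+
  then show "a' \<in> {a * 2 ^ m..<(a + 1) * 2 ^ m}" by simp
qed

text \<open>In units of the younger side, the open cell is a square of side 2^m with integer
  corners, so each coordinate of a younger centre has only 2^m half-integers to choose from.\<close>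

lemma card_grid_in_cell:
  assumes z0: "z0 = grid_point k ab"
  shows "card {p \<in> grid (k + m). \<bar>Re p - Re z0\<bar> < 1 / 2 ^ k / 2 \<and> \<bar>Im p - Im z0\<bar> < 1 / 2 ^ k / 2} \<le> 4 ^ m" (is "card ?S \<le> _")
proof -
  obtain a b where ab: "ab = (a, b)" by (cases ab)
  let ?I = "\<lambda>a. {a * 2 ^ m..<(a + 1) * 2 ^ m :: int}"
  have key: "a' \<in> ?I a" if "\<bar>(real_of_int a' + 1 / 2) / 2 ^ (k + m) - (of_int a + 1 / 2) / 2 ^ k\<bar> < 1 / 2 ^ k / 2" for a a' :: int
  proof -
    have "\<bar>(real_of_int a' + 1 / 2) / 2 ^ (k + m) - (of_int a + 1 / 2) / 2 ^ k\<bar> * 2 ^ (k + m) < 1 / 2 ^ k / 2 * 2 ^ (k + m)"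
      using that by (intro mult_strict_right_mono) auto
    moreover have "\<bar>(real_of_int a' + 1 / 2) / 2 ^ (k + m) - (of_int a + 1 / 2) / 2 ^ k\<bar> * 2 ^ (k + m) =
        \<bar>((real_of_int a' + 1 / 2) / 2 ^ (k + m) - (of_int a + 1 / 2) / 2 ^ k) * 2 ^ (k + m)\<bar>"
      by (simp add: abs_mult)
    moreover have "((real_of_int a' + 1 / 2) / 2 ^ (k + m) - (of_int a + 1 / 2) / 2 ^ k) * 2 ^ (k + m) = (real_of_int a' + 1 / 2) - (of_int a + 1 / 2) * 2 ^ m"
      by (simp add: left_diff_distrib power_add)
    moreover have "1 / 2 ^ k / 2 * 2 ^ (k + m) = (2 ^ m / 2 :: real)" by (simp add: power_add)
    ultimately have "\<bar>(real_of_int a' + 1 / 2) - (of_int a + 1 / 2) * 2 ^ m\<bar> < 2 ^ m / 2" by simp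
    then have "of_int a * 2 ^ m < real_of_int a' + 1 / 2 \<and> real_of_int a' + 1 / 2 < (of_int a + 1) * 2 ^ m"
    proof -
      have gen: "Y < X \<and> X < Y + T" if "\<bar>X - (Y + T / 2)\<bar> < T / 2" for X Y T :: real
        using that by linarith
      have "(of_int a + 1 / 2) * 2 ^ m = of_int a * 2 ^ m + (2 ^ m / 2 :: real)" "(of_int a + 1) * 2 ^ m = of_int a * 2 ^ m + (2 ^ m :: real)"
        by (simp_all add: distrib_right)
      with \<open>\<bar>(real_of_int a' + 1 / 2) - (of_int a + 1 / 2) * 2 ^ m\<bar> < 2 ^ m / 2\<close>
      show ?thesis using gen by (simp only:)
    qed
    then show ?thesis using card_interval_le[of "{a'}" a m] by simp
  qed
  have "?S \<subseteq> grid_point (k + m) ` (?I a \<times> ?I b)"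
  proof
    fix p assume p: "p \<in> ?S"
    then obtain a' b' where p': "p = grid_point (k + m) (a', b')" by (auto simp: grid_def)
    have "a' \<in> ?I a" "b' \<in> ?I b" using p unfolding p' z0 ab grid_point_def by (auto intro!: key simp del: atLeastLessThan_iff)
    then show "p \<in> grid_point (k + m) ` (?I a \<times> ?I b)" unfolding p' by blast
  qed
  then have "card ?S \<le> card (grid_point (k + m) ` (?I a \<times> ?I b))" by (rule card_mono[rotated]) simp
  also have "\<dots> \<le> card (?I a \<times> ?I b)" by (rule card_image_le) simp
  also have "\<dots> = 4 ^ m"
  proof -
    have "card (?I a) = 2 ^ m" for a by (simp add: distrib_right nat_power_eq)
    moreover have "(4::nat) ^ m = 2 ^ m * 2 ^ m" by (simp flip: power_mult_distrib)
    ultimately show ?thesis by (simp only: card_cartesian_product)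
  qed
  finally show ?thesis .
qed

text \<open>The loops enclose the whole central disc and avoid all older discs. A younger level i
  has at most 4^(i-k) discs in the cell, each with the flux 1024^-(i-k) relative to the central one;
  the levels from k on are thus bounded by a geometric series with ratio 1/256 and sum 256/255. A
  disc cut by the loop counts with a part of its mass only.\<close>

lemma loop_flux_bounds:
  assumes z0: "z0 = grid_point k ab" "z0 \<in> kept k" and K: "k < K"
    and d: "d = 1 / 2 ^ k"
    and old: "\<And>i q. i < k \<Longrightarrow> q \<in> kept i \<Longrightarrow> ball q (rad i) \<inter> sup_square (Re z0) (Im z0) (3 * d / 8) = {}"
    and \<rho>: "d / 4 \<le> \<rho>" "\<rho> \<le> 3 * d / 8"
  defines "S \<equiv> \<Sum>i<K. flux i * (\<Sum>p\<in>kept i. disc_mass i p (sup_square (Re z0) (Im z0) \<rho>))"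
  shows "2 * pi * flux k \<le> S" "S \<le> 2 * pi * flux k * (256 / 255)"
proof -
  let ?A = "sup_square (Re z0) (Im z0) \<rho>"
  have \<delta>: "0 < d" by (simp add: d)
  have half: "(1 / 2 :: real) ^ k = d" by (simp add: d power_one_over)
  have nn: "0 \<le> flux i * (\<Sum>p\<in>kept i. disc_mass i p ?A)" for i
    using flux_pos[of i] by (intro mult_nonneg_nonneg sum_nonneg disc_mass_bounds sets_sup_square) auto
  have "ball z0 (rad k) \<subseteq> ?A"
  proof
    fix z assume "z \<in> ball z0 (rad k)"
    then have "cmod (z - z0) < rad k" by (simp add: dist_norm norm_minus_commute)
    then have "cmod (z - z0) \<le> \<rho>" using rad_le_cell[of k] \<rho> \<delta> unfolding half by linarith
    then show "z \<in> ?A" using abs_Re_le_cmod[of "z - z0"] abs_Im_le_cmod[of "z - z0"] by (simp add: in_sup_square)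
  qed
  then have "disc_mass k z0 ?A = 2 * pi" by (intro disc_mass_bounds sets_sup_square)
  then have "2 * pi \<le> (\<Sum>p\<in>kept k. disc_mass k p ?A)"
    using member_le_sum[OF z0(2), of "\<lambda>p. disc_mass k p ?A"] disc_mass_bounds(1)[OF sets_sup_square] finite_kept by simp
  then have "2 * pi * flux k \<le> flux k * (\<Sum>p\<in>kept k. disc_mass k p ?A)" using flux_pos[of k] by simp
  also have "\<dots> \<le> S" unfolding S_def by (rule member_le_sum) (use K nn in auto)
  finally show "2 * pi * flux k \<le> S" .
  have young: "flux i * (\<Sum>p\<in>kept i. disc_mass i p ?A) \<le> 2 * pi * flux k * (1 / 256) ^ (i - k)" if i: "k \<le> i" for i
  proof -
    let ?T = "{p \<in> grid (k + (i - k)). \<bar>Re p - Re z0\<bar> < d / 2 \<and> \<bar>Im p - Im z0\<bar> < d / 2}"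
    have fT: "finite ?T" using finite_grid by simp
    have "(\<Sum>p\<in>kept i. disc_mass i p ?A) = (\<Sum>p\<in>kept i \<inter> ?T. disc_mass i p ?A)"
    proof (rule sum.mono_neutral_right[OF finite_kept])
      show "\<forall>p\<in>kept i - kept i \<inter> ?T. disc_mass i p ?A = 0"
      proof
        fix p assume p: "p \<in> kept i - kept i \<inter> ?T"
        then have "p \<in> grid (k + (i - k))" using kept_subset i by auto
        then have far: "d / 2 \<le> \<bar>Re p - Re z0\<bar> \<or> d / 2 \<le> \<bar>Im p - Im z0\<bar>" using p by auto
        \<comment> \<open>The loops keep a distance d/8 from the boundary of the cell, more than the
          radius of a younger disc, so a disc centred outside the open cell does not reach
          them.\<close>
        have ri: "rad i \<le> d / 64"
        proof -
          have "rad i \<le> (1 / 2) ^ i / 64" by (rule rad_le_cell)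
          also have "\<dots> \<le> (1 / 2) ^ k / 64" using i by (intro divide_right_mono power_decreasing) auto
          finally show ?thesis unfolding half .
        qed
        have "ball p (rad i) \<inter> ?A = {}"
        proof (rule ccontr)
          assume "ball p (rad i) \<inter> ?A \<noteq> {}"
          then obtain z where z: "z \<in> ball p (rad i)" "z \<in> ?A" by blast
          then have "cmod (z - p) < rad i" by (simp add: dist_norm norm_minus_commute)
          moreover have "\<bar>Re z - Re p\<bar> \<le> cmod (z - p)" "\<bar>Im z - Im p\<bar> \<le> cmod (z - p)"
            using abs_Re_le_cmod[of "z - p"] abs_Im_le_cmod[of "z - p"] by simp_all
          moreover have "\<bar>Re z - Re z0\<bar> \<le> \<rho>" "\<bar>Im z - Im z0\<bar> \<le> \<rho>" using z(2) by (auto simp: in_sup_square)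
          ultimately show False using far ri \<rho> \<delta> by linarith
        qed
        then show "disc_mass i p ?A = 0" by (intro disc_mass_bounds sets_sup_square)
      qed
    qed auto
    also have "\<dots> \<le> real (card (kept i \<inter> ?T)) * (2 * pi)"
      by (intro sum_bounded_above disc_mass_bounds sets_sup_square)
    also have "\<dots> \<le> 4 ^ (i - k) * (2 * pi)"
    proof -
      have "card (kept i \<inter> ?T) \<le> card ?T" by (rule card_mono[OF fT]) auto
      also have "\<dots> \<le> 4 ^ (i - k)" unfolding d by (rule card_grid_in_cell[OF z0(1)])
      finally have "real (card (kept i \<inter> ?T)) \<le> real (4 ^ (i - k))" by (simp only: of_nat_le_iff)
      then show ?thesis by (intro mult_right_mono) auto
    qed
    finally have "flux i * (\<Sum>p\<in>kept i. disc_mass i p ?A) \<le> flux i * (4 ^ (i - k) * (2 * pi))"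
      using flux_pos[of i] by (intro mult_left_mono) auto
    moreover have "flux i = flux k * (1 / 1024) ^ (i - k)" using i by (simp add: flux_def flip: power_add)
    moreover have "flux k * (1 / 1024) ^ (i - k) * (4 ^ (i - k) * (2 * pi)) = 2 * pi * flux k * ((1 / 1024) ^ (i - k) * 4 ^ (i - k))" by simp
    moreover have "(1 / 1024 :: real) ^ (i - k) * 4 ^ (i - k) = (1 / 256) ^ (i - k)" by (simp flip: power_mult_distrib)
    ultimately show ?thesis by simp
  qed
  have oldz: "flux i * (\<Sum>p\<in>kept i. disc_mass i p ?A) = 0" if i: "i < k" for i
  proof -
    have "disc_mass i p ?A = 0" if "p \<in> kept i" for p
    proof (rule disc_mass_bounds(4)[OF sets_sup_square])
      have "?A \<subseteq> sup_square (Re z0) (Im z0) (3 * d / 8)" using \<rho> by (auto simp: in_sup_square)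
      then show "ball p (rad i) \<inter> ?A = {}" using old[OF i that] by blast
    qed
    then show ?thesis by simp
  qed
  have "S = (\<Sum>i\<in>{k..<K}. flux i * (\<Sum>p\<in>kept i. disc_mass i p ?A))"
    unfolding S_def
  proof (rule sum.mono_neutral_right)
    show "\<forall>i\<in>{..<K} - {k..<K}. flux i * (\<Sum>p\<in>kept i. disc_mass i p ?A) = 0"
      by (intro ballI oldz) auto
  qed auto
  also have "\<dots> \<le> (\<Sum>i\<in>{k..<K}. 2 * pi * flux k * (1 / 256) ^ (i - k))" by (rule sum_mono) (use young in auto)
  also have "\<dots> = 2 * pi * flux k * (\<Sum>i\<in>{k..<K}. (1 / 256) ^ (i - k))" by (simp add: sum_distrib_left)
  also have "(\<Sum>i\<in>{k..<K}. (1 / 256 :: real) ^ (i - k)) = (\<Sum>j<K - k. (1 / 256) ^ j)"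
    by (rule sum.reindex_bij_witness[of _ "\<lambda>j. j + k" "\<lambda>i. i - k"]) auto
  also have "(\<Sum>j<K - k. (1 / 256 :: real) ^ j) \<le> (\<Sum>j. (1 / 256) ^ j)" by (intro sum_le_suminf summable_geometric) auto
  also have "(\<Sum>j. (1 / 256 :: real) ^ j) = 256 / 255" by (simp add: suminf_geometric)
  finally show "S \<le> 2 * pi * flux k * (256 / 255)" using flux_pos[of k] by simp
qed

text \<open>The interval is compact and lies strictly between 0 and 2 pi. Its ends come from the
  window for \<open>n * flux k\<close>: the lower one is 2 pi / 2048, and the upper one leaves room
  for 2 pi * (1/2) * (256/255).\<close>

lemma cis_away_from_1:
  obtains c where "0 < c" "\<And>\<theta>. pi / 1024 \<le> \<theta> \<Longrightarrow> \<theta> \<le> 3 * pi / 2 \<Longrightarrow> c \<le> cmod (cis \<theta> - 1)"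
proof -
  let ?I = "{pi / 1024..3 * pi / 2}"
  have "continuous_on ?I (\<lambda>\<theta>. cmod (cis \<theta> - 1))" by (intro continuous_intros)
  moreover have "?I \<noteq> {}" by simp
  ultimately obtain t where t: "t \<in> ?I" "\<And>\<theta>. \<theta> \<in> ?I \<Longrightarrow> cmod (cis t - 1) \<le> cmod (cis \<theta> - 1)"
    using continuous_attains_inf[OF compact_Icc] by blast
  have "cis t \<noteq> 1"
  proof
    assume "cis t = 1"
    then have "cos t = 1" by (metis cis.sel(1) one_complex.sel(1))
    then obtain m :: int where m: "t = of_int m * 2 * pi" using cos_one_2pi_int by blast
    have "pi / 1024 \<le> t" "t \<le> 3 * pi / 2" using t(1) by auto
    then have "0 < t" "t < 2 * pi" using pi_gt_zero by linarith+
    then have "0 < real_of_int m * (2 * pi)" "real_of_int m * (2 * pi) < 1 * (2 * pi)" using m by simp_all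
    then have "0 < real_of_int m" "real_of_int m < 1" by (simp_all add: zero_less_mult_iff)
    then have "0 < m" "m < 1" by (simp_all only: of_int_0_less_iff of_int_less_1_iff)
    then show False by simp
  qed
  then show thesis using t that[of "cmod (cis t - 1)"] by auto
qed

text \<open>The density of an older disc, measured in units of \<open>flux k\<close>: its flux is
  larger by 1024^(k-i), and its squared radius is at most 1 / (4096 * 64^i). For
  \<open>n * flux k\<close> at least 1/2048, the density n Delta phi on such a disc is then at least
  4 * 64^k.\<close>

lemma flux_decay: "i < k \<Longrightarrow> 8192 * 64 ^ k \<le> flux i * (2 / (rad i)\<^sup>2) / flux k"
proof -
  assume i: "i < k"
  have fk: "flux i / flux k = 1024 ^ (k - i)"
    using i by (simp add: flux_def power_one_over power_diff field_simps)
  have "rad i \<le> (1 / 2) ^ (3 * i + 6)" by (rule rad_le)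
  then have "(rad i)\<^sup>2 \<le> ((1 / 2) ^ (3 * i + 6))\<^sup>2" using rad_pos[of i] by (intro power_mono) auto
  also have "((1 / 2 :: real) ^ (3 * i + 6))\<^sup>2 = 1 / (4096 * 64 ^ i)"
    by (simp add: power_add power_mult power2_eq_square power_one_over flip: power_mult_distrib)
  finally have "4096 * 64 ^ i \<le> 1 / (rad i)\<^sup>2"
    using rad_pos[of i] by (simp add: field_simps)
  moreover have "(64::real) ^ (k - i) \<le> 1024 ^ (k - i)" by (intro power_mono) auto
  ultimately have "64 ^ (k - i) * (4096 * 64 ^ i) \<le> 1024 ^ (k - i) * (1 / (rad i)\<^sup>2)"
    by (intro mult_mono) auto
  moreover have "64 ^ (k - i) * (64::real) ^ i = 64 ^ k" using i by (simp flip: power_add)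
  ultimately have "4096 * 64 ^ k \<le> 1024 ^ (k - i) * (1 / (rad i)\<^sup>2)" by (simp add: mult_ac)
  then have "4096 * 64 ^ k \<le> flux i / flux k * (1 / (rad i)\<^sup>2)" by (simp only: fk)
  moreover have "flux i * (2 / (rad i)\<^sup>2) / flux k = 2 * (flux i / flux k * (1 / (rad i)\<^sup>2))" by (simp add: mult_ac)
  ultimately show ?thesis by linarith
qed

section \<open>The estimate on a single cell\<close>

context magnetic_data
begin

text \<open>\<open>poincare_square\<close> starting from the small square swept out by the loops,
  whose side is 1/8 of that of the cell.\<close>

lemma cell_bound_loops:
  assumes \<delta>: "0 < \<delta>" and c0: "0 < c0"
    and flux: "\<And>\<rho>. \<delta> / 4 \<le> \<rho> \<Longrightarrow> \<rho> \<le> 3 * \<delta> / 8 \<Longrightarrow> c0 \<le> cmod (cis (outward_flux p q x0 y0 \<rho>) - 1)"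
  shows "rect_integral (x0 - \<delta> / 2) (x0 + \<delta> / 2) (y0 - \<delta> / 2) (y0 + \<delta> / 2) (\<lambda>z. (cmod (u z))\<^sup>2) \<le>
    256 * ((1 / c0 + 1)\<^sup>2 + 1) * \<delta>\<^sup>2 *
    (rect_integral (x0 - \<delta> / 2) (x0 + \<delta> / 2) (y0 - \<delta> / 2) (y0 + \<delta> / 2) (\<lambda>z. (dx z)\<^sup>2) +
     rect_integral (x0 - \<delta> / 2) (x0 + \<delta> / 2) (y0 - \<delta> / 2) (y0 + \<delta> / 2) (\<lambda>z. (dy z)\<^sup>2))"
  (is "?Q \<le> 256 * (?C + 1) * \<delta>\<^sup>2 * ?D")
proof -
  let ?E = "rect_integral (x0 + \<delta> / 4) (x0 + 3 * \<delta> / 8) (y0 - \<delta> / 16) (y0 + \<delta> / 16) (\<lambda>z. (cmod (u z))\<^sup>2)"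
  have "(1 / 8)\<^sup>2 * ?Q \<le> 4 * ?E + 4 * \<delta>\<^sup>2 * ?D"
    by (rule poincare_square) (use \<delta> in auto)
  moreover have "?E \<le> ?C * \<delta>\<^sup>2 * ?D" by (rule square_loops_bound[OF assms])
  ultimately have "(1 / 8)\<^sup>2 * ?Q \<le> 4 * (?C * \<delta>\<^sup>2 * ?D) + 4 * \<delta>\<^sup>2 * ?D" by linarith
  then have "?Q \<le> 64 * (4 * (?C * \<delta>\<^sup>2 * ?D) + 4 * \<delta>\<^sup>2 * ?D)" by (simp add: power_divide)
  also have "\<dots> = 256 * (?C + 1) * \<delta>\<^sup>2 * ?D" by (simp add: algebra_simps)
  finally show ?thesis .
qed

text \<open>\<open>poincare_square\<close> with kappa = 1/16, for the case in which the density of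
  an older disc controls the mass on a small square. The bounds on its centre keep that square
  inside the cell.\<close>

lemma cell_bound_square:
  assumes \<delta>: "0 < \<delta>" and E: "\<bar>x1 - x0\<bar> \<le> 7 * \<delta> / 16" "\<bar>y1 - y0\<bar> \<le> 7 * \<delta> / 16"
  shows "rect_integral (x0 - \<delta> / 2) (x0 + \<delta> / 2) (y0 - \<delta> / 2) (y0 + \<delta> / 2) (\<lambda>z. (cmod (u z))\<^sup>2) \<le>
    1024 * (rect_integral (x1 - \<delta> / 32) (x1 + \<delta> / 32) (y1 - \<delta> / 32) (y1 + \<delta> / 32) (\<lambda>z. (cmod (u z))\<^sup>2) + \<delta>\<^sup>2 *
    (rect_integral (x0 - \<delta> / 2) (x0 + \<delta> / 2) (y0 - \<delta> / 2) (y0 + \<delta> / 2) (\<lambda>z. (dx z)\<^sup>2) +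
     rect_integral (x0 - \<delta> / 2) (x0 + \<delta> / 2) (y0 - \<delta> / 2) (y0 + \<delta> / 2) (\<lambda>z. (dy z)\<^sup>2)))"
  (is "?Q \<le> 1024 * (?E + \<delta>\<^sup>2 * ?D)")
proof -
  have sub: "x0 - \<delta> / 2 \<le> x1 - \<delta> / 32" "x1 + \<delta> / 32 \<le> x0 + \<delta> / 2" "y0 - \<delta> / 2 \<le> y1 - \<delta> / 32" "y1 + \<delta> / 32 \<le> y0 + \<delta> / 2"
    using E \<delta> by linarith+
  have "(1 / 16)\<^sup>2 * ?Q \<le> 4 * ?E + 4 * \<delta>\<^sup>2 * ?D"
    by (rule poincare_square[OF _ _ \<delta> sub]) auto
  then have "?Q \<le> 256 * (4 * ?E + 4 * \<delta>\<^sup>2 * ?D)" by (simp add: power_divide)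
  then show ?thesis by (simp add: algebra_simps)
qed

end

text \<open>The disc is centred outside the open cell but reaches the square of half-side 3 delta/8,
  so its radius exceeds delta/8. A step of length delta/16 towards its centre leaves room for a
  square of half-side delta/32 in the disc and in the cell.\<close>

lemma ball_meets_square:
  assumes pt: "z \<in> ball q r" "\<bar>Re z - x0\<bar> \<le> 3 * \<delta> / 8" "\<bar>Im z - y0\<bar> \<le> 3 * \<delta> / 8"
    and far: "\<delta> / 2 \<le> \<bar>Re q - x0\<bar> \<or> \<delta> / 2 \<le> \<bar>Im q - y0\<bar>" and \<delta>: "0 < \<delta>"
  obtains x1 y1 where "\<bar>x1 - x0\<bar> \<le> 7 * \<delta> / 16" "\<bar>y1 - y0\<bar> \<le> 7 * \<delta> / 16" "sup_square x1 y1 (\<delta> / 32) \<subseteq> ball q r"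
proof -
  have r: "cmod (z - q) < r" using pt(1) by (simp add: dist_norm norm_minus_commute)
  have "\<bar>Re z - Re q\<bar> \<le> cmod (z - q)" "\<bar>Im z - Im q\<bar> \<le> cmod (z - q)"
    using abs_Re_le_cmod[of "z - q"] abs_Im_le_cmod[of "z - q"] by simp_all
  then have n: "\<delta> / 8 \<le> cmod (z - q)" using pt(2,3) far by linarith
  have c: "0 < cmod (z - q)" using n \<delta> by linarith
  \<comment> \<open>The step length delta/16 as a fraction of |z - q|; it is at most 1/2 because |z
    - q| >= delta/8.\<close>
  define t where "t = \<delta> / 16 / cmod (z - q)"
  have t: "0 < t" "t \<le> 1 / 2" using n \<delta> c by (simp_all add: t_def field_simps)
  define w where "w = z + of_real t * (q - z)"
  have wz: "cmod (w - z) = \<delta> / 16"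
  proof -
    have "cmod (w - z) = t * cmod (z - q)" using t by (simp add: w_def norm_mult norm_minus_commute)
    then show ?thesis using c by (simp add: t_def)
  qed
  have "w - q = of_real (1 - t) * (z - q)" by (simp add: w_def algebra_simps)
  then have "cmod (w - q) = (1 - t) * cmod (z - q)" using t by (simp add: norm_mult del: of_real_diff)
  also have "\<dots> = cmod (z - q) - \<delta> / 16" using c by (simp add: t_def field_simps)
  finally have wq: "cmod (w - q) = cmod (z - q) - \<delta> / 16" .
  show thesis
  proof (rule that[of "Re w" "Im w"])
    have "\<bar>Re w - Re z\<bar> \<le> \<delta> / 16" "\<bar>Im w - Im z\<bar> \<le> \<delta> / 16"
      using abs_Re_le_cmod[of "w - z"] abs_Im_le_cmod[of "w - z"] wz by simp_all
    then show "\<bar>Re w - x0\<bar> \<le> 7 * \<delta> / 16" "\<bar>Im w - y0\<bar> \<le> 7 * \<delta> / 16" using pt by linarith+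
    show "sup_square (Re w) (Im w) (\<delta> / 32) \<subseteq> ball q r"
    proof
      fix v assume "v \<in> sup_square (Re w) (Im w) (\<delta> / 32)"
      then have "\<bar>Re (v - w)\<bar> \<le> \<delta> / 32" "\<bar>Im (v - w)\<bar> \<le> \<delta> / 32" by (auto simp: in_sup_square)
      then have "cmod (v - w) \<le> \<delta> / 16" using cmod_le[of "v - w"] by linarith
      moreover have "cmod (v - q) \<le> cmod (v - w) + cmod (w - q)" using norm_triangle_ineq[of "v - w" "w - q"] by simp
      ultimately have "cmod (v - q) < r" using wq r by linarith
      then show "v \<in> ball q r" by (simp add: dist_norm norm_minus_commute)
    qed
  qed
qed

lemma magnetic_data_pot_sum:
  assumes "u \<in> test_functions S"
  shows "magnetic_data u (\<lambda>z. m * pot_sum pot_x K z) (\<lambda>z. m * pot_sum pot_y K z)"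
proof
  show "u differentiable (at z)" for z by (rule test_functions_differentiable[OF assms])
  show "continuous_on UNIV u" "continuous_on UNIV (partial_x u)" "continuous_on UNIV (partial_y u)"
    using assms by (auto intro!: test_functions_continuous test_functions_partial)
  show "continuous_on UNIV (\<lambda>z. m * pot_sum pot_x K z)"
    by (intro continuous_on_mult continuous_on_const continuous_pot_sum continuous_pot_x)
  show "continuous_on UNIV (\<lambda>z. m * pot_sum pot_y K z)"
    by (intro continuous_on_mult continuous_on_const continuous_pot_sum continuous_pot_y)
qed

text \<open>In units of 2^-k an older centre has integer coordinates and a centre of level k
  half-integer ones, so they differ by at least 1/2.\<close>

lemma old_center_far:
  assumes "q \<in> grid i" "i < k" "z0 = grid_point k ab"
  shows "1 / 2 ^ k / 2 \<le> \<bar>Re q - Re z0\<bar>"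
proof -
  obtain a b where q: "q = grid_point i (a, b)" using assms(1) by (auto simp: grid_def)
  obtain c d where z0: "z0 = grid_point k (c, d)" using assms(3) by (cases ab) auto
  obtain m where k: "k = Suc (i + m)" using assms(2) less_imp_Suc_add by blast
  let ?N = "(2 * a + 1) * 2 ^ m - c :: int"
  have "(Re q - Re z0) * 2 ^ k = real_of_int ?N - 1 / 2"
    unfolding q z0 grid_point_def k by (simp add: power_add field_simps)
  moreover have "1 / 2 \<le> \<bar>real_of_int ?N - 1 / 2\<bar>"
  proof (cases "?N \<le> 0")
    case True
    then have "real_of_int ?N \<le> 0" by (simp only: of_int_le_0_iff)
    then show ?thesis by linarith
  next
    case False
    then have "1 \<le> ?N" by linarith
    then have "1 \<le> real_of_int ?N" by (simp only: of_int_1_le_iff)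
    then show ?thesis by linarith
  qed
  ultimately have "1 / 2 \<le> \<bar>Re q - Re z0\<bar> * 2 ^ k" by (metis abs_mult abs_of_nonneg zero_le_numeral zero_le_power)
  then show ?thesis by (simp add: field_simps)
qed

lemma set_integral_sup_square:
  fixes g :: "complex \<Rightarrow> real"
  assumes "continuous_on UNIV g"
  shows "(LINT z:sup_square x0 y0 \<rho>|lborel. g z) = rect_integral (x0 - \<rho>) (x0 + \<rho>) (y0 - \<rho>) (y0 + \<rho>) g"
    "set_integrable lborel (sup_square x0 y0 \<rho>) g"
  unfolding sup_square_def by (rule rect_integral_eq[OF assms])+

lemma measurable_pot_sum_disc: "pot_sum disc_density K \<in> borel_measurable borel"
  by (rule measurable_pot_sum[OF measurable_pots(5)])

lemma abs_pot_sum_disc_le: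
  obtains M where "\<And>z. \<bar>pot_sum disc_density K z\<bar> \<le> M"
proof
  fix z
  have "\<bar>pot_sum disc_density K z\<bar> \<le> (\<Sum>k<K. \<bar>stage disc_density k z\<bar>)" unfolding pot_sum_eq by (rule sum_abs)
  also have "\<dots> \<le> (\<Sum>k<K. flux k * (4 * 4 ^ k * (2 / (rad k)\<^sup>2)))"
    by (intro sum_mono abs_stage_le) (auto simp: disc_density_def indicator_def)
  finally show "\<bar>pot_sum disc_density K z\<bar> \<le> (\<Sum>k<K. flux k * (4 * 4 ^ k * (2 / (rad k)\<^sup>2)))" .
qed

lemma integrable_disc_u:
  assumes u: "u \<in> test_functions S"
  shows "integrable lborel (\<lambda>z. pot_sum disc_density K z * (cmod (u z))\<^sup>2)"
proof -
  obtain M where M: "\<And>z. \<bar>pot_sum disc_density K z\<bar> \<le> M" using abs_pot_sum_disc_le by blast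
  have iu: "integrable lborel (\<lambda>z. of_real (pot_sum disc_density K z) * u z)"
    by (rule integrable_bounded_mult_test_function[OF measurable_pot_sum_disc M u])
  obtain N where N: "\<And>z. cmod (u z) \<le> N" "0 \<le> N" using test_function_bounded[OF u] by blast
  show ?thesis
  proof (rule Bochner_Integration.integrable_bound)
    show "integrable lborel (\<lambda>z. of_real N * (of_real (pot_sum disc_density K z) * u z))"
      by (rule integrable_mult_right) (rule iu)
    have "(\<lambda>z. (cmod (u z))\<^sup>2) \<in> borel_measurable borel" using test_functions_measurable[OF u] by measurable
    then show "(\<lambda>z. pot_sum disc_density K z * (cmod (u z))\<^sup>2) \<in> borel_measurable lborel"
      using measurable_pot_sum_disc by simp
    show "AE z in lborel. norm (pot_sum disc_density K z * (cmod (u z))\<^sup>2) \<le> norm (of_real N * (of_real (pot_sum disc_density K z) * u z))"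
    proof (rule AE_I2)
      fix z
      have "\<bar>pot_sum disc_density K z\<bar> * cmod (u z) * cmod (u z) \<le> \<bar>pot_sum disc_density K z\<bar> * cmod (u z) * N"
        using N by (intro mult_left_mono) auto
      then show "norm (pot_sum disc_density K z * (cmod (u z))\<^sup>2) \<le> norm (of_real N * (of_real (pot_sum disc_density K z) * u z))"
        using N by (simp add: norm_mult abs_mult power2_eq_square mult_ac)
    qed
  qed
qed

text \<open>If the disc at the centre of the cell is kept and no older disc comes near the loops around it, their flux
  stays away from \<open>2\<pi>\<int>\<close>. Otherwise an older disc fills a fixed proportion of the cell, and there the density
  \<open>n \<Delta>\<phi>\<close> alone is at least of order \<open>4\<^sup>k\<close> by \<open>flux_decay\<close>.\<close>

lemma cell_estimate:
  fixes n :: nat and c0 :: real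
  assumes u: "u \<in> test_functions S" and z0: "z0 = grid_point k ab" "ab \<in> grid_index k" and K: "k < K"
    and n: "1 / 2048 \<le> real n * flux k" "real n * flux k \<le> 1 / 2"
    and d: "d = 1 / 2 ^ k"
    and c0: "0 < c0" "\<And>\<theta>. pi / 1024 \<le> \<theta> \<Longrightarrow> \<theta> \<le> 3 * pi / 2 \<Longrightarrow> c0 \<le> cmod (cis \<theta> - 1)"
  shows "(LINT z:sup_square (Re z0) (Im z0) (d / 2)|lborel. (cmod (u z))\<^sup>2) \<le>
    1024 * ((1 / c0 + 1)\<^sup>2 + 1) * d\<^sup>2 *
    ((LINT z:sup_square (Re z0) (Im z0) (d / 2)|lborel. (magnetic_data.dx u (\<lambda>z. real n * pot_sum pot_y K z) z)\<^sup>2) +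
     (LINT z:sup_square (Re z0) (Im z0) (d / 2)|lborel. (magnetic_data.dy u (\<lambda>z. real n * pot_sum pot_x K z) z)\<^sup>2) +
     real n * (LINT z:sup_square (Re z0) (Im z0) (d / 2)|lborel. pot_sum disc_density K z * (cmod (u z))\<^sup>2))"
proof -
  interpret magnetic_data u "\<lambda>z. real n * pot_sum pot_x K z" "\<lambda>z. real n * pot_sum pot_y K z"
    by (rule magnetic_data_pot_sum[OF u])
  let ?x = "Re z0" and ?y = "Im z0"
  let ?A = "sup_square ?x ?y (d / 2)"
  let ?Q = "rect_integral (?x - d / 2) (?x + d / 2) (?y - d / 2) (?y + d / 2)"
  let ?U = "\<lambda>z. (cmod (u z))\<^sup>2"
  have cU: "continuous_on UNIV ?U" and cX: "continuous_on UNIV (\<lambda>z. (dx z)\<^sup>2)" and cY: "continuous_on UNIV (\<lambda>z. (dy z)\<^sup>2)"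
    using cont continuous_d by (auto intro!: continuous_intros)
  have dpos: "0 < d" by (simp add: d)
  have n0: "0 < real n" using n(1) flux_pos[of k] by (cases "n = 0") auto
  define V where "V = (LINT z:?A|lborel. pot_sum disc_density K z * ?U z)"
  have intV: "set_integrable lborel B (\<lambda>z. pot_sum disc_density K z * ?U z)" if "B \<in> sets borel" for B
    unfolding set_integrable_def by (rule integrable_mult_indicator[OF _ integrable_disc_u[OF u]]) (use that in simp)
  have V0: "0 \<le> V"
    unfolding V_def set_lebesgue_integral_def
    by (intro Bochner_Integration.integral_nonneg) (simp add: pot_sum_disc_nonneg)
  have nn: "0 \<le> ?Q (\<lambda>z. (dx z)\<^sup>2)" "0 \<le> ?Q (\<lambda>z. (dy z)\<^sup>2)"
    unfolding set_integral_sup_square(1)[OF cX, symmetric] set_integral_sup_square(1)[OF cY, symmetric] set_lebesgue_integral_def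
    by (intro Bochner_Integration.integral_nonneg; simp)+
  let ?C = "(1 / c0 + 1)\<^sup>2"
  have C: "0 \<le> ?C" by simp
  have main: "?Q ?U \<le> 1024 * (?C + 1) * d\<^sup>2 * (?Q (\<lambda>z. (dx z)\<^sup>2) + ?Q (\<lambda>z. (dy z)\<^sup>2) + real n * V)"
  proof (cases "\<exists>i q. i < k \<and> q \<in> kept i \<and> ball q (rad i) \<inter> sup_square ?x ?y (3 * d / 8) \<noteq> {}")
    case True
    then obtain i q z where i: "i < k" "q \<in> kept i" "z \<in> ball q (rad i)" "z \<in> sup_square ?x ?y (3 * d / 8)" by blast
    have "q \<in> grid i" using i(2) kept_subset by blast
    from old_center_far[OF this i(1) z0(1)] have far: "d / 2 \<le> \<bar>Re q - ?x\<bar>" by (simp only: d)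
    obtain x1 y1 where E: "\<bar>x1 - ?x\<bar> \<le> 7 * d / 16" "\<bar>y1 - ?y\<bar> \<le> 7 * d / 16" "sup_square x1 y1 (d / 32) \<subseteq> ball q (rad i)"
      by (rule ball_meets_square[of z q "rad i" ?x d ?y]) (use i far dpos in \<open>auto simp: in_sup_square\<close>)
    let ?B = "sup_square x1 y1 (d / 32)"
    have BA: "?B \<subseteq> ?A"
    proof
      fix v assume "v \<in> ?B"
      then have "\<bar>Re v - x1\<bar> \<le> d / 32" "\<bar>Im v - y1\<bar> \<le> d / 32" by (auto simp: in_sup_square)
      then have "\<bar>Re v - ?x\<bar> \<le> d / 2" "\<bar>Im v - ?y\<bar> \<le> d / 2" using E(1,2) dpos by linarith+
      then show "v \<in> ?A" by (simp add: in_sup_square)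
    qed
    let ?c = "flux i * (2 / (rad i)\<^sup>2)"
    have cval: "pot_sum disc_density K v = ?c" if "v \<in> ?B" for v
    proof -
      have "v \<in> ball q (rad i)" using that E(3) by blast
      from stage_disc_eq[OF i(2) this] have "pot_sum disc_density K v = (\<Sum>j<K. if j = i then ?c else 0)"
        unfolding pot_sum_eq by (simp only:)
      then show ?thesis using i(1) K by simp
    qed
    have "?c * (LINT z:?B|lborel. ?U z) = (LINT z:?B|lborel. ?c * ?U z)" by (simp only: set_integral_mult_right)
    also have "\<dots> = (LINT z:?B|lborel. pot_sum disc_density K z * ?U z)"
      by (rule set_lebesgue_integral_cong) (use sets_sup_square in \<open>simp_all add: cval\<close>)
    also have "\<dots> \<le> V"
      unfolding V_def set_lebesgue_integral_def
    proof (rule integral_mono[OF intV[OF sets_sup_square, unfolded set_integrable_def] intV[OF sets_sup_square, unfolded set_integrable_def]])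
      fix z
      have "0 \<le> pot_sum disc_density K z * ?U z" by (simp add: pot_sum_disc_nonneg)
      then show "indicator ?B z *\<^sub>R (pot_sum disc_density K z * ?U z) \<le> indicator ?A z *\<^sub>R (pot_sum disc_density K z * ?U z)"
        using BA by (cases "z \<in> ?B") (auto simp: indicator_def)
    qed
    finally have cB: "?c * (LINT z:?B|lborel. ?U z) \<le> V" .
    \<comment> \<open>By \<open>flux_decay\<close>, n times the density is at least (8192 / 2048) *
      64^k, which exceeds 1 / d^2 = 4^k.\<close>
    have nc: "1 / d\<^sup>2 \<le> real n * ?c"
    proof -
      have fk: "0 < flux k" by (rule flux_pos)
      have "8192 * 64 ^ k * flux k \<le> ?c" using flux_decay[OF i(1)] fk by (simp only: pos_le_divide_eq)
      then have "real n * (8192 * 64 ^ k * flux k) \<le> real n * ?c" by (rule mult_left_mono) simp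
      moreover have "real n * (8192 * 64 ^ k * flux k) = 8192 * 64 ^ k * (real n * flux k)" by simp
      moreover have "8192 * 64 ^ k * (1 / 2048) \<le> 8192 * 64 ^ k * (real n * flux k)" using n(1) by (intro mult_left_mono) auto
      moreover have "(4::real) ^ k \<le> 64 ^ k" by (intro power_mono) auto
      moreover have "(0::real) < 64 ^ k" by simp
      moreover have "1 / d\<^sup>2 = 4 ^ k" by (simp add: d power_divide power2_eq_square flip: power_mult_distrib)
      ultimately show ?thesis by linarith
    qed
    have "(LINT z:?B|lborel. ?U z) \<le> d\<^sup>2 * (real n * V)"
    proof -
      have U0: "0 \<le> (LINT z:?B|lborel. ?U z)" unfolding set_lebesgue_integral_def by (intro Bochner_Integration.integral_nonneg) simp
      have "1 / d\<^sup>2 * (LINT z:?B|lborel. ?U z) \<le> real n * ?c * (LINT z:?B|lborel. ?U z)" by (rule mult_right_mono[OF nc U0])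
      also have "\<dots> = real n * (?c * (LINT z:?B|lborel. ?U z))" by (simp only: mult.assoc)
      also have "\<dots> \<le> real n * V" by (rule mult_left_mono[OF cB]) simp
      finally show ?thesis using dpos by (simp add: field_simps)
    qed
    then have EB: "rect_integral (x1 - d / 32) (x1 + d / 32) (y1 - d / 32) (y1 + d / 32) ?U \<le> d\<^sup>2 * (real n * V)"
      unfolding set_integral_sup_square(1)[OF cU] .
    have "?Q ?U \<le> 1024 * (d\<^sup>2 * (real n * V) + d\<^sup>2 * (?Q (\<lambda>z. (dx z)\<^sup>2) + ?Q (\<lambda>z. (dy z)\<^sup>2)))"
      by (rule order_trans[OF cell_bound_square[OF dpos E(1,2)] mult_left_mono[OF add_right_mono[OF EB]]]) simp
    also have "\<dots> = 1 * (1024 * d\<^sup>2 * (?Q (\<lambda>z. (dx z)\<^sup>2) + ?Q (\<lambda>z. (dy z)\<^sup>2) + real n * V))" by (simp add: algebra_simps)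
    also have "\<dots> \<le> (?C + 1) * (1024 * d\<^sup>2 * (?Q (\<lambda>z. (dx z)\<^sup>2) + ?Q (\<lambda>z. (dy z)\<^sup>2) + real n * V))"
      using C nn V0 n0 by (intro mult_right_mono) auto
    also have "\<dots> = 1024 * (?C + 1) * d\<^sup>2 * (?Q (\<lambda>z. (dx z)\<^sup>2) + ?Q (\<lambda>z. (dy z)\<^sup>2) + real n * V)"
      by (simp only: mult.assoc mult.left_commute)
    finally show ?thesis .
  next
    case False
    then have old: "\<And>i q. i < k \<Longrightarrow> q \<in> kept i \<Longrightarrow> ball q (rad i) \<inter> sup_square ?x ?y (3 * d / 8) = {}" by blast
    \<comment> \<open>The disc around \<open>z0\<close> lies in the square of half-side 3 d/8, which
      no older disc meets, so it passed the disjointness test.\<close>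
    have kept: "z0 \<in> kept k"
      unfolding kept_iff
    proof (intro conjI allI impI ballI)
      show "z0 \<in> grid k" using z0 by (auto simp: grid_def)
      fix i q assume i: "i < k" "q \<in> kept i"
      have "ball z0 (rad k) \<subseteq> sup_square ?x ?y (3 * d / 8)"
      proof
        fix z assume "z \<in> ball z0 (rad k)"
        then have "cmod (z - z0) < rad k" by (simp add: dist_norm norm_minus_commute)
        moreover have "(1 / 2 :: real) ^ k = d" by (simp add: d power_one_over)
        ultimately have "cmod (z - z0) \<le> 3 * d / 8" using rad_le_cell[of k] dpos by simp
        then show "z \<in> sup_square ?x ?y (3 * d / 8)" using abs_Re_le_cmod[of "z - z0"] abs_Im_le_cmod[of "z - z0"] by (simp add: in_sup_square)
      qed
      then show "disjnt (ball z0 (rad k)) (ball q (rad i))" using old[OF i] unfolding disjnt_def by blast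
    qed
    have flux: "c0 \<le> cmod (cis (outward_flux (\<lambda>z. real n * pot_sum pot_x K z) (\<lambda>z. real n * pot_sum pot_y K z) ?x ?y \<rho>) - 1)"
      if \<rho>: "d / 4 \<le> \<rho>" "\<rho> \<le> 3 * d / 8" for \<rho>
    proof -
      have \<rho>0: "0 \<le> \<rho>" using \<rho> dpos by linarith
      define F where "F = (\<Sum>i<K. flux i * (\<Sum>p\<in>kept i. disc_mass i p (sup_square ?x ?y \<rho>)))"
      have F: "2 * pi * flux k \<le> F" "F \<le> 2 * pi * flux k * (256 / 255)"
        unfolding F_def by (rule loop_flux_bounds[OF z0(1) kept K d old \<rho>]; assumption)+
      have "2 * pi * (1 / 2048) \<le> 2 * pi * (real n * flux k)" using n(1) by (intro mult_left_mono) auto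
      also have "\<dots> = real n * (2 * pi * flux k)" by simp
      also have "\<dots> \<le> real n * F" using F(1) by (intro mult_left_mono) auto
      finally have lo: "pi / 1024 \<le> real n * F" by simp
      have "real n * F \<le> real n * (2 * pi * flux k * (256 / 255))" using F(2) by (intro mult_left_mono) auto
      also have "\<dots> = 2 * pi * (256 / 255) * (real n * flux k)" by simp
      also have "\<dots> \<le> 2 * pi * (256 / 255) * (1 / 2)" using n(2) by (intro mult_left_mono) auto
      also have "\<dots> \<le> 3 * pi / 2" by simp
      finally have hi: "real n * F \<le> 3 * pi / 2" .
      show ?thesis unfolding outward_flux_pot_sum[OF \<rho>0] F_def[symmetric] by (rule c0(2)[OF lo hi])
    qed
    have "?Q ?U \<le> 256 * (?C + 1) * d\<^sup>2 * (?Q (\<lambda>z. (dx z)\<^sup>2) + ?Q (\<lambda>z. (dy z)\<^sup>2))"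
      by (rule cell_bound_loops[OF dpos c0(1) flux])
    also have "\<dots> \<le> 1024 * (?C + 1) * d\<^sup>2 * (?Q (\<lambda>z. (dx z)\<^sup>2) + ?Q (\<lambda>z. (dy z)\<^sup>2) + real n * V)"
      using C nn V0 n0 by (intro mult_mono) auto
    finally show ?thesis .
  qed
  then show ?thesis
    unfolding set_integral_sup_square(1)[OF cU] set_integral_sup_square(1)[OF cX] set_integral_sup_square(1)[OF cY] V_def .
qed

section \<open>Summation over the cells\<close>

lemma set_integral_cbox_eq_box:
  fixes g :: "complex \<Rightarrow> real"
  assumes "g \<in> borel_measurable borel"
  shows "(LINT z:cbox a b|lborel. g z) = (LINT z:box a b|lborel. g z)"
  unfolding set_lebesgue_integral_def
proof (rule integral_cong_AE)
  show "(\<lambda>z. indicator (cbox a b) z *\<^sub>R g z) \<in> borel_measurable lborel" "(\<lambda>z. indicator (box a b) z *\<^sub>R g z) \<in> borel_measurable lborel"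
    by (rule measurable_indicator_scaleR[OF assms], simp)+
  have "cbox a b - box a b \<in> null_sets lborel"
    using negligible_frontier_interval[of a b] by (simp add: negligible_iff_null_sets null_sets_completion_iff)
  then have "AE z in lborel. z \<notin> cbox a b - box a b" by (rule AE_not_in)
  then show "AE z in lborel. indicator (cbox a b) z *\<^sub>R g z = indicator (box a b) z *\<^sub>R g z"
  proof eventually_elim
    case (elim z)
    then show ?case using box_subset_cbox[of a b] by (cases "z \<in> box a b") (auto simp: indicator_def)
  qed
qed

definition cell :: "nat \<Rightarrow> int \<times> int \<Rightarrow> complex set" where
  "cell k ab = sup_square (Re (grid_point k ab)) (Im (grid_point k ab)) (1 / 2 ^ k / 2)"

lemma finite_grid_index: "finite (grid_index k)" by (simp add: grid_index_def)

lemma cell_eq: "cell k (a, b) = cbox (Complex (of_int a / 2 ^ k) (of_int b / 2 ^ k)) (Complex ((of_int a + 1) / 2 ^ k) ((of_int b + 1) / 2 ^ k))"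
  unfolding cell_def sup_square_def grid_point_def
  by (simp add: add_divide_distrib add.commute)

lemma ball_subset_cells: "ball 0 1 \<subseteq> (\<Union>ab\<in>grid_index k. cell k ab)"
proof
  fix z :: complex assume "z \<in> ball 0 1"
  then have z: "\<bar>Re z\<bar> < 1" "\<bar>Im z\<bar> < 1" using abs_Re_le_cmod[of z] abs_Im_le_cmod[of z] by auto
  have *: "- (2 ^ k) \<le> \<lfloor>x * 2 ^ k\<rfloor> \<and> \<lfloor>x * 2 ^ k\<rfloor> < 2 ^ k \<and> of_int \<lfloor>x * 2 ^ k\<rfloor> / 2 ^ k \<le> x \<and> x \<le> (of_int \<lfloor>x * 2 ^ k\<rfloor> + 1) / 2 ^ k"
    if "\<bar>x\<bar> < 1" for x :: real
  proof -
    have "\<bar>x * 2 ^ k\<bar> < 2 ^ k" using that by (simp add: abs_mult)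
    then have b: "- (2 ^ k) \<le> x * 2 ^ k" "x * 2 ^ k < 2 ^ k" by (simp_all add: abs_less_iff)
    have "real_of_int (- (2 ^ k)) \<le> x * 2 ^ k" "x * 2 ^ k < real_of_int (2 ^ k)" using b by simp_all
    then have "- (2 ^ k) \<le> \<lfloor>x * 2 ^ k\<rfloor>" "\<lfloor>x * 2 ^ k\<rfloor> < 2 ^ k" by (simp_all only: le_floor_iff floor_less_iff)
    moreover have "real_of_int \<lfloor>x * 2 ^ k\<rfloor> \<le> x * 2 ^ k" "x * 2 ^ k \<le> real_of_int \<lfloor>x * 2 ^ k\<rfloor> + 1" by linarith+
    ultimately show ?thesis by (simp add: field_simps)
  qed
  let ?ab = "(\<lfloor>Re z * 2 ^ k\<rfloor>, \<lfloor>Im z * 2 ^ k\<rfloor>)"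
  have "?ab \<in> grid_index k" using *[OF z(1)] *[OF z(2)] by (simp add: grid_index_def)
  moreover have "z \<in> cell k ?ab" unfolding cell_eq in_cbox_complex_iff using *[OF z(1)] *[OF z(2)] by simp
  ultimately show "z \<in> (\<Union>ab\<in>grid_index k. cell k ab)" by blast
qed

lemma sets_cell: "cell k ab \<in> sets borel" by (simp add: cell_def sets_sup_square)

text \<open>The closed cells cover the unit disc, and overlaps along their edges only enlarge the
  right-hand side.\<close>

lemma integral_le_sum_cells:
  fixes g :: "complex \<Rightarrow> real"
  assumes g: "integrable lborel g" "\<And>z. 0 \<le> g z" and supp: "\<And>z. z \<notin> ball 0 1 \<Longrightarrow> g z = 0"
  shows "(LINT z|lborel. g z) \<le> (\<Sum>ab\<in>grid_index k. LINT z:cell k ab|lborel. g z)"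
proof -
  have i: "integrable lborel (\<lambda>z. indicator (cell k ab) z *\<^sub>R g z)" for ab
    using sets_cell by (intro integrable_mult_indicator g) simp
  have "(LINT z|lborel. g z) \<le> (LINT z|lborel. (\<Sum>ab\<in>grid_index k. indicator (cell k ab) z *\<^sub>R g z))"
  proof (rule integral_mono[OF g(1)])
    show "integrable lborel (\<lambda>z. \<Sum>ab\<in>grid_index k. indicator (cell k ab) z *\<^sub>R g z)" by (intro Bochner_Integration.integrable_sum i)
    fix z
    show "g z \<le> (\<Sum>ab\<in>grid_index k. indicator (cell k ab) z *\<^sub>R g z)"
    proof (cases "z \<in> ball 0 1")
      case True
      then obtain ab where ab: "ab \<in> grid_index k" "z \<in> cell k ab" using ball_subset_cells[of k] by blast
      have "g z = indicator (cell k ab) z *\<^sub>R g z" using ab by simp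
      also have "\<dots> \<le> (\<Sum>ab\<in>grid_index k. indicator (cell k ab) z *\<^sub>R g z)"
        by (rule member_le_sum[OF ab(1)]) (use g finite_grid_index in auto)
      finally show ?thesis .
    next
      case False
      then show ?thesis using supp[of z] by simp
    qed
  qed
  also have "\<dots> = (\<Sum>ab\<in>grid_index k. LINT z:cell k ab|lborel. g z)"
    unfolding set_lebesgue_integral_def by (rule Bochner_Integration.integral_sum) (rule i)
  finally show ?thesis .
qed

text \<open>Here overlaps count against the inequality, so each cell is replaced by its interior,
  from which it differs by a null set; the interiors are disjoint.\<close>

lemma sum_cells_le_integral:
  fixes g :: "complex \<Rightarrow> real"
  assumes g: "integrable lborel g" "\<And>z. 0 \<le> g z"
  shows "(\<Sum>ab\<in>grid_index k. LINT z:cell k ab|lborel. g z) \<le> (LINT z|lborel. g z)"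
proof -
  define ob where "ob ab = box (Complex (of_int (fst ab) / 2 ^ k) (of_int (snd ab) / 2 ^ k)) (Complex ((of_int (fst ab) + 1) / 2 ^ k) ((of_int (snd ab) + 1) / 2 ^ k))" for ab :: "int \<times> int"
  have m: "g \<in> borel_measurable borel" using g(1) by auto
  have i: "integrable lborel (\<lambda>z. indicator (ob ab) z *\<^sub>R g z)" for ab
    by (intro integrable_mult_indicator g) (simp add: ob_def)
  have disj: "ab = cd" if "z \<in> ob ab" "z \<in> ob cd" for z ab cd
  proof -
    have *: "a = c" if "of_int a / 2 ^ k < x" "x < (of_int a + 1) / 2 ^ k" "of_int c / 2 ^ k < x" "x < (of_int c + 1) / 2 ^ k" for a c :: int and x :: real
    proof -
      have "real_of_int a < x * 2 ^ k" "x * 2 ^ k < real_of_int a + 1" "real_of_int c < x * 2 ^ k" "x * 2 ^ k < real_of_int c + 1"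
        using that by (simp_all add: field_simps)
      then have "real_of_int a < real_of_int c + 1" "real_of_int c < real_of_int a + 1" by linarith+
      then show ?thesis by linarith
    qed
    show ?thesis using that unfolding ob_def in_box_complex_iff
      by (intro prod_eqI *[of _ "Re z"] *[of _ "Im z"]) auto
  qed
  have "(\<Sum>ab\<in>grid_index k. LINT z:cell k ab|lborel. g z) = (\<Sum>ab\<in>grid_index k. LINT z:ob ab|lborel. g z)"
  proof (rule sum.cong[OF refl])
    fix ab :: "int \<times> int"
    show "(LINT z:cell k ab|lborel. g z) = (LINT z:ob ab|lborel. g z)"
      using cell_eq[of k "fst ab" "snd ab"] set_integral_cbox_eq_box[OF m] by (simp add: ob_def)
  qed
  also have "\<dots> = (LINT z|lborel. (\<Sum>ab\<in>grid_index k. indicator (ob ab) z *\<^sub>R g z))"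
    unfolding set_lebesgue_integral_def by (rule Bochner_Integration.integral_sum[symmetric]) (rule i)
  also have "\<dots> \<le> (LINT z|lborel. g z)"
  proof (rule integral_mono[OF _ g(1)])
    show "integrable lborel (\<lambda>z. \<Sum>ab\<in>grid_index k. indicator (ob ab) z *\<^sub>R g z)" by (intro Bochner_Integration.integrable_sum i)
    fix z
    show "(\<Sum>ab\<in>grid_index k. indicator (ob ab) z *\<^sub>R g z) \<le> g z"
    proof (cases "\<exists>cd\<in>grid_index k. z \<in> ob cd")
      case True
      then obtain cd where cd: "cd \<in> grid_index k" "z \<in> ob cd" by blast
      have "(\<Sum>ab\<in>grid_index k. indicator (ob ab) z *\<^sub>R g z) = (\<Sum>ab\<in>grid_index k. if ab = cd then g z else 0)"
      proof (rule sum.cong[OF refl])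
        fix ab
        show "indicator (ob ab) z *\<^sub>R g z = (if ab = cd then g z else 0)"
          using disj[OF _ cd(2), of ab] cd(2) by (cases "z \<in> ob ab") auto
      qed
      also have "\<dots> = g z" using cd(1) finite_grid_index[of k] by (simp only: sum.delta if_True)
      finally show ?thesis by simp
    next
      case False
      then have "(\<Sum>ab\<in>grid_index k. indicator (ob ab) z *\<^sub>R g z) = 0" by (intro sum.neutral) simp
      then show ?thesis using g(2) by simp
    qed
  qed
  finally show ?thesis .
qed

lemma integrable_continuous_ball:
  fixes g :: "complex \<Rightarrow> real"
  assumes "continuous_on UNIV g" "\<And>z. z \<notin> ball 0 1 \<Longrightarrow> g z = 0"
  shows "integrable lborel g" "(LINT z:ball 0 1|lborel. g z) = (LINT z|lborel. g z)"
proof -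
  have eq: "indicator (ball 0 1) z *\<^sub>R g z = g z" for z using assms(2)[of z] by (cases "z \<in> ball 0 1") simp_all
  show "integrable lborel g" using continuous_set_integrable_ball[OF assms(1)] unfolding set_integrable_def eq .
  show "(LINT z:ball 0 1|lborel. g z) = (LINT z|lborel. g z)" unfolding set_lebesgue_integral_def eq ..
qed

lemma integrable_pot_total_disc_u:
  assumes u: "u \<in> test_functions (ball 0 1)"
  shows "integrable lborel (\<lambda>z. indicator (ball 0 1) z *\<^sub>R (pot_total disc_density z * (cmod (u z))\<^sup>2))"
proof -
  obtain N where N: "\<And>z. cmod (u z) \<le> N" "0 \<le> N" using test_function_bounded[OF u] by blast
  show ?thesis
  proof (rule Bochner_Integration.integrable_bound)
    show "integrable lborel (\<lambda>z. N\<^sup>2 * pot_total disc_density z)" by (intro integrable_mult_right integrable_pot_total_disc)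
    have "(\<lambda>z. (cmod (u z))\<^sup>2) \<in> borel_measurable borel" using test_functions_measurable[OF u] by measurable
    then have "(\<lambda>z. pot_total disc_density z * (cmod (u z))\<^sup>2) \<in> borel_measurable borel"
      by (intro borel_measurable_times measurable_pot_total measurable_pots)
    then show "(\<lambda>z. indicator (ball 0 1) z *\<^sub>R (pot_total disc_density z * (cmod (u z))\<^sup>2)) \<in> borel_measurable lborel"
      by (rule measurable_indicator_scaleR) simp
    show "AE z in lborel. norm (indicator (ball 0 1) z *\<^sub>R (pot_total disc_density z * (cmod (u z))\<^sup>2)) \<le> norm (N\<^sup>2 * pot_total disc_density z)"
    proof (rule AE_I2)
      fix z
      have "(cmod (u z))\<^sup>2 \<le> N\<^sup>2" using N by (intro power_mono) auto
      then have "pot_total disc_density z * (cmod (u z))\<^sup>2 \<le> N\<^sup>2 * pot_total disc_density z"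
        using mult_right_mono[of "(cmod (u z))\<^sup>2" "N\<^sup>2", OF _ pot_total_disc_nonneg[of z]] by (simp only: mult.commute[of "(cmod (u z))\<^sup>2"])
      then show "norm (indicator (ball 0 1) z *\<^sub>R (pot_total disc_density z * (cmod (u z))\<^sup>2)) \<le> norm (N\<^sup>2 * pot_total disc_density z)"
        using pot_total_disc_nonneg[of z] by (simp add: indicator_def abs_mult)
    qed
  qed
qed

text \<open>The sum of the cell estimates. The factor (1/4)^k is the square of the side of the
  cells; the constant is the same for all truncations \<open>K\<close> beyond k, and the potential
  term is enlarged to the full density.\<close>

lemma truncated_estimate:
  fixes n :: nat and c0 :: real
  assumes u: "u \<in> test_functions (ball 0 1)" and K: "k < K"
    and n: "1 / 2048 \<le> real n * flux k" "real n * flux k \<le> 1 / 2"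
    and c0: "0 < c0" "\<And>\<theta>. pi / 1024 \<le> \<theta> \<Longrightarrow> \<theta> \<le> 3 * pi / 2 \<Longrightarrow> c0 \<le> cmod (cis \<theta> - 1)"
  shows "(LINT z:ball 0 1|lborel. (cmod (u z))\<^sup>2) \<le> 1024 * ((1 / c0 + 1)\<^sup>2 + 1) * (1 / 4) ^ k *
    ((LINT z:ball 0 1|lborel. (cmod (partial_x u z + \<i> * of_real (real n * pot_sum pot_y K z) * u z))\<^sup>2 +
      (cmod (partial_y u z - \<i> * of_real (real n * pot_sum pot_x K z) * u z))\<^sup>2) + real n * potential_energy u)"
proof -
  interpret magnetic_data u "\<lambda>z. real n * pot_sum pot_x K z" "\<lambda>z. real n * pot_sum pot_y K z"
    by (rule magnetic_data_pot_sum[OF u])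
  let ?U = "\<lambda>z. (cmod (u z))\<^sup>2" and ?V = "\<lambda>z. pot_sum disc_density K z * (cmod (u z))\<^sup>2"
  let ?C = "1024 * ((1 / c0 + 1)\<^sup>2 + 1) * (1 / 4) ^ k"
  have C: "0 \<le> ?C" by simp
  have cU: "continuous_on UNIV ?U" and cX: "continuous_on UNIV (\<lambda>z. (dx z)\<^sup>2)" and cY: "continuous_on UNIV (\<lambda>z. (dy z)\<^sup>2)"
    using cont continuous_d by (auto intro!: continuous_intros)
  have z: "u z = 0" "partial_x u z = 0" "partial_y u z = 0" if "z \<notin> ball 0 1" for z
    using test_functions_eq_0[OF u that] test_functions_eq_0[OF test_functions_partial[OF u] that] by simp_all
  have U: "integrable lborel ?U" "(LINT z:ball 0 1|lborel. ?U z) = (LINT z|lborel. ?U z)"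
    using integrable_continuous_ball[OF cU] z(1) by simp_all
  have X: "integrable lborel (\<lambda>z. (dx z)\<^sup>2)" "(LINT z:ball 0 1|lborel. (dx z)\<^sup>2) = (LINT z|lborel. (dx z)\<^sup>2)"
    using integrable_continuous_ball[OF cX] z by (simp_all add: dx_def)
  have Y: "integrable lborel (\<lambda>z. (dy z)\<^sup>2)" "(LINT z:ball 0 1|lborel. (dy z)\<^sup>2) = (LINT z|lborel. (dy z)\<^sup>2)"
    using integrable_continuous_ball[OF cY] z by (simp_all add: dy_def)
  have V: "integrable lborel ?V" by (rule integrable_disc_u[OF u])
  have d2: "(1 / 2 ^ k)\<^sup>2 = (1 / 4 :: real) ^ k" by (simp add: power_divide power2_eq_square flip: power_mult_distrib)
  have "(LINT z:ball 0 1|lborel. ?U z) \<le> (\<Sum>ab\<in>grid_index k. LINT z:cell k ab|lborel. ?U z)"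
    unfolding U(2) by (rule integral_le_sum_cells[OF U(1)]) (simp_all add: z)
  also have "\<dots> \<le> (\<Sum>ab\<in>grid_index k. ?C * ((LINT z:cell k ab|lborel. (dx z)\<^sup>2) + (LINT z:cell k ab|lborel. (dy z)\<^sup>2) + real n * (LINT z:cell k ab|lborel. ?V z)))"
  proof (rule sum_mono)
    fix ab assume ab: "ab \<in> grid_index k"
    show "(LINT z:cell k ab|lborel. ?U z) \<le> ?C * ((LINT z:cell k ab|lborel. (dx z)\<^sup>2) + (LINT z:cell k ab|lborel. (dy z)\<^sup>2) + real n * (LINT z:cell k ab|lborel. ?V z))"
      unfolding cell_def d2[symmetric] by (rule cell_estimate[OF u refl ab K n refl c0])
  qed
  also have "\<dots> = ?C * ((\<Sum>ab\<in>grid_index k. LINT z:cell k ab|lborel. (dx z)\<^sup>2) + (\<Sum>ab\<in>grid_index k. LINT z:cell k ab|lborel. (dy z)\<^sup>2) + real n * (\<Sum>ab\<in>grid_index k. LINT z:cell k ab|lborel. ?V z))"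
    by (simp only: sum.distrib sum_distrib_left[symmetric])
  also have "\<dots> \<le> ?C * ((LINT z|lborel. (dx z)\<^sup>2) + (LINT z|lborel. (dy z)\<^sup>2) + real n * potential_energy u)"
  proof (intro mult_left_mono[OF _ C] add_mono)
    show "(\<Sum>ab\<in>grid_index k. LINT z:cell k ab|lborel. (dx z)\<^sup>2) \<le> (LINT z|lborel. (dx z)\<^sup>2)" by (rule sum_cells_le_integral[OF X(1)]) simp
    show "(\<Sum>ab\<in>grid_index k. LINT z:cell k ab|lborel. (dy z)\<^sup>2) \<le> (LINT z|lborel. (dy z)\<^sup>2)" by (rule sum_cells_le_integral[OF Y(1)]) simp
    have "(\<Sum>ab\<in>grid_index k. LINT z:cell k ab|lborel. ?V z) \<le> (LINT z|lborel. ?V z)"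
      by (rule sum_cells_le_integral[OF V]) (simp add: pot_sum_disc_nonneg)
    also have "\<dots> \<le> potential_energy u"
      unfolding potential_energy_def set_lebesgue_integral_def
    proof (rule integral_mono[OF V integrable_pot_total_disc_u[OF u]])
      fix z
      show "?V z \<le> indicator (ball 0 1) z *\<^sub>R (pot_total disc_density z * (cmod (u z))\<^sup>2)"
        using z(1)[of z] pot_sum_disc_le[of K z] by (cases "z \<in> ball 0 1") (auto intro: mult_right_mono)
    qed
    finally show "real n * (\<Sum>ab\<in>grid_index k. LINT z:cell k ab|lborel. ?V z) \<le> real n * potential_energy u"
      by (rule mult_left_mono) simp
  qed
  also have "(LINT z|lborel. (dx z)\<^sup>2) + (LINT z|lborel. (dy z)\<^sup>2) = (LINT z:ball 0 1|lborel. (dx z)\<^sup>2 + (dy z)\<^sup>2)"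
    unfolding X(2)[symmetric] Y(2)[symmetric]
    by (rule set_integral_add(2)[symmetric]; rule continuous_set_integrable_ball; rule cX cY)
  finally show ?thesis unfolding dx_def dy_def .
qed

text \<open>Dominated convergence: test functions and their derivatives are bounded, so all
  integrands lie below a multiple of 1 + n^2 \<open>grad_major\<close>^2 on the unit disc.\<close>

lemma truncated_energy_tendsto:
  assumes u: "u \<in> test_functions (ball 0 1)"
  shows "(\<lambda>K. LINT z:ball 0 1|lborel. (cmod (partial_x u z + \<i> * of_real (real n * pot_sum pot_y K z) * u z))\<^sup>2 +
      (cmod (partial_y u z - \<i> * of_real (real n * pot_sum pot_x K z) * u z))\<^sup>2) \<longlonglongrightarrow> magnetic_energy n u"
  unfolding magnetic_energy_def set_lebesgue_integral_def
proof -
  have ux: "partial_x u \<in> test_functions (ball 0 1)" and uy: "partial_y u \<in> test_functions (ball 0 1)"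
    using u by (auto intro!: test_functions_partial)
  obtain M1 where M1: "\<And>z. cmod (u z) \<le> M1" using test_function_bounded[OF u] by blast
  obtain M2 where M2: "\<And>z. cmod (partial_x u z) \<le> M2" using test_function_bounded[OF ux] by blast
  obtain M3 where M3: "\<And>z. cmod (partial_y u z) \<le> M3" using test_function_bounded[OF uy] by blast
  let ?M = "\<bar>M1\<bar> + \<bar>M2\<bar> + \<bar>M3\<bar>"
  let ?w = "\<lambda>z. indicator (ball 0 1) z *\<^sub>R (4 * ?M\<^sup>2 * (1 + (real n)\<^sup>2 * (grad_major z)\<^sup>2))"
  have um: "u \<in> borel_measurable borel" "partial_x u \<in> borel_measurable borel" "partial_y u \<in> borel_measurable borel"
    using u ux uy by (auto intro: test_functions_measurable)
  have meas: "(\<lambda>z. indicator (ball 0 1) z *\<^sub>R ((cmod (partial_x u z + \<i> * of_real (real n * g z) * u z))\<^sup>2 + (cmod (partial_y u z - \<i> * of_real (real n * h z) * u z))\<^sup>2)) \<in> borel_measurable lborel"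
    if "g \<in> borel_measurable borel" "h \<in> borel_measurable borel" for g h :: "complex \<Rightarrow> real"
  proof (rule measurable_indicator_scaleR)
    show "(\<lambda>z. (cmod (partial_x u z + \<i> * of_real (real n * g z) * u z))\<^sup>2 + (cmod (partial_y u z - \<i> * of_real (real n * h z) * u z))\<^sup>2) \<in> borel_measurable borel"
      using um that by measurable
  qed simp
  show "(\<lambda>K. LINT z|lborel. indicator (ball 0 1) z *\<^sub>R ((cmod (partial_x u z + \<i> * of_real (real n * pot_sum pot_y K z) * u z))\<^sup>2 +
      (cmod (partial_y u z - \<i> * of_real (real n * pot_sum pot_x K z) * u z))\<^sup>2)) \<longlonglongrightarrow>
     (LINT z|lborel. indicator (ball 0 1) z *\<^sub>R ((cmod (partial_x u z + \<i> * of_real (real n * pot_total pot_y z) * u z))\<^sup>2 +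
      (cmod (partial_y u z - \<i> * of_real (real n * pot_total pot_x z) * u z))\<^sup>2))"
  proof (rule integral_dominated_convergence[where w = ?w])
    show "integrable lborel ?w"
      using set_integral_add(1)[OF set_integrable_const_ball[of 1] set_integrable_mult_right[OF integrable_grad_major_sq, of "(real n)\<^sup>2"], THEN set_integrable_mult_right, of "4 * ?M\<^sup>2"]
      unfolding set_integrable_def by simp
    show "AE z in lborel. (\<lambda>K. indicator (ball 0 1) z *\<^sub>R ((cmod (partial_x u z + \<i> * of_real (real n * pot_sum pot_y K z) * u z))\<^sup>2 +
      (cmod (partial_y u z - \<i> * of_real (real n * pot_sum pot_x K z) * u z))\<^sup>2)) \<longlonglongrightarrow>
      indicator (ball 0 1) z *\<^sub>R ((cmod (partial_x u z + \<i> * of_real (real n * pot_total pot_y z) * u z))\<^sup>2 +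
      (cmod (partial_y u z - \<i> * of_real (real n * pot_total pot_x z) * u z))\<^sup>2)"
      using AE_grad
    proof eventually_elim
      case (elim z)
      show ?case
      proof (cases "z \<in> ball 0 1")
        case True
        then have "(\<lambda>K. pot_sum pot_x K z) \<longlonglongrightarrow> pot_total pot_x z" "(\<lambda>K. pot_sum pot_y K z) \<longlonglongrightarrow> pot_total pot_y z"
          using elim by blast+
        then show ?thesis by (intro tendsto_intros)
      qed simp
    qed
    show "AE z in lborel. norm (indicator (ball 0 1) z *\<^sub>R ((cmod (partial_x u z + \<i> * of_real (real n * pot_sum pot_y K z) * u z))\<^sup>2 +
      (cmod (partial_y u z - \<i> * of_real (real n * pot_sum pot_x K z) * u z))\<^sup>2)) \<le> ?w z" for K
      using AE_grad
    proof eventually_elim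
      case (elim z)
      show ?case
      proof (cases "z \<in> ball 0 1")
        case True
        have key: "(cmod (a + w))\<^sup>2 \<le> 2 * ?M\<^sup>2 * (1 + (real n)\<^sup>2 * (grad_major z)\<^sup>2)"
          if a: "cmod a \<le> ?M" and w: "cmod w \<le> real n * grad_major z * ?M" for a w
        proof -
          have g: "0 \<le> real n * grad_major z * ?M" using w norm_ge_zero order_trans by blast
          have "(cmod (a + w))\<^sup>2 \<le> (cmod a + cmod w)\<^sup>2" by (intro power_mono norm_triangle_ineq) simp
          also have "\<dots> \<le> 2 * ((cmod a)\<^sup>2 + (cmod w)\<^sup>2)" using sum_squares_bound[of "cmod a" "cmod w"] by (simp add: power2_sum)
          also have "\<dots> \<le> 2 * (?M\<^sup>2 + (real n * grad_major z * ?M)\<^sup>2)"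
            using a w by (intro mult_left_mono add_mono power_mono) auto
          also have "\<dots> = 2 * ?M\<^sup>2 * (1 + (real n)\<^sup>2 * (grad_major z)\<^sup>2)" by (simp only: power_mult_distrib) (simp add: distrib_left mult_ac)
          finally show ?thesis .
        qed
        have w: "cmod (\<i> * of_real (real n * pot_sum V K z) * u z) \<le> real n * grad_major z * ?M" if "\<bar>pot_sum V K z\<bar> \<le> grad_major z" for V
        proof -
          have "cmod (\<i> * of_real (real n * pot_sum V K z) * u z) = real n * \<bar>pot_sum V K z\<bar> * cmod (u z)"
            by (simp add: norm_mult abs_mult)
          also have "\<dots> \<le> real n * grad_major z * ?M"
            using that M1[of z] by (intro mult_mono) auto
          finally show ?thesis .
        qed
        have "\<bar>pot_sum pot_x K z\<bar> \<le> grad_major z" "\<bar>pot_sum pot_y K z\<bar> \<le> grad_major z" using elim True by blast+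
        note wx = w[OF this(1)] and wy = w[OF this(2)]
        have ax: "cmod (partial_x u z) \<le> ?M" "cmod (partial_y u z) \<le> ?M" using M2[of z] M3[of z] by linarith+
        have "(cmod (partial_x u z + \<i> * of_real (real n * pot_sum pot_y K z) * u z))\<^sup>2 \<le> 2 * ?M\<^sup>2 * (1 + (real n)\<^sup>2 * (grad_major z)\<^sup>2)"
          by (rule key[OF ax(1) wy])
        moreover have "(cmod (partial_y u z - \<i> * of_real (real n * pot_sum pot_x K z) * u z))\<^sup>2 \<le> 2 * ?M\<^sup>2 * (1 + (real n)\<^sup>2 * (grad_major z)\<^sup>2)"
          using key[OF ax(2), of "- (\<i> * of_real (real n * pot_sum pot_x K z) * u z)"] wx by simp
        ultimately have "(cmod (partial_x u z + \<i> * of_real (real n * pot_sum pot_y K z) * u z))\<^sup>2 + (cmod (partial_y u z - \<i> * of_real (real n * pot_sum pot_x K z) * u z))\<^sup>2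
            \<le> 4 * ?M\<^sup>2 * (1 + (real n)\<^sup>2 * (grad_major z)\<^sup>2)" by linarith
        then show ?thesis using True by simp
      qed simp
    qed
  qed (rule meas; intro measurable_pot_total measurable_pot_sum measurable_pots; assumption)+
qed

lemma magnetic_estimate:
  fixes n :: nat and c0 :: real
  assumes u: "u \<in> test_functions (ball 0 1)"
    and n: "1 / 2048 \<le> real n * flux k" "real n * flux k \<le> 1 / 2"
    and c0: "0 < c0" "\<And>\<theta>. pi / 1024 \<le> \<theta> \<Longrightarrow> \<theta> \<le> 3 * pi / 2 \<Longrightarrow> c0 \<le> cmod (cis \<theta> - 1)"
  shows "(LINT z:ball 0 1|lborel. (cmod (u z))\<^sup>2) \<le> 1024 * ((1 / c0 + 1)\<^sup>2 + 1) * (1 / 4) ^ k * (magnetic_energy n u + real n * potential_energy u)"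
proof (rule LIMSEQ_le_const)
  show "(\<lambda>K. 1024 * ((1 / c0 + 1)\<^sup>2 + 1) * (1 / 4) ^ k *
    ((LINT z:ball 0 1|lborel. (cmod (partial_x u z + \<i> * of_real (real n * pot_sum pot_y K z) * u z))\<^sup>2 +
      (cmod (partial_y u z - \<i> * of_real (real n * pot_sum pot_x K z) * u z))\<^sup>2) + real n * potential_energy u)) \<longlonglongrightarrow>
    1024 * ((1 / c0 + 1)\<^sup>2 + 1) * (1 / 4) ^ k * (magnetic_energy n u + real n * potential_energy u)"
    by (intro tendsto_mult tendsto_const tendsto_add truncated_energy_tendsto u)
  show "\<exists>N. \<forall>K\<ge>N. (LINT z:ball 0 1|lborel. (cmod (u z))\<^sup>2) \<le> 1024 * ((1 / c0 + 1)\<^sup>2 + 1) * (1 / 4) ^ k *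
    ((LINT z:ball 0 1|lborel. (cmod (partial_x u z + \<i> * of_real (real n * pot_sum pot_y K z) * u z))\<^sup>2 +
      (cmod (partial_y u z - \<i> * of_real (real n * pot_sum pot_x K z) * u z))\<^sup>2) + real n * potential_energy u)"
    by (rule exI[of _ "Suc k"]) (intro allI impI truncated_estimate[OF u _ n c0]; simp)
qed

text \<open>The level is the first one with \<open>n * flux k\<close> at most 1/2. One level earlier
  the product exceeds 1/2, so here it exceeds 1/2048; at levels up to j it is at least 1, whence k >
  j.\<close>

lemma flux_level:
  assumes "1024 ^ j \<le> n"
  obtains k where "j \<le> k" "1 / 2048 \<le> real n * flux k" "real n * flux k \<le> 1 / 2"
proof -
  have ex: "\<exists>k. real n * flux k \<le> 1 / 2"
  proof -
    obtain k where "(1 / 1024 :: real) ^ k < 1 / (2 * (real n + 1))" using real_arch_pow_inv[of "1 / (2 * (real n + 1))" "1 / 1024"] by auto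
    then have "real n * flux k \<le> real n * (1 / (2 * (real n + 1)))" unfolding flux_def by (intro mult_left_mono) auto
    also have "\<dots> \<le> 1 / 2" by (simp add: field_simps)
    finally show ?thesis by blast
  qed
  define k where "k = (LEAST k. real n * flux k \<le> 1 / 2)"
  have k: "real n * flux k \<le> 1 / 2" unfolding k_def by (rule LeastI_ex[OF ex])
  have "real (1024 ^ j) \<le> real n" using assms by (simp only: of_nat_le_iff)
  then have nj: "1024 ^ j \<le> real n" by simp
  have big: "1 \<le> real n * flux i" if "i \<le> j" for i
  proof -
    have "(1024 :: real) ^ i \<le> 1024 ^ j" using that by (intro power_increasing) auto
    then have "1024 ^ i \<le> real n" using nj by (rule order_trans)
    then have "1024 ^ i * flux i \<le> real n * flux i" using flux_pos[of i] by (intro mult_right_mono) simp_all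
    moreover have "1024 ^ i * flux i = 1" by (simp add: flux_def power_one_over)
    ultimately show ?thesis by (simp only:)
  qed
  have jk: "j < k"
  proof (rule ccontr)
    assume "\<not> j < k"
    then show False using big[of k] k by simp
  qed
  then obtain i where i: "k = Suc i" by (cases k) auto
  have "\<not> real n * flux i \<le> 1 / 2" by (rule not_less_Least) (metis i k_def lessI)
  moreover have "real n * flux k = real n * flux i / 1024" by (simp add: flux_def i)
  ultimately have "1 / 2048 \<le> real n * flux k" by linarith
  then show thesis using that jk k by (meson less_imp_le)
qed

text \<open>For n >= 1024^j the level responsible for \<open>n\<close> is at least j, which bounds
  the eigenvalue from below by 4^j / C with one constant for all \<open>n\<close>.\<close>

lemma lambda_m_tendsto: "(\<lambda>n::nat. lambda_m (ball 0 1) (\<lambda>z. real n * pot_total log_pot z)) \<longlonglongrightarrow> \<infinity>"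
proof -
  obtain c0 where c0: "0 < c0" "\<And>\<theta>. pi / 1024 \<le> \<theta> \<Longrightarrow> \<theta> \<le> 3 * pi / 2 \<Longrightarrow> c0 \<le> cmod (cis \<theta> - 1)"
    using cis_away_from_1 by blast
  define C where "C = 1024 * ((1 / c0 + 1)\<^sup>2 + 1)"
  have C: "0 < C" unfolding C_def by (intro mult_pos_pos add_nonneg_pos) auto
  have lower: "ereal (4 ^ j / C) \<le> lambda_m (ball 0 1) (\<lambda>z. real n * pot_total log_pot z)" if nj: "1024 ^ j \<le> n" for j n
    unfolding lambda_m_eq
  proof (rule INF_greatest)
    fix u assume u: "u \<in> normalized_test_functions (ball 0 1)"
    then have ut: "u \<in> test_functions (ball 0 1)" and "sqrt (LINT z:ball 0 1|lborel. (cmod (u z))\<^sup>2) = 1"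
      by (auto simp: normalized_test_functions_def)
    then have u1: "(LINT z:ball 0 1|lborel. (cmod (u z))\<^sup>2) = 1" by (simp only: real_sqrt_eq_1_iff)
    obtain k where k: "j \<le> k" "1 / 2048 \<le> real n * flux k" "real n * flux k \<le> 1 / 2" using flux_level[OF nj] by blast
    let ?E = "magnetic_energy n u + real n * potential_energy u"
    have "1 \<le> C * (1 / 4) ^ k * ?E" using magnetic_estimate[OF ut k(2,3) c0] unfolding u1 C_def .
    then have "4 ^ k / C \<le> ?E" using C by (simp add: power_one_over field_simps)
    moreover have "4 ^ j / C \<le> 4 ^ k / C" using k(1) C by (intro divide_right_mono power_increasing) auto
    ultimately show "ereal (4 ^ j / C) \<le> ereal ?E" by simp
  qed
  show ?thesis
    unfolding tendsto_PInfty
  proof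
    fix r :: real
    obtain j where j: "r * C < 4 ^ j" using real_arch_pow[of 4 "r * C"] by auto
    then have "r < 4 ^ j / C" using C by (simp add: pos_less_divide_eq)
    then have "ereal r < lambda_m (ball 0 1) (\<lambda>z. real n * pot_total log_pot z)" if "1024 ^ j \<le> n" for n
      using lower[OF that] by (meson ereal_less_eq(3) less_ereal.simps(1) less_le_trans)
    then show "\<forall>\<^sub>F n in sequentially. ereal r < lambda_m (ball 0 1) (\<lambda>z. real n * pot_total log_pot z)"
      unfolding eventually_sequentially by blast
  qed
qed

section \<open>The electric eigenvalues stay bounded\<close>

text \<open>The step is locally constant off [0, 1], so its derivative vanishes there, and on [0, 1]
  it is bounded by compactness. By scaling, \<open>S\<close> controls the gradients of all cutoffs
  below.\<close>

lemma smooth_step_derivative: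
  obtains s' S where "\<And>t. (smooth_step has_real_derivative s' t) (at t)" "0 < S" "\<And>t. \<bar>s' t\<bar> \<le> S"
    "\<And>t. t < 0 \<or> 1 < t \<Longrightarrow> s' t = 0"
proof -
  obtain g where g: "smooth_real g" "\<And>t. (flat_exp has_real_derivative g t) (at t)"
    using smooth_real_flat_exp by (auto elim: smooth_realE)
  obtain h where h: "\<And>t. (g has_real_derivative h t) (at t)" using g(1) by (auto elim: smooth_realE)
  define s' where "s' t = g (exp (- 1) - flat_exp (1 - t)) * g (1 - t) / flat_exp (exp (- 1))" for t
  have D: "(smooth_step has_real_derivative s' t) (at t)" for t
  proof -
    have "((\<lambda>t. flat_exp (1 - t)) has_real_derivative g (1 - t) * (- 1)) (at t)"
      by (rule DERIV_chain2[OF g(2)]) (auto intro!: derivative_eq_intros)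
    then have "((\<lambda>t. exp (- 1) - flat_exp (1 - t)) has_real_derivative g (1 - t)) (at t)"
      by (auto intro!: derivative_eq_intros)
    from DERIV_cdivide[OF DERIV_chain2[OF g(2) this]] show ?thesis
      unfolding smooth_step_def s'_def .
  qed
  have cg: "continuous_on UNIV g" and cf: "continuous_on UNIV flat_exp"
    using h g(2) by (auto intro!: continuous_at_imp_continuous_on DERIV_isCont)
  have "continuous_on UNIV s'" unfolding s'_def
    by (intro continuous_intros continuous_on_compose2[OF cg] continuous_on_compose2[OF cf]) (use flat_exp_pos[of "exp (- 1)"] in auto)
  then have "compact (s' ` {0..1})" by (intro compact_continuous_image) (auto elim: continuous_on_subset)
  then obtain B where B: "\<forall>y\<in>s' ` {0..1}. norm y \<le> B" using compact_imp_bounded bounded_iff by blast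
  have zero: "s' t = 0" if "t < 0 \<or> 1 < t" for t
  proof -
    have "\<exists>c U. open U \<and> t \<in> U \<and> (\<forall>x\<in>U. c = smooth_step x)"
    proof (cases "t < 0")
      case True
      then show ?thesis by (intro exI[of _ 0] exI[of _ "{..<0}"]) (auto simp: smooth_step_0)
    next
      case False
      then show ?thesis using that by (intro exI[of _ 1] exI[of _ "{1<..}"]) (auto simp: smooth_step_1)
    qed
    then obtain c U where U: "open U" "t \<in> U" "\<forall>x\<in>U. c = smooth_step x" by blast
    then have "\<forall>\<^sub>F x in nhds t. c = smooth_step x" using eventually_nhds by blast
    then have "((\<lambda>_. c) has_real_derivative 0) (at t) = (smooth_step has_real_derivative 0) (at t)"
      by (rule DERIV_cong_ev[OF refl _ refl])
    then have "(smooth_step has_real_derivative 0) (at t)" by simp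
    then show ?thesis using D DERIV_unique by blast
  qed
  have "\<bar>s' t\<bar> \<le> \<bar>B\<bar> + 1" for t
  proof (cases "0 \<le> t \<and> t \<le> 1")
    case True
    then have "\<bar>s' t\<bar> \<le> B" using B by auto
    then show ?thesis by linarith
  qed (use zero[of t] in auto)
  then show thesis using that[of s' "\<bar>B\<bar> + 1", OF D _ _ zero] by auto
qed

text \<open>Written in |z - p|^2 to be smooth at the centre. The transition takes place between the
  radii rho and sqrt 2 rho, so ramps at the dyadic scales 2^i r have gradients with disjoint
  supports.\<close>

definition ramp :: "complex \<Rightarrow> real \<Rightarrow> complex \<Rightarrow> real" where
  "ramp p \<rho> z = smooth_step ((cmod (z - p))\<^sup>2 / \<rho>\<^sup>2 - 1)"

definition annulus :: "complex \<Rightarrow> real \<Rightarrow> complex set" where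
  "annulus p \<rho> = {z. \<rho>\<^sup>2 \<le> (cmod (z - p))\<^sup>2 \<and> (cmod (z - p))\<^sup>2 \<le> 2 * \<rho>\<^sup>2}"

lemma C_k_ramp: "C_k k (\<lambda>z. of_real (ramp p \<rho> z))"
proof -
  have "C_k k (\<lambda>z. of_real (smooth_step (1 / \<rho>\<^sup>2 * (cmod (z - p))\<^sup>2 + (- 1))))"
    by (intro C_k_smooth_step C_k_affine_real C_k_cmod_sq)
  then show ?thesis unfolding ramp_def by simp
qed

lemma ramp_nonneg: "0 \<le> ramp p \<rho> z" and ramp_le_1: "ramp p \<rho> z \<le> 1"
  by (simp_all add: ramp_def smooth_step_nonneg smooth_step_le_1)

lemma ramp_0:
  assumes "0 < \<rho>" "cmod (z - p) \<le> \<rho>"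
  shows "ramp p \<rho> z = 0"
proof -
  have "(cmod (z - p))\<^sup>2 \<le> \<rho>\<^sup>2" using assms by (intro power_mono) auto
  then show ?thesis unfolding ramp_def using assms(1) by (intro smooth_step_0) (simp add: divide_le_eq)
qed

lemma ramp_1:
  assumes "0 < \<rho>" "2 * \<rho>\<^sup>2 \<le> (cmod (z - p))\<^sup>2"
  shows "ramp p \<rho> z = 1"
  unfolding ramp_def using assms by (intro smooth_step_1) (simp add: le_divide_eq)

lemma partial_ramp:
  obtains S where "0 < S" "\<And>p \<rho> v z. 0 < \<rho> \<Longrightarrow> v = 1 \<or> v = \<i> \<Longrightarrow>
    cmod (partial v (\<lambda>z. of_real (ramp p \<rho> z)) z) \<le> S / \<rho> * indicator (annulus p \<rho>) z"
proof -
  obtain s' S where s': "\<And>t. (smooth_step has_real_derivative s' t) (at t)" and S: "0 < S" "\<And>t. \<bar>s' t\<bar> \<le> S"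
    and zero: "\<And>t. t < 0 \<or> 1 < t \<Longrightarrow> s' t = 0"
    using smooth_step_derivative by blast
  have bound: "cmod (partial v (\<lambda>z. of_real (ramp p \<rho> z)) z) \<le> 4 * S / \<rho> * indicator (annulus p \<rho>) z"
    if \<rho>: "0 < \<rho>" and v: "v = 1 \<or> v = \<i>" for p \<rho> v z
  proof -
    let ?t = "(cmod (z - p))\<^sup>2 / \<rho>\<^sup>2 - 1"
    have eq: "(\<lambda>z. (cmod (z - p))\<^sup>2 / \<rho>\<^sup>2 - 1) = (\<lambda>z. (1 / \<rho>\<^sup>2) * ((z - p) \<bullet> (z - p)) - 1)"
      by (simp add: power2_norm_eq_inner)
    have inner: "((\<lambda>z. c * ((z - p) \<bullet> (z - p)) - 1) has_derivative (\<lambda>h. c * (2 * ((z - p) \<bullet> h)))) (at z)" for c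
      by (auto intro!: derivative_eq_intros simp: inner_commute)
    have "((\<lambda>z. (cmod (z - p))\<^sup>2 / \<rho>\<^sup>2 - 1) has_derivative (\<lambda>h. 2 * ((z - p) \<bullet> h) / \<rho>\<^sup>2)) (at z)"
      unfolding eq using inner[of "1 / \<rho>\<^sup>2"] by simp
    from has_derivative_compose[OF this s'[of ?t, unfolded has_field_derivative_def]]
    have "(ramp p \<rho> has_derivative (\<lambda>h. s' ?t * (2 * ((z - p) \<bullet> h) / \<rho>\<^sup>2))) (at z)"
      unfolding ramp_def .
    then have "partial v (\<lambda>z. of_real (ramp p \<rho> z)) z = of_real (s' ?t * (2 * ((z - p) \<bullet> v) / \<rho>\<^sup>2))"
      by (intro partial_eq has_derivative_of_real)
    then have n: "cmod (partial v (\<lambda>z. of_real (ramp p \<rho> z)) z) = \<bar>s' ?t\<bar> * (2 * \<bar>(z - p) \<bullet> v\<bar> / \<rho>\<^sup>2)"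
      by (simp only: norm_of_real abs_mult abs_divide) simp
    show ?thesis
    proof (cases "z \<in> annulus p \<rho>")
      case True
      then have "(cmod (z - p))\<^sup>2 \<le> (2 * \<rho>)\<^sup>2" by (simp add: annulus_def power_mult_distrib)
      then have "cmod (z - p) \<le> 2 * \<rho>" by (rule power2_le_imp_le) (use \<rho> in simp)
      moreover have "\<bar>(z - p) \<bullet> v\<bar> \<le> cmod (z - p)" using Cauchy_Schwarz_ineq2[of "z - p" v] v by auto
      ultimately have "\<bar>s' ?t\<bar> * (2 * \<bar>(z - p) \<bullet> v\<bar> / \<rho>\<^sup>2) \<le> S * (2 * (2 * \<rho>) / \<rho>\<^sup>2)"
        using S by (intro mult_mono divide_right_mono) auto
      also have "\<dots> = 4 * S / \<rho>" using \<rho> by (simp add: power2_eq_square)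
      finally show ?thesis using n True by simp
    next
      case False
      then have "?t < 0 \<or> 1 < ?t" using \<rho> power_strict_mono[of "cmod (z - p)" \<rho> 2]
        by (auto simp: annulus_def divide_less_eq less_divide_eq not_le)
      then show ?thesis using zero n False by simp
    qed
  qed
  have "0 < 4 * S" using S by simp
  then show thesis using bound by (rule that)
qed

lemma partial_sum:
  assumes "\<And>i. i \<in> I \<Longrightarrow> u i differentiable (at z)"
  shows "partial v (\<lambda>z. \<Sum>i\<in>I. u i z) z = (\<Sum>i\<in>I. partial v (u i) z)"
proof -
  have "((\<lambda>z. \<Sum>i\<in>I. u i z) has_derivative (\<lambda>h. \<Sum>i\<in>I. frechet_derivative (u i) (at z) h)) (at z)"
    by (intro has_derivative_sum) (use assms in \<open>auto simp: frechet_derivative_works\<close>)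
  from partial_eq[OF this, of v] show ?thesis by (simp add: partial_def)
qed

lemma cmod_partial_prod_le:
  fixes F :: "'i \<Rightarrow> complex \<Rightarrow> complex"
  assumes "finite I" "\<And>i. i \<in> I \<Longrightarrow> F i differentiable (at z)" "\<And>i. i \<in> I \<Longrightarrow> cmod (F i z) \<le> 1"
  shows "(\<lambda>z. \<Prod>i\<in>I. F i z) differentiable (at z) \<and> cmod (\<Prod>i\<in>I. F i z) \<le> 1 \<and>
    cmod (partial v (\<lambda>z. \<Prod>i\<in>I. F i z) z) \<le> (\<Sum>i\<in>I. cmod (partial v (F i) z))"
  using assms
proof (induction I rule: finite_induct)
  case empty
  then show ?case by simp
next
  case (insert j I)
  let ?P = "\<lambda>z. \<Prod>i\<in>I. F i z"
  have P: "?P differentiable (at z)" "cmod (?P z) \<le> 1" "cmod (partial v ?P z) \<le> (\<Sum>i\<in>I. cmod (partial v (F i) z))"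
    using insert.IH[OF insert.prems(1)[OF insertI2] insert.prems(2)[OF insertI2]] by blast+
  have F: "F j differentiable (at z)" "cmod (F j z) \<le> 1" using insert.prems(1,2)[OF insertI1] by blast+
  have "cmod (F j z * partial v ?P z + partial v (F j) z * ?P z) \<le> cmod (F j z) * cmod (partial v ?P z) + cmod (partial v (F j) z) * cmod (?P z)"
    using norm_triangle_ineq[of "F j z * partial v ?P z" "partial v (F j) z * ?P z"] by (simp only: norm_mult)
  also have "\<dots> \<le> 1 * cmod (partial v ?P z) + cmod (partial v (F j) z) * 1"
    using F P by (intro add_mono mult_mono) auto
  also have "\<dots> \<le> cmod (partial v (F j) z) + (\<Sum>i\<in>I. cmod (partial v (F i) z))" using P(3) by simp
  finally have "cmod (F j z * partial v ?P z + partial v (F j) z * ?P z) \<le> cmod (partial v (F j) z) + (\<Sum>i\<in>I. cmod (partial v (F i) z))" .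
  moreover have "cmod (F j z * ?P z) \<le> 1" unfolding norm_mult using F(2) P(2) by (intro mult_le_one) auto
  moreover have eq: "(\<Prod>i\<in>insert j I. F i z) = F j z * ?P z" for z using insert.hyps by (rule prod.insert)
  ultimately show ?case
    unfolding eq partial_mult[OF F(1) P(1), of v] sum.insert[OF insert.hyps]
    by (intro conjI differentiable_mult[OF F(1) P(1)])
qed

text \<open>Averaging over \<open>m\<close> ramps with disjoint gradients divides the energy of a single ramp by \<open>m\<close>.\<close>

definition cap :: "nat \<Rightarrow> complex \<Rightarrow> complex \<Rightarrow> real" where
  "cap k p z = (\<Sum>i<64 ^ k. ramp p (2 ^ i * rad k) z) / 64 ^ k"

lemma C_k_cap: "C_k j (\<lambda>z. of_real (cap k p z))"
proof -
  have "C_k j (\<lambda>z. of_real (1 / 64 ^ k) * (\<Sum>i<64 ^ k. of_real (ramp p (2 ^ i * rad k) z)))"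
    by (intro C_k_mult C_k_const C_k_sum C_k_ramp)
  then show ?thesis unfolding cap_def by simp
qed

lemma cap_nonneg: "0 \<le> cap k p z"
  unfolding cap_def by (intro divide_nonneg_nonneg sum_nonneg ramp_nonneg) simp

lemma cap_le_1: "cap k p z \<le> 1"
proof -
  have "(\<Sum>i<64 ^ k. ramp p (2 ^ i * rad k) z) \<le> (\<Sum>i<(64 ^ k :: nat). 1)"
    by (intro sum_mono ramp_le_1)
  then show ?thesis unfolding cap_def by (simp add: divide_le_eq)
qed

lemma cap_0:
  assumes "z \<in> ball p (rad k)"
  shows "cap k p z = 0"
proof -
  have "ramp p (2 ^ i * rad k) z = 0" for i
  proof (rule ramp_0)
    have "1 * rad k \<le> 2 ^ i * rad k" using rad_pos[of k] by (intro mult_right_mono one_le_power) auto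
    then show "cmod (z - p) \<le> 2 ^ i * rad k" using assms by (simp add: dist_norm norm_minus_commute)
  qed (simp add: rad_pos)
  then show ?thesis by (simp add: cap_def)
qed

text \<open>Outside this radius \<open>cap k p\<close> is 1. It is of order 8^-k, small enough that
  the 4 * 4^k discs of this size per level cover little area in total.\<close>

definition outer_rad :: "nat \<Rightarrow> real" where
  "outer_rad k = (1 / 2) ^ (3 * k + 5)"

lemma rad_outer_rad: "2 ^ 64 ^ k * rad k = outer_rad k"
  unfolding rad_def outer_rad_def by (simp add: power_add power_one_over)

lemma cap_1:
  assumes "z \<notin> ball p (outer_rad k)"
  shows "cap k p z = 1"
proof -
  have four: "(2 :: real)\<^sup>2 = 4" by simp
  have "ramp p (2 ^ i * rad k) z = 1" if "i < 64 ^ k" for i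
  proof (rule ramp_1)
    \<comment> \<open>The outermost scale is i = 64^k - 1; even there 2 * 2^i * \<open>rad k\<close>
      is at most \<open>outer_rad k\<close>, so every transition is over.\<close>
    have "(2 :: real) ^ Suc i \<le> 2 ^ 64 ^ k" using that by (intro power_increasing) auto
    then have "2 ^ Suc i * rad k \<le> 2 ^ 64 ^ k * rad k" using rad_pos[of k] by (intro mult_right_mono) auto
    then have "2 * (2 ^ i * rad k) \<le> cmod (z - p)" using assms unfolding rad_outer_rad by (simp add: dist_norm norm_minus_commute)
    then have "(2 * (2 ^ i * rad k))\<^sup>2 \<le> (cmod (z - p))\<^sup>2" using rad_pos[of k] by (intro power_mono) auto
    then show "2 * (2 ^ i * rad k)\<^sup>2 \<le> (cmod (z - p))\<^sup>2" using zero_le_power2[of "2 ^ i * rad k"] by (simp only: power_mult_distrib[of 2] four)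
  qed (simp add: rad_pos)
  then show ?thesis by (simp add: cap_def)
qed

lemma annulus_disjoint:
  assumes "z \<in> annulus p (2 ^ i * r)" "z \<in> annulus p (2 ^ j * r)" "0 < r"
  shows "i = j"
proof -
  have four: "(2 :: real)\<^sup>2 = 4" by simp
  have "\<not> i < j" if "z \<in> annulus p (2 ^ i * r)" "z \<in> annulus p (2 ^ j * r)" for i j
  proof
    assume "i < j"
    then have "(2 :: real) ^ Suc i \<le> 2 ^ j" by (intro power_increasing) auto
    then have "(2 * (2 ^ i * r))\<^sup>2 \<le> (2 ^ j * r)\<^sup>2" using \<open>0 < r\<close> by (intro power_mono) auto
    moreover have "0 < (2 ^ i * r)\<^sup>2" using \<open>0 < r\<close> by simp
    ultimately show False using that unfolding annulus_def by (simp only: power_mult_distrib[of 2] four mem_Collect_eq) linarith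
  qed
  then show ?thesis using assms by (metis linorder_neqE_nat)
qed

lemma sets_annulus: "annulus p \<rho> \<in> sets borel"
  unfolding annulus_def by (intro borel_closed closed_Collect_conj closed_Collect_le continuous_intros)

lemma integral_annulus:
  assumes "0 < \<rho>"
  shows "integrable lborel (indicator (annulus p \<rho>) :: complex \<Rightarrow> real)" "(LINT z|lborel. indicator (annulus p \<rho>) z) \<le> 4 * pi * \<rho>\<^sup>2"
proof -
  have sub: "annulus p \<rho> \<subseteq> cball p (2 * \<rho>)"
  proof
    fix z assume "z \<in> annulus p \<rho>"
    then have "(cmod (z - p))\<^sup>2 \<le> (2 * \<rho>)\<^sup>2" by (simp add: annulus_def power_mult_distrib)
    then have "cmod (z - p) \<le> 2 * \<rho>" by (rule power2_le_imp_le) (use assms in simp)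
    then show "z \<in> cball p (2 * \<rho>)" by (simp add: dist_norm norm_minus_commute)
  qed
  have fin: "cball p (2 * \<rho>) \<in> fmeasurable lborel"
    by (rule fmeasurableI) (use emeasure_bounded_finite[OF bounded_cball] in \<open>auto simp: infinity_ennreal_def\<close>)
  have s: "annulus p \<rho> \<in> sets lborel" using sets_annulus by simp
  have a: "annulus p \<rho> \<in> fmeasurable lborel" by (rule fmeasurableI2[OF fin sub s])
  then show "integrable lborel (indicator (annulus p \<rho>) :: complex \<Rightarrow> real)"
    by (intro integrable_real_indicator) (auto simp: fmeasurable_def)
  have "measure lborel (annulus p \<rho>) \<le> measure lborel (cball p (2 * \<rho>))" by (rule measure_mono_fmeasurable[OF sub s fin])
  then show "(LINT z|lborel. indicator (annulus p \<rho>) z) \<le> 4 * pi * \<rho>\<^sup>2"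
    using assms by (simp add: measure_cball_complex power_mult_distrib)
qed

text \<open>A majorant of the squared gradient of \<open>cap k p\<close>, up to the constant S^2,
  kept as a sum over annuli so that it can be integrated term by term.\<close>

definition cap_grad :: "nat \<Rightarrow> complex \<Rightarrow> complex \<Rightarrow> real" where
  "cap_grad k p z = (\<Sum>i<64 ^ k. (1 / (2 ^ i * rad k))\<^sup>2 * indicator (annulus p (2 ^ i * rad k)) z) / (64 ^ k)\<^sup>2"

lemma cap_grad_nonneg: "0 \<le> cap_grad k p z"
  unfolding cap_grad_def by (intro divide_nonneg_nonneg sum_nonneg mult_nonneg_nonneg) auto

text \<open>Dirichlet energy is scale invariant in the plane, so each annulus contributes at most 4
  pi. There are 64^k annuli, and the averaging divides by the square of this number.\<close>

lemma integral_cap_grad: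
  "integrable lborel (cap_grad k p)" "(LINT z|lborel. cap_grad k p z) \<le> 4 * pi * (1 / 64) ^ k"
proof -
  have r: "0 < 2 ^ i * rad k" for i using rad_pos[of k] by simp
  have i: "integrable lborel (\<lambda>z. (1 / (2 ^ i * rad k))\<^sup>2 * indicator (annulus p (2 ^ i * rad k)) z :: real)" for i
    by (intro integrable_mult_right integral_annulus(1) r)
  show "integrable lborel (cap_grad k p)" unfolding cap_grad_def
    by (intro integrable_divide Bochner_Integration.integrable_sum i)
  have "(LINT z|lborel. cap_grad k p z) = (\<Sum>j<64 ^ k. LINT z|lborel. (1 / (2 ^ j * rad k))\<^sup>2 * indicator (annulus p (2 ^ j * rad k)) z) / (64 ^ k)\<^sup>2"
    unfolding cap_grad_def integral_divide_zero by (subst Bochner_Integration.integral_sum) (rule i, rule refl)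
  also have "\<dots> \<le> (\<Sum>j<(64 ^ k :: nat). 4 * pi) / (64 ^ k)\<^sup>2"
  proof (intro divide_right_mono sum_mono)
    fix j
    have "(LINT z|lborel. (1 / (2 ^ j * rad k))\<^sup>2 * indicator (annulus p (2 ^ j * rad k)) z) \<le> (1 / (2 ^ j * rad k))\<^sup>2 * (4 * pi * (2 ^ j * rad k)\<^sup>2)"
      unfolding integral_mult_right_zero by (intro mult_left_mono integral_annulus(2) r) simp
    also have "\<dots> = 4 * pi" using rad_pos[of k] by (simp add: power_divide)
    finally show "(LINT z|lborel. (1 / (2 ^ j * rad k))\<^sup>2 * indicator (annulus p (2 ^ j * rad k)) z) \<le> 4 * pi" .
  qed simp
  also have "\<dots> = 4 * pi * (1 / 64) ^ k" by (simp add: power2_eq_square power_one_over)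
  finally show "(LINT z|lborel. cap_grad k p z) \<le> 4 * pi * (1 / 64) ^ k" .
qed

text \<open>The annuli are disjoint, so at most one of the bounds for the ramps is nonzero at a
  given point, and the square of their sum is the sum of their squares.\<close>

lemma partial_cap:
  assumes S: "0 < S" "\<And>p \<rho> z. 0 < \<rho> \<Longrightarrow> cmod (partial v (\<lambda>z. of_real (ramp p \<rho> z)) z) \<le> S / \<rho> * indicator (annulus p \<rho>) z"
  shows "(cmod (partial v (\<lambda>z. of_real (cap k p z)) z))\<^sup>2 \<le> S\<^sup>2 * cap_grad k p z"
proof -
  let ?\<rho> = "\<lambda>i. 2 ^ i * rad k"
  let ?a = "\<lambda>i. 1 / ?\<rho> i * indicator (annulus p (?\<rho> i)) z"
  have r: "0 < ?\<rho> i" for i using rad_pos[of k] by simp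
  have d: "(\<lambda>z. of_real (ramp p \<rho> z) :: complex) differentiable (at z)" for \<rho> using C_k_ramp[of "Suc 0" p \<rho>] by (simp only: C_k.simps(2) simp_thms)
  have "partial v (\<lambda>z. of_real (cap k p z)) z = partial v (\<lambda>z. of_real (1 / 64 ^ k) * (\<Sum>i<64 ^ k. of_real (ramp p (?\<rho> i) z))) z"
    unfolding cap_def by simp
  also have "\<dots> = of_real (1 / 64 ^ k) * (\<Sum>i<64 ^ k. partial v (\<lambda>z. of_real (ramp p (?\<rho> i) z)) z)"
    by (subst partial_cmult) (simp_all add: d partial_sum)
  finally have "cmod (partial v (\<lambda>z. of_real (cap k p z)) z) = 1 / 64 ^ k * cmod (\<Sum>i<64 ^ k. partial v (\<lambda>z. of_real (ramp p (?\<rho> i) z)) z)"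
    by (simp only: norm_mult norm_of_real) simp
  also have "\<dots> \<le> 1 / 64 ^ k * (\<Sum>i<64 ^ k. S / ?\<rho> i * indicator (annulus p (?\<rho> i)) z)"
    by (intro mult_left_mono sum_norm_le S(2) r) simp
  also have "\<dots> = 1 / 64 ^ k * (S * (\<Sum>i<64 ^ k. ?a i))" by (simp add: sum_distrib_left)
  finally have "(cmod (partial v (\<lambda>z. of_real (cap k p z)) z))\<^sup>2 \<le> (1 / 64 ^ k * (S * (\<Sum>i<64 ^ k. ?a i)))\<^sup>2"
    by (rule power_mono) simp
  also have "\<dots> = S\<^sup>2 / (64 ^ k)\<^sup>2 * (\<Sum>i<64 ^ k. ?a i)\<^sup>2" by (simp add: power_mult_distrib power_divide)
  finally have le: "(cmod (partial v (\<lambda>z. of_real (cap k p z)) z))\<^sup>2 \<le> S\<^sup>2 / (64 ^ k)\<^sup>2 * (\<Sum>i<64 ^ k. ?a i)\<^sup>2" .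
  have sq: "(\<Sum>i<64 ^ k. ?a i)\<^sup>2 = (\<Sum>i<64 ^ k. (1 / ?\<rho> i)\<^sup>2 * indicator (annulus p (?\<rho> i)) z)"
  proof (cases "\<exists>j<64 ^ k. z \<in> annulus p (?\<rho> j)")
    case True
    then obtain j where j: "j < 64 ^ k" "z \<in> annulus p (?\<rho> j)" by blast
    have off: "z \<notin> annulus p (?\<rho> i)" if "i \<noteq> j" for i using annulus_disjoint[OF _ j(2) rad_pos] that by blast
    have "(\<Sum>i<64 ^ k. f i * indicator (annulus p (?\<rho> i)) z) = f j" for f :: "nat \<Rightarrow> real"
    proof -
      have "(\<Sum>i<64 ^ k. f i * indicator (annulus p (?\<rho> i)) z) = (\<Sum>i<64 ^ k. if i = j then f i else 0)"
        using off j by (intro sum.cong refl) auto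
      then show ?thesis using j(1) by simp
    qed
    then show ?thesis by (simp only:)
  next
    case False
    then have "indicator (annulus p (?\<rho> i)) z = (0 :: real)" if "i \<in> {..<64 ^ k}" for i
      using that by (auto simp: indicator_def)
    then show ?thesis by (simp only: mult_zero_right sum.neutral_const cong: sum.cong) (simp only: zero_power2)
  qed
  have eq: "S\<^sup>2 / (64 ^ k)\<^sup>2 * B = S\<^sup>2 * (B / (64 ^ k)\<^sup>2)" for B by simp
  show ?thesis using le unfolding cap_grad_def sq eq .
qed

lemma sum_kept_upto: "(\<Sum>(i, p)\<in>kept_upto K. g i p) = (\<Sum>k<K. \<Sum>p\<in>kept k. g k p :: real)"
proof -
  have "kept_upto K = Sigma {..<K} kept" using kept_upto_iff[of _ _ K] by auto
  then show ?thesis by (simp add: sum.Sigma finite_kept)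
qed

text \<open>The ratio 9/16 is the largest one that occurs, from 4^k discs with weights 9^k and
  energies 64^-k. The geometric series then gives 4 * 16/7, which is less than 10.\<close>

lemma sum_kept_upto_le:
  fixes g :: "nat \<Rightarrow> complex \<Rightarrow> real"
  assumes g: "\<And>k p. p \<in> kept k \<Longrightarrow> g k p \<le> c * x ^ k" and c: "0 \<le> c" and x: "0 \<le> x" "4 * x \<le> 9 / 16"
  shows "(\<Sum>(i, p)\<in>kept_upto K. g i p) \<le> 10 * c"
proof -
  have "(\<Sum>(i, p)\<in>kept_upto K. g i p) \<le> (\<Sum>k<K. 4 * c * (9 / 16) ^ k)"
    unfolding sum_kept_upto
  proof (rule sum_mono)
    fix k
    have "(\<Sum>p\<in>kept k. g k p) \<le> 4 * 4 ^ k * (c * x ^ k)" using g c x by (intro sum_kept_le) auto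
    also have "\<dots> = 4 * c * (4 * x) ^ k" by (simp add: power_mult_distrib)
    also have "\<dots> \<le> 4 * c * (9 / 16) ^ k" using c x by (intro mult_left_mono power_mono) auto
    finally show "(\<Sum>p\<in>kept k. g k p) \<le> 4 * c * (9 / 16) ^ k" .
  qed
  also have "\<dots> = 4 * c * ((1 - (9 / 16) ^ K) * (16 / 7))"
    unfolding sum_distrib_left[symmetric] by (subst geometric_sum) (simp_all add: field_simps)
  also have "\<dots> \<le> 4 * c * (1 * (16 / 7))" using c by (intro mult_left_mono mult_right_mono) auto
  also have "\<dots> \<le> 10 * c" using c by simp
  finally show ?thesis .
qed

section \<open>The trial functions\<close>

definition cutoff :: "complex \<Rightarrow> real" where
  "cutoff z = 1 - ramp 0 (1 / 2) z"

definition trial :: "nat \<Rightarrow> complex \<Rightarrow> complex" where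
  "trial K z = of_real (cutoff z) * (\<Prod>(i, p)\<in>kept_upto K. of_real (cap i p z))"

lemma C_k_cutoff: "C_k k (\<lambda>z. of_real (cutoff z))"
  using C_k_affine_real[OF C_k_ramp[of k 0 "1 / 2"], of "- 1" 1] by (simp add: cutoff_def)

lemma cutoff_bounds: "0 \<le> cutoff z" "cutoff z \<le> 1"
  using ramp_nonneg[of 0 "1 / 2" z] ramp_le_1[of 0 "1 / 2" z] by (simp_all add: cutoff_def)

lemma trial_eq: "trial K z = of_real (cutoff z * (\<Prod>(i, p)\<in>kept_upto K. cap i p z))"
  by (simp add: trial_def case_prod_unfold)

lemma prod_cap_bounds:
  "0 \<le> (\<Prod>(i, p)\<in>A. cap i p z)" "(\<Prod>(i, p)\<in>A. cap i p z) \<le> 1"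
  by (auto intro!: prod_nonneg prod_le_1 simp: cap_nonneg cap_le_1)

lemma cmod_trial_le_1: "cmod (trial K z) \<le> 1"
  unfolding trial_eq norm_of_real using cutoff_bounds[of z] prod_cap_bounds[where A = "kept_upto K" and z = z]
  by (simp add: abs_mult mult_le_one)

lemma C_k_trial: "C_k k (trial K)"
proof -
  have "C_k k (\<lambda>z. of_real (cutoff z) * (\<Prod>x\<in>kept_upto K. of_real (cap (fst x) (snd x) z)))"
    by (intro C_k_mult C_k_cutoff C_k_prod C_k_cap)
  then show ?thesis unfolding trial_def case_prod_unfold .
qed

lemma trial_test_function: "trial K \<in> test_functions (ball 0 1)"
proof -
  \<comment> \<open>The cutoff vanishes where |z|^2 >= 1/2, and 3/4 is a convenient radius below 1
    with square above 1/2.\<close>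
  have "{z. trial K z \<noteq> 0} \<subseteq> cball 0 (3 / 4)"
  proof
    fix z assume "z \<in> {z. trial K z \<noteq> 0}"
    then have "cutoff z \<noteq> 0" by (auto simp: trial_def)
    then have "(cmod z)\<^sup>2 < 1 / 2" using ramp_1[of "1 / 2" z 0] by (force simp: cutoff_def power_divide)
    then have "(cmod z)\<^sup>2 \<le> (3 / 4)\<^sup>2" by (simp add: power_divide)
    then have "cmod z \<le> 3 / 4" by (rule power2_le_imp_le) simp
    then show "z \<in> cball 0 (3 / 4)" by simp
  qed
  then have cl: "closure {z. trial K z \<noteq> 0} \<subseteq> cball 0 (3 / 4)" by (rule closure_minimal) simp
  moreover have "compact (closure {z. trial K z \<noteq> 0})" using bounded_subset[OF bounded_cball cl] by (simp add: compact_eq_bounded_closed)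
  moreover have "cball (0::complex) (3 / 4) \<subseteq> ball 0 1" by auto
  ultimately show ?thesis unfolding test_functions_def using C_k_trial by blast
qed

lemma trial_0:
  assumes "k < K" "p \<in> kept k" "z \<in> ball p (rad k)"
  shows "trial K z = 0"
proof -
  have "(k, p) \<in> kept_upto K" using assms kept_upto_iff by blast
  moreover have "cap k p z = 0" using cap_0[OF assms(3)] .
  ultimately have "(\<Prod>(i, p)\<in>kept_upto K. cap i p z) = 0" using finite_kept_upto[of K] by (auto intro!: prod_zero bexI[of _ "(k, p)"])
  then show ?thesis unfolding trial_eq by simp
qed

lemma outer_rad_pos: "0 < outer_rad k" by (simp add: outer_rad_def)

lemma outer_rad_sq: "(outer_rad k)\<^sup>2 = (1 / 64) ^ k / 1024"
proof -
  have e: "outer_rad k = (1 / 8) ^ k / 32"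
    unfolding outer_rad_def by (simp add: power_add power_mult power_divide)
  have sq: "(a / 32)\<^sup>2 = a\<^sup>2 / 1024" for a :: real by (simp add: power_divide)
  have "((1 / 8 :: real) ^ k)\<^sup>2 = (1 / 8 * (1 / 8)) ^ k" by (simp only: power2_eq_square power_mult_distrib)
  then show ?thesis unfolding e sq by simp
qed

text \<open>The trial function is 1 on the disc of radius 1/2, away from the balls of radius
  \<open>outer_rad\<close>. These have total area at most 10 pi / 1024, so out of pi/4 more than
  pi/8 remains.\<close>

lemma integral_trial_ge: "pi / 8 \<le> (LINT z:ball 0 1|lborel. (cmod (trial K z))\<^sup>2)"
proof -
  let ?U = "\<lambda>z. (cmod (trial K z))\<^sup>2"
  let ?B = "\<lambda>k p. indicator (ball p (outer_rad k)) :: complex \<Rightarrow> real"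
  have cont: "continuous_on UNIV ?U" using C_k_continuous[OF C_k_trial] by (intro continuous_intros)
  have off: "?U z = 0" if "z \<notin> ball 0 1" for z using test_functions_eq_0[OF trial_test_function that] by simp
  note U = integrable_continuous_ball[OF cont off]
  have b: "integrable lborel (indicator (ball a r) :: complex \<Rightarrow> real)" for a r
    by (intro integrable_real_indicator) (use emeasure_bounded_finite[OF bounded_ball] in \<open>auto simp: infinity_ennreal_def\<close>)
  have i: "integrable lborel (\<lambda>z. \<Sum>(k, p)\<in>kept_upto K. ?B k p z)"
    unfolding case_prod_unfold by (intro Bochner_Integration.integrable_sum b)
  have "(LINT z|lborel. indicator (ball 0 (1 / 2)) z - (\<Sum>(k, p)\<in>kept_upto K. ?B k p z)) \<le> (LINT z|lborel. ?U z)"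
  proof (rule integral_mono)
    fix z
    show "indicator (ball 0 (1 / 2)) z - (\<Sum>(k, p)\<in>kept_upto K. ?B k p z) \<le> ?U z"
    proof (cases "z \<in> ball 0 (1 / 2) \<and> (\<forall>(k, p)\<in>kept_upto K. z \<notin> ball p (outer_rad k))")
      case True
      then have "(\<Prod>(i, p)\<in>kept_upto K. cap i p z) = 1" by (intro prod.neutral) (auto intro!: cap_1)
      moreover have "cutoff z = 1" using ramp_0[of "1 / 2" z 0] True by (simp add: cutoff_def)
      ultimately have "trial K z = 1" unfolding trial_eq by simp
      moreover have "0 \<le> (\<Sum>(k, p)\<in>kept_upto K. ?B k p z)" by (intro sum_nonneg) auto
      ultimately show ?thesis by (simp add: indicator_def)
    next
      case False
      have nn: "0 \<le> (\<Sum>(k, p)\<in>kept_upto K. ?B k p z)" by (intro sum_nonneg) auto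
      show ?thesis
      proof (cases "z \<in> ball 0 (1 / 2)")
        case True
        then obtain k p where kp: "(k, p) \<in> kept_upto K" "z \<in> ball p (outer_rad k)" using False by blast
        have "1 = (case (k, p) of (k, p) \<Rightarrow> ?B k p z)" using kp by simp
        also have "\<dots> \<le> (\<Sum>(k, p)\<in>kept_upto K. ?B k p z)"
          by (rule member_le_sum[OF kp(1)]) (auto simp: finite_kept_upto)
        finally show ?thesis using True by (simp add: order_trans[OF _ zero_le_power2])
      next
        case False
        then have "indicator (ball 0 (1 / 2)) z = (0 :: real)" by simp
        moreover have "0 \<le> ?U z" by simp
        ultimately show ?thesis using nn by linarith
      qed
    qed
  qed (intro Bochner_Integration.integrable_diff i b U(1))+
  also have "(LINT z|lborel. indicator (ball 0 (1 / 2)) z - (\<Sum>(k, p)\<in>kept_upto K. ?B k p z)) =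
      measure lborel (ball (0::complex) (1 / 2)) - (\<Sum>(k, p)\<in>kept_upto K. measure lborel (ball p (outer_rad k)))"
  proof -
    have "(LINT z|lborel. (\<Sum>(k, p)\<in>kept_upto K. ?B k p z)) = (\<Sum>(k, p)\<in>kept_upto K. measure lborel (ball p (outer_rad k)))"
      unfolding case_prod_unfold by (subst Bochner_Integration.integral_sum) (auto intro: b)
    then show ?thesis by (subst Bochner_Integration.integral_diff[OF b i]) simp
  qed
  finally have *: "measure lborel (ball (0::complex) (1 / 2)) - (\<Sum>(k, p)\<in>kept_upto K. measure lborel (ball p (outer_rad k))) \<le> (LINT z|lborel. ?U z)" .
  have "(\<Sum>(k, p)\<in>kept_upto K. measure lborel (ball p (outer_rad k))) \<le> 10 * (pi / 1024)"
  proof (rule sum_kept_upto_le[where x = "1 / 64"])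
    show "measure lborel (ball p (outer_rad k)) \<le> pi / 1024 * (1 / 64) ^ k" for k and p :: complex
      using measure_ball_complex[of "outer_rad k" p] outer_rad_pos[of k] outer_rad_sq[of k] by simp
  qed auto
  moreover have "measure lborel (ball (0::complex) (1 / 2)) = pi / 4" by (simp add: measure_ball_complex power_divide)
  ultimately show ?thesis using * pi_gt_zero U(2) by linarith
qed

text \<open>The trial function vanishes on the discs of the first \<open>K\<close> levels, so it
  sees only the tail of the density, and the integral of the tail tends to 0.\<close>

lemma potential_trial_le:
  assumes "0 < \<epsilon>"
  obtains K where "potential_energy (trial K) \<le> \<epsilon>"
proof -
  let ?f = "pot_total disc_density"
  let ?T = "\<lambda>K z. ?f z - pot_sum disc_density K z"
  have m: "pot_sum disc_density K \<in> borel_measurable borel" for K by (intro measurable_pot_sum measurable_pots)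
  have "(\<lambda>K. LINT z|lborel. ?T K z) \<longlonglongrightarrow> (LINT z|(lborel :: complex measure). (0 :: real))"
  proof (rule integral_dominated_convergence[where w = ?f])
    show "AE z in lborel. (\<lambda>K. ?T K z) \<longlonglongrightarrow> 0"
    proof (rule AE_I2)
      fix z
      show "(\<lambda>K. ?T K z) \<longlonglongrightarrow> 0" using tendsto_diff[OF tendsto_const pot_sum_disc_tendsto[of z], of "?f z"] by simp
    qed
    show "AE z in lborel. norm (?T K z) \<le> ?f z" for K
    proof (rule AE_I2)
      fix z
      show "norm (?T K z) \<le> ?f z" using pot_sum_disc_le[of K z] pot_sum_disc_nonneg[of K z] by simp
    qed
    have "?f \<in> borel_measurable borel" by (intro measurable_pot_total measurable_pots)
    then show "?T K \<in> borel_measurable lborel" for K using m[of K] by (simp add: borel_measurable_diff)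
  qed (simp_all add: integrable_pot_total_disc)
  then have "\<forall>\<^sub>F K in sequentially. (LINT z|lborel. ?T K z) < \<epsilon>" using assms by (intro order_tendstoD) auto
  then obtain K where K: "(LINT z|lborel. ?T K z) < \<epsilon>" using eventually_sequentially by auto
  have "integrable lborel (pot_sum disc_density K)"
    unfolding pot_sum_eq by (intro Bochner_Integration.integrable_sum integral_stage_disc(1))
  then have iT: "integrable lborel (?T K)" by (intro Bochner_Integration.integrable_diff integrable_pot_total_disc)
  have "potential_energy (trial K) \<le> (LINT z|lborel. ?T K z)"
    unfolding potential_energy_def set_lebesgue_integral_def
  proof (rule integral_mono[OF integrable_pot_total_disc_u[OF trial_test_function] iT])
    fix z
    have nn: "0 \<le> ?T K z" using pot_sum_disc_le[of K z] by simp
    have "?f z * (cmod (trial K z))\<^sup>2 \<le> ?T K z"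
    proof (cases "\<exists>k<K. \<exists>p\<in>kept k. z \<in> ball p (rad k)")
      case True
      then have "trial K z = 0" using trial_0 by blast
      then show ?thesis using nn by simp
    next
      case False
      have "stage disc_density k z = 0" if "k < K" for k by (rule stage_disc_eq_0) (use False that in blast)
      then have "pot_sum disc_density K z = 0" unfolding pot_sum_eq by (intro sum.neutral) simp
      moreover have "?f z * (cmod (trial K z))\<^sup>2 \<le> ?f z * 1"
        using cmod_trial_le_1[of K z] by (intro mult_left_mono pot_total_disc_nonneg) (simp add: power_le_one)
      ultimately show ?thesis by simp
    qed
    then show "indicator (ball 0 1) z *\<^sub>R (?f z * (cmod (trial K z))\<^sup>2) \<le> ?T K z" using nn by (simp add: indicator_def)
  qed
  then show thesis using that[of K] K by linarith
qed

text \<open>The gradients of the factors are summed by Cauchy--Schwarz with weights \<open>3\<^sup>-\<^sup>k\<close>.\<close>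

lemma partial_trial:
  assumes v: "v = 1 \<or> v = \<i>"
    and S: "0 < S" "\<And>p \<rho> z. 0 < \<rho> \<Longrightarrow> cmod (partial v (\<lambda>z. of_real (ramp p \<rho> z)) z) \<le> S / \<rho> * indicator (annulus p \<rho>) z"
  shows "(cmod (partial v (trial K) z))\<^sup>2 \<le> 8 * S\<^sup>2 + 20 * S\<^sup>2 * (\<Sum>(i, p)\<in>kept_upto K. 9 ^ i * cap_grad i p z)"
proof -
  let ?F = "\<lambda>x z. of_real (cap (fst x) (snd x) z) :: complex"
  let ?P = "\<lambda>z. \<Prod>x\<in>kept_upto K. ?F x z"
  let ?X = "\<lambda>z. of_real (cutoff z) :: complex"
  let ?g = "\<lambda>x. cmod (partial v (?F x) z)"
  have dF: "?F x differentiable (at z)" for x using C_k_cap[of "Suc 0" "fst x" "snd x"] by (simp only: C_k.simps(2) simp_thms)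
  have bF: "cmod (?F x z) \<le> 1" for x using cap_nonneg[of "fst x" "snd x" z] cap_le_1[of "fst x" "snd x" z] by (simp only: norm_of_real abs_of_nonneg)
  have P: "?P differentiable (at z)" "cmod (?P z) \<le> 1" "cmod (partial v ?P z) \<le> (\<Sum>x\<in>kept_upto K. ?g x)"
    using cmod_partial_prod_le[where F = ?F and I = "kept_upto K" and z = z and v = v, OF finite_kept_upto dF bF] by blast+
  have dX: "?X differentiable (at z)" using C_k_cutoff[of "Suc 0"] by (simp only: C_k.simps(2) simp_thms)
  have bX: "cmod (?X z) \<le> 1" using cutoff_bounds[of z] by (simp only: norm_of_real abs_of_nonneg)
  have dR: "(\<lambda>z. of_real (ramp 0 (1 / 2) z) :: complex) differentiable (at z)"
    using C_k_ramp[of "Suc 0" 0 "1 / 2"] by (simp only: C_k.simps(2) simp_thms)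
  have "partial v ?X z = partial v (\<lambda>z. 1 + (- 1) * of_real (ramp 0 (1 / 2) z)) z" by (simp add: cutoff_def)
  also have "\<dots> = - partial v (\<lambda>z. of_real (ramp 0 (1 / 2) z)) z"
    using dR partial_add[of "\<lambda>_. 1" z "\<lambda>z. (- 1) * of_real (ramp 0 (1 / 2) z)" v] partial_cmult[OF dR, of v "- 1"] by simp
  finally have "cmod (partial v ?X z) = cmod (partial v (\<lambda>z. of_real (ramp 0 (1 / 2) z)) z)" by (simp only: norm_minus_cancel)
  also have "\<dots> \<le> S / (1 / 2) * indicator (annulus 0 (1 / 2)) z" by (rule S(2)) simp
  also have "\<dots> \<le> 2 * S" using S(1) by (simp add: indicator_def)
  finally have gX: "cmod (partial v ?X z) \<le> 2 * S" .
  have "partial v (trial K) z = ?X z * partial v ?P z + partial v ?X z * ?P z"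
    unfolding trial_def case_prod_unfold by (rule partial_mult[OF dX P(1)])
  then have "cmod (partial v (trial K) z) \<le> cmod (?X z) * cmod (partial v ?P z) + cmod (partial v ?X z) * cmod (?P z)"
    using norm_triangle_ineq[of "?X z * partial v ?P z" "partial v ?X z * ?P z"] by (simp only: norm_mult)
  also have "\<dots> \<le> 1 * (\<Sum>x\<in>kept_upto K. ?g x) + 2 * S * 1"
    using bX P gX S(1) by (intro add_mono mult_mono) (auto intro: sum_nonneg)
  finally have "cmod (partial v (trial K) z) \<le> 2 * S + (\<Sum>x\<in>kept_upto K. ?g x)" by simp
  then have "(cmod (partial v (trial K) z))\<^sup>2 \<le> (2 * S + (\<Sum>x\<in>kept_upto K. ?g x))\<^sup>2" by (rule power_mono) simp
  also have "\<dots> \<le> 2 * (2 * S)\<^sup>2 + 2 * (\<Sum>x\<in>kept_upto K. ?g x)\<^sup>2"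
    using sum_squares_bound[of "2 * S" "\<Sum>x\<in>kept_upto K. ?g x"] by (simp only: power2_sum)
  finally have A: "(cmod (partial v (trial K) z))\<^sup>2 \<le> 2 * (2 * S)\<^sup>2 + 2 * (\<Sum>x\<in>kept_upto K. ?g x)\<^sup>2" .
  \<comment> \<open>The base 3 fits on both sides: the squared weights 9^-k are summable over the 4
    * 4^k discs per level, and the inverse weights 9^k times this number are still beaten by the
    energies 64^-k.\<close>
  have "(\<Sum>x\<in>kept_upto K. ?g x) = (\<Sum>x\<in>kept_upto K. (1 / 3) ^ fst x * (3 ^ fst x * ?g x))"
    by (intro sum.cong refl) (simp add: power_one_over)
  then have "(\<Sum>x\<in>kept_upto K. ?g x)\<^sup>2 \<le> (\<Sum>x\<in>kept_upto K. ((1 / 3) ^ fst x)\<^sup>2) * (\<Sum>x\<in>kept_upto K. (3 ^ fst x * ?g x)\<^sup>2)"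
    using Cauchy_Schwarz_ineq_sum[of "\<lambda>x. (1 / 3) ^ fst x" "\<lambda>x. 3 ^ fst x * ?g x" "kept_upto K"] by (simp only:)
  also have "\<dots> \<le> 10 * (\<Sum>x\<in>kept_upto K. S\<^sup>2 * (9 ^ fst x * cap_grad (fst x) (snd x) z))"
  proof (rule mult_mono)
    have "(\<Sum>(i, p)\<in>kept_upto K. ((1 / 3) ^ i)\<^sup>2) \<le> 10 * (1 :: real)"
      by (rule sum_kept_upto_le[where x = "1 / 9"]) (auto simp: power2_eq_square simp flip: power_mult_distrib)
    then show "(\<Sum>x\<in>kept_upto K. ((1 / 3) ^ fst x)\<^sup>2) \<le> (10 :: real)" by (simp add: case_prod_unfold)
    show "(\<Sum>x\<in>kept_upto K. (3 ^ fst x * ?g x)\<^sup>2) \<le> (\<Sum>x\<in>kept_upto K. S\<^sup>2 * (9 ^ fst x * cap_grad (fst x) (snd x) z))"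
    proof (rule sum_mono)
      fix x
      have n: "(3 ^ k)\<^sup>2 = (9 :: real) ^ k" for k by (simp add: power2_eq_square flip: power_mult_distrib)
      have "(3 ^ fst x * ?g x)\<^sup>2 = 9 ^ fst x * (?g x)\<^sup>2" unfolding power_mult_distrib n ..
      also have "\<dots> \<le> 9 ^ fst x * (S\<^sup>2 * cap_grad (fst x) (snd x) z)"
        by (rule mult_left_mono[OF partial_cap[OF S]]) simp_all
      finally show "(3 ^ fst x * ?g x)\<^sup>2 \<le> S\<^sup>2 * (9 ^ fst x * cap_grad (fst x) (snd x) z)" by (simp only: mult.left_commute)
    qed
  qed (auto intro!: sum_nonneg)
  finally have "(\<Sum>x\<in>kept_upto K. ?g x)\<^sup>2 \<le> 10 * (S\<^sup>2 * (\<Sum>(i, p)\<in>kept_upto K. 9 ^ i * cap_grad i p z))"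
    unfolding sum_distrib_left[symmetric] case_prod_unfold .
  moreover have "(2 * S)\<^sup>2 = 4 * S\<^sup>2" by (simp add: power_mult_distrib)
  ultimately show ?thesis using A by linarith
qed

text \<open>The weighted energies of the caps of level k add up to at most a multiple of (4 *
  9/64)^k, whence a bound that does not depend on the number \<open>K\<close> of levels.\<close>

lemma dirichlet_trial_le:
  obtains C where "0 \<le> C" "\<And>K. dirichlet_energy (trial K) \<le> C"
proof -
  obtain S where S: "0 < S" "\<And>p \<rho> v z. 0 < \<rho> \<Longrightarrow> v = 1 \<or> v = \<i> \<Longrightarrow>
    cmod (partial v (\<lambda>z. of_real (ramp p \<rho> z)) z) \<le> S / \<rho> * indicator (annulus p \<rho>) z"
    using partial_ramp by blast
  have "dirichlet_energy (trial K) \<le> 16 * S\<^sup>2 * pi + 40 * S\<^sup>2 * (10 * (4 * pi))" for K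
  proof -
    let ?H = "\<lambda>z. \<Sum>(i, p)\<in>kept_upto K. 9 ^ i * cap_grad i p z"
    have iH: "integrable lborel ?H" unfolding case_prod_unfold
      by (intro Bochner_Integration.integrable_sum integrable_mult_right integral_cap_grad(1))
    have "(LINT z|lborel. ?H z) = (\<Sum>(i, p)\<in>kept_upto K. 9 ^ i * (LINT z|lborel. cap_grad i p z))"
      unfolding case_prod_unfold
      by (subst Bochner_Integration.integral_sum) (auto intro: integral_cap_grad(1))
    also have "\<dots> \<le> 10 * (4 * pi)"
    proof (rule sum_kept_upto_le[where x = "9 / 64"])
      fix k p
      have "9 ^ k * (LINT z|lborel. cap_grad k p z) \<le> 9 ^ k * (4 * pi * (1 / 64) ^ k)"
        by (intro mult_left_mono integral_cap_grad(2)) simp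
      also have "\<dots> = 4 * pi * (9 / 64) ^ k" by (simp add: power_divide)
      finally show "9 ^ k * (LINT z|lborel. cap_grad k p z) \<le> 4 * pi * (9 / 64) ^ k" .
    qed auto
    finally have H: "(LINT z|lborel. ?H z) \<le> 10 * (4 * pi)" .
    have nn: "0 \<le> ?H z" for z by (intro sum_nonneg) (auto simp: cap_grad_nonneg)
    have cont: "continuous_on UNIV (\<lambda>z. (cmod (partial_x (trial K) z))\<^sup>2 + (cmod (partial_y (trial K) z))\<^sup>2)"
      by (intro continuous_intros C_k_continuous[OF C_k_partial[OF C_k_trial]]) auto
    have ib: "integrable lborel (\<lambda>z::complex. indicator (ball 0 1) z *\<^sub>R (16 * S\<^sup>2))"
      using set_integrable_const_ball[of "16 * S\<^sup>2"] unfolding set_integrable_def .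
    have "dirichlet_energy (trial K) \<le> (LINT z|lborel. indicator (ball 0 1) z *\<^sub>R (16 * S\<^sup>2) + 40 * S\<^sup>2 * ?H z)"
      unfolding dirichlet_energy_def set_lebesgue_integral_def
    proof (rule integral_mono)
      show "integrable lborel (\<lambda>z. indicator (ball 0 1) z *\<^sub>R ((cmod (partial_x (trial K) z))\<^sup>2 + (cmod (partial_y (trial K) z))\<^sup>2))"
        using continuous_set_integrable_ball[OF cont] unfolding set_integrable_def .
      show "integrable lborel (\<lambda>z. indicator (ball 0 1) z *\<^sub>R (16 * S\<^sup>2) + 40 * S\<^sup>2 * ?H z)"
        by (intro Bochner_Integration.integrable_add ib integrable_mult_right iH)
      fix z
      have "(cmod (partial v (trial K) z))\<^sup>2 \<le> 8 * S\<^sup>2 + 20 * S\<^sup>2 * ?H z" if "v = 1 \<or> v = \<i>" for v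
        by (rule partial_trial[OF that S(1)]) (rule S(2)[OF _ that])
      from this[of 1] this[of \<i>]
      have "(cmod (partial_x (trial K) z))\<^sup>2 + (cmod (partial_y (trial K) z))\<^sup>2 \<le> 16 * S\<^sup>2 + 40 * S\<^sup>2 * ?H z" by simp
      moreover have "0 \<le> 40 * S\<^sup>2 * ?H z" using nn[of z] by simp
      ultimately show "indicator (ball 0 1) z *\<^sub>R ((cmod (partial_x (trial K) z))\<^sup>2 + (cmod (partial_y (trial K) z))\<^sup>2)
          \<le> indicator (ball 0 1) z *\<^sub>R (16 * S\<^sup>2) + 40 * S\<^sup>2 * ?H z"
        by (simp only: indicator_def of_bool_def split: if_splits) simp
    qed
    also have "\<dots> = 16 * S\<^sup>2 * pi + 40 * S\<^sup>2 * (LINT z|lborel. ?H z)"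
      by (subst Bochner_Integration.integral_add[OF ib integrable_mult_right[OF iH]]) (simp add: measure_ball_complex)
    also have "\<dots> \<le> 16 * S\<^sup>2 * pi + 40 * S\<^sup>2 * (10 * (4 * pi))" by (intro add_left_mono mult_left_mono H) simp
    finally show ?thesis .
  qed
  then show thesis by (rule that[rotated]) simp
qed

section \<open>Boundedness and convergence of the electric eigenvalues\<close>

lemma potential_energy_nonneg: "0 \<le> potential_energy u"
  unfolding potential_energy_def set_lebesgue_integral_def
  by (intro Bochner_Integration.integral_nonneg) (simp add: pot_total_disc_nonneg indicator_def)

text \<open>The Rayleigh quotient as an upper bound: both energies are quadratic, so dividing
  \<open>u\<close> by its norm divides them by the squared norm.\<close>

lemma lambda_e_le:
  assumes u: "u \<in> test_functions (ball 0 1)" and pos: "0 < (LINT z:ball 0 1|lborel. (cmod (u z))\<^sup>2)"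
  shows "lambda_e (ball 0 1) (\<lambda>z. real n * pot_total log_pot z) \<le>
    ereal ((dirichlet_energy u + real n * potential_energy u) / (LINT z:ball 0 1|lborel. (cmod (u z))\<^sup>2))"
proof -
  let ?N = "LINT z:ball 0 1|lborel. (cmod (u z))\<^sup>2"
  let ?c = "1 / sqrt ?N"
  let ?w = "\<lambda>z. of_real ?c * u z"
  have c: "?c\<^sup>2 = 1 / ?N" "?c \<noteq> 0" using pos by (simp_all add: power_divide)
  have sm: "(LINT z:A|lborel. a * f z) = a * (LINT z:A|lborel. f z)" for a :: real and f and A :: "complex set"
    unfolding set_lebesgue_integral_def integral_mult_right_zero[symmetric]
    by (intro Bochner_Integration.integral_cong refl) simp
  have n: "(cmod (of_real ?c * a))\<^sup>2 = 1 / ?N * (cmod a)\<^sup>2" for a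
    by (simp only: norm_mult norm_of_real power_mult_distrib power2_abs c(1))
  have "?w \<in> test_functions (ball 0 1)"
  proof -
    have "C_k k ?w" for k using u by (intro C_k_mult C_k_const) (auto simp: test_functions_def)
    moreover have "{z. ?w z \<noteq> 0} = {z. u z \<noteq> 0}" using c(2) by auto
    ultimately show ?thesis using u unfolding test_functions_def by simp
  qed
  moreover have "(LINT z:ball 0 1|lborel. (cmod (?w z))\<^sup>2) = 1" unfolding n sm using pos by simp
  ultimately have w: "?w \<in> normalized_test_functions (ball 0 1)" by (simp add: normalized_test_functions_def)
  have p: "partial v ?w z = of_real ?c * partial v u z" for v z
    by (rule partial_cmult[OF test_functions_differentiable[OF u]])
  have d: "dirichlet_energy ?w = 1 / ?N * dirichlet_energy u"
    unfolding dirichlet_energy_def p n distrib_left[symmetric] by (rule sm)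
  have q: "potential_energy ?w = 1 / ?N * potential_energy u"
    unfolding potential_energy_def n mult.left_commute[of _ "1 / ?N"] by (rule sm)
  have "lambda_e (ball 0 1) (\<lambda>z. real n * pot_total log_pot z) \<le> ereal (dirichlet_energy ?w + real n * potential_energy ?w)"
    unfolding lambda_e_eq by (rule INF_lower[OF w])
  also have "dirichlet_energy ?w + real n * potential_energy ?w = (dirichlet_energy u + real n * potential_energy u) / ?N"
    unfolding d q by (simp add: add_divide_distrib)
  finally show ?thesis .
qed

text \<open>For each \<open>n\<close> the truncation \<open>K\<close> is chosen so large that n
  times the potential energy is at most 1; the Dirichlet energy and the norm of the trial function
  are controlled independently of \<open>K\<close>.\<close>

lemma lambda_e_bounded:
  obtains C where "\<And>n. lambda_e (ball 0 1) (\<lambda>z. real n * pot_total log_pot z) \<le> ereal C"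
proof -
  obtain C where C: "0 \<le> C" "\<And>K. dirichlet_energy (trial K) \<le> C" using dirichlet_trial_le by blast
  have "lambda_e (ball 0 1) (\<lambda>z. real n * pot_total log_pot z) \<le> ereal ((C + 1) / (pi / 8))" for n
  proof -
    obtain K where K: "potential_energy (trial K) \<le> 1 / (real n + 1)" using potential_trial_le[of "1 / (real n + 1)"] by auto
    let ?N = "LINT z:ball 0 1|lborel. (cmod (trial K z))\<^sup>2"
    have N: "pi / 8 \<le> ?N" by (rule integral_trial_ge)
    then have pos: "0 < ?N" using pi_gt_zero by linarith
    have "real n * potential_energy (trial K) \<le> real n * (1 / (real n + 1))" by (intro mult_left_mono K) simp
    also have "\<dots> \<le> 1" by simp
    finally have "dirichlet_energy (trial K) + real n * potential_energy (trial K) \<le> C + 1" using C(2)[of K] by linarith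
    then have "(dirichlet_energy (trial K) + real n * potential_energy (trial K)) / ?N \<le> (C + 1) / ?N"
      using pos by (intro divide_right_mono) auto
    also have "\<dots> \<le> (C + 1) / (pi / 8)" using N C(1) pos by (intro divide_left_mono mult_pos_pos) auto
    finally show ?thesis using lambda_e_le[OF trial_test_function pos, of n] by (meson ereal_less_eq(3) order_trans)
  qed
  then show thesis by (rule that)
qed

text \<open>The density is nonnegative, so the energy of each fixed function increases with
  \<open>n\<close>; hence the eigenvalues increase and converge to their supremum.\<close>

lemma lambda_e_convergent:
  "\<exists>L::ereal. L < \<infinity> \<and> (\<lambda>n::nat. lambda_e (ball 0 1) (\<lambda>z. real n * pot_total log_pot z)) \<longlonglongrightarrow> L"
proof -
  let ?l = "\<lambda>n::nat. lambda_e (ball 0 1) (\<lambda>z. real n * pot_total log_pot z)"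
  obtain C where C: "\<And>n. ?l n \<le> ereal C" using lambda_e_bounded by blast
  have "incseq ?l"
  proof (rule incseq_SucI)
    fix n
    show "?l n \<le> ?l (Suc n)"
      unfolding lambda_e_eq
    proof (rule INF_mono)
      fix u assume "u \<in> normalized_test_functions (ball 0 1)"
      moreover have "ereal (dirichlet_energy u + real n * potential_energy u) \<le> ereal (dirichlet_energy u + real (Suc n) * potential_energy u)"
        using potential_energy_nonneg[of u] by (simp add: distrib_right)
      ultimately show "\<exists>w\<in>normalized_test_functions (ball 0 1). ereal (dirichlet_energy w + real n * potential_energy w)
          \<le> ereal (dirichlet_energy u + real (Suc n) * potential_energy u)" by blast
    qed
  qed
  then have "?l \<longlonglongrightarrow> (SUP n. ?l n)" by (rule LIMSEQ_SUP)
  moreover have "(SUP n. ?l n) \<le> ereal C" by (rule SUP_least) (rule C)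
  then have "(SUP n. ?l n) < \<infinity>" by (rule le_less_trans) simp
  ultimately show ?thesis by blast
qed

theorem theorem1p3:
  fixes \<Omega>0 :: "complex set"
  assumes "\<Omega>0 = ball 0 1"
  shows "\<exists>\<phi> :: complex \<Rightarrow> real.
    continuous_on \<Omega>0 \<phi> \<and> subharmonic_on \<Omega>0 \<phi> \<and>
    (\<exists>p q. has_weak_partial \<Omega>0 1 \<phi> p \<and> square_integrable_on \<Omega>0 p \<and>
           has_weak_partial \<Omega>0 \<i> \<phi> q \<and> square_integrable_on \<Omega>0 q) \<and>
    (\<exists>f. has_weak_laplacian \<Omega>0 \<phi> f \<and> set_integrable lborel \<Omega>0 f \<and>
         lower_semicontinuous_on \<Omega>0 f) \<and>
    ((\<lambda>n::nat. lambda_m \<Omega>0 (\<lambda>z. real n * \<phi> z)) \<longlonglongrightarrow> \<infinity>) \<and>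
    (\<exists>L::ereal. L < \<infinity> \<and> (\<lambda>n::nat. lambda_e \<Omega>0 (\<lambda>z. real n * \<phi> z)) \<longlonglongrightarrow> L)"
  unfolding assms
proof (rule exI[of _ "pot_total log_pot"], intro conjI)
  show "\<exists>p q. has_weak_partial (ball 0 1) 1 (pot_total log_pot) p \<and> square_integrable_on (ball 0 1) p \<and>
           has_weak_partial (ball 0 1) \<i> (pot_total log_pot) q \<and> square_integrable_on (ball 0 1) q"
    using has_weak_partial_x_pot_total has_weak_partial_y_pot_total square_integrable_pot_total by blast
  show "\<exists>f. has_weak_laplacian (ball 0 1) (pot_total log_pot) f \<and> set_integrable lborel (ball 0 1) f \<and> lower_semicontinuous_on (ball 0 1) f"
    using has_weak_laplacian_pot_total set_integrable_pot_total_disc lower_semicontinuous_pot_total_disc by blast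
qed (rule continuous_pot_total_log subharmonic_pot_total_log lambda_m_tendsto lambda_e_convergent)+

end
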